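(* Let $p$ be a prime and $T_\beta$ the theory of $\mathbb{Q}_p$ in the language $\mathcal{L}_\beta=\{0,1,+,\cdot,\mathcal{O},P_2,P_3,\dots\}$, where $\mathcal{O}$ is interpreted as the valuation ring and $P_n(x)\leftrightarrow\exists y\,(y^n=x)$. Let $\mathcal{L}_\alpha'$ be a relational language disjoint from $\mathcal{L}_\beta$ and $T_\alpha'$ a complete consistent $\mathcal{L}_\alpha'$-theory. Let $\mathcal{L}_\alpha=\mathcal{L}_\alpha'\cup\{E\}$ with $E$ a new binary relation symbol, and let $T_\alpha$ be the $\mathcal{L}_\alpha$-theory consisting of all $\theta_e$ for $\theta\in T_\alpha'$ (where $\theta_e$ is obtained from $\theta$ by replacing each equality $x=y$ by $xEy$), together with axioms saying $E$ is an equivalence relation with infinite classes and every relation of $\mathcal{L}_\alpha'$ is $E$-invariant. Let $T^*\supseteq T^2$ be the $\mathcal{L}^2$-theory stating additionally that in a model $(\mathcal{Q}_p,\mathcal{A})$, $A$ is dense in $Q_p$ in the valuation topology and $\operatorname{acl}$-independent in $\mathcal{Q}_p$, and each $E$-equivalence class is dense in $A$ in the valuation topology. Then $T^*$ is an ML-theory.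
   Context: Setup. For the given $\mathcal{L}_\alpha,\mathcal{L}_\beta,T_\alpha,T_\beta$ ($T_\beta$ is geometric: eliminates $\exists^\infty$, $\operatorname{acl}$ a pregeometry): $\mathcal{L}=\mathcal{L}_\alpha\cap\mathcal{L}_\beta$, $\mathcal{L}^2=\mathcal{L}_\beta\cup\mathcal{L}_\alpha\cup\{A\}$, $A$ a new unary predicate. For an $\mathcal{L}_\alpha$-formula $\theta$, $\theta_A$ is $\theta$ with all quantifiers relativized to $A$. $T^2$ is the $\mathcal{L}^2$-theory consisting of $T_\beta$, all $\phi_A$ with $T_\alpha\models\phi$, sentences saying $A$ is closed under each function symbol of $\mathcal{L}_\alpha$, and for each relation symbol $R\in\mathcal{L}_\alpha\setminus\mathcal{L}_\beta$ a sentence saying $R$ holds only of tuples from $A$. A model of $T^2$ is written $(\mathcal{B},\mathcal{A})$ with $\mathcal{B}$ its $\mathcal{L}_\beta$-reduct (universe $B$) and $\mathcal{A}$ the induced $\mathcal{L}_\alpha$-structure on $A$. $|T^2|=|\mathcal{L}^2|$ if infinite, else $\aleph_0$. $\operatorname{acl}$ is algebraic closure in $\mathcal{B}$. For $X,Y,Z\subseteq B$, $X\downarrow_Z Y$ means every subset of $X$ that is $\operatorname{acl}$-independent over $Z$ is $\operatorname{acl}$-independent over $Y\cup Z$. For a tuple $\vec c$ from $B$, $\vec c_\alpha$ is the subtuple of entries lying in $A$; for a variable tuple $\vec x$, $\vec x_\alpha$ is a designated subtuple. For an $\mathcal{L}_\alpha$-type $p$, $p_A=\{\psi_A:\psi\in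 p\}$. A Mordell-Lang challenge for $T\supseteq T^2$ is $(p(\vec x_\alpha),q(\vec x),\phi(\vec x,y),\psi(\vec x_\alpha,y))$ with $p$ a complete $\mathcal{L}_\alpha$-type, $q$ a complete $\mathcal{L}_\beta$-type, $\phi$ an $\mathcal{L}_\beta$-formula, $\psi$ an $\mathcal{L}_\alpha$-formula, and $q\models\exists^{<\infty}y\,\phi(\vec x,y)$. A contender is $((\mathcal{B},\mathcal{A}),\vec c)$ with $(\mathcal{B},\mathcal{A})\models T$, $\vec c$ realizing $q$, $\vec c_\alpha$ realizing $p_A$, and $\vec c\downarrow_{\vec c_\alpha}A$; a solution is a contender plus $a\in A$ with $(\mathcal{B},\mathcal{A})\models\phi(\vec c,a)\wedge\psi_A(\vec c_\alpha,a)$. $T$ satisfies the Mordell-Lang condition if for every challenge having some solution and every contender $((\mathcal{B},\mathcal{A}),\vec c)$ there is $a\in A$ with $((\mathcal{B},\mathcal{A}),\vec c,a)$ a solution. Density/codensity conditions: for every $\kappa$-saturated $(\mathcal{B},\mathcal{A})\models T$ with $\kappa>|T^2|$, every $C\subseteq B$ with $|C|<\kappa$ and every non-algebraic unary $\mathcal{L}_\beta(C)$-type $q(x)$: (Density) if $p(x)$ is a unary $\mathcal{L}_\alpha(A\cap C)$-type such that $q$ implies all quantifier-free $\mathcal{L}$-formulas in $p$, then some $a\in A$ realizes $p_A\cup q$; (Codensity) some $b\in B\setminus\operatorname{acl}(A\cup C)$ realizes $q$. An ML-theory is an $\mathcal{L}^2$-theory $T\supseteq T^2$ satisfying the Mordell-Lang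 condition and the density and codensity conditions. *)

theory Defs
  imports Complex_Main "HOL-Computational_Algebra.Primes"
begin

unbundle cardinal_syntax

section \<open>First-order logic with equality\<close>

text \<open>A symbol is a name together with its arity, so that languages over the same types of names can
  be intersected, united and compared as sets. Formulas of all the languages involved share one
  type; membership in a language is a predicate, and taking a reduct of a structure amounts to
  evaluating only formulas of the smaller language.\<close>

record ('f, 'r) lang =
  funs :: "('f \<times> nat) set"
  rels :: "('r \<times> nat) set"

definition lang_Int :: "('f, 'r) lang \<Rightarrow> ('f, 'r) lang \<Rightarrow> ('f, 'r) lang" where
  "lang_Int L L' = \<lparr>funs = funs L \<inter> funs L', rels = rels L \<inter> rels L'\<rparr>"

definition lang_Un :: "('f, 'r) lang \<Rightarrow> ('f, 'r) lang \<Rightarrow> ('f, 'r) lang" where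
  "lang_Un L L' = \<lparr>funs = funs L \<union> funs L', rels = rels L \<union> rels L'\<rparr>"

datatype 'f trm = Var nat | Fn 'f "'f trm list"

datatype ('f, 'r) fm =
    Fls
  | Equ "'f trm" "'f trm"
  | Rel 'r "'f trm list"
  | Neg "('f, 'r) fm"
  | And "('f, 'r) fm" "('f, 'r) fm"
  | Exi nat "('f, 'r) fm"

definition Imp :: "('f, 'r) fm \<Rightarrow> ('f, 'r) fm \<Rightarrow> ('f, 'r) fm" where
  "Imp \<phi> \<psi> = Neg (And \<phi> (Neg \<psi>))"

definition Forall :: "nat \<Rightarrow> ('f, 'r) fm \<Rightarrow> ('f, 'r) fm" where
  "Forall x \<phi> = Neg (Exi x (Neg \<phi>))"

definition Conjs :: "('f, 'r) fm list \<Rightarrow> ('f, 'r) fm" where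
  "Conjs \<phi>s = foldr And \<phi>s (Neg Fls)"

definition Disjs :: "('f, 'r) fm list \<Rightarrow> ('f, 'r) fm" where
  "Disjs \<phi>s = Neg (Conjs (map Neg \<phi>s))"

definition Foralls :: "nat list \<Rightarrow> ('f, 'r) fm \<Rightarrow> ('f, 'r) fm" where
  "Foralls xs \<phi> = foldr Forall xs \<phi>"

definition Exis :: "nat list \<Rightarrow> ('f, 'r) fm \<Rightarrow> ('f, 'r) fm" where
  "Exis xs \<phi> = foldr Exi xs \<phi>"

fun trm_vars :: "'f trm \<Rightarrow> nat set" where
  "trm_vars (Var x) = {x}"
| "trm_vars (Fn f ts) = (\<Union>t\<in>set ts. trm_vars t)"

fun fv :: "('f, 'r) fm \<Rightarrow> nat set" where
  "fv Fls = {}"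
| "fv (Equ s t) = trm_vars s \<union> trm_vars t"
| "fv (Rel R ts) = (\<Union>t\<in>set ts. trm_vars t)"
| "fv (Neg \<phi>) = fv \<phi>"
| "fv (And \<phi> \<psi>) = fv \<phi> \<union> fv \<psi>"
| "fv (Exi x \<phi>) = fv \<phi> - {x}"

fun trm_in :: "('f, 'r) lang \<Rightarrow> 'f trm \<Rightarrow> bool" where
  "trm_in L (Var x) = True"
| "trm_in L (Fn f ts) = ((f, length ts) \<in> funs L \<and> (\<forall>t\<in>set ts. trm_in L t))"

fun fm_in :: "('f, 'r) lang \<Rightarrow> ('f, 'r) fm \<Rightarrow> bool" where
  "fm_in L Fls = True"
| "fm_in L (Equ s t) = (trm_in L s \<and> trm_in L t)"
| "fm_in L (Rel R ts) = ((R, length ts) \<in> rels L \<and> (\<forall>t\<in>set ts. trm_in L t))"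
| "fm_in L (Neg \<phi>) = fm_in L \<phi>"
| "fm_in L (And \<phi> \<psi>) = (fm_in L \<phi> \<and> fm_in L \<psi>)"
| "fm_in L (Exi x \<phi>) = fm_in L \<phi>"

definition fms :: "('f, 'r) lang \<Rightarrow> nat set \<Rightarrow> ('f, 'r) fm set" where
  "fms L V = {\<phi>. fm_in L \<phi> \<and> fv \<phi> \<subseteq> V}"

abbreviation sentences :: "('f, 'r) lang \<Rightarrow> ('f, 'r) fm set" where
  "sentences L \<equiv> fms L {}"

fun quantifier_free :: "('f, 'r) fm \<Rightarrow> bool" where
  "quantifier_free (Neg \<phi>) = quantifier_free \<phi>"
| "quantifier_free (And \<phi> \<psi>) = (quantifier_free \<phi> \<and> quantifier_free \<psi>)"
| "quantifier_free (Exi x \<phi>) = False"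
| "quantifier_free _ = True"

record ('f, 'r, 'u) struc =
  univ :: "'u set"
  fint :: "'f \<Rightarrow> 'u list \<Rightarrow> 'u"
  rint :: "'r \<Rightarrow> 'u list \<Rightarrow> bool"

definition is_struc :: "('f, 'r) lang \<Rightarrow> ('f, 'r, 'u) struc \<Rightarrow> bool" where
  "is_struc L M \<longleftrightarrow> univ M \<noteq> {} \<and>
     (\<forall>(f, n)\<in>funs L. \<forall>xs. length xs = n \<and> set xs \<subseteq> univ M \<longrightarrow> fint M f xs \<in> univ M)"

fun eval :: "('f, 'r, 'u) struc \<Rightarrow> (nat \<Rightarrow> 'u) \<Rightarrow> 'f trm \<Rightarrow> 'u" where
  "eval M e (Var x) = e x"
| "eval M e (Fn f ts) = fint M f (map (eval M e) ts)"

fun sat :: "('f, 'r, 'u) struc \<Rightarrow> (nat \<Rightarrow> 'u) \<Rightarrow> ('f, 'r) fm \<Rightarrow> bool" where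
  "sat M e Fls = False"
| "sat M e (Equ s t) = (eval M e s = eval M e t)"
| "sat M e (Rel R ts) = rint M R (map (eval M e) ts)"
| "sat M e (Neg \<phi>) = (\<not> sat M e \<phi>)"
| "sat M e (And \<phi> \<psi>) = (sat M e \<phi> \<and> sat M e \<psi>)"
| "sat M e (Exi x \<phi>) = (\<exists>a\<in>univ M. sat M (e(x := a)) \<phi>)"

definition assignment :: "('f, 'r, 'u) struc \<Rightarrow> (nat \<Rightarrow> 'u) \<Rightarrow> bool" where
  "assignment M e \<longleftrightarrow> (\<forall>i. e i \<in> univ M)"

definition model :: "('f, 'r) lang \<Rightarrow> ('f, 'r, 'u) struc \<Rightarrow> ('f, 'r) fm set \<Rightarrow> bool" where
  "model L M T \<longleftrightarrow> is_struc L M \<and> (\<forall>\<phi>\<in>T. \<forall>e. assignment M e \<longrightarrow> sat M e \<phi>)"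

definition theory_of :: "('f, 'r) lang \<Rightarrow> ('f, 'r, 'u) struc \<Rightarrow> ('f, 'r) fm set" where
  "theory_of L M = {\<phi> \<in> sentences L. \<forall>e. assignment M e \<longrightarrow> sat M e \<phi>}"

text \<open>Notions referring to all structures of a language are evaluated on structures whose universe
  is a subset of the type of formulas. That type is infinite and at least as large as any
  language over the given names, so by the downward Loewenheim-Skolem theorem (with compactness
  where finiteness of solution sets is concerned) nothing changes if arbitrary structures
  are admitted.\<close>

type_synonym ('f, 'r) struc0 = "('f, 'r, ('f, 'r) fm) struc"

definition entails :: "('f, 'r) lang \<Rightarrow> ('f, 'r) fm set \<Rightarrow> ('f, 'r) fm \<Rightarrow> bool" where
  "entails L T \<phi> \<longleftrightarrow>
     (\<forall>(M :: ('f, 'r) struc0) e. model L M T \<and> assignment M e \<longrightarrow> sat M e \<phi>)"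

definition consistent_theory :: "('f, 'r) lang \<Rightarrow> ('f, 'r) fm set \<Rightarrow> bool" where
  "consistent_theory L T \<longleftrightarrow> (\<exists>M :: ('f, 'r) struc0. model L M T)"

definition complete_theory :: "('f, 'r) lang \<Rightarrow> ('f, 'r) fm set \<Rightarrow> bool" where
  "complete_theory L T \<longleftrightarrow> (\<forall>\<phi>\<in>sentences L. entails L T \<phi> \<or> entails L T (Neg \<phi>))"

definition complete_type :: "('f, 'r) lang \<Rightarrow> nat set \<Rightarrow> ('f, 'r) fm set \<Rightarrow> bool" where
  "complete_type L V p \<longleftrightarrow> p \<subseteq> fms L V \<and>
     (\<exists>(M :: ('f, 'r) struc0) e. is_struc L M \<and> assignment M e \<and> (\<forall>\<phi>\<in>p. sat M e \<phi>)) \<and>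
     (\<forall>\<phi>\<in>fms L V. \<phi> \<in> p \<or> Neg \<phi> \<in> p)"


section \<open>Parameters, unary types, saturation, algebraic closure\<close>

text \<open>\<open>lang_params L C\<close> is the language \<open>L(C)\<close>: a constant \<open>Inr c\<close> is added for each \<open>c \<in> C\<close>.\<close>

definition lang_params :: "('f, 'r) lang \<Rightarrow> 'u set \<Rightarrow> ('f + 'u, 'r) lang" where
  "lang_params L C =
     \<lparr>funs = (\<lambda>(f, n). (Inl f, n)) ` funs L \<union> (\<lambda>c. (Inr c, 0)) ` C, rels = rels L\<rparr>"

definition name_all :: "('f, 'r, 'u) struc \<Rightarrow> ('f + 'u, 'r, 'u) struc" where
  "name_all M =
     \<lparr>univ = univ M, fint = case_sum (fint M) (\<lambda>c _. c), rint = rint M\<rparr>"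

definition unary_fms :: "('f, 'r) lang \<Rightarrow> 'u set \<Rightarrow> ('f + 'u, 'r) fm set" where
  "unary_fms L C = fms (lang_params L C) {0}"

definition holds_at :: "('f, 'r, 'u) struc \<Rightarrow> ('f + 'u, 'r) fm \<Rightarrow> 'u \<Rightarrow> bool" where
  "holds_at M \<phi> b \<longleftrightarrow> sat (name_all M) (\<lambda>_. b) \<phi>"

definition fin_sat :: "('f, 'r, 'u) struc \<Rightarrow> ('f + 'u, 'r) fm set \<Rightarrow> bool" where
  "fin_sat M q \<longleftrightarrow> (\<forall>F. finite F \<and> F \<subseteq> q \<longrightarrow> (\<exists>b\<in>univ M. \<forall>\<phi>\<in>F. holds_at M \<phi> b))"

text \<open>\<open>q\<close> together with the elementary diagram of \<open>M\<close> entails \<open>\<psi>\<close> (in the form given by compactness).\<close>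

definition type_implies ::
  "('f, 'r, 'u) struc \<Rightarrow> ('f + 'u, 'r) fm set \<Rightarrow> ('f + 'u, 'r) fm \<Rightarrow> bool" where
  "type_implies M q \<psi> \<longleftrightarrow>
     (\<exists>F. finite F \<and> F \<subseteq> q \<and> (\<forall>b\<in>univ M. (\<forall>\<phi>\<in>F. holds_at M \<phi> b) \<longrightarrow> holds_at M \<psi> b))"

text \<open>Unary \<open>L(C)\<close>-types in \<open>M\<close> need not be complete, but they are taken to contain their
  consequences; complete types do so automatically.\<close>

definition unary_type ::
  "('f, 'r) lang \<Rightarrow> 'u set \<Rightarrow> ('f, 'r, 'u) struc \<Rightarrow> ('f + 'u, 'r) fm set \<Rightarrow> bool" where
  "unary_type L C M q \<longleftrightarrow> q \<subseteq> unary_fms L C \<and> fin_sat M q \<and>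
     (\<forall>\<psi>\<in>unary_fms L C. type_implies M q \<psi> \<longrightarrow> \<psi> \<in> q)"

definition nonalgebraic :: "('f, 'r, 'u) struc \<Rightarrow> ('f + 'u, 'r) fm set \<Rightarrow> bool" where
  "nonalgebraic M q \<longleftrightarrow> (\<forall>\<phi>\<in>q. infinite {b \<in> univ M. holds_at M \<phi> b})"

definition saturated :: "('f, 'r) lang \<Rightarrow> 'k rel \<Rightarrow> ('f, 'r, 'u) struc \<Rightarrow> bool" where
  "saturated L \<kappa> M \<longleftrightarrow>
     (\<forall>C q. C \<subseteq> univ M \<and> |C| <o \<kappa> \<and> q \<subseteq> unary_fms L C \<and> fin_sat M q
        \<longrightarrow> (\<exists>b\<in>univ M. \<forall>\<phi>\<in>q. holds_at M \<phi> b))"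

definition acl :: "('f, 'r) lang \<Rightarrow> ('f, 'r, 'u) struc \<Rightarrow> 'u set \<Rightarrow> 'u set" where
  "acl L M X = {b \<in> univ M. \<exists>\<phi>\<in>unary_fms L X.
     holds_at M \<phi> b \<and> finite {b' \<in> univ M. holds_at M \<phi> b'}}"

definition acl_indep :: "('f, 'r) lang \<Rightarrow> ('f, 'r, 'u) struc \<Rightarrow> 'u set \<Rightarrow> 'u set \<Rightarrow> bool" where
  "acl_indep L M X Z \<longleftrightarrow> (\<forall>x\<in>X. x \<notin> acl L M ((X - {x}) \<union> Z))"

text \<open>\<open>indep_over L M X Z Y\<close> is the relation \<open>X \<down>\<^sub>Z Y\<close>.\<close>

definition indep_over ::
  "('f, 'r) lang \<Rightarrow> ('f, 'r, 'u) struc \<Rightarrow> 'u set \<Rightarrow> 'u set \<Rightarrow> 'u set \<Rightarrow> bool" where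
  "indep_over L M X Z Y \<longleftrightarrow> (\<forall>S\<subseteq>X. acl_indep L M S Z \<longrightarrow> acl_indep L M S (Y \<union> Z))"

definition pregeometry :: "'u set \<Rightarrow> ('u set \<Rightarrow> 'u set) \<Rightarrow> bool" where
  "pregeometry U cl \<longleftrightarrow>
     (\<forall>X\<subseteq>U. X \<subseteq> cl X \<and> cl X \<subseteq> U \<and> cl (cl X) = cl X) \<and>
     (\<forall>X Y. X \<subseteq> Y \<and> Y \<subseteq> U \<longrightarrow> cl X \<subseteq> cl Y) \<and>
     (\<forall>X\<subseteq>U. \<forall>b\<in>cl X. \<exists>F\<subseteq>X. finite F \<and> b \<in> cl F) \<and>
     (\<forall>X\<subseteq>U. \<forall>b\<in>U. \<forall>c\<in>U. b \<in> cl (insert c X) - cl X \<longrightarrow> c \<in> cl (insert b X))"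

definition eliminates_ex_inf :: "('f, 'r) lang \<Rightarrow> ('f, 'r) fm set \<Rightarrow> bool" where
  "eliminates_ex_inf L T \<longleftrightarrow>
     (\<forall>\<phi> y. fm_in L \<phi> \<longrightarrow>
        (\<exists>N. \<forall>(M :: ('f, 'r) struc0) e. model L M T \<and> assignment M e \<and>
           finite {b \<in> univ M. sat M (e(y := b)) \<phi>} \<longrightarrow>
           card {b \<in> univ M. sat M (e(y := b)) \<phi>} \<le> N))"

definition geometric :: "('f, 'r) lang \<Rightarrow> ('f, 'r) fm set \<Rightarrow> bool" where
  "geometric L T \<longleftrightarrow> eliminates_ex_inf L T \<and>
     (\<forall>M :: ('f, 'r) struc0. model L M T \<longrightarrow> pregeometry (univ M) (acl L M))"


section \<open>Pairs and ML-theories\<close>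

text \<open>\<open>A\<close> is the name of the new unary predicate.\<close>

definition lang2 :: "'r \<Rightarrow> ('f, 'r) lang \<Rightarrow> ('f, 'r) lang \<Rightarrow> ('f, 'r) lang" where
  "lang2 A L\<alpha> L\<beta> = lang_Un (lang_Un L\<beta> L\<alpha>) \<lparr>funs = {}, rels = {(A, 1)}\<rparr>"

fun relativize :: "'r \<Rightarrow> ('f, 'r) fm \<Rightarrow> ('f, 'r) fm" where
  "relativize A (Neg \<phi>) = Neg (relativize A \<phi>)"
| "relativize A (And \<phi> \<psi>) = And (relativize A \<phi>) (relativize A \<psi>)"
| "relativize A (Exi x \<phi>) = Exi x (And (Rel A [Var x]) (relativize A \<phi>))"
| "relativize A \<phi> = \<phi>"

definition fun_closed_ax :: "'r \<Rightarrow> 'f \<Rightarrow> nat \<Rightarrow> ('f, 'r) fm" where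
  "fun_closed_ax A f n = Foralls [0..<n]
     (Imp (Conjs (map (\<lambda>i. Rel A [Var i]) [0..<n])) (Rel A [Fn f (map Var [0..<n])]))"

definition rel_within_ax :: "'r \<Rightarrow> 'r \<Rightarrow> nat \<Rightarrow> ('f, 'r) fm" where
  "rel_within_ax A R n = Foralls [0..<n]
     (Imp (Rel R (map Var [0..<n])) (Conjs (map (\<lambda>i. Rel A [Var i]) [0..<n])))"

definition theory2 ::
  "'r \<Rightarrow> ('f, 'r) lang \<Rightarrow> ('f, 'r) lang \<Rightarrow> ('f, 'r) fm set \<Rightarrow> ('f, 'r) fm set \<Rightarrow> ('f, 'r) fm set" where
  "theory2 A L\<alpha> L\<beta> T\<alpha> T\<beta> = T\<beta>
     \<union> {relativize A \<phi> |\<phi>. \<phi> \<in> sentences L\<alpha> \<and> entails L\<alpha> T\<alpha> \<phi>}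
     \<union> {fun_closed_ax A f n |f n. (f, n) \<in> funs L\<alpha>}
     \<union> {rel_within_ax A R n |R n. (R, n) \<in> rels L\<alpha> - rels L\<beta>}"

definition pred_ext :: "'r \<Rightarrow> ('f, 'r, 'u) struc \<Rightarrow> 'u set" where
  "pred_ext A M = {a \<in> univ M. rint M A [a]}"

definition induced :: "'r \<Rightarrow> ('f, 'r, 'u) struc \<Rightarrow> ('f, 'r, 'u) struc" where
  "induced A M = M\<lparr>univ := pred_ext A M\<rparr>"

text \<open>The variable tuple is \<open>x\<^sub>0, \<dots>, x\<^sub>n\<^sub>-\<^sub>1\<close>, its designated subtuple is given by a set \<open>S\<close> of
  indices, and \<open>y\<close> is the variable with index \<open>n\<close>.\<close>

definition mordell_lang_challenge ::
  "('f, 'r) lang \<Rightarrow> ('f, 'r) lang \<Rightarrow> nat \<Rightarrow> nat set \<Rightarrow> ('f, 'r) fm set \<Rightarrow> ('f, 'r) fm set \<Rightarrow>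
   ('f, 'r) fm \<Rightarrow> ('f, 'r) fm \<Rightarrow> bool" where
  "mordell_lang_challenge L\<alpha> L\<beta> n S p q \<phi> \<psi> \<longleftrightarrow> S \<subseteq> {..<n} \<and>
     complete_type L\<alpha> S p \<and> complete_type L\<beta> {..<n} q \<and>
     \<phi> \<in> fms L\<beta> {..n} \<and> \<psi> \<in> fms L\<alpha> (insert n S) \<and>
     (\<forall>(M :: ('f, 'r) struc0) e. is_struc L\<beta> M \<and> assignment M e \<and> (\<forall>\<chi>\<in>q. sat M e \<chi>) \<longrightarrow>
        finite {b \<in> univ M. sat M (e(n := b)) \<phi>})"

definition contender ::
  "'r \<Rightarrow> ('f, 'r) lang \<Rightarrow> ('f, 'r) lang \<Rightarrow> ('f, 'r) fm set \<Rightarrow> nat \<Rightarrow> nat set \<Rightarrow>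
   ('f, 'r) fm set \<Rightarrow> ('f, 'r) fm set \<Rightarrow> ('f, 'r, 'u) struc \<Rightarrow> 'u list \<Rightarrow> bool" where
  "contender A L\<alpha> L\<beta> T n S p q M c \<longleftrightarrow>
     model (lang2 A L\<alpha> L\<beta>) M T \<and> length c = n \<and> set c \<subseteq> univ M \<and>
     (\<forall>\<chi>\<in>q. sat M ((!) c) \<chi>) \<and>
     {i. i < n \<and> c ! i \<in> pred_ext A M} = S \<and> (\<forall>\<chi>\<in>p. sat M ((!) c) (relativize A \<chi>)) \<and>
     indep_over L\<beta> M (set c) ((!) c ` S) (pred_ext A M)"

definition solution ::
  "'r \<Rightarrow> ('f, 'r) lang \<Rightarrow> ('f, 'r) lang \<Rightarrow> ('f, 'r) fm set \<Rightarrow> nat \<Rightarrow> nat set \<Rightarrow>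
   ('f, 'r) fm set \<Rightarrow> ('f, 'r) fm set \<Rightarrow> ('f, 'r) fm \<Rightarrow> ('f, 'r) fm \<Rightarrow>
   ('f, 'r, 'u) struc \<Rightarrow> 'u list \<Rightarrow> 'u \<Rightarrow> bool" where
  "solution A L\<alpha> L\<beta> T n S p q \<phi> \<psi> M c a \<longleftrightarrow>
     contender A L\<alpha> L\<beta> T n S p q M c \<and> a \<in> pred_ext A M \<and>
     sat M ((!) (c @ [a])) \<phi> \<and> sat M ((!) (c @ [a])) (relativize A \<psi>)"

text \<open>The conditions below quantify over structures whose universe is any subset of a type \<open>'u\<close>; the
  full notions are obtained by letting \<open>'u\<close> be arbitrary (any two structures embed
  into a common type).\<close>

definition mordell_lang_condition ::
  "'u itself \<Rightarrow> 'r \<Rightarrow> ('f, 'r) lang \<Rightarrow> ('f, 'r) lang \<Rightarrow> ('f, 'r) fm set \<Rightarrow> bool" where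
  "mordell_lang_condition _ A L\<alpha> L\<beta> T \<longleftrightarrow>
     (\<forall>n S p q \<phi> \<psi>. mordell_lang_challenge L\<alpha> L\<beta> n S p q \<phi> \<psi> \<and>
        (\<exists>(M :: ('f, 'r, 'u) struc) c a. solution A L\<alpha> L\<beta> T n S p q \<phi> \<psi> M c a) \<longrightarrow>
        (\<forall>(M :: ('f, 'r, 'u) struc) c. contender A L\<alpha> L\<beta> T n S p q M c \<longrightarrow>
           (\<exists>a. solution A L\<alpha> L\<beta> T n S p q \<phi> \<psi> M c a)))"

text \<open>\<open>|T\<^sup>2|\<close> is \<open>|L\<^sup>2| + \<aleph>\<^sub>0\<close>. It is enough to let \<open>\<kappa>\<close> range over cardinals on \<open>'u\<close>, since a
  \<open>\<kappa>\<close>-saturated structure of cardinality below \<open>\<kappa>\<close> is finite and has no non-algebraic types.\<close>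

definition saturated_setting ::
  "'r \<Rightarrow> ('f, 'r) lang \<Rightarrow> ('f, 'r) lang \<Rightarrow> ('f, 'r) fm set \<Rightarrow> 'u rel \<Rightarrow>
   ('f, 'r, 'u) struc \<Rightarrow> 'u set \<Rightarrow> ('f + 'u, 'r) fm set \<Rightarrow> bool" where
  "saturated_setting A L\<alpha> L\<beta> T \<kappa> M C q \<longleftrightarrow>
     Card_order \<kappa> \<and> |funs (lang2 A L\<alpha> L\<beta>) <+> rels (lang2 A L\<alpha> L\<beta>)| +c natLeq <o \<kappa> \<and>
     model (lang2 A L\<alpha> L\<beta>) M T \<and> saturated (lang2 A L\<alpha> L\<beta>) \<kappa> M \<and>
     C \<subseteq> univ M \<and> |C| <o \<kappa> \<and> unary_type L\<beta> C M q \<and> nonalgebraic M q"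

definition density ::
  "'u itself \<Rightarrow> 'r \<Rightarrow> ('f, 'r) lang \<Rightarrow> ('f, 'r) lang \<Rightarrow> ('f, 'r) fm set \<Rightarrow> bool" where
  "density _ A L\<alpha> L\<beta> T \<longleftrightarrow>
     (\<forall>(M :: ('f, 'r, 'u) struc) \<kappa> C q p.
        saturated_setting A L\<alpha> L\<beta> T \<kappa> M C q \<and>
        unary_type L\<alpha> (pred_ext A M \<inter> C) (induced A M) p \<and>
        (\<forall>\<psi>\<in>p. quantifier_free \<psi> \<and> \<psi> \<in> unary_fms (lang_Int L\<alpha> L\<beta>) (pred_ext A M \<inter> C)
           \<longrightarrow> type_implies M q \<psi>) \<longrightarrow>
        (\<exists>a\<in>pred_ext A M. (\<forall>\<psi>\<in>p. holds_at M (relativize A \<psi>) a) \<and> (\<forall>\<phi>\<in>q. holds_at M \<phi> a)))"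

definition codensity ::
  "'u itself \<Rightarrow> 'r \<Rightarrow> ('f, 'r) lang \<Rightarrow> ('f, 'r) lang \<Rightarrow> ('f, 'r) fm set \<Rightarrow> bool" where
  "codensity _ A L\<alpha> L\<beta> T \<longleftrightarrow>
     (\<forall>(M :: ('f, 'r, 'u) struc) \<kappa> C q.
        saturated_setting A L\<alpha> L\<beta> T \<kappa> M C q \<longrightarrow>
        (\<exists>b\<in>univ M - acl L\<beta> M (pred_ext A M \<union> C). \<forall>\<phi>\<in>q. holds_at M \<phi> b))"

text \<open>Geometricity of \<open>T\<beta>\<close> is the standing assumption under which ML-theories are defined.\<close>

definition ml_theory ::
  "'u itself \<Rightarrow> 'r \<Rightarrow> ('f, 'r) lang \<Rightarrow> ('f, 'r) lang \<Rightarrow> ('f, 'r) fm set \<Rightarrow> ('f, 'r) fm set \<Rightarrow>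
   ('f, 'r) fm set \<Rightarrow> bool" where
  "ml_theory U A L\<alpha> L\<beta> T\<alpha> T\<beta> T \<longleftrightarrow> geometric L\<beta> T\<beta> \<and>
     T \<subseteq> sentences (lang2 A L\<alpha> L\<beta>) \<and> theory2 A L\<alpha> L\<beta> T\<alpha> T\<beta> \<subseteq> T \<and>
     mordell_lang_condition U A L\<alpha> L\<beta> T \<and> density U A L\<alpha> L\<beta> T \<and> codensity U A L\<alpha> L\<beta> T"


section \<open>The field of p-adic numbers\<close>

text \<open>The completion of the rationals with respect to the p-adic absolute value, as Cauchy
  sequences modulo null sequences.\<close>

definition padic_abs :: "nat \<Rightarrow> rat \<Rightarrow> real" where
  "padic_abs p x = (if x = 0 then 0 else
     (case quotient_of x of (a, b) \<Rightarrow>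
        real p powi (int (multiplicity (int p) b) - int (multiplicity (int p) a))))"

definition padic_Cauchy :: "nat \<Rightarrow> (nat \<Rightarrow> rat) \<Rightarrow> bool" where
  "padic_Cauchy p X \<longleftrightarrow> (\<forall>e>0. \<exists>N. \<forall>m\<ge>N. \<forall>n\<ge>N. padic_abs p (X m - X n) < e)"

definition padic_rel :: "nat \<Rightarrow> (nat \<Rightarrow> rat) rel" where
  "padic_rel p = {(X, Y). padic_Cauchy p X \<and> padic_Cauchy p Y \<and>
     (\<lambda>n. padic_abs p (X n - Y n)) \<longlonglongrightarrow> 0}"

type_synonym padic = "(nat \<Rightarrow> rat) set"

definition Qp :: "nat \<Rightarrow> padic set" where
  "Qp p = {X. padic_Cauchy p X} // padic_rel p"

definition Qp_class :: "nat \<Rightarrow> (nat \<Rightarrow> rat) \<Rightarrow> padic" where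
  "Qp_class p X = padic_rel p `` {X}"

definition Qp_rep :: "padic \<Rightarrow> nat \<Rightarrow> rat" where
  "Qp_rep a = (SOME X. X \<in> a)"

definition Qp_of_rat :: "nat \<Rightarrow> rat \<Rightarrow> padic" where
  "Qp_of_rat p r = Qp_class p (\<lambda>_. r)"

definition Qp_add :: "nat \<Rightarrow> padic \<Rightarrow> padic \<Rightarrow> padic" where
  "Qp_add p a b = Qp_class p (\<lambda>n. Qp_rep a n + Qp_rep b n)"

definition Qp_mult :: "nat \<Rightarrow> padic \<Rightarrow> padic \<Rightarrow> padic" where
  "Qp_mult p a b = Qp_class p (\<lambda>n. Qp_rep a n * Qp_rep b n)"

definition Qp_power :: "nat \<Rightarrow> padic \<Rightarrow> nat \<Rightarrow> padic" where
  "Qp_power p a n = (Qp_mult p a ^^ n) (Qp_of_rat p 1)"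

definition Qp_abs :: "nat \<Rightarrow> padic \<Rightarrow> real" where
  "Qp_abs p a = lim (\<lambda>n. padic_abs p (Qp_rep a n))"

datatype fname = Zero | One | Plus | Times

text \<open>\<open>EqRel\<close> names \<open>E\<close> and \<open>APred\<close> names \<open>A\<close>; \<open>Sym\<close> supplies arbitrarily many further names.\<close>

datatype 'r rname = ValRing | PowP nat | EqRel | APred | Sym 'r

definition L_beta :: "(fname, 'r rname) lang" where
  "L_beta = \<lparr>funs = {(Zero, 0), (One, 0), (Plus, 2), (Times, 2)},
     rels = insert (ValRing, 1) {(PowP n, 1) |n. n \<ge> 2}\<rparr>"

fun Qp_fint :: "nat \<Rightarrow> fname \<Rightarrow> padic list \<Rightarrow> padic" where
  "Qp_fint p Zero [] = Qp_of_rat p 0"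
| "Qp_fint p One [] = Qp_of_rat p 1"
| "Qp_fint p Plus [a, b] = Qp_add p a b"
| "Qp_fint p Times [a, b] = Qp_mult p a b"
| "Qp_fint p _ _ = undefined"

fun Qp_rint :: "nat \<Rightarrow> 'r rname \<Rightarrow> padic list \<Rightarrow> bool" where
  "Qp_rint p ValRing [a] = (Qp_abs p a \<le> 1)"
| "Qp_rint p (PowP n) [a] = (\<exists>b\<in>Qp p. Qp_power p b n = a)"
| "Qp_rint p _ _ = False"

definition Qp_struc :: "nat \<Rightarrow> (fname, 'r rname, padic) struc" where
  "Qp_struc p = \<lparr>univ = Qp p, fint = Qp_fint p, rint = Qp_rint p\<rparr>"

definition T_beta :: "nat \<Rightarrow> (fname, 'r rname) fm set" where
  "T_beta p = theory_of L_beta (Qp_struc p)"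


section \<open>The theories of the statement\<close>

definition L_alpha :: "(fname, 'r rname) lang \<Rightarrow> (fname, 'r rname) lang" where
  "L_alpha L' = lang_Un L' \<lparr>funs = {}, rels = {(EqRel, 2)}\<rparr>"

abbreviation E_fm :: "nat \<Rightarrow> nat \<Rightarrow> (fname, 'r rname) fm" where
  "E_fm i j \<equiv> Rel EqRel [Var i, Var j]"

fun eq_to_E :: "(fname, 'r rname) fm \<Rightarrow> (fname, 'r rname) fm" where
  "eq_to_E Fls = Fls"
| "eq_to_E (Equ s t) = Rel EqRel [s, t]"
| "eq_to_E (Rel R ts) = Rel R ts"
| "eq_to_E (Neg \<phi>) = Neg (eq_to_E \<phi>)"
| "eq_to_E (And \<phi> \<psi>) = And (eq_to_E \<phi>) (eq_to_E \<psi>)"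
| "eq_to_E (Exi x \<phi>) = Exi x (eq_to_E \<phi>)"

definition E_equiv_axs :: "(fname, 'r rname) fm set" where
  "E_equiv_axs = {Forall 0 (E_fm 0 0),
     Foralls [0, 1] (Imp (E_fm 0 1) (E_fm 1 0)),
     Foralls [0, 1, 2] (Imp (And (E_fm 0 1) (E_fm 1 2)) (E_fm 0 2))}"

text \<open>Every class has at least \<open>k\<close> elements.\<close>

definition E_class_size_ax :: "nat \<Rightarrow> (fname, 'r rname) fm" where
  "E_class_size_ax k = Forall 0 (Exis [1..<Suc k]
     (And (Conjs (map (\<lambda>i. E_fm 0 i) [1..<Suc k]))
        (Conjs [Neg (Equ (Var i) (Var j)). i \<leftarrow> [1..<Suc k], j \<leftarrow> [1..<i]])))"

definition E_invariant_ax :: "'r rname \<Rightarrow> nat \<Rightarrow> (fname, 'r rname) fm" where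
  "E_invariant_ax R n = Foralls [0..<2 * n]
     (Imp (And (Conjs (map (\<lambda>i. E_fm i (n + i)) [0..<n])) (Rel R (map Var [0..<n])))
        (Rel R (map Var [n..<2 * n])))"

definition T_alpha ::
  "(fname, 'r rname) lang \<Rightarrow> (fname, 'r rname) fm set \<Rightarrow> (fname, 'r rname) fm set" where
  "T_alpha L' T' = eq_to_E ` T' \<union> E_equiv_axs \<union> range E_class_size_ax
     \<union> {E_invariant_ax R n |R n. (R, n) \<in> rels L'}"

text \<open>The basic open sets of the valuation topology are the balls \<open>b + z\<O>\<close> with \<open>z \<noteq> 0\<close>;
  the formula says that \<open>x\<close> lies in that ball (for distinct variables \<open>x\<close>, \<open>b\<close>, \<open>z\<close>, \<open>u\<close>).\<close>

definition in_ball_fm :: "nat \<Rightarrow> nat \<Rightarrow> nat \<Rightarrow> nat \<Rightarrow> (fname, 'r rname) fm" where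
  "in_ball_fm x b z u = Exi u (And (Rel ValRing [Var u])
     (Equ (Var x) (Fn Plus [Var b, Fn Times [Var z, Var u]])))"

abbreviation A_fm :: "nat \<Rightarrow> (fname, 'r rname) fm" where
  "A_fm i \<equiv> Rel APred [Var i]"

abbreviation nonzero_fm :: "nat \<Rightarrow> (fname, 'r rname) fm" where
  "nonzero_fm i \<equiv> Neg (Equ (Var i) (Fn Zero []))"

definition A_dense_ax :: "(fname, 'r rname) fm" where
  "A_dense_ax = Foralls [0, 1] (Imp (nonzero_fm 1) (Exi 2 (And (A_fm 2) (in_ball_fm 2 0 1 3))))"

definition E_class_dense_ax :: "(fname, 'r rname) fm" where
  "E_class_dense_ax = Foralls [0, 1, 2] (Imp (Conjs [A_fm 0, A_fm 1, nonzero_fm 2])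
     (Exi 3 (Conjs [A_fm 3, E_fm 3 0, in_ball_fm 3 1 2 4])))"

text \<open>\<open>at_most_fm n k \<phi>\<close> says that at most \<open>k\<close> values of \<open>x\<^sub>n\<close> satisfy \<open>\<phi>\<close>, for \<open>\<phi>\<close> with free
  variables among \<open>x\<^sub>0, \<dots>, x\<^sub>n\<close>.\<close>

definition at_most_fm :: "nat \<Rightarrow> nat \<Rightarrow> ('f, 'r) fm \<Rightarrow> ('f, 'r) fm" where
  "at_most_fm n k \<phi> = Exis [Suc n..<Suc n + k]
     (Forall n (Imp \<phi> (Disjs (map (\<lambda>i. Equ (Var n) (Var i)) [Suc n..<Suc n + k]))))"

text \<open>\<open>acl\<close>-independence of \<open>A\<close> as a scheme: if \<open>a \<in> A\<close> differs from \<open>a\<^sub>0, \<dots>, a\<^sub>n\<^sub>-\<^sub>1 \<in> A\<close>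
  and \<open>\<phi>(a\<^sub>0, \<dots>, a\<^sub>n\<^sub>-\<^sub>1, y)\<close> has at most \<open>k\<close> solutions, then \<open>a\<close> is not one of them.\<close>

definition A_indep_ax :: "nat \<Rightarrow> nat \<Rightarrow> (fname, 'r rname) fm \<Rightarrow> (fname, 'r rname) fm" where
  "A_indep_ax n k \<phi> = Foralls [0..<Suc n]
     (Imp (Conjs [Conjs (map A_fm [0..<Suc n]),
                  Conjs (map (\<lambda>i. Neg (Equ (Var n) (Var i))) [0..<n]),
                  at_most_fm n k \<phi>])
        (Neg \<phi>))"

definition T_star ::
  "nat \<Rightarrow> (fname, 'r rname) lang \<Rightarrow> (fname, 'r rname) fm set \<Rightarrow> (fname, 'r rname) fm set" where
  "T_star p L' T' = theory2 APred (L_alpha L') L_beta (T_alpha L' T') (T_beta p)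
     \<union> {A_dense_ax, E_class_dense_ax}
     \<union> {A_indep_ax n k \<phi> |n k \<phi>. \<phi> \<in> fms L_beta {..n}}"

end

theory Submission
  imports Defs "HOL-Library.Countable_Set"
begin

text \<open>
  The core is a quantifier elimination for \<open>Q\<^sub>p\<close> relative to leading terms, in the style of Cohen
  and Denef. Call a predicate of a tuple \<open>e\<close> determined if it depends only on the classes
  modulo \<open>1 + I\<close>, for some ball \<open>I\<close> around \<open>0\<close>, of finitely many polynomials in \<open>e\<close>. Determined
  predicates are closed under projection. Indeed, for a polynomial \<open>f(e, t)\<close> there are finitely many
  centres \<open>c(e)\<close>, themselves with determined leading terms, such that for every \<open>t\<close> the Taylor expansion
  of \<open>f\<close> at one of them shows only bounded cancellation. By induction on the degree one
  starts with centres for the derivative of \<open>f\<close>; if the expansion at such a centre cancels too much,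
  Hensel's lemma gives a simple root of \<open>f\<close> close to \<open>t\<close>, and this root is added as a centre. Its
  distance to any other centre \<open>b\<close> has a determined leading term, either by approximation or because it is
  close to the Newton step \<open>- f(b) / f'(b)\<close>.

  So each formula bounds the number of its solutions in the last variable, unless the
  solutions contain a ball, and this dichotomy passes from \<open>Q\<^sub>p\<close> to all models of its theory. Since
  \<open>Q\<^sub>p\<close> is separable and uncountable, the dichotomy yields the exchange principle, so the theory
  is geometric. If \<open>a\<close> solves a Mordell-Lang challenge at \<open>c\<close>, then independence forces \<open>a\<close> to be an entry
  of \<open>c\<close> lying in \<open>A\<close>, which the types \<open>p\<close> and \<open>q\<close> express. Density holds because
  exchanging two equivalent elements of \<open>A\<close> is an automorphism of the induced structure and every class meets
  every ball. For codensity, a sum of many elements of \<open>A\<close> can be placed in any ball, and it is not algebraic over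
  fewer elements of \<open>A\<close>.
\<close>


subsection \<open>Complete valued rings and Hensel's lemma\<close>

text \<open>The roots used as centres are not polynomials in the tuple, so the induction runs over
  rings of functions whose leading terms, to every precision, are controlled by finitely many
  polynomials. Adjoining a root of a polynomial of degree \<open>d + 1\<close> preserves this
  because a polynomial in the root can be reduced, modulo the equation of the root, to degree at
  most \<open>d\<close>, where centres are already available. All constants must be uniform in the
  tuple: the norms of the integers that enter through derivatives are bounded below in terms of the
  degree, so one threshold serves Hensel's lemma everywhere, and the size of a solution set without
  interior is bounded by a sum of degrees. This uniform bound makes "few solutions or interior" a
  single formula, which holds in all models, where no completeness or countability argument is
  available. For codensity the obstacle is that being non-algebraic over \<open>A\<close> is an
  infinite conjunction; each finite part of it is met by a sum of more elements of \<open>A\<close>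
  than that part can mention, and saturation realizes all parts at once.\<close>

text \<open>\<open>N\<close> is only a seminorm: elements with \<open>N x = 0\<close> play the role of \<open>0\<close>, so that a complete valued
  field may be represented by a ring of Cauchy sequences.\<close>

locale vring =
  fixes N :: "'a::comm_ring_1 \<Rightarrow> real"
  assumes N_nonneg [simp]: "0 \<le> N x"
    and N_zero [simp]: "N 0 = 0"
    and N_one [simp]: "N 1 = 1"
    and N_mult: "N (x * y) = N x * N y"
    and N_add: "N (x + y) \<le> max (N x) (N y)"
    and N_inv: "N x \<noteq> 0 \<Longrightarrow> \<exists>y. N (x * y - 1) = 0"
    and N_of_nat: "0 < n \<Longrightarrow> N (of_nat n) \<noteq> 0"
    and N_complete: "(\<And>\<epsilon>::real. 0 < \<epsilon> \<Longrightarrow> \<exists>k. \<forall>m\<ge>k. \<forall>n\<ge>k. N (u m - u n) < \<epsilon>) \<Longrightarrow>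
      \<exists>l. (\<lambda>n. N (u n - l)) \<longlonglongrightarrow> 0"
    and N_small: "\<exists>x. 0 < N x \<and> N x < 1"
begin

lemma N_le_0 [simp]: "N x \<le> 0 \<longleftrightarrow> N x = 0"
  by (simp add: antisym)

lemma N_minus [simp]: "N (- x) = N x"
proof -
  have "N (- 1) * N (- 1) = 1" using N_mult[of "- 1" "- 1"] by simp
  then have "N (- 1) = 1"
    by (metis N_nonneg abs_of_nonneg abs_one mult_cancel_left1 power2_eq_square real_sqrt_abs real_sqrt_one)
  then show ?thesis using N_mult[of "- 1" x] by simp
qed

lemma N_diff: "N (x - y) \<le> max (N x) (N y)"
  using N_add[of x "- y"] by simp

lemma N_diff_commute: "N (x - y) = N (y - x)"
  using N_minus[of "x - y"] by simp

lemma N_power: "N (x ^ n) = N x ^ n"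
  by (induction n) (simp_all add: N_mult)

lemma N_triangle: "N (x - z) \<le> max (N (x - y)) (N (y - z))"
  using N_add[of "x - y" "y - z"] by simp

lemma N_add_eq: "N y < N x \<Longrightarrow> N (x + y) = N x"
  using N_add[of x y] N_diff[of "x + y" y] by (auto simp: max_def split: if_splits)

lemma N_eq_if_close: "N (x - y) < N x \<Longrightarrow> N y = N x"
  using N_add_eq[of "y - x" x] by (simp add: N_diff_commute)

lemma N_eq_if_null: "N (x - y) = 0 \<Longrightarrow> N x = N y"
  using N_add[of "x - y" y] N_add[of "y - x" x] by (simp add: N_diff_commute)

lemma N_null_add: "N x = 0 \<Longrightarrow> N y = 0 \<Longrightarrow> N (x + y) = 0"
  using N_add[of x y] using N_nonneg[of "x + y"] by simp

lemma N_sum: "(\<And>i. i \<in> I \<Longrightarrow> N (f i) \<le> B) \<Longrightarrow> 0 \<le> B \<Longrightarrow> N (sum f I) \<le> B"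
proof (induction I rule: infinite_finite_induct)
  case (insert x F)
  have "N (f x) \<le> B" "N (sum f F) \<le> B" using insert by auto
  then show ?case using N_add[of "f x" "sum f F"] insert(1,2) by simp
qed auto

lemma N_sum_less: "(\<And>i. i \<in> I \<Longrightarrow> N (f i) < B) \<Longrightarrow> 0 < B \<Longrightarrow> N (sum f I) < B"
proof (induction I rule: infinite_finite_induct)
  case (insert x F)
  then have "N (f x) < B" "N (sum f F) < B" by auto
  then show ?case using N_add[of "f x" "sum f F"] insert(1,2) by simp
qed auto

lemma N_of_nat_le: "N (of_nat n) \<le> 1"
proof (induction n)
  case (Suc n)
  then show ?case using N_add[of 1 "of_nat n"] by simp
qed simp

lemma N_of_nat_mult_le: "N (of_nat n * x) \<le> N x"
  using mult_right_mono[OF N_of_nat_le[of n], of "N x"] by (simp add: N_mult)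

text \<open>\<open>app \<epsilon> a b\<close>: the leading terms of \<open>a\<close> and \<open>b\<close> agree to relative precision \<open>\<epsilon>\<close>.\<close>

definition app :: "real \<Rightarrow> 'a \<Rightarrow> 'a \<Rightarrow> bool" where
  "app \<epsilon> a b \<longleftrightarrow> N (a - b) \<le> \<epsilon> * N a"

lemma app_refl [simp]: "0 \<le> \<epsilon> \<Longrightarrow> app \<epsilon> a a"
  by (simp add: app_def)

text \<open>Precision below \<open>1\<close> forces equal norms. This makes
  \<open>app \<epsilon>\<close> an equivalence relation although its definition measures the error
  against \<open>a\<close> alone.\<close>

lemma app_N: assumes "app \<epsilon> a b" "\<epsilon> < 1" shows "N a = N b"
proof (cases "N a = 0")
  case True
  then have "N (a - b) = 0" using assms(1) N_nonneg[of "a - b"] unfolding app_def by simp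
  then show ?thesis by (rule N_eq_if_null)
next
  case False
  then have "0 < N a" using N_nonneg[of a] by linarith
  then have "\<epsilon> * N a < N a" using assms(2) by simp
  then show ?thesis using assms(1) N_eq_if_close[of a b] unfolding app_def by simp
qed

lemma app_sym: "app \<epsilon> a b \<Longrightarrow> \<epsilon> < 1 \<Longrightarrow> app \<epsilon> b a"
  using app_N[of \<epsilon> a b] by (simp add: app_def N_diff_commute)

lemma app_trans: "app \<epsilon> a b \<Longrightarrow> app \<epsilon> b c \<Longrightarrow> \<epsilon> < 1 \<Longrightarrow> app \<epsilon> a c"
  using app_N[of \<epsilon> a b] N_triangle[of a c b] by (simp add: app_def)

lemma app_mono: "app \<epsilon> a b \<Longrightarrow> \<epsilon> \<le> \<delta> \<Longrightarrow> app \<delta> a b"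
  unfolding app_def by (meson N_nonneg mult_right_mono order_trans)

lemma app_mult:
  assumes "app \<epsilon> a b" "app \<epsilon> c d" "\<epsilon> < 1"
  shows "app \<epsilon> (a * c) (b * d)"
proof -
  have eq: "a * c - b * d = a * (c - d) + (a - b) * d" by (simp add: algebra_simps)
  have "N a * N (c - d) \<le> N a * (\<epsilon> * N c)"
    using assms(2) unfolding app_def by (simp add: mult_left_mono)
  moreover have "N (a - b) * N d \<le> (\<epsilon> * N a) * N c"
    using assms(1) app_N[OF assms(2,3)] unfolding app_def by (metis N_nonneg mult_right_mono)
  ultimately show ?thesis
    unfolding app_def eq using N_add[of "a * (c - d)" "(a - b) * d"]
    by (simp add: N_mult mult.commute mult.left_commute)
qed

lemma app_power: "app \<epsilon> a b \<Longrightarrow> 0 \<le> \<epsilon> \<Longrightarrow> \<epsilon> < 1 \<Longrightarrow> app \<epsilon> (a ^ n) (b ^ n)"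
  by (induction n) (auto intro: app_mult)

text \<open>Cancelling a factor of nonzero norm costs no precision. Quotients are never formed in
  this ring, so a quotient such as the Newton step is handled through its product with the
  denominator.\<close>

lemma app_cancel:
  assumes "app \<epsilon> (a * c) (b * d)" "app \<epsilon> a b" "N a \<noteq> 0" "\<epsilon> < 1"
  shows "app \<epsilon> c d"
proof -
  have ab: "N a = N b" and "N (a * c) = N (b * d)" using app_N assms by blast+
  then have cd: "N c = N d" using assms(3) by (simp add: N_mult)
  have eq: "a * (c - d) = (a * c - b * d) + (b - a) * d" by (simp add: algebra_simps)
  have "N ((b - a) * d) \<le> (\<epsilon> * N a) * N c"
    using assms(2) cd unfolding app_def N_mult by (metis N_diff_commute N_nonneg mult_right_mono)
  then have "N (a * (c - d)) \<le> \<epsilon> * N a * N c"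
    unfolding eq using assms(1) N_add[of "a * c - b * d" "(b - a) * d"]
    by (simp add: app_def N_mult mult.assoc)
  then have "N a * N (c - d) \<le> N a * (\<epsilon> * N c)"
    by (simp add: N_mult mult.commute mult.left_commute)
  moreover have "0 < N a" using assms(3) N_nonneg[of a] by linarith
  ultimately show ?thesis unfolding app_def by simp
qed

lemma app_minus: "app \<epsilon> a b \<Longrightarrow> app \<epsilon> (- a) (- b)"
  unfolding app_def using N_minus[of "a - b"] by (simp add: algebra_simps)

lemma app_null: "N (a - b) = 0 \<Longrightarrow> 0 \<le> \<epsilon> \<Longrightarrow> app \<epsilon> a b"
  by (simp add: app_def)

text \<open>Vanishing is part of the leading term at every precision, so it is controlled together
  with the leading terms.\<close>

lemma app_null_iff: "N a = 0 \<Longrightarrow> app \<epsilon> a b \<longleftrightarrow> N b = 0"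
proof -
  assume a: "N a = 0"
  then have "app \<epsilon> a b \<longleftrightarrow> N (a - b) = 0" by (simp add: app_def)
  also have "\<dots> \<longleftrightarrow> N b = 0"
    using N_eq_if_null[of a b] a N_diff[of a b] N_nonneg[of "a - b"] by auto
  finally show ?thesis .
qed

text \<open>The error is relative to the largest summand and not to the sum. It informs about the
  leading term of the sum only if the summands do not cancel too much, which is what centres
  guarantee.\<close>

lemma app_sum:
  assumes "\<And>i. i \<in> I \<Longrightarrow> app \<epsilon> (f i) (g i)" "\<And>i. i \<in> I \<Longrightarrow> N (f i) \<le> B" "0 \<le> \<epsilon>" "0 \<le> B"
  shows "N (sum f I - sum g I) \<le> \<epsilon> * B"
proof -
  have "N (\<Sum>i\<in>I. f i - g i) \<le> \<epsilon> * B"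
  proof (rule N_sum)
    fix i assume "i \<in> I"
    then show "N (f i - g i) \<le> \<epsilon> * B"
      using assms(1,2)[of i] assms(3) unfolding app_def by (meson mult_left_mono order_trans)
  qed (use assms in auto)
  then show ?thesis by (simp add: sum_subtractf)
qed

section \<open>Polynomials and their expansions at a centre\<close>

definition pol :: "nat \<Rightarrow> (nat \<Rightarrow> 'a) \<Rightarrow> 'a \<Rightarrow> 'a" where
  "pol d a t = (\<Sum>i\<le>d. a i * t ^ i)"

text \<open>The \<open>i\<close>-th Hasse derivative at \<open>c\<close>; binomial coefficients
  replace division by factorials.\<close>

definition tay :: "nat \<Rightarrow> (nat \<Rightarrow> 'a) \<Rightarrow> 'a \<Rightarrow> nat \<Rightarrow> 'a" where
  "tay d a c i = (\<Sum>j\<le>d. of_nat (j choose i) * a j * c ^ (j - i))"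

definition der :: "(nat \<Rightarrow> 'a) \<Rightarrow> nat \<Rightarrow> 'a" where
  "der a i = of_nat (Suc i) * a (Suc i)"

lemma binomial_sum_upto:
  assumes "j \<le> d"
  shows "(\<Sum>i\<le>d. of_nat (j choose i) * (c::'a) ^ (j - i) * s ^ i) = (c + s) ^ j"
proof -
  have "(\<Sum>i\<le>d. of_nat (j choose i) * c ^ (j - i) * s ^ i)
      = (\<Sum>i\<le>j. of_nat (j choose i) * c ^ (j - i) * s ^ i)"
    using assms by (intro sum.mono_neutral_right) (auto simp: binomial_eq_0)
  also have "\<dots> = (s + c) ^ j" unfolding binomial_ring by (rule sum.cong) (auto simp: mult_ac)
  finally show ?thesis by (simp add: add.commute)
qed

lemma pol_tay: "pol d a (c + s) = pol d (tay d a c) s"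
proof -
  have "pol d (tay d a c) s = (\<Sum>i\<le>d. \<Sum>j\<le>d. of_nat (j choose i) * a j * c ^ (j - i) * s ^ i)"
    unfolding pol_def tay_def by (simp add: sum_distrib_right)
  also have "\<dots> = (\<Sum>j\<le>d. \<Sum>i\<le>d. of_nat (j choose i) * a j * c ^ (j - i) * s ^ i)"
    by (rule sum.swap)
  also have "\<dots> = (\<Sum>j\<le>d. a j * (\<Sum>i\<le>d. of_nat (j choose i) * c ^ (j - i) * s ^ i))"
    by (simp add: sum_distrib_left mult_ac)
  also have "\<dots> = pol d a (c + s)"
    unfolding pol_def by (rule sum.cong) (auto simp: binomial_sum_upto)
  finally show ?thesis by simp
qed

lemma tay_0: "tay d a c 0 = pol d a c"
  by (simp add: tay_def pol_def)

lemma tay_at_0: "i \<le> d \<Longrightarrow> tay d a 0 i = a i"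
proof -
  assume i: "i \<le> d"
  have "tay d a 0 i = (\<Sum>j\<le>d. if j = i then a j else 0)"
    unfolding tay_def by (rule sum.cong) (auto simp: power_0_left binomial_eq_0 not_le)
  then show ?thesis using i by simp
qed

text \<open>Choosing a subset of a subset in either order gives the same product of binomial
  coefficients; the binomial theorem then collects the powers of \<open>c\<close> and
  \<open>s\<close>.\<close>

lemma tay_tay: "tay d (tay d a c) s i = tay d a (c + s) i"
proof -
  have *: "(\<Sum>j\<le>d. of_nat (j choose i) * of_nat (k choose j) * c ^ (k - j) * s ^ (j - i))
      = of_nat (k choose i) * (c + s) ^ (k - i)" if "k \<le> d" for k
  proof (cases "i \<le> k")
    case True
    have "(\<Sum>j\<le>d. of_nat (j choose i) * of_nat (k choose j) * c ^ (k - j) * s ^ (j - i))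
       = (\<Sum>j\<in>{i..k}. of_nat (j choose i) * of_nat (k choose j) * c ^ (k - j) * s ^ (j - i))"
      using that by (intro sum.mono_neutral_right) (auto simp: binomial_eq_0)
    also have "\<dots> = (\<Sum>j\<in>{i..k}. of_nat (k choose i) *
        (of_nat ((k - i) choose (j - i)) * c ^ ((k - i) - (j - i)) * s ^ (j - i)))"
    proof (rule sum.cong[OF refl])
      fix j assume j: "j \<in> {i..k}"
      have "(k choose j) * (j choose i) = (k choose i) * ((k - i) choose (j - i))"
        using choose_mult[of i j k] j by auto
      then have "(of_nat (j choose i) * of_nat (k choose j) :: 'a)
          = of_nat (k choose i) * of_nat ((k - i) choose (j - i))"
        by (metis mult.commute of_nat_mult)
      moreover have "k - i - (j - i) = k - j" using j by auto
      ultimately show "of_nat (j choose i) * of_nat (k choose j) * c ^ (k - j) * s ^ (j - i) =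
        of_nat (k choose i) * (of_nat ((k - i) choose (j - i)) * c ^ ((k - i) - (j - i)) * s ^ (j - i))"
        by (simp add: mult.assoc)
    qed
    also have "\<dots> = of_nat (k choose i) *
        (\<Sum>j\<in>{i..k}. of_nat ((k - i) choose (j - i)) * c ^ ((k - i) - (j - i)) * s ^ (j - i))"
      by (simp add: sum_distrib_left)
    also have "(\<Sum>j\<in>{i..k}. of_nat ((k - i) choose (j - i)) * c ^ ((k - i) - (j - i)) * s ^ (j - i))
        = (\<Sum>m\<le>k - i. of_nat ((k - i) choose m) * c ^ ((k - i) - m) * s ^ m)"
      using True by (intro sum.reindex_bij_witness[of _ "\<lambda>m. m + i" "\<lambda>j. j - i"]) auto
    also have "\<dots> = (c + s) ^ (k - i)" by (rule binomial_sum_upto) simp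
    finally show ?thesis .
  next
    case False
    then have "of_nat (j choose i) * of_nat (k choose j) = (0::'a)" for j
      by (cases "j \<le> k") (auto simp: binomial_eq_0)
    then show ?thesis using False by (simp add: binomial_eq_0)
  qed
  have "tay d (tay d a c) s i
      = (\<Sum>j\<le>d. \<Sum>k\<le>d. a k * (of_nat (j choose i) * of_nat (k choose j) * c ^ (k - j) * s ^ (j - i)))"
    unfolding tay_def by (simp add: sum_distrib_right sum_distrib_left mult_ac)
  also have "\<dots> = (\<Sum>k\<le>d. \<Sum>j\<le>d. a k * (of_nat (j choose i) * of_nat (k choose j) * c ^ (k - j) * s ^ (j - i)))"
    by (rule sum.swap)
  also have "\<dots> = (\<Sum>k\<le>d. a k * (of_nat (k choose i) * (c + s) ^ (k - i)))"
    by (rule sum.cong[OF refl]) (simp add: sum_distrib_left[symmetric] *)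
  finally show ?thesis unfolding tay_def by (simp add: mult_ac)
qed

text \<open>Differentiation multiplies coefficients by positive integers. Their norms may be below
  \<open>1\<close> but are not \<open>0\<close>, so in bounded degree only a bounded factor is lost
  when estimates for the derivative are read back.\<close>

lemma tay_der: "tay d (der a) c i = of_nat (Suc i) * tay (Suc d) a c (Suc i)"
proof -
  have "(of_nat (j choose i) * of_nat (Suc j) :: 'a) = of_nat (Suc i) * of_nat (Suc j choose Suc i)" for j
    using Suc_times_binomial_eq[of j i] by (metis mult.commute of_nat_mult)
  then have "tay d (der a) c i = (\<Sum>j\<le>d. of_nat (Suc i) * (of_nat (Suc j choose Suc i) * a (Suc j) * c ^ (j - i)))"
    unfolding tay_def der_def by (intro sum.cong) (simp_all only: mult.assoc[symmetric])
  also have "\<dots> = of_nat (Suc i) * (\<Sum>j\<le>d. of_nat (Suc j choose Suc i) * a (Suc j) * c ^ (Suc j - Suc i))"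
    by (simp only: sum_distrib_left diff_Suc_Suc)
  also have "(\<Sum>j\<le>d. of_nat (Suc j choose Suc i) * a (Suc j) * c ^ (Suc j - Suc i)) = tay (Suc d) a c (Suc i)"
    unfolding tay_def by (subst sum.atMost_Suc_shift) simp
  finally show ?thesis .
qed

lemma pol_der: "pol d (der a) t = tay (Suc d) a t 1"
  using tay_der[of d a t 0] by (simp add: tay_0)

text \<open>The Gauss norm on the disc of radius \<open>S\<close> does not grow when the centre
  moves within the disc, because binomial coefficients have norm at most \<open>1\<close>.\<close>

lemma tay_bound:
  assumes "\<And>i. i \<le> d \<Longrightarrow> N (a i) * S ^ i \<le> A" "N t \<le> S" "0 \<le> A"
  shows "N (tay d a t i) * S ^ i \<le> A"
proof -
  have S: "0 \<le> S" using assms(2) N_nonneg[of t] by linarith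
  have "N (tay d a t i * 1) * S ^ i \<le> A"
  proof (cases "S ^ i = 0")
    case True then show ?thesis using assms(3) by (simp only: mult_zero_right)
  next
    case False
    then have pos: "0 < S ^ i" using zero_le_power[OF S, of i] by linarith
    have "N (tay d a t i) \<le> A / S ^ i"
      unfolding tay_def
    proof (rule N_sum)
      fix j assume j: "j \<in> {..d}"
      show "N (of_nat (j choose i) * a j * t ^ (j - i)) \<le> A / S ^ i"
      proof (cases "i \<le> j")
        case True
        have "N (of_nat (j choose i) * a j * t ^ (j - i)) \<le> N (a j) * N t ^ (j - i)"
          using N_of_nat_mult_le[of "j choose i" "a j"] by (simp add: N_mult N_power mult_right_mono)
        also have "\<dots> \<le> N (a j) * S ^ (j - i)"
          using assms(2) by (intro mult_left_mono power_mono) auto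
        finally have "N (of_nat (j choose i) * a j * t ^ (j - i)) * S ^ i \<le> N (a j) * S ^ (j - i) * S ^ i"
          using pos by (simp add: mult_right_mono)
        also have "\<dots> = N (a j) * S ^ j" using True by (simp add: mult.assoc power_add[symmetric])
        also have "\<dots> \<le> A" using assms(1) j by simp
        finally show ?thesis using pos by (simp add: pos_le_divide_eq)
      qed (use assms(3) pos in \<open>simp add: binomial_eq_0\<close>)
    qed (use assms(3) pos in simp)
    then show ?thesis using pos by (simp add: pos_le_divide_eq)
  qed
  then show ?thesis by simp
qed

text \<open>With Gauss norm at most \<open>A\<close> and relative step
  \<open>N h / S \<le> x \<le> 1\<close>, a term of order \<open>i\<close> is at most
  \<open>A\<close> times the \<open>i\<close>-th power of the relative step. Terms of order two and
  more therefore gain a factor \<open>x\<close> over the bound for the linear term.\<close>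

lemma pol_taylor:
  assumes a: "\<And>i. i \<le> d \<Longrightarrow> N (a i) * S ^ i \<le> A" and t: "N t \<le> S" and S: "0 < S" and A: "0 \<le> A"
    and h: "N h \<le> x * S" and x: "0 \<le> x" "x \<le> 1" and d: "1 \<le> d"
  shows "N (pol d a (t + h) - (pol d a t + tay d a t 1 * h)) \<le> A * x * (N h / S)"
    and "N (tay d a (t + h) 1 - tay d a t 1) \<le> A * x / S"
    and "N (pol d a (t + h) - pol d a t) \<le> A * (N h / S)"
proof -
  define b where "b = tay d a t"
  have b: "N (b i) * S ^ i \<le> A" for i unfolding b_def by (rule tay_bound[OF a t A])
  define y where "y = N h / S"
  have y: "0 \<le> y" "y \<le> x" "N h = y * S" unfolding y_def using S h by (auto simp: field_simps)
  have bi: "N (b i * h ^ i) \<le> A * y ^ i" for i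
  proof -
    have "N (b i * h ^ i) = (N (b i) * S ^ i) * y ^ i"
      by (simp add: N_mult N_power y(3) power_mult_distrib)
    also have "\<dots> \<le> A * y ^ i" using b[of i] y by (intro mult_right_mono) auto
    finally show ?thesis .
  qed
  have p2: "y ^ i \<le> x * y" if "2 \<le> i" for i
  proof -
    have "y ^ i = y ^ (i - 1) * y" using that by (metis One_nat_def Suc_1 Suc_le_D diff_Suc_1 power_Suc2)
    also have "y ^ (i - 1) \<le> x"
    proof -
      have "y ^ (i - 1) \<le> y ^ 1" using y x that by (intro power_decreasing) auto
      then show ?thesis using y by simp
    qed
    finally show ?thesis using y by (simp add: mult_right_mono)
  qed
  have p1: "y ^ i \<le> y" if "1 \<le> i" for i
    using power_decreasing[of 1 i y] y x that by simp
  have split: "pol d b h = (b 0 + b 1 * h) + (\<Sum>i\<in>{2..d}. b i * h ^ i)"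
  proof -
    have "{..d} = {0,1} \<union> {2..d}" using d by auto
    then have "pol d b h = (\<Sum>i\<in>{0,1}\<union>{2..d}. b i * h ^ i)" by (simp add: pol_def)
    also have "\<dots> = (\<Sum>i\<in>{0,1}. b i * h ^ i) + (\<Sum>i\<in>{2..d}. b i * h ^ i)"
      by (rule sum.union_disjoint) auto
    finally show ?thesis by simp
  qed
  have eq1: "pol d a (t + h) - (pol d a t + tay d a t 1 * h) = (\<Sum>i\<in>{2..d}. b i * h ^ i)"
    using split by (simp add: pol_tay b_def tay_0)
  show "N (pol d a (t + h) - (pol d a t + tay d a t 1 * h)) \<le> A * x * (N h / S)"
    unfolding eq1 y_def[symmetric]
  proof (rule N_sum)
    fix i assume "i \<in> {2..d}"
    then show "N (b i * h ^ i) \<le> A * x * y"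
      using bi[of i] p2[of i] A by (metis atLeastAtMost_iff mult.assoc mult_left_mono order_trans)
  qed (use A x y in auto)
  have "{..d} = insert 0 {1..d}" by auto
  then have "pol d b h = b 0 + (\<Sum>i\<in>{1..d}. b i * h ^ i)" by (simp add: pol_def)
  then have eq3: "pol d a (t + h) - pol d a t = (\<Sum>i\<in>{1..d}. b i * h ^ i)"
    by (simp add: pol_tay b_def tay_0)
  show "N (pol d a (t + h) - pol d a t) \<le> A * (N h / S)"
    unfolding eq3 y_def[symmetric]
  proof (rule N_sum)
    fix i assume "i \<in> {1..d}"
    then show "N (b i * h ^ i) \<le> A * y"
      using bi[of i] p1[of i] A by (meson atLeastAtMost_iff mult_left_mono order_trans)
  qed (use A y in auto)
  have eq2: "tay d a (t + h) 1 - tay d a t 1 = (\<Sum>i\<in>{2..d}. of_nat i * b i * h ^ (i - 1))"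
  proof -
    have "tay d a (t + h) 1 = tay d b h 1" unfolding b_def tay_tay ..
    also have "\<dots> = (\<Sum>j\<in>{0,1}\<union>{2..d}. of_nat j * b j * h ^ (j - 1))"
    proof -
      have "{..d} = {0,1} \<union> {2..d}" using d by auto
      then show ?thesis unfolding tay_def by simp
    qed
    also have "\<dots> = b 1 + (\<Sum>i\<in>{2..d}. of_nat i * b i * h ^ (i - 1))"
      by (subst sum.union_disjoint) auto
    finally show ?thesis unfolding b_def by simp
  qed
  show "N (tay d a (t + h) 1 - tay d a t 1) \<le> A * x / S"
    unfolding eq2
  proof (rule N_sum)
    fix i assume i: "i \<in> {2..d}"
    have "N (of_nat i * b i * h ^ (i - 1)) \<le> N (b i) * N h ^ (i - 1)"
      using N_of_nat_mult_le[of i "b i"] by (simp add: N_mult N_power mult_right_mono)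
    also have "\<dots> = (N (b i) * S ^ i) * y ^ (i - 1) / S"
    proof -
      have "S ^ i = S ^ (i - 1) * S" using i by (metis One_nat_def Suc_diff_le Suc_le_D atLeastAtMost_iff diff_Suc_1 diff_Suc_Suc numeral_2_eq_2 power_Suc2)
      then show ?thesis using S by (simp add: y(3) power_mult_distrib)
    qed
    also have "\<dots> \<le> A * x / S"
    proof -
      have "y ^ (i - 1) \<le> x" using p1[of "i - 1"] i y by fastforce
      then have "(N (b i) * S ^ i) * y ^ (i - 1) \<le> A * x" using b[of i] A y by (intro mult_mono) auto
      then show ?thesis using S by (simp add: divide_right_mono)
    qed
    finally show "N (of_nat i * b i * h ^ (i - 1)) \<le> A * x / S" .
  qed (use A x S in auto)
qed


section \<open>Newton iteration and simple roots\<close>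

text \<open>By the ultrametric inequality a whole tail moves no further than the bound on its first
  step, so the limit obeys the same bound without a factor \<open>1 / (1 - q)\<close>.\<close>

lemma steps_limit:
  assumes step: "\<And>n. N (u (Suc n) - u n) \<le> c * q ^ n" and q: "0 \<le> q" "q < 1" and c: "0 \<le> c"
  obtains l where "\<And>n. N (u n - l) \<le> c * q ^ n"
proof -
  have mono: "N (u (k + m) - u k) \<le> c * q ^ k" for k m
  proof (induction m)
    case (Suc m)
    have "c * q ^ (k + m) \<le> c * q ^ k" using q c by (intro mult_left_mono power_decreasing) auto
    then show ?case using Suc step[of "k + m"] N_triangle[of "u (k + Suc m)" "u k" "u (k + m)"] by simp
  qed (use q c in simp)
  have lim: "(\<lambda>n. c * q ^ n) \<longlonglongrightarrow> 0"
    using tendsto_mult_left[OF LIMSEQ_power_zero[of q], of c] q by simp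
  have "\<exists>l. (\<lambda>n. N (u n - l)) \<longlonglongrightarrow> 0"
  proof (rule N_complete)
    fix \<epsilon> :: real assume "0 < \<epsilon>"
    then obtain k where k: "\<bar>c * q ^ k\<bar> < \<epsilon>"
      using LIMSEQ_D[OF lim, of \<epsilon>] by auto
    have *: "N (u m - u k) < \<epsilon>" if "m \<ge> k" for m
      using mono[of k "m - k"] that k by simp
    show "\<exists>k. \<forall>m\<ge>k. \<forall>n\<ge>k. N (u m - u n) < \<epsilon>"
    proof (intro exI allI impI)
      fix m n assume "m \<ge> k" "n \<ge> k"
      then show "N (u m - u n) < \<epsilon>"
        using *[of m] *[of n] N_triangle[of "u m" "u n" "u k"] by (simp add: N_diff_commute)
    qed
  qed
  then obtain l where l: "(\<lambda>n. N (u n - l)) \<longlonglongrightarrow> 0" ..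
  have "N (u n - l) \<le> c * q ^ n" for n
  proof (rule ccontr)
    assume "\<not> ?thesis"
    then have gt: "c * q ^ n < N (u n - l)" by simp
    then have "0 < N (u n - l)" using q c by (smt (verit) mult_nonneg_nonneg zero_le_power)
    then obtain m0 where m0: "\<And>m. m \<ge> m0 \<Longrightarrow> N (u m - l) < N (u n - l)"
      using LIMSEQ_D[OF l, of "N (u n - l)"] by auto
    have "N (u n - u (n + m0)) < N (u n - l)" using mono[of n m0] gt by (simp add: N_diff_commute)
    then show False using m0[of "n + m0"] N_triangle[of "u n" l "u (n + m0)"] by simp
  qed
  then show thesis by (rule that)
qed

lemma le_geometric_imp_le_0:
  assumes "\<And>n. y \<le> c * q ^ n" "0 \<le> q" "(q::real) < 1"
  shows "y \<le> 0"
proof -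
  have "(\<lambda>n. c * q ^ n) \<longlonglongrightarrow> 0"
    using tendsto_mult_left[OF LIMSEQ_power_zero[of q], of c] assms by simp
  then show ?thesis using assms(1) by (intro LIMSEQ_le_const) auto
qed

text \<open>Newton's method with explicit constants. The number \<open>\<theta>\<close> compares the
  linear term with the Gauss bound \<open>A\<close>; a value below
  \<open>\<theta>\<^sup>2 * A\<close> makes the iteration contract without leaving the disc or
  changing the size of the derivative. No residue field is involved, so one \<open>\<theta>\<close>
  can serve all parameters.\<close>

lemma hensel:
  assumes a: "\<And>i. i \<le> d \<Longrightarrow> N (a i) * S ^ i \<le> A" and s: "N s \<le> S" and S: "0 < S" and A: "0 < A"
    and d: "1 \<le> d" and \<theta>: "0 < \<theta>" "\<theta> \<le> 1" and der: "\<theta> * A \<le> N (tay d a s 1) * S"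
    and x: "0 \<le> x" "x < \<theta>\<^sup>2" and f: "N (pol d a s) \<le> x * A"
  obtains \<xi> where "N (pol d a \<xi>) = 0" "N (\<xi> - s) \<le> x / \<theta> * S"
proof -
  \<comment> \<open>The inverse of the derivative exists only up to norm \<open>0\<close> and is
    picked by choice; the linear part of the new value then has norm \<open>0\<close> instead of
    being \<open>0\<close>.\<close>
  define step where "step t = - pol d a t * (SOME y. N (tay d a t 1 * y - 1) = 0)" for t
  define u where "u = rec_nat s (\<lambda>_ t. t + step t)"
  have u0: "u 0 = s" and uS: "u (Suc n) = u n + step (u n)" for n by (simp_all add: u_def)
  define q where "q = x / \<theta>\<^sup>2"
  have q: "0 \<le> q" "q < 1" using x \<theta> by (auto simp: q_def)
  \<comment> \<open>\<open>xn n * S\<close> bounds the \<open>n\<close>-th step: a value of size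
    \<open>x * q ^ n * A\<close> divided by a derivative of size at least
    \<open>\<theta> * A / S\<close>.\<close>
  define xn where "xn n = x / \<theta> * q ^ n" for n
  have x\<theta>: "x / \<theta> < \<theta>" using x \<theta> by (simp add: power2_eq_square divide_less_eq)
  have xn: "0 \<le> xn n" "xn n \<le> x / \<theta>" for n
    using x \<theta> q mult_left_le[OF power_le_one[of q n], of "x / \<theta>"] by (auto simp: xn_def)
  have xn1: "xn n < \<theta>" "xn n \<le> 1" for n using xn[of n] x\<theta> \<theta> by linarith+
    have main: "N (step t) \<le> xn n * S \<and> N (t + step t) \<le> S \<and> \<theta> * A \<le> N (tay d a (t + step t) 1) * S
         \<and> N (pol d a (t + step t)) \<le> x * q ^ Suc n * A"
      if t: "N t \<le> S" and D: "\<theta> * A \<le> N (tay d a t 1) * S" and P: "N (pol d a t) \<le> x * q ^ n * A" for t n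
    proof -
      define y where "y = (SOME y. N (tay d a t 1 * y - 1) = 0)"
      have Dpos: "0 < N (tay d a t 1)"
        using D mult_pos_pos[OF \<theta>(1) A] S N_nonneg[of "tay d a t 1"] by (metis order_le_less mult_zero_left not_less)
      then have y: "N (tay d a t 1 * y - 1) = 0" unfolding y_def using someI_ex[OF N_inv[of "tay d a t 1"]] by simp
      then have Ny: "N (tay d a t 1) * N y = 1" using N_eq_if_null[OF y] by (simp add: N_mult)
      have h: "step t = - pol d a t * y" by (simp add: step_def y_def)
      have "N (step t) * (\<theta> * A) \<le> N (step t) * (N (tay d a t 1) * S)"
        using D by (intro mult_left_mono) auto
      also have "\<dots> = N (pol d a t) * S * (N (tay d a t 1) * N y)" by (simp add: h N_mult)
      also have "\<dots> = N (pol d a t) * S" by (simp only: Ny mult_1_right)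
      also have "\<dots> \<le> x * q ^ n * A * S" using P S by simp
      finally have hN: "N (step t) \<le> xn n * S"
        using \<theta> A by (simp add: xn_def field_simps)
      have t1: "N (t + step t) \<le> S"
      proof -
        have "xn n * S \<le> S" using mult_right_mono[OF xn1(2)[of n], of S] S by linarith
        then have "N (step t) \<le> S" using hN by linarith
        then show ?thesis using N_add[of t "step t"] t by linarith
      qed
      note T = pol_taylor[OF a t S less_imp_le[OF A] hN xn(1) xn1(2) d]
      have lin: "N (pol d a t + tay d a t 1 * step t) = 0"
      proof -
        have "pol d a t + tay d a t 1 * step t = - pol d a t * (tay d a t 1 * y - 1)"
          by (simp add: h algebra_simps)
        then show ?thesis using y by (simp only: N_mult mult_zero_right)
      qed
      have hS: "N (step t) / S \<le> xn n" using hN S by (simp add: pos_divide_le_eq)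
      have "N (pol d a (t + step t)) \<le> A * xn n * xn n"
      proof -
        have "N (pol d a (t + step t)) \<le> max (N (pol d a (t + step t) - (pol d a t + tay d a t 1 * step t))) 0"
          using N_add[of "pol d a (t + step t) - (pol d a t + tay d a t 1 * step t)"
              "pol d a t + tay d a t 1 * step t"] lin by simp
        also have "\<dots> \<le> A * xn n * (N (step t) / S)" using T(1) by simp
        also have "\<dots> \<le> A * xn n * xn n" using hS A xn(1) by (intro mult_left_mono) auto
        finally show ?thesis .
      qed
      also have "A * xn n * xn n = A * x * q * (q ^ n * q ^ n)"
        using \<theta> by (simp add: xn_def q_def power2_eq_square field_simps)
      \<comment> \<open>The decrease is quadratic; one of the two factors \<open>q ^ n\<close> is
        dropped since a geometric rate suffices.\<close>
      also have "\<dots> \<le> A * x * q * (q ^ n * 1)"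
        using A x q by (intro mult_left_mono power_le_one) auto
      finally have P1: "N (pol d a (t + step t)) \<le> x * q ^ Suc n * A" by (simp add: mult_ac)
      have "N (tay d a (t + step t) 1 - tay d a t 1) < N (tay d a t 1)"
      proof -
        have "A * xn n / S < A * \<theta> / S" using A S xn1(1)[of n] by (simp add: divide_strict_right_mono)
        also have "\<dots> \<le> N (tay d a t 1)" using D S by (simp add: divide_le_eq mult.commute)
        finally show ?thesis using T(2) by simp
      qed
      then have "N (tay d a (t + step t) 1) = N (tay d a t 1)"
        by (intro N_eq_if_close) (simp add: N_diff_commute)
      then show ?thesis using hN t1 P1 D by simp
    qed
    have inv: "N (u n) \<le> S \<and> \<theta> * A \<le> N (tay d a (u n) 1) * S \<and> N (pol d a (u n)) \<le> x * q ^ n * A" for n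
    proof (induction n)
      case 0 then show ?case using s der f by (simp add: u0)
    next
      case (Suc n) then show ?case using main[of "u n" n] unfolding uS by blast
    qed
    have stp: "N (step (u n)) \<le> xn n * S" for n using main[of "u n" n] inv[of n] by blast
  have "N (u (Suc n) - u n) \<le> (x / \<theta> * S) * q ^ n" for n
    using stp[of n] by (simp add: uS xn_def mult_ac)
  then obtain l where l: "\<And>n. N (u n - l) \<le> (x / \<theta> * S) * q ^ n"
    using steps_limit[of u "x / \<theta> * S" q] q x \<theta> S by auto
  have "N (pol d a l) \<le> (x / \<theta> * A) * q ^ n" for n
  proof -
    have h: "N (l - u n) \<le> xn n * S" using l[of n] by (simp add: N_diff_commute xn_def mult_ac)
    have "N (pol d a l - pol d a (u n)) \<le> A * (N (l - u n) / S)"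
    proof -
      have un: "N (u n) \<le> S" using inv[of n] by blast
      show ?thesis using pol_taylor(3)[OF a un S less_imp_le[OF A] h xn(1) xn1(2) d] by simp
    qed
    also have "\<dots> \<le> A * xn n" using h S A by (intro mult_left_mono) (auto simp: pos_divide_le_eq)
    finally have 1: "N (pol d a l - pol d a (u n)) \<le> (x / \<theta> * A) * q ^ n" by (simp add: xn_def mult_ac)
    have "x \<le> x / \<theta>" using x \<theta> by (simp add: le_divide_eq mult_left_le)
    then have "x * q ^ n * A \<le> (x / \<theta>) * q ^ n * A" using q A by (intro mult_right_mono) auto
    then have 2: "N (pol d a (u n)) \<le> (x / \<theta> * A) * q ^ n" using inv[of n] by (simp add: mult_ac)
    show ?thesis using 1 2 N_add[of "pol d a l - pol d a (u n)" "pol d a (u n)"] by simp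
  qed
  then have "N (pol d a l) \<le> 0" using q by (rule le_geometric_imp_le_0)
  moreover have "N (l - s) \<le> x / \<theta> * S" using l[of 0] by (simp add: u0 N_diff_commute)
  ultimately show thesis by (intro that) auto
qed

text \<open>Within relative distance \<open>\<theta>\<close> of such a root the linear term
  dominates all others, so the expansion at the root shows no cancellation at all.\<close>

lemma near_root:
  assumes a: "\<And>i. i \<le> d \<Longrightarrow> N (a i) * S ^ i \<le> A" and \<sigma>: "N \<sigma> \<le> S" and S: "0 < S" and A: "0 < A"
    and d: "1 \<le> d" and \<theta>: "0 < \<theta>" "\<theta> \<le> 1" and der: "\<theta> * A \<le> N (tay d a \<sigma> 1) * S"
    and root: "N (pol d a \<sigma>) = 0" and w: "N w < \<theta> * S"
  shows "N (pol d a (\<sigma> + w)) = N (tay d a \<sigma> 1) * N w"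
    and "i \<le> d \<Longrightarrow> N (tay d a \<sigma> i * w ^ i) \<le> N (pol d a (\<sigma> + w))"
proof -
  define x where "x = N w / S"
  have x: "0 \<le> x" "x < \<theta>" "x \<le> 1" "N w \<le> x * S" "N w = x * S"
  proof -
    have "N w \<le> S" using w mult_right_mono[OF \<theta>(2), of S] S by linarith
    then show "0 \<le> x" "x < \<theta>" "x \<le> 1" "N w \<le> x * S" "N w = x * S"
      using w S by (auto simp: x_def pos_divide_less_eq)
  qed
  have D: "\<theta> * A * x \<le> N (tay d a \<sigma> 1) * N w"
    using mult_right_mono[OF der x(1)] by (simp add: x(5) mult_ac)
  have T: "N (pol d a (\<sigma> + w) - (pol d a \<sigma> + tay d a \<sigma> 1 * w)) \<le> A * x * x"
    using pol_taylor(1)[OF a \<sigma> S less_imp_le[OF A] x(4) x(1,3) d] by (simp add: x_def)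
  have lin: "N (pol d a \<sigma> + tay d a \<sigma> 1 * w) = N (tay d a \<sigma> 1) * N w"
    using N_eq_if_null[of "pol d a \<sigma> + tay d a \<sigma> 1 * w" "tay d a \<sigma> 1 * w"] root by (simp add: N_mult)
  show main: "N (pol d a (\<sigma> + w)) = N (tay d a \<sigma> 1) * N w"
  proof (cases "x = 0")
    case True
    then have "N w = 0" using x by simp
    moreover have "N (pol d a (\<sigma> + w) - (pol d a \<sigma> + tay d a \<sigma> 1 * w)) = 0" using T True by simp
    ultimately show ?thesis using lin N_eq_if_null by metis
  next
    case False
    then have "A * x * x < \<theta> * A * x" using x A by (simp add: mult.commute)
    then show ?thesis using D T lin N_eq_if_close[of "pol d a \<sigma> + tay d a \<sigma> 1 * w" "pol d a (\<sigma> + w)"]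
      by (simp add: N_diff_commute)
  qed
  show "N (tay d a \<sigma> i * w ^ i) \<le> N (pol d a (\<sigma> + w))" if i: "i \<le> d"
  proof (cases "i = 0")
    case True then show ?thesis using root by (simp add: tay_0 N_mult)
  next
    case i0: False
    show ?thesis
    proof (cases "i = 1")
      case True then show ?thesis using main by (simp add: N_mult)
    next
      case False
      have "N (tay d a \<sigma> i * w ^ i) = (N (tay d a \<sigma> i) * S ^ i) * x ^ i"
        by (simp add: N_mult N_power x(5) power_mult_distrib)
      also have "\<dots> \<le> A * x ^ i"
        using tay_bound[OF a \<sigma> less_imp_le[OF A]] x by (intro mult_right_mono) auto
      also have "\<dots> \<le> A * (x * \<theta>)"
      proof -
        have "x ^ i \<le> x ^ 2" using i0 False x by (intro power_decreasing) auto
        also have "\<dots> \<le> x * \<theta>" using x by (simp add: power2_eq_square mult_left_mono)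
        finally show ?thesis using A by simp
      qed
      also have "\<dots> \<le> N (pol d a (\<sigma> + w))" using D main by (simp add: mult_ac)
      finally show ?thesis .
    qed
  qed
qed

text \<open>Dominance of the linear term leaves no room for a second root.\<close>

lemma root_unique:
  assumes "\<And>i. i \<le> d \<Longrightarrow> N (a i) * S ^ i \<le> A" "N \<sigma> \<le> S" "0 < S" "0 < A"
    "1 \<le> d" "0 < \<theta>" "\<theta> \<le> 1" "\<theta> * A \<le> N (tay d a \<sigma> 1) * S"
    "N (pol d a \<sigma>) = 0" "N (pol d a \<tau>) = 0" "N (\<tau> - \<sigma>) < \<theta> * S"
  shows "N (\<tau> - \<sigma>) = 0"
proof -
  have "0 < N (tay d a \<sigma> 1)"
    using assms(3,8) mult_pos_pos[OF assms(6,4)] N_nonneg[of "tay d a \<sigma> 1"]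
    by (metis order_le_less mult_zero_left not_less)
  then show ?thesis using near_root(1)[OF assms(1-9,11)] assms(10) by simp
qed

text \<open>Divide out one root and induct. Because \<open>N\<close> is only a seminorm, distinct
  roots must be at nonzero distance, and the zero polynomial is one whose coefficients have norm
  \<open>0\<close>.\<close>

lemma root_count:
  assumes "finite R" "\<And>r. r \<in> R \<Longrightarrow> N (pol d a r) = 0"
    "\<And>r s. r \<in> R \<Longrightarrow> s \<in> R \<Longrightarrow> r \<noteq> s \<Longrightarrow> N (r - s) \<noteq> 0" "d < card R" "i \<le> d"
  shows "N (a i) = 0"
  using assms
proof (induction d arbitrary: a R i)
  case 0
  then obtain r where "r \<in> R" by fastforce
  then show ?case using 0 by (auto simp: pol_def)
next
  case (Suc d)
  then obtain r where r: "r \<in> R" by fastforce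
  define b where "b = tay (Suc d) a r"
  have b0: "N (b 0) = 0" using Suc.prems(2)[OF r] by (simp add: b_def tay_0)
  define R' where "R' = (\<lambda>s. s - r) ` (R - {r})"
  have inj: "inj_on (\<lambda>s. s - r) (R - {r})" by (simp add: inj_on_def)
  have bS: "N (b (Suc j)) = 0" if "j \<le> d" for j
  proof (rule Suc.IH[where R = R' and a = "\<lambda>j. b (Suc j)"])
    show "finite R'" using Suc.prems(1) by (simp add: R'_def)
    show "d < card R'" using Suc.prems(1,4) r by (simp add: R'_def card_image[OF inj])
    show "j \<le> d" by (rule that)
    show "N (s - t) \<noteq> 0" if "s \<in> R'" "t \<in> R'" "s \<noteq> t" for s t
      using that Suc.prems(3) by (auto simp: R'_def)
    show "N (pol d (\<lambda>j. b (Suc j)) h) = 0" if h: "h \<in> R'" for h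
    proof -
      from h obtain s where s: "s \<in> R" "s \<noteq> r" "h = s - r" by (auto simp: R'_def)
      have "pol (Suc d) a (r + h) = b 0 + h * pol d (\<lambda>j. b (Suc j)) h"
        unfolding pol_tay b_def[symmetric] unfolding pol_def
        by (subst sum.atMost_Suc_shift) (simp add: sum_distrib_left mult_ac)
      then have "N (b 0 + h * pol d (\<lambda>j. b (Suc j)) h) = 0" using Suc.prems(2)[OF s(1)] s(3) by simp
      then have "N (h * pol d (\<lambda>j. b (Suc j)) h) = 0"
        using N_eq_if_null[of "b 0 + h * pol d (\<lambda>j. b (Suc j)) h" "h * pol d (\<lambda>j. b (Suc j)) h"] b0
        by simp
      then show ?thesis using Suc.prems(3)[OF s(1) r s(2)] s(3) by (simp add: N_mult)
    qed
  qed
  have b: "N (b j) = 0" if "j \<le> Suc d" for j using b0 bS that by (cases j) auto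
  have "a i = tay (Suc d) b (- r) i"
    unfolding b_def tay_tay using Suc.prems(5) by (simp add: tay_at_0)
  moreover have "N (tay (Suc d) b (- r) i) \<le> 0"
    unfolding tay_def by (rule N_sum) (auto simp: N_mult b)
  ultimately show ?case by simp
qed

end

subsection \<open>Centres of polynomials\<close>

inductive_set polyfun :: "((nat \<Rightarrow> 'a::comm_ring_1) \<Rightarrow> 'a) set" where
  const: "(\<lambda>_. c) \<in> polyfun"
| var: "(\<lambda>e. e i) \<in> polyfun"
| add: "f \<in> polyfun \<Longrightarrow> g \<in> polyfun \<Longrightarrow> (\<lambda>e. f e + g e) \<in> polyfun"
| mult: "f \<in> polyfun \<Longrightarrow> g \<in> polyfun \<Longrightarrow> (\<lambda>e. f e * g e) \<in> polyfun"

context vring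
begin

text \<open>\<open>ev P\<close>: \<open>P\<close> holds for all tuples \<open>e\<close>, \<open>e'\<close> that are close enough, in the sense that the leading
  terms of sufficiently many polynomials agree at \<open>e\<close> and \<open>e'\<close> to sufficient precision.\<close>

definition ev :: "((nat \<Rightarrow> 'a) \<Rightarrow> (nat \<Rightarrow> 'a) \<Rightarrow> bool) \<Rightarrow> bool" where
  "ev P \<longleftrightarrow> (\<exists>H \<delta>. finite H \<and> H \<subseteq> polyfun \<and> 0 < \<delta> \<and> \<delta> < 1 \<and>
     (\<forall>e e'. (\<forall>h\<in>H. app \<delta> (h e) (h e')) \<longrightarrow> P e e'))"

lemma ev_mono: "ev P \<Longrightarrow> (\<And>e e'. P e e' \<Longrightarrow> Q e e') \<Longrightarrow> ev Q"
  unfolding ev_def by meson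

lemma ev_True: "(\<And>e e'. P e e') \<Longrightarrow> ev P"
  unfolding ev_def by (rule exI[of _ "{}"], rule exI[of _ "1/2"]) auto

lemma ev_conj: assumes "ev P" "ev Q" shows "ev (\<lambda>e e'. P e e' \<and> Q e e')"
proof -
  obtain H \<delta> where H: "finite H" "H \<subseteq> polyfun" "0 < \<delta>" "\<delta> < 1"
    "\<And>e e'. (\<forall>h\<in>H. app \<delta> (h e) (h e')) \<Longrightarrow> P e e'" using assms(1) unfolding ev_def by blast
  obtain K \<epsilon> where K: "finite K" "K \<subseteq> polyfun" "0 < \<epsilon>" "\<epsilon> < 1"
    "\<And>e e'. (\<forall>h\<in>K. app \<epsilon> (h e) (h e')) \<Longrightarrow> Q e e'" using assms(2) unfolding ev_def by blast
  have "P e e' \<and> Q e e'" if "\<forall>h\<in>H \<union> K. app (min \<delta> \<epsilon>) (h e) (h e')" for e e'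
    using that H(5)[of e e'] K(5)[of e e'] app_mono[of "min \<delta> \<epsilon>"] by (metis UnCI min.cobounded1 min.cobounded2)
  then show ?thesis unfolding ev_def using H K
    by (intro exI[of _ "H \<union> K"] exI[of _ "min \<delta> \<epsilon>"]) auto
qed

lemma ev_ball: "finite I \<Longrightarrow> (\<And>i. i \<in> I \<Longrightarrow> ev (P i)) \<Longrightarrow> ev (\<lambda>e e'. \<forall>i\<in>I. P i e e')"
proof (induction I rule: finite_induct)
  case (insert x F)
  then have "ev (\<lambda>e e'. P x e e' \<and> (\<forall>i\<in>F. P i e e'))" by (intro ev_conj) auto
  then show ?case by (rule ev_mono) auto
qed (auto intro: ev_True)

lemma ev_sym: assumes "ev P" shows "ev (\<lambda>e e'. P e' e)"
  using assms unfolding ev_def by (meson app_sym subsetD)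

section \<open>Rings of functions with determined leading terms, and centres over them\<close>

definition ring_of_functions :: "((nat \<Rightarrow> 'a) \<Rightarrow> 'a) set \<Rightarrow> bool" where
  "ring_of_functions R \<longleftrightarrow> polyfun \<subseteq> R \<and>
     (\<forall>f\<in>R. \<forall>g\<in>R. (\<lambda>e. f e + g e) \<in> R \<and> (\<lambda>e. f e * g e) \<in> R)"

text \<open>The members need not be polynomials; what matters is that polynomials control their
  leading terms to every precision. Being a ring is essential, since Taylor coefficients at a centre
  and differences of centres must again be controlled.\<close>

definition good :: "((nat \<Rightarrow> 'a) \<Rightarrow> 'a) set \<Rightarrow> bool" where
  "good R \<longleftrightarrow> ring_of_functions R \<and> (\<forall>g\<in>R. \<forall>\<epsilon>. 0 < \<epsilon> \<and> \<epsilon> < 1 \<longrightarrow> ev (\<lambda>e e'. app \<epsilon> (g e) (g e')))"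

lemma good_ring: "good R \<Longrightarrow> ring_of_functions R"
  by (simp add: good_def)

lemma good_app: "good R \<Longrightarrow> g \<in> R \<Longrightarrow> 0 < \<epsilon> \<Longrightarrow> \<epsilon> < 1 \<Longrightarrow> ev (\<lambda>e e'. app \<epsilon> (g e) (g e'))"
  by (simp add: good_def)

lemma good_polyfun: "good polyfun"
proof -
  have "ev (\<lambda>e e'. app \<epsilon> (g e) (g e'))" if "g \<in> polyfun" "0 < \<epsilon>" "\<epsilon> < 1" for g \<epsilon>
    using that unfolding ev_def by (intro exI[of _ "{g}"] exI[of _ \<epsilon>]) auto
  then show ?thesis unfolding good_def ring_of_functions_def by (auto intro: polyfun.add polyfun.mult)
qed

context
  fixes R assumes R: "ring_of_functions R"
begin

lemma ring_const: "(\<lambda>_. c) \<in> R"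
  using R polyfun.const unfolding ring_of_functions_def by blast

lemma ring_add: "f \<in> R \<Longrightarrow> g \<in> R \<Longrightarrow> (\<lambda>e. f e + g e) \<in> R"
  and ring_mult: "f \<in> R \<Longrightarrow> g \<in> R \<Longrightarrow> (\<lambda>e. f e * g e) \<in> R"
  using R unfolding ring_of_functions_def by blast+

lemma ring_diff: "f \<in> R \<Longrightarrow> g \<in> R \<Longrightarrow> (\<lambda>e. f e - g e) \<in> R"
  using ring_add[of f "\<lambda>e. - 1 * g e"] ring_mult[OF ring_const[of "- 1"], of g] by simp

lemma ring_sum: "(\<And>i. i \<in> I \<Longrightarrow> f i \<in> R) \<Longrightarrow> (\<lambda>e. \<Sum>i\<in>I. f i e) \<in> R"
  by (induction I rule: infinite_finite_induct) (auto intro: ring_const ring_add)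

lemma ring_power: "f \<in> R \<Longrightarrow> (\<lambda>e. f e ^ n) \<in> R"
  by (induction n) (auto intro: ring_const ring_mult)

lemma ring_pol: "(\<And>j. a j \<in> R) \<Longrightarrow> c \<in> R \<Longrightarrow> (\<lambda>e. pol d (\<lambda>j. a j e) (c e)) \<in> R"
  unfolding pol_def by (intro ring_sum ring_mult ring_power)

lemma ring_tay: "(\<And>j. a j \<in> R) \<Longrightarrow> c \<in> R \<Longrightarrow> (\<lambda>e. tay d (\<lambda>j. a j e) (c e) i) \<in> R"
  unfolding tay_def by (intro ring_sum ring_mult ring_power ring_const)

definition polyR :: "((nat \<Rightarrow> 'a) \<Rightarrow> 'a \<Rightarrow> 'a) set" where
  "polyR = {F. \<exists>n G. (\<forall>j. G j \<in> R) \<and> F = (\<lambda>e t. pol n (\<lambda>j. G j e) t)}"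

lemma pol_pad: "n \<le> m \<Longrightarrow> pol n a t = pol m (\<lambda>j. if j \<le> n then a j else 0) t"
proof -
  assume "n \<le> m"
  then have "(\<Sum>i\<le>m. (if i \<le> n then a i else 0) * t ^ i) = (\<Sum>i\<le>n. (if i \<le> n then a i else 0) * t ^ i)"
    by (intro sum.mono_neutral_right) auto
  then show ?thesis by (simp add: pol_def)
qed

lemma polyR_I: "(\<And>j. G j \<in> R) \<Longrightarrow> (\<lambda>e t. pol n (\<lambda>j. G j e) t) \<in> polyR"
  unfolding polyR_def by blast

lemma polyR_const: "f \<in> R \<Longrightarrow> (\<lambda>e t. f e) \<in> polyR"
  using polyR_I[of "\<lambda>_. f" 0] by (simp add: pol_def)

lemma polyR_add: assumes "F \<in> polyR" "F' \<in> polyR" shows "(\<lambda>e t. F e t + F' e t) \<in> polyR"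
proof -
  obtain n G where F: "\<And>j. G j \<in> R" "F = (\<lambda>e t. pol n (\<lambda>j. G j e) t)" using assms unfolding polyR_def by auto
  obtain m H where F': "\<And>j. H j \<in> R" "F' = (\<lambda>e t. pol m (\<lambda>j. H j e) t)" using assms unfolding polyR_def by auto
  define K where "K j = (\<lambda>e. (if j \<le> n then G j e else 0) + (if j \<le> m then H j e else 0))" for j
  have "K j \<in> R" for j unfolding K_def using F(1) F'(1) by (cases "j \<le> n"; cases "j \<le> m") (auto intro: ring_add ring_const)
  moreover have "(\<lambda>e t. F e t + F' e t) = (\<lambda>e t. pol (max n m) (\<lambda>j. K j e) t)"
  proof (intro ext)
    fix e t
    have "F e t = pol (max n m) (\<lambda>j. if j \<le> n then G j e else 0) t"
      and "F' e t = pol (max n m) (\<lambda>j. if j \<le> m then H j e else 0) t"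
      unfolding F F' by (rule pol_pad; simp)+
    then show "F e t + F' e t = pol (max n m) (\<lambda>j. K j e) t"
      by (simp add: pol_def K_def distrib_right sum.distrib)
  qed
  ultimately show ?thesis using polyR_I by metis
qed

lemma polyR_scale: assumes "f \<in> R" "F \<in> polyR" shows "(\<lambda>e t. f e * F e t) \<in> polyR"
proof -
  obtain n G where F: "\<And>j. G j \<in> R" "F = (\<lambda>e t. pol n (\<lambda>j. G j e) t)" using assms unfolding polyR_def by auto
  have "(\<lambda>e t. f e * F e t) = (\<lambda>e t. pol n (\<lambda>j. (\<lambda>e. f e * G j e) e) t)"
    by (simp add: F pol_def sum_distrib_left mult.assoc)
  then show ?thesis using polyR_I[of "\<lambda>j e. f e * G j e" n] F(1) assms(1) ring_mult by simp
qed

lemma polyR_shift: assumes "F \<in> polyR" shows "(\<lambda>e t. t * F e t) \<in> polyR"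
proof -
  obtain n G where F: "\<And>j. G j \<in> R" "F = (\<lambda>e t. pol n (\<lambda>j. G j e) t)" using assms unfolding polyR_def by auto
  define K where "K j = (case j of 0 \<Rightarrow> (\<lambda>_. 0) | Suc i \<Rightarrow> G i)" for j
  have "K j \<in> R" for j unfolding K_def using F(1) by (auto intro: ring_const split: nat.split)
  moreover have "(\<lambda>e t. t * F e t) = (\<lambda>e t. pol (Suc n) (\<lambda>j. K j e) t)"
    unfolding F pol_def by (subst sum.atMost_Suc_shift) (simp add: K_def sum_distrib_left mult_ac)
  ultimately show ?thesis using polyR_I by metis
qed

lemma pol_Suc_shift: "pol (Suc n) a t = a 0 + t * pol n (\<lambda>j. a (Suc j)) t"
  unfolding pol_def by (subst sum.atMost_Suc_shift) (simp add: sum_distrib_left mult_ac)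

lemma polyR_mult: assumes "F \<in> polyR" "F' \<in> polyR" shows "(\<lambda>e t. F e t * F' e t) \<in> polyR"
proof -
  obtain n G where F: "\<And>j. G j \<in> R" "F = (\<lambda>e t. pol n (\<lambda>j. G j e) t)" using assms unfolding polyR_def by auto
  have "(\<lambda>e t. pol n (\<lambda>j. G j e) t * F' e t) \<in> polyR"
    using F(1)
  proof (induction n arbitrary: G)
    case 0
    then show ?case using polyR_scale[OF _ assms(2), of "G 0"] by (simp add: pol_def)
  next
    case (Suc n)
    have "(\<lambda>e t. t * (pol n (\<lambda>j. G (Suc j) e) t * F' e t)) \<in> polyR"
      by (rule polyR_shift, rule Suc.IH) (rule Suc.prems)
    then have "(\<lambda>e t. G 0 e * F' e t + t * (pol n (\<lambda>j. G (Suc j) e) t * F' e t)) \<in> polyR"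
      using polyR_scale[OF _ assms(2), of "G 0"] Suc.prems by (intro polyR_add) auto
    then show ?case by (simp add: pol_Suc_shift distrib_right mult.assoc)
  qed
  then show ?thesis by (simp add: F)
qed

lemma polyR_var: "(\<lambda>e t. t) \<in> polyR"
  using polyR_shift[OF polyR_const[OF ring_const[of 1]]] by simp

end

text \<open>The constant \<open>\<eta>\<close> bounds the cancellation: for each \<open>e\<close>
  and \<open>t\<close> some centre gives an expansion none of whose terms exceeds the value by more
  than \<open>1 / \<eta>\<close>. The centre may depend on \<open>e\<close> and \<open>t\<close>,
  but \<open>\<eta>\<close> and the finite list of centres may not.\<close>

definition centers :: "((nat \<Rightarrow> 'a) \<Rightarrow> 'a) set \<Rightarrow> nat \<Rightarrow> (nat \<Rightarrow> (nat \<Rightarrow> 'a) \<Rightarrow> 'a) \<Rightarrow>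
    ((nat \<Rightarrow> 'a) \<Rightarrow> 'a) set \<Rightarrow> real \<Rightarrow> bool" where
  "centers R d a cs \<eta> \<longleftrightarrow> finite cs \<and> cs \<subseteq> R \<and> 0 < \<eta> \<and>
     (\<forall>e t. \<exists>c\<in>cs. \<forall>i\<le>d. \<eta> * N (tay d (\<lambda>j. a j e) (c e) i * (t - c e) ^ i) \<le> N (pol d (\<lambda>j. a j e) t))"

definition has_centers :: "nat \<Rightarrow> bool" where
  "has_centers d \<longleftrightarrow> (\<forall>R a. good R \<and> (\<forall>j. a j \<in> R) \<longrightarrow>
     (\<exists>R' cs \<eta>. good R' \<and> R \<subseteq> R' \<and> centers R' d a cs \<eta>))"

text \<open>Agreement of the coefficients at the centres and of the displacements from them gives
  agreement of the Taylor terms; bounded cancellation turns this into agreement of the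
  values.\<close>

lemma centers_app:
  assumes R: "good R" and a: "\<And>j. a j \<in> R" and c: "centers R d a cs \<eta>" and \<epsilon>: "0 < \<epsilon>" "\<epsilon> < 1"
  obtains \<delta> where "0 < \<delta>" "\<delta> < 1" "ev (\<lambda>e e'. \<forall>t t'. (\<forall>c\<in>cs. app \<delta> (t - c e) (t' - c e')) \<longrightarrow>
     app \<epsilon> (pol d (\<lambda>j. a j e) t) (pol d (\<lambda>j. a j e') t'))"
proof -
  \<comment> \<open>The factor \<open>\<eta>\<close> pays for the cancellation; the minimum with
    \<open>1\<close> keeps \<open>\<delta>\<close> below \<open>1\<close>.\<close>
  define \<delta> where "\<delta> = \<epsilon> * min \<eta> 1"
  have \<eta>: "0 < \<eta>" and cs: "finite cs" "cs \<subseteq> R" using c by (auto simp: centers_def)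
  have \<delta>: "0 < \<delta>" "\<delta> < 1" "\<delta> \<le> \<epsilon> * \<eta>"
  proof -
    have "\<epsilon> * min \<eta> 1 \<le> \<epsilon> * 1" using \<epsilon> by (intro mult_left_mono) auto
    then show "\<delta> < 1" using \<epsilon> unfolding \<delta>_def by linarith
    show "0 < \<delta>" "\<delta> \<le> \<epsilon> * \<eta>" using \<epsilon> \<eta> by (auto simp: \<delta>_def)
  qed
  have "ev (\<lambda>e e'. \<forall>c\<in>cs. \<forall>i\<in>{..d}. app \<delta> (tay d (\<lambda>j. a j e) (c e) i) (tay d (\<lambda>j. a j e') (c e') i))"
    using cs by (intro ev_ball good_app[OF R ring_tay[OF good_ring[OF R]]]) (auto intro: a \<delta>)
  then have "ev (\<lambda>e e'. \<forall>t t'. (\<forall>c\<in>cs. app \<delta> (t - c e) (t' - c e')) \<longrightarrow>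
     app \<epsilon> (pol d (\<lambda>j. a j e) t) (pol d (\<lambda>j. a j e') t'))"
  proof (rule ev_mono, intro allI impI)
    fix e e' t t'
    assume A: "\<forall>c\<in>cs. \<forall>i\<in>{..d}. app \<delta> (tay d (\<lambda>j. a j e) (c e) i) (tay d (\<lambda>j. a j e') (c e') i)"
      and T: "\<forall>c\<in>cs. app \<delta> (t - c e) (t' - c e')"
    obtain c where c: "c \<in> cs"
      "\<And>i. i \<le> d \<Longrightarrow> \<eta> * N (tay d (\<lambda>j. a j e) (c e) i * (t - c e) ^ i) \<le> N (pol d (\<lambda>j. a j e) t)"
      using c unfolding centers_def by meson
    have exp: "pol d (\<lambda>j. a j e) t = (\<Sum>i\<le>d. tay d (\<lambda>j. a j e) (c e) i * (t - c e) ^ i)" for e t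
      using pol_tay[of d "\<lambda>j. a j e" "c e" "t - c e"] by (simp add: pol_def)
    have "N (pol d (\<lambda>j. a j e) t - pol d (\<lambda>j. a j e') t') \<le> \<delta> * (N (pol d (\<lambda>j. a j e) t) / \<eta>)"
      unfolding exp[of e t] exp[of e' t']
    proof (rule app_sum, unfold exp[of e t, symmetric])
      fix i assume "i \<in> {..d}"
      then show "app \<delta> (tay d (\<lambda>j. a j e) (c e) i * (t - c e) ^ i) (tay d (\<lambda>j. a j e') (c e') i * (t' - c e') ^ i)"
        using A T c(1) \<delta> by (intro app_mult app_power) auto
      show "N (tay d (\<lambda>j. a j e) (c e) i * (t - c e) ^ i) \<le> N (pol d (\<lambda>j. a j e) t) / \<eta>"
        using c(2)[of i] \<open>i \<in> {..d}\<close> \<eta> by (simp add: field_simps)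
    qed (use \<delta> \<eta> in auto)
    also have "\<dots> \<le> \<epsilon> * N (pol d (\<lambda>j. a j e) t)"
      using mult_right_mono[OF \<delta>(3), of "N (pol d (\<lambda>j. a j e) t)"] \<eta> by (simp add: field_simps)
    finally show "app \<epsilon> (pol d (\<lambda>j. a j e) t) (pol d (\<lambda>j. a j e') t')" unfolding app_def .
  qed
  then show thesis using that \<delta> by blast
qed

section \<open>Gauss norms and stability of simple roots\<close>

definition mx :: "nat \<Rightarrow> (nat \<Rightarrow> 'a) \<Rightarrow> real \<Rightarrow> real" where
  "mx d a S = Max ((\<lambda>i. N (a i) * S ^ i) ` {..d})"

lemma mx_ge: "i \<le> d \<Longrightarrow> N (a i) * S ^ i \<le> mx d a S"
  unfolding mx_def by (rule Max_ge) auto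

lemma mx_attained: obtains i where "i \<le> d" "mx d a S = N (a i) * S ^ i"
proof -
  have "mx d a S \<in> (\<lambda>i. N (a i) * S ^ i) ` {..d}" unfolding mx_def by (rule Max_in) auto
  then show thesis using that by auto
qed

lemma mx_cong: "(\<And>i. i \<le> d \<Longrightarrow> N (a i) = N (b i)) \<Longrightarrow> mx d a S = mx d b S"
  unfolding mx_def by (rule arg_cong[where f = Max]) (rule image_cong, auto)

text \<open>\<open>\<theta>\<close> quantifies simplicity: the linear term at the root is at least
  \<open>\<theta>\<close> times the Gauss norm. Requiring \<open>0 < N \<sigma>\<close> keeps the
  root away from the centre, so that relative precision is meaningful.\<close>

definition simple_root :: "nat \<Rightarrow> real \<Rightarrow> (nat \<Rightarrow> 'a) \<Rightarrow> 'a \<Rightarrow> bool" where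
  "simple_root d \<theta> a \<sigma> \<longleftrightarrow> 0 < N \<sigma> \<and> 0 < mx d a (N \<sigma>) \<and> N (pol d a \<sigma>) = 0 \<and>
     \<theta> * mx d a (N \<sigma>) \<le> N (tay d a \<sigma> 1) * N \<sigma>"

lemma tay1_stable:
  assumes a: "\<And>i. i \<le> d \<Longrightarrow> N (a i) * S ^ i \<le> A" and t: "N t \<le> S" and S: "0 < S" and A: "0 < A"
    and d: "1 \<le> d" and \<theta>: "0 < \<theta>" "\<theta> \<le> 1" and D: "\<theta> * A \<le> N (tay d a t 1) * S" and h: "N h < \<theta> * S"
  shows "N (tay d a (t + h) 1) = N (tay d a t 1)"
proof -
  define x where "x = N h / S"
  have x: "0 \<le> x" "x < \<theta>" "x \<le> 1" "N h \<le> x * S"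
  proof -
    have "N h \<le> S" using h mult_right_mono[OF \<theta>(2), of S] S by linarith
    then show "0 \<le> x" "x < \<theta>" "x \<le> 1" "N h \<le> x * S"
      using h S by (auto simp: x_def pos_divide_less_eq)
  qed
  have "N (tay d a (t + h) 1 - tay d a t 1) \<le> A * x / S"
    using pol_taylor(2)[OF a t S less_imp_le[OF A] x(4) x(1,3) d] .
  also have "A * x / S < A * \<theta> / S" using A S x(2) by (simp add: divide_strict_right_mono)
  also have "\<dots> \<le> N (tay d a t 1)" using D S by (simp add: divide_le_eq mult.commute)
  finally show ?thesis by (intro N_eq_if_close) (simp add: N_diff_commute)
qed

text \<open>The root inherits the same \<open>\<theta>\<close>, since between \<open>s\<close> and
  the root the derivative changes by less than its own size.\<close>

lemma approx_root:
  assumes s: "0 < N s" and A: "0 < mx d a (N s)" and d: "1 \<le> d" and \<theta>: "0 < \<theta>" "\<theta> \<le> 1"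
    and D: "\<theta> * mx d a (N s) \<le> N (tay d a s 1) * N s"
    and x: "0 \<le> x" "x < \<theta>\<^sup>2" and f: "N (pol d a s) \<le> x * mx d a (N s)"
  obtains \<sigma> where "simple_root d \<theta> a \<sigma>" "N (\<sigma> - s) \<le> x / \<theta> * N s" "N \<sigma> = N s"
proof -
  obtain \<sigma> where \<sigma>: "N (pol d a \<sigma>) = 0" "N (\<sigma> - s) \<le> x / \<theta> * N s"
    using hensel[OF mx_ge order.refl s A d \<theta> D x f] by blast
  have "x / \<theta> < \<theta>" using x \<theta> by (simp add: power2_eq_square divide_less_eq)
  then have lt: "N (\<sigma> - s) < \<theta> * N s" using \<sigma>(2) s by (meson mult_strict_right_mono order_le_less_trans)
  moreover have "\<theta> * N s \<le> N s" using \<theta> by (simp add: mult_left_le_one_le)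
  ultimately have Ns: "N \<sigma> = N s" by (intro N_eq_if_close) (simp add: N_diff_commute)
  have "N (tay d a (s + (\<sigma> - s)) 1) = N (tay d a s 1)"
    using tay1_stable[OF mx_ge order.refl s A d \<theta> D lt] .
  then have "simple_root d \<theta> a \<sigma>" unfolding simple_root_def using \<sigma>(1) D s A Ns by simp
  then show thesis using that \<sigma>(2) Ns by blast
qed

lemma tay_diff: "tay d a t j - tay d b t j = tay d (\<lambda>i. a i - b i) t j"
  unfolding tay_def by (simp add: sum_subtractf[symmetric] algebra_simps)

text \<open>A simple root of \<open>a\<close> is an approximate root of \<open>b\<close>: relative
  precision \<open>x\<close> in the coefficients shifts the value by at most \<open>x\<close> times
  the Gauss norm, which is within reach of Hensel's lemma.\<close>

lemma perturb_root:
  assumes r: "simple_root d \<theta> a \<sigma>" and ab: "\<And>i. i \<le> d \<Longrightarrow> app x (a i) (b i)"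
    and d: "1 \<le> d" and \<theta>: "0 < \<theta>" "\<theta> \<le> 1" and x: "0 \<le> x" "x < \<theta>\<^sup>2"
  obtains \<tau> where "simple_root d \<theta> b \<tau>" "N (\<tau> - \<sigma>) \<le> x / \<theta> * N \<sigma>" "N \<tau> = N \<sigma>"
proof -
  define S A where "S = N \<sigma>" and "A = mx d a S"
  have "\<theta>\<^sup>2 \<le> \<theta>" using \<theta> by (simp add: power2_eq_square mult_left_le_one_le)
  then have x1: "x < \<theta>" "x < 1" using x \<theta> by auto
  have mxb: "mx d b S = A" unfolding A_def by (rule mx_cong) (metis app_N[OF ab x1(2)])
  have S: "0 < S" and A: "0 < A" and D: "\<theta> * A \<le> N (tay d a \<sigma> 1) * S" and f: "N (pol d a \<sigma>) = 0"
    using r by (auto simp: simple_root_def S_def A_def)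
  have diff: "N (b i - a i) * S ^ i \<le> x * A" if "i \<le> d" for i
  proof -
    have "N (b i - a i) * S ^ i \<le> x * N (a i) * S ^ i"
      using ab[OF that] S unfolding app_def by (intro mult_right_mono) (auto simp: N_diff_commute)
    also have "\<dots> \<le> x * A" using mx_ge[OF that, of a S] x(1) by (simp add: A_def mult.assoc mult_left_mono)
    finally show ?thesis .
  qed
  have tb: "N (tay d b \<sigma> i - tay d a \<sigma> i) * S ^ i \<le> x * A" for i
    unfolding tay_diff by (rule tay_bound[OF diff]) (use x A in \<open>auto simp: S_def\<close>)
  have "N (pol d b \<sigma> - pol d a \<sigma>) \<le> x * A" using tb[of 0] by (simp add: tay_0)
  then have fb: "N (pol d b \<sigma>) \<le> x * A"
    using N_add[of "pol d b \<sigma> - pol d a \<sigma>" "pol d a \<sigma>"] f x A by simp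
  have "N (tay d b \<sigma> 1 - tay d a \<sigma> 1) * S < N (tay d a \<sigma> 1) * S"
    using tb[of 1] D mult_strict_right_mono[OF x1(1) A] by simp
  then have "N (tay d b \<sigma> 1) = N (tay d a \<sigma> 1)"
    using S by (intro N_eq_if_close) (simp add: N_diff_commute)
  then show thesis
    using approx_root[of \<sigma> d b \<theta> x] S A D d \<theta> x fb mxb that unfolding S_def by metis
qed

lemma simple_root_unique:
  assumes "simple_root d \<theta> a \<sigma>" "N (pol d a \<tau>) = 0" "N (\<tau> - \<sigma>) < \<theta> * N \<sigma>" "1 \<le> d" "0 < \<theta>" "\<theta> \<le> 1"
  shows "N (\<tau> - \<sigma>) = 0"
  using root_unique[of d a "N \<sigma>" "mx d a (N \<sigma>)" \<sigma> \<theta> \<tau>] assms mx_ge[of _ d a "N \<sigma>"]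
  unfolding simple_root_def by blast

text \<open>Close to the root, \<open>\<sigma> - \<Delta>\<close> has the leading term of the Newton
  step at \<open>\<Delta>\<close>. This supplies the leading term of a difference that is too small
  to be read off from approximations of \<open>\<sigma>\<close> and \<open>\<Delta>\<close>.\<close>

lemma newton_approx:
  assumes r: "simple_root d \<theta> a \<sigma>" and d: "1 \<le> d" and \<theta>: "0 < \<theta>" "\<theta> \<le> 1" and \<delta>: "0 < \<delta>" "\<delta> < 1"
    and w: "N (\<sigma> - \<Delta>) \<le> \<theta> * \<delta> * N \<sigma>"
  shows "app \<delta> (tay d a \<Delta> 1 * (\<sigma> - \<Delta>)) (- pol d a \<Delta>)" "N (tay d a \<Delta> 1) \<noteq> 0"
proof -
  define S A where "S = N \<sigma>" and "A = mx d a S"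
  have S: "0 < S" and A: "0 < A" and D: "\<theta> * A \<le> N (tay d a \<sigma> 1) * S" and f: "N (pol d a \<sigma>) = 0"
    using r by (auto simp: simple_root_def S_def A_def)
  have a: "i \<le> d \<Longrightarrow> N (a i) * S ^ i \<le> A" for i unfolding A_def by (rule mx_ge)
  have "\<theta> * \<delta> * S < \<theta> * S" using \<theta> \<delta> S by simp
  then have w1: "N (\<Delta> - \<sigma>) < \<theta> * S" using w by (simp add: N_diff_commute S_def)
  moreover have "\<theta> * S \<le> S" using \<theta> S by (simp add: mult_left_le_one_le)
  ultimately have N\<Delta>: "N \<Delta> = S" unfolding S_def by (intro N_eq_if_close) (simp add: N_diff_commute)
  have "N (tay d a (\<sigma> + (\<Delta> - \<sigma>)) 1) = N (tay d a \<sigma> 1)"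
    by (rule tay1_stable[OF a _ S A d \<theta> D w1]) (auto simp: S_def)
  then have D1: "\<theta> * A \<le> N (tay d a \<Delta> 1) * S" using D by simp
  then show "N (tay d a \<Delta> 1) \<noteq> 0"
    using mult_pos_pos[OF \<theta>(1) A] by auto
  have \<mu>: "0 \<le> \<theta> * \<delta>" "\<theta> * \<delta> \<le> 1" using \<theta> \<delta> by (auto intro: mult_le_one)
  have "N (pol d a (\<Delta> + (\<sigma> - \<Delta>)) - (pol d a \<Delta> + tay d a \<Delta> 1 * (\<sigma> - \<Delta>))) \<le> A * (\<theta> * \<delta>) * (N (\<sigma> - \<Delta>) / S)"
    by (rule pol_taylor(1)[OF a _ S less_imp_le[OF A] _ \<mu> d]) (use w N\<Delta> in \<open>auto simp: S_def\<close>)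
  also have "\<dots> = \<delta> * (\<theta> * A) * (N (\<sigma> - \<Delta>) / S)" by simp
  also have "\<dots> \<le> \<delta> * (N (tay d a \<Delta> 1) * S) * (N (\<sigma> - \<Delta>) / S)"
    using D1 \<delta> S by (intro mult_right_mono mult_left_mono) auto
  also have "\<dots> = \<delta> * N (tay d a \<Delta> 1 * (\<sigma> - \<Delta>))" using S by (simp add: N_mult)
  finally have *: "N (pol d a \<sigma> - (pol d a \<Delta> + tay d a \<Delta> 1 * (\<sigma> - \<Delta>))) \<le> \<delta> * N (tay d a \<Delta> 1 * (\<sigma> - \<Delta>))"
    by simp
  have "N (pol d a \<Delta> + tay d a \<Delta> 1 * (\<sigma> - \<Delta>)) = N (pol d a \<sigma> - (pol d a \<Delta> + tay d a \<Delta> 1 * (\<sigma> - \<Delta>)))"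
    using N_eq_if_null[of "pol d a \<sigma> - (pol d a \<Delta> + tay d a \<Delta> 1 * (\<sigma> - \<Delta>))" "- (pol d a \<Delta> + tay d a \<Delta> 1 * (\<sigma> - \<Delta>))"] f
    by (metis N_minus diff_minus_eq_add diff_add_cancel)
  then show "app \<delta> (tay d a \<Delta> 1 * (\<sigma> - \<Delta>)) (- pol d a \<Delta>)"
    using * unfolding app_def by (simp add: add.commute)
qed


text \<open>Precision \<open>\<theta> / 2\<close> suffices to identify a branch, since simple roots are isolated to relative
  precision \<open>\<theta>\<close>.\<close>

definition root_branch :: "nat \<Rightarrow> real \<Rightarrow> (nat \<Rightarrow> (nat \<Rightarrow> 'a) \<Rightarrow> 'a) \<Rightarrow> ((nat \<Rightarrow> 'a) \<Rightarrow> 'a) \<Rightarrow>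
    ((nat \<Rightarrow> 'a) \<Rightarrow> bool) \<Rightarrow> ((nat \<Rightarrow> 'a) \<Rightarrow> 'a) \<Rightarrow> bool" where
  "root_branch d \<theta> a c B \<xi> \<longleftrightarrow>
     (\<forall>e. B e \<longrightarrow> N (a d e) \<noteq> 0 \<and> simple_root d \<theta> (tay d (\<lambda>j. a j e) (c e)) (\<xi> e - c e)) \<and>
     (\<forall>e. \<not> B e \<longrightarrow> \<xi> e = c e) \<and> ev (\<lambda>e e'. B e = B e') \<and>
     ev (\<lambda>e e'. B e \<longrightarrow> app (\<theta> / 2) (\<xi> e - c e) (\<xi> e' - c e'))"

section \<open>Adjoining a branch of simple roots to a good ring\<close>

context
  fixes d \<theta> a c B \<xi> R
  assumes R: "good R" and a: "\<And>j. a j \<in> R" and c: "c \<in> R" and d: "1 \<le> d" and \<theta>: "0 < \<theta>" "\<theta> \<le> 1"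
    and rb: "root_branch d \<theta> a c B \<xi>"
begin

lemma branch_root: "B e \<Longrightarrow> simple_root d \<theta> (tay d (\<lambda>j. a j e) (c e)) (\<xi> e - c e)"
  and branch_lead: "B e \<Longrightarrow> N (a d e) \<noteq> 0"
  and branch_off: "\<not> B e \<Longrightarrow> \<xi> e = c e"
  and branch_ev: "ev (\<lambda>e e'. B e = B e')"
  using rb unfolding root_branch_def by blast+

text \<open>The definition of a branch grants a fixed precision only. Perturbing the root at
  \<open>e\<close> yields a root at \<open>e'\<close> as close as desired, and uniqueness within
  relative distance \<open>\<theta>\<close> identifies it with the branch at
  \<open>e'\<close>.\<close>

lemma branch_app_center:
  assumes \<delta>: "0 < \<delta>" "\<delta> < 1"
  shows "ev (\<lambda>e e'. B e \<longrightarrow> app \<delta> (\<xi> e - c e) (\<xi> e' - c e'))"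
proof -
  define \<delta>' where "\<delta>' = min \<delta> (\<theta> / 2)"
  \<comment> \<open>With this precision in the coefficients \<open>perturb_root\<close> moves the
    root by at most \<open>x / \<theta> = \<delta>'\<close>.\<close>
  define x where "x = \<theta> * \<delta>'"
  have \<delta>': "0 < \<delta>'" "\<delta>' \<le> \<delta>" "\<delta>' \<le> \<theta> / 2" using \<delta> \<theta> by (auto simp: \<delta>'_def)
  have x: "0 < x" "x < \<theta>\<^sup>2" "x / \<theta> = \<delta>'" "x < 1"
  proof -
    show "0 < x" "x / \<theta> = \<delta>'" using \<theta> \<delta>' by (auto simp: x_def)
    have "\<delta>' < \<theta>" using \<delta>' \<theta> by linarith
    then show "x < \<theta>\<^sup>2" using \<theta> by (simp add: x_def power2_eq_square)
    also have "\<dots> \<le> 1" using \<theta> by (simp add: power_le_one)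
    finally show "x < 1" .
  qed
  define \<alpha> where "\<alpha> e = tay d (\<lambda>j. a j e) (c e)" for e
  have "ev (\<lambda>e e'. \<forall>i\<in>{..d}. app x (\<alpha> e i) (\<alpha> e' i))"
    unfolding \<alpha>_def by (intro ev_ball good_app[OF R ring_tay[OF good_ring[OF R]]]) (auto intro: a c x)
  moreover have "ev (\<lambda>e e'. B e \<longrightarrow> app (\<theta> / 2) (\<xi> e - c e) (\<xi> e' - c e'))"
    using rb unfolding root_branch_def by blast
  ultimately have "ev (\<lambda>e e'. (\<forall>i\<in>{..d}. app x (\<alpha> e i) (\<alpha> e' i)) \<and>
      (B e \<longrightarrow> app (\<theta> / 2) (\<xi> e - c e) (\<xi> e' - c e')) \<and> B e = B e')"
    by (intro ev_conj branch_ev)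
  then show ?thesis
  proof (rule ev_mono, intro impI, elim conjE)
    fix e e' assume \<alpha>: "\<forall>i\<in>{..d}. app x (\<alpha> e i) (\<alpha> e' i)" and Be: "B e" "B e = B e'"
      and "B e \<longrightarrow> app (\<theta> / 2) (\<xi> e - c e) (\<xi> e' - c e')"
    define \<sigma> \<tau> where "\<sigma> = \<xi> e - c e" and "\<tau> = \<xi> e' - c e'"
    have \<sigma>\<tau>: "app (\<theta> / 2) \<sigma> \<tau>" unfolding \<sigma>_def \<tau>_def using Be \<open>B e \<longrightarrow> _\<close> by blast
    have r: "simple_root d \<theta> (\<alpha> e) \<sigma>" "simple_root d \<theta> (\<alpha> e') \<tau>"
      using branch_root Be unfolding \<alpha>_def \<sigma>_def \<tau>_def by auto
    obtain \<rho> where \<rho>: "simple_root d \<theta> (\<alpha> e') \<rho>" "N (\<rho> - \<sigma>) \<le> x / \<theta> * N \<sigma>"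
      using perturb_root[OF r(1) _ d \<theta> _ x(2), of "\<alpha> e'"] \<alpha> x(1) by (metis atMost_iff less_imp_le)
    have N\<tau>: "N \<tau> = N \<sigma>" using app_N[OF \<sigma>\<tau>] \<theta> by simp
    have pos: "0 < N \<sigma>" using r(1) by (simp add: simple_root_def)
    have "N (\<rho> - \<sigma>) \<le> \<delta>' * N \<sigma>" using \<rho>(2) x(3) by simp
    moreover have "\<delta>' * N \<sigma> \<le> \<theta> / 2 * N \<sigma>" using \<delta>'(3) by (intro mult_right_mono) auto
    moreover have "N (\<sigma> - \<tau>) \<le> \<theta> / 2 * N \<sigma>" using \<sigma>\<tau> unfolding app_def .
    ultimately have "N (\<rho> - \<tau>) \<le> \<theta> / 2 * N \<sigma>" using N_triangle[of \<rho> \<tau> \<sigma>] by linarith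
    also have "\<dots> < \<theta> * N \<tau>" using \<theta> pos N\<tau> by simp
    finally have "N (\<rho> - \<tau>) = 0"
      using simple_root_unique[OF r(2) _ _ d \<theta>, of \<rho>] \<rho>(1) by (simp add: simple_root_def)
    then have "N (\<sigma> - \<tau>) \<le> \<delta>' * N \<sigma>"
      using N_triangle[of \<sigma> \<tau> \<rho>] \<rho>(2) x(3) \<delta>' N_nonneg[of \<sigma>] by (simp add: N_diff_commute)
    also have "\<dots> \<le> \<delta> * N \<sigma>" using \<delta>' by (intro mult_right_mono) auto
    finally show "app \<delta> (\<xi> e - c e) (\<xi> e' - c e')" unfolding app_def \<sigma>_def \<tau>_def .
  qed
qed

text \<open>If \<open>b\<close> is not too close to the root, subtracting approximations keeps
  enough precision; if it is close, the leading term is that of the Newton step at \<open>b\<close>.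
  The function \<open>b\<close> may come from a larger ring, as the centres of a polynomial over
  \<open>R\<close> do.\<close>

lemma branch_app_diff:
  assumes S: "good S" "R \<subseteq> S" "b \<in> S" and \<delta>: "0 < \<delta>" "\<delta> < 1"
  shows "ev (\<lambda>e e'. B e \<longrightarrow> app \<delta> (\<xi> e - b e) (\<xi> e' - b e'))"
proof -
  \<comment> \<open>The threshold of closeness below which \<open>newton_approx\<close> yields
    precision \<open>\<delta>\<close>. Above it, relative precision \<open>\<delta> * \<mu>\<close>
    in both terms leaves precision \<open>\<delta>\<close> in their difference.\<close>
  define \<mu> where "\<mu> = \<theta> * \<delta>"
  have \<mu>: "0 < \<mu>" "\<mu> < 1" "\<delta> * \<mu> < 1" "0 < \<delta> * \<mu>" "\<delta> * \<mu> \<le> \<mu>"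
  proof -
    have "\<theta> * \<delta> \<le> 1 * \<delta>" using \<theta> \<delta> by (intro mult_right_mono) auto
    then show 1: "\<mu> < 1" using \<delta> unfolding \<mu>_def by linarith
    show 2: "0 < \<mu>" using \<theta> \<delta> by (auto simp: \<mu>_def)
    then show "0 < \<delta> * \<mu>" using \<delta> by simp
    show 3: "\<delta> * \<mu> \<le> \<mu>" using \<delta> 2 by simp
    show "\<delta> * \<mu> < 1" using 1 3 by linarith
  qed
  have rS: "ring_of_functions S" using S(1) by (rule good_ring)
  have aS: "a j \<in> S" and cS: "c \<in> S" for j using a c S(2) by auto
  have "ev (\<lambda>e e'. app (\<delta> * \<mu>) (b e - c e) (b e' - c e'))"
    using S(1) ring_diff[OF rS S(3) cS] \<mu> by (intro good_app[where g = "\<lambda>e. b e - c e"])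
  moreover have "ev (\<lambda>e e'. app \<delta> (tay d (\<lambda>j. a j e) (b e) 0) (tay d (\<lambda>j. a j e') (b e') 0))"
    "ev (\<lambda>e e'. app \<delta> (tay d (\<lambda>j. a j e) (b e) 1) (tay d (\<lambda>j. a j e') (b e') 1))"
    by (rule good_app[OF S(1) ring_tay[OF rS aS S(3)] \<delta>])+
  ultimately have "ev (\<lambda>e e'. app (\<delta> * \<mu>) (b e - c e) (b e' - c e') \<and>
      app \<delta> (tay d (\<lambda>j. a j e) (b e) 0) (tay d (\<lambda>j. a j e') (b e') 0) \<and>
      app \<delta> (tay d (\<lambda>j. a j e) (b e) 1) (tay d (\<lambda>j. a j e') (b e') 1) \<and>
      (B e \<longrightarrow> app (\<delta> * \<mu>) (\<xi> e - c e) (\<xi> e' - c e')) \<and> B e = B e')"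
    by (intro ev_conj branch_ev branch_app_center \<mu>)
  then show ?thesis
  proof (rule ev_mono, intro impI, elim conjE)
    fix e e'
    assume app\<Delta>: "app (\<delta> * \<mu>) (b e - c e) (b e' - c e')"
      and \<beta>0: "app \<delta> (tay d (\<lambda>j. a j e) (b e) 0) (tay d (\<lambda>j. a j e') (b e') 0)"
      and \<beta>1: "app \<delta> (tay d (\<lambda>j. a j e) (b e) 1) (tay d (\<lambda>j. a j e') (b e') 1)"
      and Be: "B e" "B e = B e'" and "B e \<longrightarrow> app (\<delta> * \<mu>) (\<xi> e - c e) (\<xi> e' - c e')"
    then have app\<sigma>: "app (\<delta> * \<mu>) (\<xi> e - c e) (\<xi> e' - c e')" by blast
    define \<sigma> \<sigma>' \<Delta> \<Delta>' where defs: "\<sigma> = \<xi> e - c e" "\<sigma>' = \<xi> e' - c e'" "\<Delta> = b e - c e" "\<Delta>' = b e' - c e'"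
    have w: "\<xi> e - b e = \<sigma> - \<Delta>" "\<xi> e' - b e' = \<sigma>' - \<Delta>'" by (simp_all add: defs)
    have pos: "0 < N \<sigma>" using branch_root[OF Be(1)] by (simp add: simple_root_def defs)
    have err: "N ((\<sigma> - \<Delta>) - (\<sigma>' - \<Delta>')) \<le> \<delta> * \<mu> * max (N \<sigma>) (N \<Delta>)"
    proof -
      have "N (\<sigma> - \<sigma>') \<le> \<delta> * \<mu> * max (N \<sigma>) (N \<Delta>)"
        using app\<sigma> \<mu>(4) mult_left_mono[of "N \<sigma>" "max (N \<sigma>) (N \<Delta>)" "\<delta> * \<mu>"] unfolding app_def defs by simp
      moreover have "N (\<Delta> - \<Delta>') \<le> \<delta> * \<mu> * max (N \<sigma>) (N \<Delta>)"
        using app\<Delta> \<mu>(4) mult_left_mono[of "N \<Delta>" "max (N \<sigma>) (N \<Delta>)" "\<delta> * \<mu>"] unfolding app_def defs by simp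
      moreover have "(\<sigma> - \<Delta>) - (\<sigma>' - \<Delta>') = (\<sigma> - \<sigma>') - (\<Delta> - \<Delta>')" by simp
      ultimately show ?thesis using N_diff[of "\<sigma> - \<sigma>'" "\<Delta> - \<Delta>'"] by (metis max.boundedI order_trans)
    qed
    show "app \<delta> (\<xi> e - b e) (\<xi> e' - b e')"
    proof (cases "\<mu> * N \<sigma> < N (\<sigma> - \<Delta>)")
      case True
      have "\<mu> * max (N \<sigma>) (N \<Delta>) \<le> N (\<sigma> - \<Delta>)"
      proof (cases "N \<Delta> \<le> N \<sigma>")
        case False
        then have "N (\<sigma> - \<Delta>) = N \<Delta>" using N_add_eq[of "- \<sigma>" \<Delta>] by (simp add: N_diff_commute)
        then show ?thesis using False \<mu> by (simp add: mult_left_le_one_le)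
      qed (use True in auto)
      then have "\<delta> * \<mu> * max (N \<sigma>) (N \<Delta>) \<le> \<delta> * N (\<sigma> - \<Delta>)"
        using \<delta> by (simp add: mult.assoc mult_left_mono)
      then show ?thesis using err unfolding app_def w by simp
    next
      case False
      then have wl: "N (\<sigma> - \<Delta>) \<le> \<theta> * \<delta> * N \<sigma>" by (simp add: \<mu>_def)
      have "\<mu> * N \<sigma> < N \<sigma>" using \<mu> pos by simp
      then have N\<Delta>: "N \<Delta> = N \<sigma>" using False by (intro N_eq_if_close) simp
      have "N (\<sigma> - \<Delta>) \<le> \<mu> * N \<sigma>" using False by simp
      moreover have "\<delta> * \<mu> * N \<sigma> \<le> \<mu> * N \<sigma>" using \<mu>(5) by (intro mult_right_mono) auto
      moreover have "N ((\<sigma>' - \<Delta>') - (\<sigma> - \<Delta>)) \<le> \<delta> * \<mu> * N \<sigma>" using err N\<Delta> by (simp add: N_diff_commute)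
      ultimately have "N (\<sigma>' - \<Delta>') \<le> \<mu> * N \<sigma>"
        using N_add[of "(\<sigma>' - \<Delta>') - (\<sigma> - \<Delta>)" "\<sigma> - \<Delta>"] by simp
      moreover have "N \<sigma>' = N \<sigma>" using app_N[OF app\<sigma> \<mu>(3)] by (simp add: defs)
      ultimately have wl': "N (\<sigma>' - \<Delta>') \<le> \<theta> * \<delta> * N \<sigma>'" by (simp add: \<mu>_def)
      have exp: "tay d (tay d (\<lambda>j. a j e) (c e)) (b e - c e) i = tay d (\<lambda>j. a j e) (b e) i" for e i
        by (simp add: tay_tay)
      have exp0: "pol d (tay d (\<lambda>j. a j e) (c e)) (b e - c e) = tay d (\<lambda>j. a j e) (b e) 0" for e
        using exp[of e 0] by (simp add: tay_0)
      note n1 = newton_approx[OF branch_root[OF Be(1)] d \<theta> \<delta> wl[unfolded defs]]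
      note n2 = newton_approx[OF branch_root[of e'] d \<theta> \<delta> wl'[unfolded defs]]
      have 1: "app \<delta> (tay d (\<lambda>j. a j e) (b e) 1 * (\<sigma> - \<Delta>)) (- tay d (\<lambda>j. a j e) (b e) 0)"
        and nz: "N (tay d (\<lambda>j. a j e) (b e) 1) \<noteq> 0"
        using n1 unfolding exp exp0 defs by auto
      have 2: "app \<delta> (tay d (\<lambda>j. a j e') (b e') 1 * (\<sigma>' - \<Delta>')) (- tay d (\<lambda>j. a j e') (b e') 0)"
        using n2 Be unfolding exp exp0 defs by auto
      have "app \<delta> (tay d (\<lambda>j. a j e) (b e) 1 * (\<sigma> - \<Delta>)) (tay d (\<lambda>j. a j e') (b e') 1 * (\<sigma>' - \<Delta>'))"
        using app_trans[OF app_trans[OF 1 app_minus[OF \<beta>0]] app_sym[OF 2]] \<delta> by auto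
      then show ?thesis unfolding w using app_cancel[OF _ \<beta>1 nz \<delta>(2)] by blast
    qed
  qed
qed

text \<open>Below the degree of \<open>a\<close> the centres given by \<open>has_centers d'\<close>
  apply, with displacements handled by \<open>branch_app_diff\<close>. Higher degrees are lowered by
  pseudo-division by \<open>a\<close>, which vanishes on the branch; the leading coefficient
  introduced this way is nonzero there and is cancelled afterwards.\<close>

lemma branch_app_pol:
  assumes hc: "has_centers d'" "d = Suc d'" and G: "\<And>j. G j \<in> R" and \<epsilon>: "0 < \<epsilon>" "\<epsilon> < 1"
  shows "ev (\<lambda>e e'. B e \<longrightarrow> app \<epsilon> (pol n (\<lambda>j. G j e) (\<xi> e)) (pol n (\<lambda>j. G j e') (\<xi> e')))"
  using G
proof (induction n arbitrary: G rule: less_induct)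
  case (less n)
  show ?case
  proof (cases "n \<le> d'")
    case True
    define G' where "G' j = (if j \<le> n then G j else (\<lambda>_. 0))" for j
    have G': "G' j \<in> R" for j using less.prems ring_const[OF good_ring[OF R]] by (simp add: G'_def)
    have eq: "pol n (\<lambda>j. G j e) t = pol d' (\<lambda>j. G' j e) t" for e t
    proof -
      have "pol n (\<lambda>j. G j e) t = pol d' (\<lambda>j. if j \<le> n then G j e else 0) t"
        by (rule pol_pad[OF good_ring[OF R] True])
      also have "(\<lambda>j. if j \<le> n then G j e else 0) = (\<lambda>j. G' j e)" by (auto simp: G'_def)
      finally show ?thesis .
    qed
    obtain S cs \<eta> where S: "good S" "R \<subseteq> S" "centers S d' G' cs \<eta>"
      using hc(1) R G' unfolding has_centers_def by meson
    have GS: "G' j \<in> S" for j using G' S(2) by blast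
    obtain \<delta> where \<delta>: "0 < \<delta>" "\<delta> < 1" "ev (\<lambda>e e'. \<forall>t t'. (\<forall>c\<in>cs. app \<delta> (t - c e) (t' - c e')) \<longrightarrow>
      app \<epsilon> (pol d' (\<lambda>j. G' j e) t) (pol d' (\<lambda>j. G' j e') t'))"
      using centers_app[OF S(1) GS S(3) \<epsilon>] by blast
    have cs: "finite cs" "cs \<subseteq> S" using S(3) by (auto simp: centers_def)
    have "ev (\<lambda>e e'. \<forall>b\<in>cs. B e \<longrightarrow> app \<delta> (\<xi> e - b e) (\<xi> e' - b e'))"
      using cs by (intro ev_ball branch_app_diff[OF S(1,2) _ \<delta>(1,2)]) auto
    from ev_conj[OF \<delta>(3) this] show ?thesis unfolding eq by (rule ev_mono) blast
  next
    case False
    \<comment> \<open>One step of pseudo-division: \<open>G' j\<close> are the coefficients of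
      \<open>a d\<close> times the polynomial minus \<open>G n * t ^ k\<close> times
      \<open>a\<close>, and the coefficient of index \<open>n\<close> cancels.\<close>
    define k where "k = n - d"
    have n: "n = k + d" "0 < n" using False hc(2) by (auto simp: k_def)
    define G' where "G' j = (\<lambda>e. a d e * G j e - (if k \<le> j then G n e * a (j - k) e else 0))" for j
    have G': "G' j \<in> R" for j
    proof -
      have "(\<lambda>e. if k \<le> j then G n e * a (j - k) e else 0) \<in> R"
        using less.prems a ring_mult[OF good_ring[OF R]] ring_const[OF good_ring[OF R]] by (cases "k \<le> j") auto
      then show ?thesis unfolding G'_def
        using less.prems a by (intro ring_diff[OF good_ring[OF R]] ring_mult[OF good_ring[OF R]])
    qed
    have red: "a d e * pol n (\<lambda>j. G j e) t - G n e * t ^ k * pol d (\<lambda>j. a j e) t = pol (n - 1) (\<lambda>j. G' j e) t" for e t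
    proof -
      have "(\<Sum>j\<le>n. (if k \<le> j then G n e * a (j - k) e else 0) * t ^ j) = (\<Sum>j\<in>{k..n}. G n e * a (j - k) e * t ^ j)"
        by (rule sum.mono_neutral_cong_right) auto
      also have "\<dots> = (\<Sum>i\<le>d. G n e * a i e * t ^ (i + k))"
        by (rule sum.reindex_bij_witness[of _ "\<lambda>i. i + k" "\<lambda>j. j - k"]) (auto simp: n)
      also have "\<dots> = G n e * t ^ k * pol d (\<lambda>j. a j e) t"
        by (simp add: pol_def sum_distrib_left power_add mult_ac)
      finally have hi: "(\<Sum>j\<le>n. (if k \<le> j then G n e * a (j - k) e else 0) * t ^ j) = G n e * t ^ k * pol d (\<lambda>j. a j e) t" .
      have "pol n (\<lambda>j. G' j e) t
          = a d e * pol n (\<lambda>j. G j e) t - (\<Sum>j\<le>n. (if k \<le> j then G n e * a (j - k) e else 0) * t ^ j)"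
        unfolding pol_def G'_def by (simp only: left_diff_distrib sum_subtractf sum_distrib_left mult.assoc)
      then have "a d e * pol n (\<lambda>j. G j e) t - G n e * t ^ k * pol d (\<lambda>j. a j e) t = pol n (\<lambda>j. G' j e) t"
        unfolding hi by simp
      also have "\<dots> = pol (n - 1) (\<lambda>j. G' j e) t"
      proof -
        obtain m where m: "n = Suc m" using n(2) by (cases n) auto
        have "G' n e = 0" by (simp add: G'_def n(1) mult.commute)
        then have "G' (Suc m) e = 0" unfolding m .
        then show ?thesis unfolding m by (simp add: pol_def)
      qed
      finally show ?thesis .
    qed
    have "ev (\<lambda>e e'. B e \<longrightarrow> app \<epsilon> (pol (n - 1) (\<lambda>j. G' j e) (\<xi> e)) (pol (n - 1) (\<lambda>j. G' j e') (\<xi> e')))"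
      using n(2) by (intro less.IH G') auto
    moreover have "ev (\<lambda>e e'. app \<epsilon> (a d e) (a d e'))" using good_app[OF R a \<epsilon>] .
    ultimately have "ev (\<lambda>e e'. (B e \<longrightarrow> app \<epsilon> (pol (n - 1) (\<lambda>j. G' j e) (\<xi> e)) (pol (n - 1) (\<lambda>j. G' j e') (\<xi> e')))
        \<and> app \<epsilon> (a d e) (a d e') \<and> B e = B e')" by (intro ev_conj branch_ev)
    then show ?thesis
    proof (rule ev_mono, intro impI, elim conjE)
      fix e e' assume IH: "B e \<longrightarrow> app \<epsilon> (pol (n - 1) (\<lambda>j. G' j e) (\<xi> e)) (pol (n - 1) (\<lambda>j. G' j e') (\<xi> e'))"
        and ad: "app \<epsilon> (a d e) (a d e')" and Be: "B e" "B e = B e'"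
      have null: "N (a d e * pol n (\<lambda>j. G j e) (\<xi> e) - pol (n - 1) (\<lambda>j. G' j e) (\<xi> e)) = 0" if "B e" for e
      proof -
        have "N (pol d (\<lambda>j. a j e) (\<xi> e)) = 0"
          using branch_root[OF that] pol_tay[of d "\<lambda>j. a j e" "c e" "\<xi> e - c e"] by (simp add: simple_root_def)
        then show ?thesis unfolding red[symmetric] by (simp add: N_mult)
      qed
      have "app \<epsilon> (a d e * pol n (\<lambda>j. G j e) (\<xi> e)) (pol (n - 1) (\<lambda>j. G' j e) (\<xi> e))"
        using null[OF Be(1)] \<epsilon> by (intro app_null) auto
      moreover have "app \<epsilon> (pol (n - 1) (\<lambda>j. G' j e') (\<xi> e')) (a d e' * pol n (\<lambda>j. G j e') (\<xi> e'))"
        using null[of e'] Be \<epsilon> by (intro app_null) (auto simp: N_diff_commute)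
      ultimately have "app \<epsilon> (a d e * pol n (\<lambda>j. G j e) (\<xi> e)) (a d e' * pol n (\<lambda>j. G j e') (\<xi> e'))"
        using IH Be(1) \<epsilon>(2) app_trans by blast
      then show "app \<epsilon> (pol n (\<lambda>j. G j e) (\<xi> e)) (pol n (\<lambda>j. G j e') (\<xi> e'))"
        using app_cancel[OF _ ad branch_lead[OF Be(1)] \<epsilon>(2)] by blast
    qed
  qed
qed

text \<open>The new ring consists of the values at \<open>\<xi>\<close> of polynomials over
  \<open>R\<close>. Off the branch \<open>\<xi>\<close> equals \<open>c\<close>, so there the values
  agree with functions of \<open>R\<close> and are controlled anyway.\<close>

lemma adjoin_branch:
  assumes hc: "has_centers d'" "d = Suc d'"
  shows "\<exists>S. good S \<and> R \<subseteq> S \<and> \<xi> \<in> S"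
proof -
  have rR: "ring_of_functions R" by (rule good_ring[OF R])
  define S where "S = (\<lambda>F e. F e (\<xi> e)) ` polyR R"
  have RS: "R \<subseteq> S" using polyR_const[OF rR] by (force simp: S_def)
  have "good S" unfolding good_def ring_of_functions_def
  proof (intro conjI ballI allI impI)
    show "polyfun \<subseteq> S" using RS rR unfolding ring_of_functions_def by blast
    fix f g assume "f \<in> S" "g \<in> S"
    then obtain F G where F: "F \<in> polyR R" "f = (\<lambda>e. F e (\<xi> e))" and G: "G \<in> polyR R" "g = (\<lambda>e. G e (\<xi> e))"
      by (auto simp: S_def)
    show "(\<lambda>e. f e + g e) \<in> S" using polyR_add[OF rR F(1) G(1)] by (force simp: S_def F G)
    show "(\<lambda>e. f e * g e) \<in> S" using polyR_mult[OF rR F(1) G(1)] by (force simp: S_def F G)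
  next
    fix g \<epsilon> assume "g \<in> S" and \<epsilon>: "0 < \<epsilon> \<and> \<epsilon> < (1::real)"
    then obtain n G where G: "\<And>j. G j \<in> R" "g = (\<lambda>e. pol n (\<lambda>j. G j e) (\<xi> e))"
      by (auto simp: S_def polyR_def[OF rR])
    have "ev (\<lambda>e e'. B e \<longrightarrow> app \<epsilon> (g e) (g e'))" unfolding G using \<epsilon> G(1) by (intro branch_app_pol[OF hc]) auto
    moreover have "ev (\<lambda>e e'. app \<epsilon> (pol n (\<lambda>j. G j e) (c e)) (pol n (\<lambda>j. G j e') (c e')))"
      using \<epsilon> by (intro good_app[OF R ring_pol[OF rR G(1) c]]) auto
    ultimately have "ev (\<lambda>e e'. (B e \<longrightarrow> app \<epsilon> (g e) (g e')) \<and>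
      app \<epsilon> (pol n (\<lambda>j. G j e) (c e)) (pol n (\<lambda>j. G j e') (c e')) \<and> B e = B e')"
      by (intro ev_conj branch_ev)
    then show "ev (\<lambda>e e'. app \<epsilon> (g e) (g e'))"
      by (rule ev_mono) (metis G(2) branch_off)
  qed
  moreover have "\<xi> \<in> S" using polyR_var[OF rR] by (force simp: S_def)
  ultimately show ?thesis using RS by blast
qed

end


lemma adjoin_branches:
  assumes hc: "has_centers d'" "d = Suc d'" and R: "good R" and a: "\<And>j. a j \<in> R"
    and \<theta>: "0 < \<theta>" "\<theta> \<le> 1" and fin: "finite X"
    and X: "\<And>\<xi>. \<xi> \<in> X \<Longrightarrow> \<exists>c\<in>R. \<exists>B. root_branch d \<theta> a c B \<xi>"
  shows "\<exists>S. good S \<and> R \<subseteq> S \<and> X \<subseteq> S"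
  using fin X
proof (induction X rule: finite_induct)
  case empty
  then show ?case using R by blast
next
  case (insert \<xi> X)
  then obtain S where S: "good S" "R \<subseteq> S" "X \<subseteq> S" by auto
  obtain c B where c: "c \<in> R" "root_branch d \<theta> a c B \<xi>" using insert.prems[of \<xi>] by blast
  have "\<exists>S'. good S' \<and> S \<subseteq> S' \<and> \<xi> \<in> S'"
    using adjoin_branch[OF S(1) _ _ _ \<theta> c(2) hc] a c(1) S(2) hc(2) by auto
  then show ?case using S by blast
qed

section \<open>Enumerating the simple roots through their leading terms\<close>

definition rvc :: "real \<Rightarrow> 'a \<Rightarrow> 'a set" where
  "rvc \<epsilon> \<sigma> = {s. app \<epsilon> \<sigma> s}"

lemma rvc_eq_iff: "0 \<le> \<epsilon> \<Longrightarrow> \<epsilon> < 1 \<Longrightarrow> rvc \<epsilon> \<sigma> = rvc \<epsilon> \<tau> \<longleftrightarrow> app \<epsilon> \<sigma> \<tau>"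
  unfolding rvc_def using app_refl[of \<epsilon> \<tau>] app_sym[of \<epsilon>] app_trans[of \<epsilon>] by blast

text \<open>Classes are used instead of roots because roots are fixed only up to norm
  \<open>0\<close> and move with the tuple, whereas their classes at precision
  \<open>\<theta> / 2\<close> stay the same for close tuples.\<close>

definition root_classes :: "nat \<Rightarrow> real \<Rightarrow> (nat \<Rightarrow> 'a) \<Rightarrow> 'a \<Rightarrow> 'a set set" where
  "root_classes d \<theta> a c = {rvc (\<theta> / 2) \<sigma> |\<sigma>. N (a d) \<noteq> 0 \<and> simple_root d \<theta> (tay d a c) \<sigma>}"

text \<open>Representatives of different classes are roots at nonzero distance; more than
  \<open>d\<close> of them would make all Taylor coefficients null, against the positive Gauss norm
  required of a simple root.\<close>

lemma root_classes_finite: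
  assumes \<theta>: "0 < \<theta>" "\<theta> \<le> 1"
  shows "finite (root_classes d \<theta> a c) \<and> card (root_classes d \<theta> a c) \<le> d"
proof (rule ccontr)
  assume neg: "\<not> ?thesis"
  have "\<exists>C\<subseteq>root_classes d \<theta> a c. finite C \<and> card C = Suc d"
  proof (cases "finite (root_classes d \<theta> a c)")
    case True
    then show ?thesis using neg obtain_subset_with_card_n[of "Suc d" "root_classes d \<theta> a c"]
      by (metis not_less_eq_eq finite_subset)
  next
    case False then show ?thesis using infinite_arbitrarily_large[of "root_classes d \<theta> a c" "Suc d"] by blast
  qed
  then obtain C where C: "C \<subseteq> root_classes d \<theta> a c" "finite C" "card C = Suc d" by blast
  have "\<forall>K\<in>C. \<exists>\<sigma>. K = rvc (\<theta> / 2) \<sigma> \<and> simple_root d \<theta> (tay d a c) \<sigma>"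
    using C(1) unfolding root_classes_def by blast
  then obtain r where r: "\<And>K. K \<in> C \<Longrightarrow> K = rvc (\<theta> / 2) (r K) \<and> simple_root d \<theta> (tay d a c) (r K)"
    by metis
  have inj: "inj_on r C" using r by (metis inj_onI)
  have null: "N (tay d a c i) = 0" if "i \<le> d" for i
  proof (rule root_count[of "r ` C" d "tay d a c" i])
    show "finite (r ` C)" "d < card (r ` C)" "i \<le> d" using C that by (auto simp: card_image[OF inj])
    show "N (pol d (tay d a c) s) = 0" if "s \<in> r ` C" for s using that r by (auto simp: simple_root_def)
    fix s t assume "s \<in> r ` C" "t \<in> r ` C" "s \<noteq> t"
    then obtain K K' where K: "K \<in> C" "K' \<in> C" "s = r K" "t = r K'" by blast
    then have "K \<noteq> K'" using \<open>s \<noteq> t\<close> by blast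
    then have "rvc (\<theta> / 2) s \<noteq> rvc (\<theta> / 2) t" using r K by metis
    then show "N (s - t) \<noteq> 0" using rvc_eq_iff[of "\<theta> / 2" s t] app_null[of s t "\<theta> / 2"] \<theta> by auto
  qed
  obtain K where "K \<in> C" using C by fastforce
  then have "0 < mx d (tay d a c) (N (r K))" using r by (simp add: simple_root_def)
  moreover obtain i where "i \<le> d" "mx d (tay d a c) (N (r K)) = N (tay d a c i) * N (r K) ^ i"
    by (rule mx_attained)
  ultimately show False using null by simp
qed

text \<open>Precision \<open>\<theta> * (\<theta> / 2)\<close> in the coefficients moves a simple
  root by at most \<open>\<theta> / 2\<close> relative to its size, hence within its class. The
  inclusion obtained this way is applied in both directions.\<close>

lemma root_classes_ev:
  assumes R: "good R" and a: "\<And>j. a j \<in> R" and c: "c \<in> R" and d: "1 \<le> d" and \<theta>: "0 < \<theta>" "\<theta> \<le> 1"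
  shows "ev (\<lambda>e e'. root_classes d \<theta> (\<lambda>j. a j e) (c e) = root_classes d \<theta> (\<lambda>j. a j e') (c e'))"
proof -
  define x where "x = \<theta> * (\<theta> / 2)"
  have x: "0 < x" "x < \<theta>\<^sup>2" "x / \<theta> = \<theta> / 2" "x < 1"
  proof -
    show "0 < x" "x < \<theta>\<^sup>2" "x / \<theta> = \<theta> / 2" using \<theta> by (auto simp: x_def power2_eq_square)
    moreover have "\<theta>\<^sup>2 \<le> 1" using \<theta> by (simp add: power_le_one)
    ultimately show "x < 1" by linarith
  qed
  have "ev (\<lambda>e e'. (\<forall>i\<in>{..d}. app x (tay d (\<lambda>j. a j e) (c e) i) (tay d (\<lambda>j. a j e') (c e') i)) \<and>
      app x (a d e) (a d e'))"
    by (intro ev_conj ev_ball good_app[OF R ring_tay[OF good_ring[OF R]]] good_app[OF R]) (auto intro: a c x)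
  then have sub: "ev (\<lambda>e e'. root_classes d \<theta> (\<lambda>j. a j e) (c e) \<subseteq> root_classes d \<theta> (\<lambda>j. a j e') (c e'))"
  proof (rule ev_mono, intro subsetI, elim conjE)
    fix e e' K assume A: "\<forall>i\<in>{..d}. app x (tay d (\<lambda>j. a j e) (c e) i) (tay d (\<lambda>j. a j e') (c e') i)"
      and ad: "app x (a d e) (a d e')" and "K \<in> root_classes d \<theta> (\<lambda>j. a j e) (c e)"
    then obtain \<sigma> where \<sigma>: "K = rvc (\<theta> / 2) \<sigma>" "N (a d e) \<noteq> 0" "simple_root d \<theta> (tay d (\<lambda>j. a j e) (c e)) \<sigma>"
      by (auto simp: root_classes_def)
    obtain \<tau> where \<tau>: "simple_root d \<theta> (tay d (\<lambda>j. a j e') (c e')) \<tau>" "N (\<tau> - \<sigma>) \<le> x / \<theta> * N \<sigma>"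
      using perturb_root[OF \<sigma>(3) _ d \<theta> _ x(2), of "tay d (\<lambda>j. a j e') (c e')"] A x(1)
      by (metis atMost_iff less_imp_le)
    have "app (\<theta> / 2) \<sigma> \<tau>" using \<tau>(2) x(3) by (simp add: app_def N_diff_commute)
    then have "K = rvc (\<theta> / 2) \<tau>" using rvc_eq_iff[of "\<theta> / 2" \<sigma> \<tau>] \<sigma>(1) \<theta> by simp
    moreover have "N (a d e') \<noteq> 0" using app_N[OF ad x(4)] \<sigma>(2) by simp
    ultimately show "K \<in> root_classes d \<theta> (\<lambda>j. a j e') (c e')"
      using \<tau>(1) unfolding root_classes_def by blast
  qed
  show ?thesis by (rule ev_mono[OF ev_conj[OF sub ev_sym[OF sub]]]) blast
qed

text \<open>An enumeration of the classes depends only on the set of classes, so the \<open>k\<close>-th branch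
  does not jump.\<close>

lemma root_branches:
  assumes R: "good R" and a: "\<And>j. a j \<in> R" and c: "c \<in> R" and d: "1 \<le> d" and \<theta>: "0 < \<theta>" "\<theta> \<le> 1"
  obtains X where "finite X" "\<And>\<xi>. \<xi> \<in> X \<Longrightarrow> \<exists>B. root_branch d \<theta> a c B \<xi>"
    "\<And>e \<sigma>. N (a d e) \<noteq> 0 \<Longrightarrow> simple_root d \<theta> (tay d (\<lambda>j. a j e) (c e)) \<sigma> \<Longrightarrow>
      \<exists>\<xi>\<in>X. simple_root d \<theta> (tay d (\<lambda>j. a j e) (c e)) (\<xi> e - c e) \<and> N (\<xi> e - c e - \<sigma>) = 0"
proof -
  define enum where "enum C = (SOME xs :: 'a set list. set xs = C \<and> distinct xs)" for C
  define Q where "Q e = root_classes d \<theta> (\<lambda>j. a j e) (c e)" for e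
  have enum: "set (enum (Q e)) = Q e" "distinct (enum (Q e))" for e
    using someI_ex[OF finite_distinct_list[of "Q e"]] root_classes_finite[OF \<theta>, of d "\<lambda>j. a j e" "c e"]
    by (auto simp: enum_def Q_def)
  have len: "length (enum (Q e)) = card (Q e)" "card (Q e) \<le> d" for e
    using enum[of e] distinct_card root_classes_finite[OF \<theta>, of d "\<lambda>j. a j e" "c e"] by (fastforce simp: Q_def)+
  define B where "B k e \<longleftrightarrow> k < card (Q e)" for k e
  define P where "P k e \<sigma> \<longleftrightarrow> N (a d e) \<noteq> 0 \<and> simple_root d \<theta> (tay d (\<lambda>j. a j e) (c e)) \<sigma> \<and>
      rvc (\<theta> / 2) \<sigma> = enum (Q e) ! k" for k e \<sigma>
  \<comment> \<open>Where fewer than \<open>k + 1\<close> classes exist the branch falls back to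
    \<open>c\<close>, which already lies in the ring.\<close>
  define \<xi> where "\<xi> k e = (if B k e then c e + (SOME \<sigma>. P k e \<sigma>) else c e)" for k e
  have P: "P k e (\<xi> k e - c e)" if "B k e" for k e
  proof -
    have "enum (Q e) ! k \<in> Q e" using that enum[of e] len[of e] by (metis B_def nth_mem)
    then have "\<exists>\<sigma>. P k e \<sigma>" unfolding P_def by (auto simp: Q_def root_classes_def)
    then show ?thesis using that someI_ex[of "P k e"] by (simp add: \<xi>_def)
  qed
  have evQ: "ev (\<lambda>e e'. Q e = Q e')" unfolding Q_def by (rule root_classes_ev[OF R a c d \<theta>])
  have "root_branch d \<theta> a c (B k) (\<xi> k)" for k
    unfolding root_branch_def
  proof (intro conjI allI impI)
    show "N (a d e) \<noteq> 0" "simple_root d \<theta> (tay d (\<lambda>j. a j e) (c e)) (\<xi> k e - c e)" if "B k e" for e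
      using P[OF that] by (auto simp: P_def)
    show "\<xi> k e = c e" if "\<not> B k e" for e using that by (simp add: \<xi>_def)
    show "ev (\<lambda>e e'. B k e = B k e')" by (rule ev_mono[OF evQ]) (simp add: B_def)
    show "ev (\<lambda>e e'. B k e \<longrightarrow> app (\<theta> / 2) (\<xi> k e - c e) (\<xi> k e' - c e'))"
    proof (rule ev_mono[OF evQ], intro impI)
      fix e e' assume "Q e = Q e'" "B k e"
      then have "P k e (\<xi> k e - c e)" "P k e' (\<xi> k e' - c e')" using P by (auto simp: B_def)
      then show "app (\<theta> / 2) (\<xi> k e - c e) (\<xi> k e' - c e')"
        using \<open>Q e = Q e'\<close> rvc_eq_iff[of "\<theta> / 2" "\<xi> k e - c e" "\<xi> k e' - c e'"] \<theta> by (simp add: P_def)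
    qed
  qed
  moreover have "\<exists>\<xi>'\<in>\<xi> ` {..<d}. simple_root d \<theta> (tay d (\<lambda>j. a j e) (c e)) (\<xi>' e - c e) \<and> N (\<xi>' e - c e - \<sigma>) = 0"
    if ad: "N (a d e) \<noteq> 0" and r: "simple_root d \<theta> (tay d (\<lambda>j. a j e) (c e)) \<sigma>" for e \<sigma>
  proof -
    have "rvc (\<theta> / 2) \<sigma> \<in> Q e" using ad r by (auto simp: Q_def root_classes_def)
    then obtain k where k: "k < card (Q e)" "enum (Q e) ! k = rvc (\<theta> / 2) \<sigma>"
      using enum[of e] len[of e] by (metis in_set_conv_nth)
    have P': "P k e (\<xi> k e - c e)" using P k(1) by (simp add: B_def)
    then have "app (\<theta> / 2) \<sigma> (\<xi> k e - c e)" using k(2) rvc_eq_iff[of "\<theta> / 2" \<sigma> "\<xi> k e - c e"] \<theta> by (simp add: P_def)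
    then have "N (\<xi> k e - c e - \<sigma>) \<le> \<theta> / 2 * N \<sigma>" by (simp add: app_def N_diff_commute)
    also have "\<dots> < \<theta> * N \<sigma>" using \<theta> r by (simp add: simple_root_def)
    finally have "N (\<xi> k e - c e - \<sigma>) = 0"
      using simple_root_unique[OF r _ _ d \<theta>, of "\<xi> k e - c e"] P' by (simp add: P_def simple_root_def)
    then show ?thesis using P' k(1) len[of e] by (intro bexI[of _ "\<xi> k"]) (auto simp: P_def)
  qed
  ultimately show thesis using that[of "\<xi> ` {..<d}"] by blast
qed

section \<open>Existence of centres, by induction on the degree\<close>

lemma has_centers_0: "has_centers 0"
  unfolding has_centers_def
proof (intro allI impI, elim conjE)
  fix R and a :: "nat \<Rightarrow> (nat \<Rightarrow> 'a) \<Rightarrow> 'a" assume R: "good R" and "\<forall>j. a j \<in> R"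
  have "centers R 0 a {\<lambda>_. 0} 1"
    using ring_const[OF good_ring[OF R]] by (simp add: centers_def tay_def pol_def)
  then show "\<exists>R' cs \<eta>. good R' \<and> R \<subseteq> R' \<and> centers R' 0 a cs \<eta>" using R by blast
qed

text \<open>If the terms of the Taylor expansion at a centre of the derivative cancel too much, Hensel's
  lemma produces a root of the polynomial close to \<open>t\<close>, and that root is a better centre.\<close>

lemma has_centers_Suc:
  assumes hc: "has_centers d"
  shows "has_centers (Suc d)"
  unfolding has_centers_def
proof (intro allI impI, elim conjE)
  fix R and a :: "nat \<Rightarrow> (nat \<Rightarrow> 'a) \<Rightarrow> 'a" assume R: "good R" and a: "\<forall>j. a j \<in> R"
  let ?D = "Suc d"
  \<comment> \<open>These centres serve the tuples at which the leading coefficient is null and the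
    degree drops.\<close>
  obtain R1 cs1 \<eta>1 where R1: "good R1" "R \<subseteq> R1" "centers R1 d a cs1 \<eta>1"
    using hc R a unfolding has_centers_def by meson
  have a1: "a j \<in> R1" for j using a R1(2) by blast
  define b where "b j = (\<lambda>e. der (\<lambda>i. a i e) j)" for j
  have b: "\<forall>j. b j \<in> R1"
    unfolding b_def der_def using a1 ring_mult[OF good_ring[OF R1(1)]] ring_const[OF good_ring[OF R1(1)]] by blast
  \<comment> \<open>Centres for the derivative; they are the first candidates for centres of the
    polynomial itself.\<close>
  obtain R2 cs2 \<eta>2 where R2: "good R2" "R1 \<subseteq> R2" "centers R2 d b cs2 \<eta>2"
    using hc R1(1) b unfolding has_centers_def by meson
  have a2: "a j \<in> R2" for j using a1 R2(2) by blast
  define \<kappa> where "\<kappa> = Min ((\<lambda>i. N (of_nat i)) ` {1..?D})"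
  have \<kappa>: "0 < \<kappa>" "\<And>i. 1 \<le> i \<Longrightarrow> i \<le> ?D \<Longrightarrow> \<kappa> \<le> N (of_nat i)"
  proof -
    show "\<kappa> \<le> N (of_nat i)" if "1 \<le> i" "i \<le> ?D" for i unfolding \<kappa>_def using that by (intro Min_le) auto
    have "\<kappa> \<in> (\<lambda>i. N (of_nat i)) ` {1..?D}" unfolding \<kappa>_def by (rule Min_in) auto
    then obtain i where i: "1 \<le> i" "\<kappa> = N (of_nat i)" by auto
    then have "N (of_nat i) \<noteq> 0" by (intro N_of_nat) auto
    then show "0 < \<kappa>" using i(2) N_nonneg[of "of_nat i"] by linarith
  qed
  \<comment> \<open>\<open>\<eta>2\<close> is the cancellation allowed in the derivative and
    \<open>\<kappa>\<close> the smallest norm of an integer that differentiation introduces.\<close>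
  define \<theta> where "\<theta> = min (\<eta>2 * \<kappa>) 1"
  have \<eta>: "0 < \<eta>1" "0 < \<eta>2" using R1(3) R2(3) by (auto simp: centers_def)
  have \<theta>: "0 < \<theta>" "\<theta> \<le> 1" "\<theta> \<le> \<eta>2 * \<kappa>" using \<eta> \<kappa> by (auto simp: \<theta>_def)
  have cs2: "finite cs2" "cs2 \<subseteq> R2" using R2(3) by (auto simp: centers_def)
  have "\<forall>c\<in>cs2. \<exists>X. finite X \<and> (\<forall>\<xi>\<in>X. \<exists>B. root_branch ?D \<theta> a c B \<xi>) \<and>
     (\<forall>e \<sigma>. N (a ?D e) \<noteq> 0 \<longrightarrow> simple_root ?D \<theta> (tay ?D (\<lambda>j. a j e) (c e)) \<sigma> \<longrightarrow>
      (\<exists>\<xi>\<in>X. simple_root ?D \<theta> (tay ?D (\<lambda>j. a j e) (c e)) (\<xi> e - c e) \<and> N (\<xi> e - c e - \<sigma>) = 0))"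
  proof
    fix c assume "c \<in> cs2"
    then have "c \<in> R2" using cs2 by blast
    then obtain X where "finite X" "\<And>\<xi>. \<xi> \<in> X \<Longrightarrow> \<exists>B. root_branch ?D \<theta> a c B \<xi>"
      "\<And>e \<sigma>. N (a ?D e) \<noteq> 0 \<Longrightarrow> simple_root ?D \<theta> (tay ?D (\<lambda>j. a j e) (c e)) \<sigma> \<Longrightarrow>
      \<exists>\<xi>\<in>X. simple_root ?D \<theta> (tay ?D (\<lambda>j. a j e) (c e)) (\<xi> e - c e) \<and> N (\<xi> e - c e - \<sigma>) = 0"
      using root_branches[where a = a and c = c and d = "Suc d" and R = R2, OF R2(1) a2 _ _ \<theta>(1,2)]
      by (metis le_add1 plus_1_eq_Suc)
    then show "\<exists>X. finite X \<and> (\<forall>\<xi>\<in>X. \<exists>B. root_branch ?D \<theta> a c B \<xi>) \<and>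
     (\<forall>e \<sigma>. N (a ?D e) \<noteq> 0 \<longrightarrow> simple_root ?D \<theta> (tay ?D (\<lambda>j. a j e) (c e)) \<sigma> \<longrightarrow>
      (\<exists>\<xi>\<in>X. simple_root ?D \<theta> (tay ?D (\<lambda>j. a j e) (c e)) (\<xi> e - c e) \<and> N (\<xi> e - c e - \<sigma>) = 0))"
      by blast
  qed
  then obtain X where X: "\<And>c. c \<in> cs2 \<Longrightarrow> finite (X c)"
     "\<And>c \<xi>. c \<in> cs2 \<Longrightarrow> \<xi> \<in> X c \<Longrightarrow> \<exists>B. root_branch ?D \<theta> a c B \<xi>"
     "\<And>c e \<sigma>. c \<in> cs2 \<Longrightarrow> N (a ?D e) \<noteq> 0 \<Longrightarrow> simple_root ?D \<theta> (tay ?D (\<lambda>j. a j e) (c e)) \<sigma> \<Longrightarrow>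
      \<exists>\<xi>\<in>X c. simple_root ?D \<theta> (tay ?D (\<lambda>j. a j e) (c e)) (\<xi> e - c e) \<and> N (\<xi> e - c e - \<sigma>) = 0"
    by metis
  define Y where "Y = (\<Union>c\<in>cs2. X c)"
  have finY: "finite Y" unfolding Y_def using cs2(1) X(1) by blast
  have "\<exists>R3. good R3 \<and> R2 \<subseteq> R3 \<and> Y \<subseteq> R3"
    by (rule adjoin_branches[where a = a, OF hc refl R2(1) a2 \<theta>(1,2) finY]) (use X(2) cs2(2) in \<open>unfold Y_def, blast\<close>)
  then obtain R3 where R3: "good R3" "R2 \<subseteq> R3" "Y \<subseteq> R3" by blast
  define cs where "cs = cs1 \<union> cs2 \<union> Y"
  \<comment> \<open>\<open>\<eta>1\<close> covers a null leading coefficient, and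
    \<open>\<theta> * (\<theta> / 2)\<close> is a value small enough for Hensel's lemma. The bound
    \<open>1\<close> suffices at the adjoined roots, where nothing cancels.\<close>
  define \<eta> where "\<eta> = min (min \<eta>1 (\<theta> * (\<theta> / 2))) 1"
  have \<eta>': "0 < \<eta>" "\<eta> \<le> \<eta>1" "\<eta> \<le> \<theta> * (\<theta> / 2)" "\<eta> \<le> 1" using \<eta> \<theta> by (auto simp: \<eta>_def)
  have "centers R3 ?D a cs \<eta>"
    unfolding centers_def
  proof (intro conjI allI)
    show "finite cs" using R1(3) cs2 finY by (simp add: cs_def centers_def)
    show "cs \<subseteq> R3" using R1(3) R2(2) R3 cs2 by (auto simp: cs_def centers_def)
    show "0 < \<eta>" by (rule \<eta>')
    fix e t
    define f where "f = (\<lambda>j. a j e)"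
    show "\<exists>c\<in>cs. \<forall>i\<le>?D. \<eta> * N (tay ?D (\<lambda>j. a j e) (c e) i * (t - c e) ^ i) \<le> N (pol ?D (\<lambda>j. a j e) t)"
      unfolding f_def[symmetric]
    proof (cases "N (f ?D) = 0")
      case True
      obtain c where c: "c \<in> cs1" "\<And>i. i \<le> d \<Longrightarrow> \<eta>1 * N (tay d f (c e) i * (t - c e) ^ i) \<le> N (pol d f t)"
        using R1(3) unfolding centers_def f_def by meson
      have np: "N (pol ?D f t) = N (pol d f t)"
        by (rule N_eq_if_null) (simp add: pol_def N_mult True)
      have nt: "N (tay ?D f (c e) i) = N (tay d f (c e) i)" for i
        by (rule N_eq_if_null) (simp add: tay_def N_mult True)
      have "\<eta> * N (tay ?D f (c e) i * (t - c e) ^ i) \<le> N (pol ?D f t)" if "i \<le> ?D" for i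
      proof (cases "i \<le> d")
        case True
        have "\<eta> * N (tay d f (c e) i * (t - c e) ^ i) \<le> \<eta>1 * N (tay d f (c e) i * (t - c e) ^ i)"
          using \<eta>' by (intro mult_right_mono) auto
        then show ?thesis using c(2)[OF True] np nt[of i] by (simp add: N_mult)
      next
        case False
        then have "tay d f (c e) i = 0" unfolding tay_def by (intro sum.neutral) (auto simp: binomial_eq_0)
        then have "N (tay ?D f (c e) i) = 0" using nt[of i] by simp
        then show ?thesis by (simp add: N_mult)
      qed
      then show "\<exists>c\<in>cs. \<forall>i\<le>?D. \<eta> * N (tay ?D f (c e) i * (t - c e) ^ i) \<le> N (pol ?D f t)"
        using c(1) by (auto simp: cs_def)
    next
      case lead: False
      obtain c where c: "c \<in> cs2"
        "\<And>i. i \<le> d \<Longrightarrow> \<eta>2 * N (tay d (der f) (c e) i * (t - c e) ^ i) \<le> N (pol d (der f) t)"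
        using R2(3) unfolding centers_def b_def f_def by meson
      define s \<alpha> where "s = t - c e" and "\<alpha> = tay ?D f (c e)"
      define A where "A = mx ?D \<alpha> (N s)"
      have t: "t = c e + s" by (simp add: s_def)
      have ft: "pol ?D f t = pol ?D \<alpha> s" unfolding t \<alpha>_def pol_tay ..
      have Nterm: "N (\<alpha> i * s ^ i) = N (\<alpha> i) * N s ^ i" for i by (simp add: N_mult N_power)
      \<comment> \<open>Bounded cancellation in the derivative bounds every term of positive order
        of the polynomial by the size of the derivative at \<open>t\<close> times the
        displacement.\<close>
      have der: "\<theta> * (N (\<alpha> i) * N s ^ i) \<le> N (tay ?D \<alpha> s 1) * N s" if i: "1 \<le> i" "i \<le> ?D" for i
      proof -
        obtain k where k: "i = Suc k" "k \<le> d" using i by (cases i) auto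
        have "\<theta> * (N (\<alpha> i) * N s ^ i) \<le> \<eta>2 * N (of_nat i) * (N (\<alpha> i) * N s ^ i)"
        proof (rule mult_right_mono)
          show "\<theta> \<le> \<eta>2 * N (of_nat i)"
            using \<theta>(3) mult_left_mono[OF \<kappa>(2)[OF i], of \<eta>2] \<eta> by linarith
        qed simp
        also have "\<dots> = \<eta>2 * N (tay d (der f) (c e) k * s ^ k) * N s"
          by (simp add: tay_der N_mult N_power \<alpha>_def k(1) mult_ac)
        also have "\<dots> \<le> N (pol d (der f) t) * N s"
          using c(2)[OF k(2)] by (intro mult_right_mono) (auto simp: s_def)
        also have "pol d (der f) t = tay ?D \<alpha> s 1" unfolding pol_der \<alpha>_def tay_tay t ..
        finally show ?thesis .
      qed
      show "\<exists>c\<in>cs. \<forall>i\<le>?D. \<eta> * N (tay ?D f (c e) i * (t - c e) ^ i) \<le> N (pol ?D f t)"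
      proof (cases "\<eta> * A \<le> N (pol ?D f t)")
        case True
        have "\<eta> * N (\<alpha> i * s ^ i) \<le> N (pol ?D f t)" if "i \<le> ?D" for i
          using mult_left_mono[OF mx_ge[OF that, of \<alpha> "N s"], of \<eta>] True \<eta>'(1) unfolding A_def Nterm by linarith
        then show ?thesis using c(1) unfolding \<alpha>_def s_def cs_def by blast
      next
        case False
        \<comment> \<open>The largest term may be taken of positive order: a strictly dominant
          constant term could not be cancelled, so the value would be as large as
          \<open>A\<close>.\<close>
        obtain m where m: "1 \<le> m" "m \<le> ?D" "A = N (\<alpha> m) * N s ^ m"
        proof -
          have "\<exists>m. 1 \<le> m \<and> m \<le> ?D \<and> A = N (\<alpha> m) * N s ^ m"
          proof (rule ccontr)
            assume none: "\<not> ?thesis"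
            have lt: "N (\<alpha> i) * N s ^ i < A" if "1 \<le> i" "i \<le> ?D" for i
              using mx_ge[OF that(2), of \<alpha> "N s"] none that unfolding A_def by fastforce
            obtain i where "i \<le> ?D" "A = N (\<alpha> i) * N s ^ i" unfolding A_def by (rule mx_attained)
            then have A0: "A = N (\<alpha> 0)" using none by (cases i) auto
            have "0 < A" using lt[of 1] by (simp add: order_le_less_trans[of 0 "N (\<alpha> 1) * N s"])
            then have "N (\<Sum>i\<in>{1..?D}. \<alpha> i * s ^ i) < A" using lt by (intro N_sum_less) (auto simp: Nterm)
            then have "N (\<alpha> 0 + (\<Sum>i\<in>{1..?D}. \<alpha> i * s ^ i)) = A"
              unfolding A0 by (intro N_add_eq) simp
            moreover have "pol ?D \<alpha> s = \<alpha> 0 + (\<Sum>i\<in>{1..?D}. \<alpha> i * s ^ i)"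
            proof -
              have "{..?D} = insert 0 {1..?D}" by auto
              then show ?thesis by (simp add: pol_def)
            qed
            ultimately have "N (pol ?D f t) = A" using ft by simp
            then show False using False \<eta>'(4) \<open>0 < A\<close> by (simp add: mult_left_le_one_le)
          qed
          then show thesis using that by blast
        qed
        have Apos: "0 < A"
        proof -
          have "N (pol ?D f t) < \<eta> * A" using False by simp
          then have "0 < \<eta> * A" using N_nonneg[of "pol ?D f t"] by linarith
          then show ?thesis using \<eta>'(1) by (simp add: zero_less_mult_iff)
        qed
        have spos: "0 < N s"
        proof (rule ccontr)
          assume "\<not> 0 < N s"
          then have "N s = 0" by (simp add: not_less)
          then show False using m Apos by (simp add: power_0_left)
        qed
        have D: "\<theta> * A \<le> N (tay ?D \<alpha> s 1) * N s" using der[OF m(1,2)] m(3) by simp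
        \<comment> \<open>Below the Hensel threshold, and chosen so that the root found lies within
          \<open>x / \<theta> = \<theta> / 2\<close> of \<open>s\<close>, inside the region where
          the linear term at the root dominates.\<close>
        define x where "x = \<theta> * (\<theta> / 2)"
        have x: "0 \<le> x" "x < \<theta>\<^sup>2" "x / \<theta> = \<theta> / 2" using \<theta> by (auto simp: x_def power2_eq_square)
        have "\<eta> * A \<le> x * A" using \<eta>'(3) Apos by (simp add: x_def)
        then have fx: "N (pol ?D \<alpha> s) \<le> x * A" using False ft by simp
        obtain \<sigma> where \<sigma>: "simple_root ?D \<theta> \<alpha> \<sigma>" "N (\<sigma> - s) \<le> x / \<theta> * N s" "N \<sigma> = N s"
          using approx_root[of s ?D \<alpha> \<theta> x] spos Apos D \<theta> x fx unfolding A_def by auto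
        obtain \<xi> where \<xi>: "\<xi> \<in> X c" "simple_root ?D \<theta> \<alpha> (\<xi> e - c e)" "N (\<xi> e - c e - \<sigma>) = 0"
          using X(3)[OF c(1), of e \<sigma>] lead \<sigma>(1) unfolding \<alpha>_def f_def by blast
        define \<tau> where "\<tau> = \<xi> e - c e"
        have N\<tau>: "N \<tau> = N s" using N_eq_if_null[OF \<xi>(3)] \<sigma>(3) by (simp add: \<tau>_def)
        have "N (s - \<tau>) \<le> \<theta> / 2 * N s"
          using N_triangle[of s \<tau> \<sigma>] \<sigma>(2) \<xi>(3) x(3) \<theta> by (simp add: \<tau>_def N_diff_commute)
        also have "\<dots> < \<theta> * N \<tau>" using \<theta> spos N\<tau> by simp
        finally have w: "N (s - \<tau>) < \<theta> * N \<tau>" .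
        have r: "0 < N \<tau>" "0 < mx ?D \<alpha> (N \<tau>)" "N (pol ?D \<alpha> \<tau>) = 0" "\<theta> * mx ?D \<alpha> (N \<tau>) \<le> N (tay ?D \<alpha> \<tau> 1) * N \<tau>"
          using \<xi>(2) by (auto simp: simple_root_def \<tau>_def)
        have "N (tay ?D f (\<xi> e) i * (t - \<xi> e) ^ i) \<le> N (pol ?D f t)" if i: "i \<le> ?D" for i
        proof -
          have D1: "1 \<le> ?D" by simp
          have "N (tay ?D \<alpha> \<tau> i * (s - \<tau>) ^ i) \<le> N (pol ?D \<alpha> s)"
            using near_root(2)[OF mx_ge order.refl r(1,2) D1 \<theta>(1,2) r(4,3) w i] by simp
          moreover have "tay ?D \<alpha> \<tau> i = tay ?D f (\<xi> e) i" unfolding \<alpha>_def tay_tay by (simp add: \<tau>_def)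
          moreover have "s - \<tau> = t - \<xi> e" by (simp add: s_def \<tau>_def)
          ultimately show ?thesis using ft by simp
        qed
        then have "\<forall>i\<le>?D. \<eta> * N (tay ?D f (\<xi> e) i * (t - \<xi> e) ^ i) \<le> N (pol ?D f t)"
          using \<eta>' by (meson N_nonneg mult_left_le_one_le order_trans less_imp_le)
        moreover have "\<xi> \<in> cs" using \<xi>(1) c(1) by (auto simp: cs_def Y_def)
        ultimately show ?thesis by blast
      qed
    qed
  qed
  then show "\<exists>R' cs \<eta>. good R' \<and> R \<subseteq> R' \<and> centers R' ?D a cs \<eta>"
    using R1(2) R2(2) R3 by blast
qed

theorem has_centers: "has_centers d"
  by (induction d) (auto intro: has_centers_0 has_centers_Suc)

end

subsection \<open>Determined predicates\<close>

context vring
begin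

definition det :: "((nat \<Rightarrow> 'a) \<Rightarrow> bool) \<Rightarrow> bool" where
  "det S \<longleftrightarrow> ev (\<lambda>e e'. S e = S e')"

lemma det_Not: "det S \<Longrightarrow> det (\<lambda>e. \<not> S e)"
  unfolding det_def by (rule ev_mono) auto

lemma det_conj: assumes "det S" "det T" shows "det (\<lambda>e. S e \<and> T e)"
  using ev_conj[OF assms[unfolded det_def]] unfolding det_def by (rule ev_mono) auto

lemma det_if_app:
  assumes h: "h \<in> polyfun" and \<epsilon>: "0 < \<epsilon>" "\<epsilon> < 1" and P: "\<And>x y. app \<epsilon> x y \<Longrightarrow> P x = P y"
  shows "det (\<lambda>e. P (h e))"
  using good_app[OF good_polyfun h \<epsilon>] unfolding det_def by (rule ev_mono) (rule P)

lemma det_null: "h \<in> polyfun \<Longrightarrow> det (\<lambda>e. N (h e) = 0)"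
  and det_le_1: "h \<in> polyfun \<Longrightarrow> det (\<lambda>e. N (h e) \<le> 1)"
  by (rule det_if_app[where \<epsilon> = "1/2"]; use app_N[of "1/2"] in auto)+

text \<open>Hensel's lemma for \<open>t ^ n - x'\<close> started at the given root \<open>y\<close>.
  The linear term at \<open>y\<close> is \<open>N (of_nat n)\<close> times the Gauss norm, so the
  precision required is half the square of that factor.\<close>

lemma power_app:
  assumes n: "0 < n" and xx: "app (N (of_nat n) ^ 2 / 2) x x'" and y: "N (y ^ n - x) = 0"
  shows "\<exists>y. N (y ^ n - x') = 0"
proof (cases "N x = 0")
  case True
  then have "N x' = 0" using xx app_null_iff by blast
  then show ?thesis using n by (intro exI[of _ 0]) (simp add: power_0_left)
next
  case False
  define \<theta> where "\<theta> = N (of_nat n)"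
  have \<theta>: "0 < \<theta>" "\<theta> \<le> 1" unfolding \<theta>_def using N_of_nat[OF n] N_of_nat_le[of n] N_nonneg[of "of_nat n"] by linarith+
  have half: "\<theta> ^ 2 / 2 < 1" using power_le_one[of \<theta> 2] \<theta> by simp
  define S where "S = N y"
  have Sn: "S ^ n = N x" using N_eq_if_null[OF y] by (simp add: S_def N_power)
  then have S: "0 < S" using False n by (metis N_nonneg S_def less_le zero_power)
  have Nx: "N x' = N x" using app_N[OF xx] half by (simp add: \<theta>_def)
  define a where "a i = (if i = n then 1 else if i = 0 then - x' else 0)" for i
  have pol: "pol n a t = t ^ n - x'" for t
  proof -
    have "pol n a t = (\<Sum>i\<in>{0, n}. a i * t ^ i)"
      unfolding pol_def by (rule sum.mono_neutral_right) (auto simp: a_def)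
    then show ?thesis using n by (simp add: a_def)
  qed
  have tay: "tay n a t 1 = of_nat n * t ^ (n - 1)" for t
  proof -
    have "tay n a t 1 = (\<Sum>j\<in>{n}. of_nat (j choose 1) * a j * t ^ (j - 1))"
      unfolding tay_def by (rule sum.mono_neutral_right) (auto simp: a_def)
    then show ?thesis by (simp add: a_def)
  qed
  have 1: "N (a i) * S ^ i \<le> S ^ n" if "i \<le> n" for i
    using Nx Sn n S by (auto simp: a_def)
  have A: "0 < S ^ n" using S by simp
  have 2: "\<theta> * S ^ n \<le> N (tay n a y 1) * S"
    unfolding tay using power_minus_mult[OF n, of "N y"] by (simp add: N_mult N_power \<theta>_def S_def mult.assoc)
  have 3: "N (pol n a y) \<le> \<theta> ^ 2 / 2 * S ^ n"
  proof -
    have "N (y ^ n - x') \<le> max (N (y ^ n - x)) (N (x - x'))" by (rule N_triangle)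
    also have "\<dots> \<le> \<theta> ^ 2 / 2 * S ^ n" using y xx by (simp add: app_def Sn \<theta>_def)
    finally show ?thesis by (simp add: pol)
  qed
  have x: "0 \<le> \<theta> ^ 2 / 2" "\<theta> ^ 2 / 2 < \<theta> ^ 2" using \<theta> by auto
  obtain \<xi> where "N (pol n a \<xi>) = 0"
    using hensel[OF 1 _ S A _ \<theta> 2 x 3] n S_def by auto
  then show ?thesis by (auto simp: pol)
qed

lemma det_power: assumes h: "h \<in> polyfun" and n: "0 < n" shows "det (\<lambda>e. \<exists>y. N (y ^ n - h e) = 0)"
proof -
  define \<epsilon> where "\<epsilon> = N (of_nat n) ^ 2 / 2"
  have "0 < N (of_nat n)" using N_of_nat[OF n] N_nonneg[of "of_nat n"] by linarith
  then have \<epsilon>: "0 < \<epsilon>" "\<epsilon> < 1" using power_le_one[OF N_nonneg N_of_nat_le, of n 2] by (auto simp: \<epsilon>_def)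
  show ?thesis
    using power_app[OF n] app_sym[OF _ \<epsilon>(2)] unfolding \<epsilon>_def[symmetric]
    by (intro det_if_app[OF h \<epsilon>, where P = "\<lambda>x. \<exists>y. N (y ^ n - x) = 0"]) blast
qed

lemma polyfun_update: "h \<in> polyfun \<Longrightarrow> (\<lambda>e t. h (e(i := t))) \<in> polyR polyfun"
proof (induction rule: polyfun.induct)
  case (const c) then show ?case by (rule polyR_const[OF good_ring[OF good_polyfun] polyfun.const])
next
  case (var j)
  show ?case
    using polyR_var[OF good_ring[OF good_polyfun]] polyR_const[OF good_ring[OF good_polyfun] polyfun.var[of j]]
    by (cases "j = i") auto
qed (use polyR_add[OF good_ring[OF good_polyfun]] polyR_mult[OF good_ring[OF good_polyfun]] in auto)

lemma polyR_mono: "good R \<Longrightarrow> good S \<Longrightarrow> R \<subseteq> S \<Longrightarrow> polyR R \<subseteq> polyR S"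
  unfolding polyR_def[OF good_ring] by blast

text \<open>The union of the sets of centres works for all polynomials at once, since additional
  centres only strengthen the assumption on \<open>t\<close> and \<open>t'\<close>.\<close>

lemma common_centers:
  assumes "good R" "finite H" "H \<subseteq> polyR R"
  shows "\<exists>S cs. good S \<and> R \<subseteq> S \<and> finite cs \<and> cs \<subseteq> S \<and>
    (\<forall>\<epsilon>. 0 < \<epsilon> \<and> \<epsilon> < 1 \<longrightarrow> (\<exists>\<delta>. 0 < \<delta> \<and> \<delta> < 1 \<and>
      ev (\<lambda>e e'. \<forall>t t'. (\<forall>c\<in>cs. app \<delta> (t - c e) (t' - c e')) \<longrightarrow> (\<forall>F\<in>H. app \<epsilon> (F e t) (F e' t')))))"
  using assms(2,3)
proof (induction H rule: finite_induct)
  case empty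
  then show ?case using assms(1) by (intro exI[of _ R] exI[of _ "{}"]) (auto intro!: exI[of _ "1/2"] ev_True)
next
  case (insert F H)
  then obtain S cs where S: "good S" "R \<subseteq> S" "finite cs" "cs \<subseteq> S"
    and IH: "\<And>\<epsilon>. 0 < \<epsilon> \<Longrightarrow> \<epsilon> < 1 \<Longrightarrow> \<exists>\<delta>. 0 < \<delta> \<and> \<delta> < 1 \<and>
      ev (\<lambda>e e'. \<forall>t t'. (\<forall>c\<in>cs. app \<delta> (t - c e) (t' - c e')) \<longrightarrow> (\<forall>F\<in>H. app \<epsilon> (F e t) (F e' t')))"
    by auto
  have "F \<in> polyR S" using insert.prems polyR_mono[OF assms(1) S(1,2)] by blast
  then obtain n G where G: "\<forall>j. G j \<in> S" "F = (\<lambda>e t. pol n (\<lambda>j. G j e) t)"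
    unfolding polyR_def[OF good_ring[OF S(1)]] by blast
  obtain S' cs' \<eta> where S': "good S'" "S \<subseteq> S'" "centers S' n G cs' \<eta>"
    using has_centers[of n] S(1) G(1) unfolding has_centers_def by meson
  have GS': "G j \<in> S'" for j using G S' by blast
  have cs': "finite cs'" "cs' \<subseteq> S'" using S'(3) by (auto simp: centers_def)
  have "\<exists>\<delta>. 0 < \<delta> \<and> \<delta> < 1 \<and> ev (\<lambda>e e'. \<forall>t t'. (\<forall>c\<in>cs \<union> cs'. app \<delta> (t - c e) (t' - c e')) \<longrightarrow>
      (\<forall>F\<in>insert F H. app \<epsilon> (F e t) (F e' t')))" if \<epsilon>: "0 < \<epsilon> \<and> \<epsilon> < 1" for \<epsilon>
  proof -
    obtain \<delta>1 where \<delta>1: "0 < \<delta>1" "\<delta>1 < 1"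
      "ev (\<lambda>e e'. \<forall>t t'. (\<forall>c\<in>cs. app \<delta>1 (t - c e) (t' - c e')) \<longrightarrow> (\<forall>F\<in>H. app \<epsilon> (F e t) (F e' t')))"
      using IH[of \<epsilon>] \<epsilon> by blast
    obtain \<delta>2 where \<delta>2: "0 < \<delta>2" "\<delta>2 < 1"
      "ev (\<lambda>e e'. \<forall>t t'. (\<forall>c\<in>cs'. app \<delta>2 (t - c e) (t' - c e')) \<longrightarrow> app \<epsilon> (F e t) (F e' t'))"
      using centers_app[OF S'(1) GS' S'(3)] \<epsilon> unfolding G(2) by blast
    have "ev (\<lambda>e e'. \<forall>t t'. (\<forall>c\<in>cs \<union> cs'. app (min \<delta>1 \<delta>2) (t - c e) (t' - c e')) \<longrightarrow>
      (\<forall>F\<in>insert F H. app \<epsilon> (F e t) (F e' t')))"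
      using ev_conj[OF \<delta>1(3) \<delta>2(3)]
    proof (rule ev_mono, intro allI impI ballI)
      fix e e' t t' K
      assume *: "(\<forall>t t'. (\<forall>c\<in>cs. app \<delta>1 (t - c e) (t' - c e')) \<longrightarrow> (\<forall>F\<in>H. app \<epsilon> (F e t) (F e' t'))) \<and>
        (\<forall>t t'. (\<forall>c\<in>cs'. app \<delta>2 (t - c e) (t' - c e')) \<longrightarrow> app \<epsilon> (F e t) (F e' t'))"
        and t: "\<forall>c\<in>cs \<union> cs'. app (min \<delta>1 \<delta>2) (t - c e) (t' - c e')" and K: "K \<in> insert F H"
      have "\<forall>c\<in>cs. app \<delta>1 (t - c e) (t' - c e')" "\<forall>c\<in>cs'. app \<delta>2 (t - c e) (t' - c e')"
        using t app_mono by (meson UnCI min.cobounded1 min.cobounded2)+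
      then show "app \<epsilon> (K e t) (K e' t')" using * K by blast
    qed
    then show ?thesis using \<delta>1 \<delta>2 by (intro exI[of _ "min \<delta>1 \<delta>2"]) auto
  qed
  then show ?case using S S' cs' by (intro exI[of _ S'] exI[of _ "cs \<union> cs'"]) auto
qed

text \<open>Keeping the displacement from the nearest centre moves \<open>t\<close> along with the centres.\<close>

lemma move_point:
  assumes fin: "finite cs" and \<delta>: "0 \<le> \<delta>"
    and cc: "\<And>c c'. c \<in> cs \<Longrightarrow> c' \<in> cs \<Longrightarrow> app \<delta> (c e - c' e) (c e' - c' e')"
  shows "\<exists>t'. \<forall>c\<in>cs. app \<delta> (t - c e) (t' - (c e' :: 'a))"
proof (cases "cs = {}")
  case False
  define c where "c = arg_min_on (\<lambda>c. N (t - c e)) cs"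
  have c: "c \<in> cs" "\<And>b. b \<in> cs \<Longrightarrow> N (t - c e) \<le> N (t - b e)"
    unfolding c_def using arg_min_if_finite[OF fin False, of "\<lambda>c. N (t - c e)"] by (auto simp: not_less)
  have "app \<delta> (t - b e) (c e' + (t - c e) - b e')" if b: "b \<in> cs" for b
  proof -
    have "N (c e - b e) \<le> N (t - b e)"
      using N_triangle[of "c e" "b e" t] c(2)[OF b] by (simp add: N_diff_commute)
    then have "\<delta> * N (c e - b e) \<le> \<delta> * N (t - b e)" using \<delta> by (rule mult_left_mono)
    moreover have "N ((c e - b e) - (c e' - b e')) \<le> \<delta> * N (c e - b e)"
      using cc[OF c(1) b] by (simp add: app_def)
    moreover have "(t - b e) - (c e' + (t - c e) - b e') = (c e - b e) - (c e' - b e')" by simp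
    ultimately show ?thesis unfolding app_def by (metis order_trans)
  qed
  then show ?thesis by blast
qed simp

text \<open>Differences of centres belong to the good ring, so their leading terms are controlled. A
  witness can therefore be moved from \<open>e\<close> to \<open>e'\<close> without changing its
  leading terms relative to any centre, and with these all polynomials defining the predicate
  agree.\<close>

theorem det_ex:
  assumes "det S"
  shows "det (\<lambda>e. \<exists>t. S (e(i := t)))"
proof -
  obtain H \<epsilon> where H: "finite H" "H \<subseteq> polyfun" "0 < \<epsilon>" "\<epsilon> < 1"
    "\<And>e e'. (\<forall>h\<in>H. app \<epsilon> (h e) (h e')) \<Longrightarrow> S e = S e'"
    using assms unfolding det_def ev_def by blast
  define K where "K = (\<lambda>h e t. h (e(i := t))) ` H"
  have K: "finite K" "K \<subseteq> polyR polyfun" using H(1,2) polyfun_update by (auto simp: K_def)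
  obtain R cs where R: "good R" "finite cs" "cs \<subseteq> R" and ex: "\<forall>\<epsilon>. 0 < \<epsilon> \<and> \<epsilon> < 1 \<longrightarrow> (\<exists>\<delta>. 0 < \<delta> \<and> \<delta> < 1 \<and>
      ev (\<lambda>e e'. \<forall>t t'. (\<forall>c\<in>cs. app \<delta> (t - c e) (t' - c e')) \<longrightarrow> (\<forall>F\<in>K. app \<epsilon> (F e t) (F e' t'))))"
    using common_centers[OF good_polyfun K] by (elim exE conjE)
  obtain \<delta> where \<delta>: "0 < \<delta>" "\<delta> < 1"
      "ev (\<lambda>e e'. \<forall>t t'. (\<forall>c\<in>cs. app \<delta> (t - c e) (t' - c e')) \<longrightarrow> (\<forall>F\<in>K. app \<epsilon> (F e t) (F e' t')))"
    using ex[rule_format, OF conjI[OF H(3,4)]] by (elim exE conjE)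
  have "ev (\<lambda>e e'. app \<delta> (c e - c' e) (c e' - c' e'))" if "c \<in> cs" "c' \<in> cs" for c c'
    using that R(3) by (intro good_app[OF R(1) ring_diff[OF good_ring[OF R(1)], of c c'] \<delta>(1,2)]) auto
  then have "ev (\<lambda>e e'. \<forall>c\<in>cs. \<forall>c'\<in>cs. app \<delta> (c e - c' e) (c e' - c' e'))"
    by (intro ev_ball R(2))
  from ev_conj[OF \<delta>(3) this]
  have half: "ev (\<lambda>e e'. (\<exists>t. S (e(i := t))) \<longrightarrow> (\<exists>t. S (e'(i := t))))"
  proof (rule ev_mono, intro impI, elim exE conjE)
    fix e e' t
    assume *: "\<forall>t t'. (\<forall>c\<in>cs. app \<delta> (t - c e) (t' - c e')) \<longrightarrow> (\<forall>F\<in>K. app \<epsilon> (F e t) (F e' t'))"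
      and cc: "\<forall>c\<in>cs. \<forall>c'\<in>cs. app \<delta> (c e - c' e) (c e' - c' e')" and S: "S (e(i := t))"
    obtain t' where "\<forall>c\<in>cs. app \<delta> (t - c e) (t' - c e')"
      using move_point[OF R(2), of \<delta> e e' t] cc \<delta>(1) by auto
    then have "\<forall>F\<in>K. app \<epsilon> (F e t) (F e' t')" using * by blast
    then have "S (e(i := t)) = S (e'(i := t'))" by (intro H(5)) (auto simp: K_def)
    then show "\<exists>t. S (e'(i := t))" using S by blast
  qed
  show ?thesis unfolding det_def by (rule ev_mono[OF ev_conj[OF half ev_sym[OF half]]]) blast
qed

section \<open>Determined sets in one variable: bounded size or interior\<close>

lemma pol_continuous:
  assumes "0 < \<eta>"
  obtains r where "0 < r" "\<And>t. N (t - s) \<le> r \<Longrightarrow> N (pol d a t - pol d a s) \<le> \<eta>"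
proof -
  define b where "b = tay d a s"
  define C where "C = 1 + (\<Sum>i\<le>d. N (b i))"
  have C: "1 \<le> C" "\<And>i. i \<le> d \<Longrightarrow> N (b i) \<le> C"
  proof -
    show "1 \<le> C" unfolding C_def by (simp add: sum_nonneg)
    show "N (b i) \<le> C" if "i \<le> d" for i
      using member_le_sum[of i "{..d}" "\<lambda>i. N (b i)"] that by (simp add: C_def)
  qed
  define r where "r = min 1 (\<eta> / C)"
  have r: "0 < r" "r \<le> 1" "C * r \<le> \<eta>" using assms C(1) by (auto simp: r_def min_def field_simps)
  have "N (pol d a t - pol d a s) \<le> \<eta>" if t: "N (t - s) \<le> r" for t
  proof -
    have "pol d a t = pol d b (t - s)" using pol_tay[of d a s "t - s"] by (simp add: b_def)
    also have "\<dots> = b 0 + (\<Sum>i\<in>{1..d}. b i * (t - s) ^ i)"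
    proof -
      have "{..d} = insert 0 {1..d}" by auto
      then show ?thesis by (simp add: pol_def)
    qed
    finally have eq: "pol d a t - pol d a s = (\<Sum>i\<in>{1..d}. b i * (t - s) ^ i)" by (simp add: b_def tay_0)
    show ?thesis unfolding eq
    proof (rule N_sum)
      fix i assume i: "i \<in> {1..d}"
      have "N (t - s) ^ i \<le> N (t - s) ^ 1" using i t r by (intro power_decreasing) auto
      then have "N (t - s) ^ i \<le> r" using t by simp
      then have "N (b i) * N (t - s) ^ i \<le> C * r" using C i by (intro mult_mono) auto
      then show "N (b i * (t - s) ^ i) \<le> \<eta>" using r(3) by (simp add: N_mult N_power)
    qed (use assms in simp)
  qed
  then show thesis using that r(1) by blast
qed

text \<open>The leading term of a polynomial is locally constant away from its roots. If there are
  more solutions than roots counted over all polynomials, some solution is a root of none of them,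
  and the predicate is constant on a ball around it. The bound is a sum of degrees and does not
  depend on \<open>e\<close>.\<close>

theorem det_dichotomy:
  assumes "det S"
  obtains n where "\<And>e. (\<forall>X. finite X \<and> (\<forall>x\<in>X. S (e(i := x))) \<and> (\<forall>x\<in>X. \<forall>y\<in>X. x \<noteq> y \<longrightarrow> N (x - y) \<noteq> 0) \<longrightarrow> card X \<le> n)
     \<or> (\<exists>s r. 0 < r \<and> (\<forall>t. N (t - s) \<le> r \<longrightarrow> S (e(i := t))))"
proof -
  obtain H \<epsilon> where H: "finite H" "H \<subseteq> polyfun" "0 < \<epsilon>" "\<epsilon> < 1"
    "\<And>e e'. (\<forall>h\<in>H. app \<epsilon> (h e) (h e')) \<Longrightarrow> S e = S e'"
    using assms unfolding det_def ev_def by blast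
  have "\<forall>h\<in>H. \<exists>d a. \<forall>e t. h (e(i := t)) = pol d (\<lambda>j. a j e) t"
  proof
    fix h assume "h \<in> H"
    then have "(\<lambda>e t. h (e(i := t))) \<in> polyR polyfun" using H(2) polyfun_update by blast
    then obtain d a where "(\<lambda>e t. h (e(i := t))) = (\<lambda>e t. pol d (\<lambda>j. a j e) t)"
      unfolding polyR_def[OF good_ring[OF good_polyfun]] by blast
    then show "\<exists>d a. \<forall>e t. h (e(i := t)) = pol d (\<lambda>j. a j e) t" by metis
  qed
  then obtain d a where da: "\<And>h e t. h \<in> H \<Longrightarrow> h (e(i := t)) = pol (d h) (\<lambda>j. a h j e) t" by metis
  define n where "n = (\<Sum>h\<in>H. d h)"
  have "(\<forall>X. finite X \<and> (\<forall>x\<in>X. S (e(i := x))) \<and> (\<forall>x\<in>X. \<forall>y\<in>X. x \<noteq> y \<longrightarrow> N (x - y) \<noteq> 0) \<longrightarrow> card X \<le> n)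
     \<or> (\<exists>s r. 0 < r \<and> (\<forall>t. N (t - s) \<le> r \<longrightarrow> S (e(i := t))))" for e
  proof (subst disj_commute, rule disjCI)
    assume "\<not> (\<forall>X. finite X \<and> (\<forall>x\<in>X. S (e(i := x))) \<and> (\<forall>x\<in>X. \<forall>y\<in>X. x \<noteq> y \<longrightarrow> N (x - y) \<noteq> 0) \<longrightarrow> card X \<le> n)"
    then obtain X where X: "finite X" "\<And>x. x \<in> X \<Longrightarrow> S (e(i := x))"
      "\<And>x y. x \<in> X \<Longrightarrow> y \<in> X \<Longrightarrow> x \<noteq> y \<Longrightarrow> N (x - y) \<noteq> 0" "n < card X" by force
    \<comment> \<open>Polynomials outside \<open>H0\<close> are null at every \<open>t\<close> for
      this \<open>e\<close> and impose no condition.\<close>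
    define H0 where "H0 = {h \<in> H. \<exists>j\<le>d h. N (a h j e) \<noteq> 0}"
    define Z where "Z h = {x \<in> X. N (h (e(i := x))) = 0}" for h
    have Z: "card (Z h) \<le> d h" if h: "h \<in> H0" for h
    proof (rule ccontr)
      assume "\<not> ?thesis"
      then have "N (a h j e) = 0" if "j \<le> d h" for j
        using root_count[of "Z h" "d h" "\<lambda>j. a h j e" j] X h that da[of h] by (auto simp: Z_def H0_def)
      then show False using h by (auto simp: H0_def)
    qed
    have H0: "finite H0" "H0 \<subseteq> H" using H(1) by (auto simp: H0_def)
    have "card (\<Union>h\<in>H0. Z h) \<le> (\<Sum>h\<in>H0. card (Z h))" by (rule card_UN_le[OF H0(1)])
    also have "\<dots> \<le> (\<Sum>h\<in>H0. d h)" using Z by (rule sum_mono)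
    also have "\<dots> \<le> n" unfolding n_def using H0 H(1) by (intro sum_mono2) auto
    finally have "(\<Union>h\<in>H0. Z h) \<noteq> X" using X(4) by auto
    then obtain s where s: "s \<in> X" "\<And>h. h \<in> H0 \<Longrightarrow> N (h (e(i := s))) \<noteq> 0" by (auto simp: Z_def)
    have "\<forall>h\<in>H. \<exists>r>0. \<forall>t. N (t - s) \<le> r \<longrightarrow> app \<epsilon> (h (e(i := s))) (h (e(i := t)))"
    proof
      fix h assume h: "h \<in> H"
      show "\<exists>r>0. \<forall>t. N (t - s) \<le> r \<longrightarrow> app \<epsilon> (h (e(i := s))) (h (e(i := t)))"
      proof (cases "h \<in> H0")
        case True
        then have "0 < \<epsilon> * N (h (e(i := s)))" using s(2)[OF True] H(3) N_nonneg[of "h (e(i := s))"] by (simp add: less_le)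
        then obtain r where r: "0 < r" "\<And>t. N (t - s) \<le> r \<Longrightarrow>
            N (pol (d h) (\<lambda>j. a h j e) t - pol (d h) (\<lambda>j. a h j e) s) \<le> \<epsilon> * N (h (e(i := s)))"
          using pol_continuous by blast
        then show ?thesis using da[OF h] by (intro exI[of _ r]) (auto simp: app_def N_diff_commute)
      next
        case False
        then have "N (h (e(i := t))) \<le> 0" for t
          unfolding da[OF h] pol_def using h by (intro N_sum) (auto simp: H0_def N_mult)
        then show ?thesis by (intro exI[of _ 1]) (auto simp: app_null_iff)
      qed
    qed
    then obtain r where r: "\<And>h. h \<in> H \<Longrightarrow> 0 < r h"
      "\<And>h t. h \<in> H \<Longrightarrow> N (t - s) \<le> r h \<Longrightarrow> app \<epsilon> (h (e(i := s))) (h (e(i := t)))" by metis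
    define \<rho> where "\<rho> = Min (insert 1 (r ` H))"
    have \<rho>: "0 < \<rho>" "\<And>h. h \<in> H \<Longrightarrow> \<rho> \<le> r h" using H(1) r(1) by (auto simp: \<rho>_def)
    have "S (e(i := t))" if "N (t - s) \<le> \<rho>" for t
    proof -
      have "S (e(i := s)) = S (e(i := t))" using r(2) \<rho>(2) that by (intro H(5)) (meson order_trans)
      then show ?thesis using X(2)[OF s(1)] by simp
    qed
    then show "\<exists>s r. 0 < r \<and> (\<forall>t. N (t - s) \<le> r \<longrightarrow> S (e(i := t)))" using \<rho>(1) by blast
  qed
  then show thesis using that by blast
qed

text \<open>A diagonal construction: the \<open>n\<close>-th step moves by
  \<open>\<pi> ^ (m + n)\<close> if the current point is closer than that to \<open>y n\<close>. All
  later moves are strictly smaller, so the distance gained is never lost.\<close>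

lemma ball_uncountable:
  assumes "0 < r"
  obtains t where "N (t - s) \<le> r" "\<And>n::nat. N (t - y n) \<noteq> 0"
proof -
  obtain \<pi> where \<pi>: "0 < N \<pi>" "N \<pi> < 1" using N_small by blast
  obtain m where m: "N \<pi> ^ m < r" using real_arch_pow_inv[OF assms \<pi>(2)] by blast
  define c where "c = rec_nat s (\<lambda>n x. if N \<pi> ^ (m + n) \<le> N (x - y n) then x else x + \<pi> ^ (m + n))"
  have c0: "c 0 = s" and cS: "c (Suc n) = (if N \<pi> ^ (m + n) \<le> N (c n - y n) then c n else c n + \<pi> ^ (m + n))" for n
    by (simp_all add: c_def)
  have avoid: "N \<pi> ^ (m + n) \<le> N (c (Suc n) - y n)" for n
  proof (cases "N \<pi> ^ (m + n) \<le> N (c n - y n)")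
    case False
    then have "N (\<pi> ^ (m + n) + (c n - y n)) = N (\<pi> ^ (m + n))" by (intro N_add_eq) (simp add: N_power)
    then show ?thesis using False by (simp add: cS N_power algebra_simps)
  qed (simp add: cS)
  have "N (c (Suc n) - c n) \<le> N \<pi> ^ m * N \<pi> ^ n" for n
    by (simp add: cS N_power N_mult power_add)
  then obtain l where l: "\<And>n. N (c n - l) \<le> N \<pi> ^ m * N \<pi> ^ n"
    using steps_limit[of c "N \<pi> ^ m" "N \<pi>"] \<pi> by auto
  have "N (l - y n) \<noteq> 0" for n
  proof -
    have "N (c (Suc n) - l) \<le> N \<pi> * N \<pi> ^ (m + n)" using l[of "Suc n"] by (simp add: power_add mult_ac)
    also have "\<dots> < N \<pi> ^ (m + n)" using \<pi> by simp
    also have "\<dots> \<le> N (c (Suc n) - y n)" by (rule avoid)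
    finally have lt: "N (c (Suc n) - l) < N (c (Suc n) - y n)" .
    then have "N (l - y n) = N (c (Suc n) - y n)"
      using N_eq_if_close[of "c (Suc n) - y n" "l - y n"] by simp
    then show ?thesis using lt N_nonneg[of "c (Suc n) - l"] by linarith
  qed
  moreover have "N (l - s) \<le> r" using l[of 0] m by (simp add: c0 N_diff_commute)
  ultimately show thesis using that by blast
qed

end

subsection \<open>The p-adic absolute value\<close>

text \<open>The definition reads off the reduced fraction; additivity of multiplicities allows any
  fraction, in particular two numbers over a common denominator.\<close>

lemma padic_abs_frac:
  assumes p: "prime p" and ab: "a \<noteq> 0" "b \<noteq> 0"
  shows "padic_abs p (of_int a / of_int b)
    = real p powi (int (multiplicity (int p) b) - int (multiplicity (int p) a))"
proof -
  obtain c d where cd: "quotient_of (of_int a / of_int b) = (c, d)" by fastforce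
  have d: "d > 0" using quotient_of_denom_pos[OF cd] .
  have eq: "(of_int a / of_int b :: rat) = of_int c / of_int d" using quotient_of_div[OF cd] .
  then have c: "c \<noteq> 0" using ab by auto
  have "of_int (a * d) = (of_int (c * b) :: rat)" using eq ab d by (simp add: field_simps)
  then have "a * d = c * b" by (simp only: of_int_eq_iff)
  moreover have "prime_elem (int p)" using p by auto
  ultimately have "multiplicity (int p) a + multiplicity (int p) d = multiplicity (int p) c + multiplicity (int p) b"
    using ab c d prime_elem_multiplicity_mult_distrib[of "int p"] by (metis less_numeral_extra(3))
  then have "int (multiplicity (int p) d) - int (multiplicity (int p) c)
      = int (multiplicity (int p) b) - int (multiplicity (int p) a)" by linarith
  then show ?thesis using ab cd by (simp add: padic_abs_def)
qed

lemma rat_frac_cases: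
  obtains a b where "(x::rat) = of_int a / of_int b" "b \<noteq> 0"
proof -
  obtain c d where "quotient_of x = (c, d)" by fastforce
  then show thesis using that[of c d] quotient_of_div quotient_of_denom_pos by (metis less_numeral_extra(3))
qed

lemma padic_abs_0 [simp]: "padic_abs p 0 = 0"
  by (simp add: padic_abs_def)

lemma padic_abs_nonneg [simp]: "0 \<le> padic_abs p x"
  by (auto simp: padic_abs_def split: prod.split)

lemma padic_abs_mult:
  assumes p: "prime p" shows "padic_abs p (x * y) = padic_abs p x * padic_abs p y"
proof (cases "x = 0 \<or> y = 0")
  case False
  obtain a b where x: "x = of_int a / of_int b" "b \<noteq> 0" by (rule rat_frac_cases)
  obtain c d where y: "y = of_int c / of_int d" "d \<noteq> 0" by (rule rat_frac_cases)
  have nz: "a \<noteq> 0" "c \<noteq> 0" using False x y by auto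
  have xy: "x * y = of_int (a * c) / of_int (b * d)" using x y by simp
  have pe: "prime_elem (int p)" using p by auto
  have p0: "real p \<noteq> 0" using p by auto
  show ?thesis
    unfolding xy x(1) y(1) using nz x(2) y(2) p0
    by (simp add: padic_abs_frac[OF p] prime_elem_multiplicity_mult_distrib[OF pe] padic_abs_frac[OF p, of "a * c" "b * d", simplified]
        flip: power_int_add) (simp add: algebra_simps)
qed auto

lemma padic_abs_1 [simp]: "padic_abs p 1 = 1"
  by (simp add: padic_abs_def)

lemma padic_abs_add:
  assumes p: "prime p" shows "padic_abs p (x + y) \<le> max (padic_abs p x) (padic_abs p y)"
proof (cases "x = 0 \<or> y = 0 \<or> x + y = 0")
  case True
  then show ?thesis by (auto simp: le_max_iff_disj)
next
  case False
  obtain a b where x: "x = of_int a / of_int b" "b \<noteq> 0" by (rule rat_frac_cases)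
  obtain c d where y: "y = of_int c / of_int d" "d \<noteq> 0" by (rule rat_frac_cases)
  define u v w where "u = a * d" and "v = c * b" and "w = b * d"
  have w: "w \<noteq> 0" using x y by (simp add: w_def)
  have xu: "x = of_int u / of_int w" and yv: "y = of_int v / of_int w" and xy: "x + y = of_int (u + v) / of_int w"
    using x y by (simp_all add: u_def v_def w_def field_simps)
  have nz: "u \<noteq> 0" "v \<noteq> 0" "u + v \<noteq> 0" using False xu yv xy by auto
  define m where "m = min (multiplicity (int p) u) (multiplicity (int p) v)"
  have "int p ^ m dvd u" "int p ^ m dvd v" by (auto simp: m_def multiplicity_dvd')
  then have "int p ^ m dvd u + v" by simp
  then have "m \<le> multiplicity (int p) (u + v)"
    using nz(3) p by (intro multiplicity_geI) (auto simp: prime_gt_1_nat)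
  then have le: "int (multiplicity (int p) w) - int (multiplicity (int p) (u + v))
        \<le> int (multiplicity (int p) w) - int (multiplicity (int p) u) \<or>
      int (multiplicity (int p) w) - int (multiplicity (int p) (u + v))
        \<le> int (multiplicity (int p) w) - int (multiplicity (int p) v)"
    by (auto simp: m_def)
  have "1 \<le> real p" using prime_ge_1_nat[OF p] by simp
  then have "padic_abs p (of_int (u + v) / of_int w) \<le> padic_abs p (of_int u / of_int w) \<or>
      padic_abs p (of_int (u + v) / of_int w) \<le> padic_abs p (of_int v / of_int w)"
    unfolding padic_abs_frac[OF p nz(3) w] padic_abs_frac[OF p nz(1) w] padic_abs_frac[OF p nz(2) w]
    using le by (elim disjE) (auto intro: power_int_increasing)
  then have "padic_abs p (x + y) \<le> padic_abs p x \<or> padic_abs p (x + y) \<le> padic_abs p y"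
    unfolding xy[symmetric] xu[symmetric] yv[symmetric] .
  then show ?thesis by linarith
qed

lemma padic_abs_eq_0: "prime p \<Longrightarrow> padic_abs p x = 0 \<longleftrightarrow> x = 0"
  by (auto simp: padic_abs_def split: prod.splits)

lemma padic_abs_minus:
  assumes p: "prime p" shows "padic_abs p (- x) = padic_abs p x"
proof -
  have "padic_abs p (- 1) * padic_abs p (- 1) = 1" using padic_abs_mult[OF p, of "- 1" "- 1"] by simp
  then have "padic_abs p (- 1) = 1"
    by (metis padic_abs_nonneg abs_of_nonneg abs_one mult_cancel_left1 power2_eq_square real_sqrt_abs real_sqrt_one)
  then show ?thesis using padic_abs_mult[OF p, of "- 1" x] by simp
qed

lemma padic_abs_diff_commute: "prime p \<Longrightarrow> padic_abs p (x - y) = padic_abs p (y - x)"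
  using padic_abs_minus[of p "x - y"] by simp

lemma padic_abs_triangle: "prime p \<Longrightarrow> padic_abs p (x - z) \<le> max (padic_abs p (x - y)) (padic_abs p (y - z))"
  using padic_abs_add[of p "x - y" "y - z"] by simp

lemma padic_abs_abs_diff: "prime p \<Longrightarrow> \<bar>padic_abs p x - padic_abs p y\<bar> \<le> padic_abs p (x - y)"
proof -
  assume p: "prime p"
  have "max a b \<le> a + b" if "0 \<le> a" "0 \<le> b" for a b :: real using that by simp
  then have *: "padic_abs p u \<le> padic_abs p (u - v) + padic_abs p v" for u v
    using padic_abs_add[OF p, of "u - v" v] by (metis diff_add_cancel order_trans padic_abs_nonneg)
  show ?thesis using *[of x y] *[of y x] by (simp add: abs_le_iff padic_abs_diff_commute[OF p, of y x])
qed

lemma padic_abs_prime: assumes p: "prime p" shows "padic_abs p (of_nat p) = 1 / real p"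
proof -
  have "padic_abs p (of_int (int p) / of_int 1) = real p powi (- 1)"
    using padic_abs_frac[OF p, of "int p" 1] p by (simp add: prime_gt_0_nat prime_imp_prime_elem)
  then show ?thesis by (simp add: power_int_minus field_simps)
qed

section \<open>Cauchy sequences of rationals\<close>

lemma padic_Cauchy_const: "padic_Cauchy p (\<lambda>_. r)"
  by (simp add: padic_Cauchy_def)

lemma padic_Cauchy_add:
  assumes p: "prime p" and "padic_Cauchy p X" "padic_Cauchy p Y"
  shows "padic_Cauchy p (\<lambda>n. X n + Y n)"
  unfolding padic_Cauchy_def
proof (intro allI impI)
  fix e :: real assume "0 < e"
  then obtain K L where K: "\<And>m n. m \<ge> K \<Longrightarrow> n \<ge> K \<Longrightarrow> padic_abs p (X m - X n) < e"
    and L: "\<And>m n. m \<ge> L \<Longrightarrow> n \<ge> L \<Longrightarrow> padic_abs p (Y m - Y n) < e"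
    using assms unfolding padic_Cauchy_def by meson
  show "\<exists>N. \<forall>m\<ge>N. \<forall>n\<ge>N. padic_abs p (X m + Y m - (X n + Y n)) < e"
  proof (intro exI[of _ "max K L"] allI impI)
    fix m n assume "m \<ge> max K L" "n \<ge> max K L"
    then show "padic_abs p (X m + Y m - (X n + Y n)) < e"
      using K[of m n] L[of m n] padic_abs_add[OF p, of "X m - X n" "Y m - Y n"] by (simp add: algebra_simps)
  qed
qed

lemma padic_Cauchy_bounded:
  assumes p: "prime p" and X: "padic_Cauchy p X"
  obtains B where "0 < B" "\<And>n. padic_abs p (X n) \<le> B"
proof -
  obtain K where K: "\<And>m n. m \<ge> K \<Longrightarrow> n \<ge> K \<Longrightarrow> padic_abs p (X m - X n) < 1"
    using X unfolding padic_Cauchy_def by (meson zero_less_one)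
  define B where "B = 1 + (\<Sum>n\<le>K. padic_abs p (X n))"
  have "padic_abs p (X n) \<le> B" for n
  proof (cases "n \<le> K")
    case True
    then show ?thesis using member_le_sum[of n "{..K}" "\<lambda>n. padic_abs p (X n)"] by (simp add: B_def)
  next
    case False
    have "padic_abs p (X K) \<le> B"
      using member_le_sum[of K "{..K}" "\<lambda>n. padic_abs p (X n)"] by (simp add: B_def)
    moreover have "1 \<le> B" by (simp add: B_def sum_nonneg)
    ultimately show ?thesis using K[of n K] False padic_abs_add[OF p, of "X n - X K" "X K"] by simp
  qed
  moreover have "0 < B" by (simp add: B_def sum_nonneg add_pos_nonneg)
  ultimately show thesis using that by blast
qed

lemma padic_Cauchy_mult:
  assumes p: "prime p" and X: "padic_Cauchy p X" and Y: "padic_Cauchy p Y"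
  shows "padic_Cauchy p (\<lambda>n. X n * Y n)"
  unfolding padic_Cauchy_def
proof (intro allI impI)
  fix e :: real assume e: "0 < e"
  obtain B where B: "0 < B" "\<And>n. padic_abs p (X n) \<le> B" using padic_Cauchy_bounded[OF p X] by blast
  obtain C where C: "0 < C" "\<And>n. padic_abs p (Y n) \<le> C" using padic_Cauchy_bounded[OF p Y] by blast
  have "0 < e / C" "0 < e / B" using e B C by auto
  then obtain K L where K: "\<And>m n. m \<ge> K \<Longrightarrow> n \<ge> K \<Longrightarrow> padic_abs p (X m - X n) < e / C"
    and L: "\<And>m n. m \<ge> L \<Longrightarrow> n \<ge> L \<Longrightarrow> padic_abs p (Y m - Y n) < e / B"
    using X Y unfolding padic_Cauchy_def by meson
  show "\<exists>N. \<forall>m\<ge>N. \<forall>n\<ge>N. padic_abs p (X m * Y m - X n * Y n) < e"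
  proof (intro exI[of _ "max K L"] allI impI)
    fix m n assume mn: "m \<ge> max K L" "n \<ge> max K L"
    have "padic_abs p ((X m - X n) * Y m) \<le> padic_abs p (X m - X n) * C"
      using C(2)[of m] by (simp add: padic_abs_mult[OF p] mult_left_mono)
    then have 1: "padic_abs p ((X m - X n) * Y m) < e" using K[of m n] mn C(1) by (simp add: pos_less_divide_eq)
    have "padic_abs p (X n * (Y m - Y n)) \<le> B * padic_abs p (Y m - Y n)"
      using B(2)[of n] by (simp add: padic_abs_mult[OF p] mult_right_mono)
    then have 2: "padic_abs p (X n * (Y m - Y n)) < e" using L[of m n] mn B(1) by (simp add: pos_less_divide_eq mult.commute)
    have "X m * Y m - X n * Y n = (X m - X n) * Y m + X n * (Y m - Y n)" by (simp add: algebra_simps)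
    then show "padic_abs p (X m * Y m - X n * Y n) < e"
      using 1 2 padic_abs_add[OF p, of "(X m - X n) * Y m" "X n * (Y m - Y n)"] by simp
  qed
qed

lemma padic_Cauchy_minus: "prime p \<Longrightarrow> padic_Cauchy p X \<Longrightarrow> padic_Cauchy p (\<lambda>n. - X n)"
  using padic_Cauchy_mult[OF _ padic_Cauchy_const[of p "- 1"], of X] by simp

lemma padic_Cauchy_diff:
  "prime p \<Longrightarrow> padic_Cauchy p X \<Longrightarrow> padic_Cauchy p Y \<Longrightarrow> padic_Cauchy p (\<lambda>n. X n - Y n)"
  using padic_Cauchy_add[OF _ _ padic_Cauchy_minus, of p X Y] by simp

subsection \<open>One ring for all primes\<close>

text \<open>A type cannot depend on \<open>p\<close>. The product over all primes of the rings of Cauchy sequences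
  is a commutative ring, and for each \<open>p\<close> it carries a multiplicative seminorm whose Hausdorff
  quotient is \<open>Q\<^sub>p\<close>.\<close>

typedef mpadic = "{X :: nat \<Rightarrow> nat \<Rightarrow> rat. \<forall>p. prime p \<longrightarrow> padic_Cauchy p (X p)}"
  morphisms seq mk
  by (rule exI[of _ "\<lambda>_ _. 0"]) (simp add: padic_Cauchy_const)

lemma seq_Cauchy: "prime p \<Longrightarrow> padic_Cauchy p (seq x p)"
  using seq[of x] by blast

lemma seq_mk: "(\<And>p. prime p \<Longrightarrow> padic_Cauchy p (X p)) \<Longrightarrow> seq (mk X) = X"
  by (rule mk_inverse) blast

instantiation mpadic :: comm_ring_1
begin

definition "0 = mk (\<lambda>_ _. 0)"
definition "1 = mk (\<lambda>_ _. 1)"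
definition "x + y = mk (\<lambda>p n. seq x p n + seq y p n)"
definition "x * y = mk (\<lambda>p n. seq x p n * seq y p n)"
definition "- x = mk (\<lambda>p n. - seq x p n)"
definition "x - y = mk (\<lambda>p n. seq x p n - seq y p n)" for x y :: mpadic

lemma seq_zero [simp]: "seq 0 p n = 0"
  and seq_one [simp]: "seq 1 p n = 1"
  and seq_add [simp]: "seq (x + y) p n = seq x p n + seq y p n"
  and seq_mult [simp]: "seq (x * y) p n = seq x p n * seq y p n"
  and seq_minus [simp]: "seq (- x) p n = - seq x p n"
  and seq_diff [simp]: "seq (x - y) p n = seq x p n - seq y p n"
  unfolding zero_mpadic_def one_mpadic_def plus_mpadic_def times_mpadic_def uminus_mpadic_def minus_mpadic_def
  by (subst seq_mk; auto intro!: padic_Cauchy_const padic_Cauchy_add padic_Cauchy_mult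
      padic_Cauchy_minus padic_Cauchy_diff seq_Cauchy)+

lemma mpadic_eqI: "(\<And>p n. seq x p n = seq y p n) \<Longrightarrow> x = y"
  by (simp add: seq_inject[symmetric] fun_eq_iff)

instance
proof
  show "(0::mpadic) \<noteq> 1"
  proof
    assume "(0::mpadic) = 1"
    then have "seq 0 0 0 = seq 1 0 0" by simp
    then show False by simp
  qed
qed (rule mpadic_eqI; simp add: algebra_simps)+

end

section \<open>The seminorm at one prime, inverses and completeness\<close>

definition nm :: "nat \<Rightarrow> mpadic \<Rightarrow> real" where
  "nm p x = lim (\<lambda>n. padic_abs p (seq x p n))"

lemma nm_lim: assumes p: "prime p" shows "(\<lambda>n. padic_abs p (seq x p n)) \<longlonglongrightarrow> nm p x"
proof -
  have "Cauchy (\<lambda>n. padic_abs p (seq x p n))"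
  proof (rule metric_CauchyI)
    fix e :: real assume "0 < e"
    then obtain K where "\<forall>m\<ge>K. \<forall>n\<ge>K. padic_abs p (seq x p m - seq x p n) < e"
      using seq_Cauchy[OF p, of x] unfolding padic_Cauchy_def by blast
    then show "\<exists>M. \<forall>m\<ge>M. \<forall>n\<ge>M. dist (padic_abs p (seq x p m)) (padic_abs p (seq x p n)) < e"
      using padic_abs_abs_diff[OF p] by (metis dist_real_def order_le_less_trans)
  qed
  then show ?thesis unfolding nm_def using Cauchy_convergent convergent_LIMSEQ_iff by blast
qed

lemma nm_eqI: "prime p \<Longrightarrow> (\<lambda>n. padic_abs p (seq x p n)) \<longlonglongrightarrow> l \<Longrightarrow> nm p x = l"
  using nm_lim LIMSEQ_unique by blast

lemma nm_le:
  assumes p: "prime p" and "\<And>n. n \<ge> K \<Longrightarrow> padic_abs p (seq x p n) \<le> b" shows "nm p x \<le> b"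
  using assms(2) by (intro LIMSEQ_le_const2[OF nm_lim[OF p]]) blast

lemma seq_of_nat [simp]: "seq (of_nat k) p n = of_nat k"
  by (induction k) auto

lemma nm_const:
  assumes "prime p" "\<And>n. seq x p n = r" shows "nm p x = padic_abs p r"
  by (rule nm_eqI[OF assms(1)]) (simp add: assms(2))

text \<open>The seminorm at \<open>p\<close> sees only the component at \<open>p\<close>, so the
  other components may be filled with \<open>0\<close>.\<close>

lemma mk_single:
  assumes "padic_Cauchy p X"
  obtains x where "seq x p = X"
proof
  show "seq (mk (\<lambda>q. if q = p then X else (\<lambda>_. 0))) p = X"
    by (subst seq_mk) (auto simp: assms padic_Cauchy_const)
qed

text \<open>A sequence of nonzero norm is eventually bounded away from \<open>0\<close>, which makes
  the termwise inverses a Cauchy sequence; finitely many vanishing entries do not affect the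
  limit.\<close>

lemma nm_inverse:
  assumes p: "prime p" and x: "nm p x \<noteq> 0"
  shows "\<exists>y. nm p (x * y - 1) = 0"
proof -
  define X where "X = seq x p"
  define c where "c = nm p x / 2"
  have "0 \<le> nm p x" using LIMSEQ_le_const[OF nm_lim[OF p, of x], of 0] by auto
  then have c: "0 < c" "c < nm p x" using x by (auto simp: c_def)
  obtain K where K: "\<And>n. n \<ge> K \<Longrightarrow> c < padic_abs p (X n)"
    using order_tendstoD(1)[OF nm_lim[OF p, of x] c(2)] unfolding eventually_sequentially X_def by blast
  have nz: "X n \<noteq> 0" if "n \<ge> K" for n using K[OF that] c by auto
  have "padic_Cauchy p (\<lambda>n. inverse (X n))"
    unfolding padic_Cauchy_def
  proof (intro allI impI)
    fix e :: real assume "0 < e"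
    then have "0 < e * (c * c)" using c by simp
    then obtain L where L: "\<And>m n. m \<ge> L \<Longrightarrow> n \<ge> L \<Longrightarrow> padic_abs p (X m - X n) < e * (c * c)"
      using seq_Cauchy[OF p, of x] unfolding padic_Cauchy_def X_def by meson
    show "\<exists>N. \<forall>m\<ge>N. \<forall>n\<ge>N. padic_abs p (inverse (X m) - inverse (X n)) < e"
    proof (intro exI[of _ "max K L"] allI impI)
      fix m n assume mn: "m \<ge> max K L" "n \<ge> max K L"
      have "(inverse (X m) - inverse (X n)) * (X m * X n) = X n - X m"
        using nz mn by (simp add: field_simps)
      then have "padic_abs p (inverse (X m) - inverse (X n)) * (padic_abs p (X m) * padic_abs p (X n)) = padic_abs p (X n - X m)"
        by (metis padic_abs_mult[OF p])
      also have "\<dots> < e * (c * c)" using L mn by simp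
      also have "\<dots> \<le> e * (padic_abs p (X m) * padic_abs p (X n))"
        using K[of m] K[of n] mn c \<open>0 < e\<close> by (intro mult_left_mono mult_mono) auto
      finally show "padic_abs p (inverse (X m) - inverse (X n)) < e"
        using K[of m] K[of n] mn c by (simp add: mult_less_cancel_right split: if_splits)
    qed
  qed
  then obtain y where y: "seq y p = (\<lambda>n. inverse (X n))" by (rule mk_single)
  have "(\<lambda>n. padic_abs p (seq (x * y - 1) p n)) \<longlonglongrightarrow> 0"
  proof (rule tendsto_eventually)
    show "\<forall>\<^sub>F n in sequentially. padic_abs p (seq (x * y - 1) p n) = 0"
      unfolding eventually_sequentially using nz by (intro exI[of _ K]) (auto simp: y X_def)
  qed
  then show ?thesis using nm_eqI[OF p] by blast
qed

text \<open>A diagonal sequence: from \<open>u m\<close> take an entry beyond which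
  \<open>u m\<close> varies by less than \<open>1 / Suc m\<close>.\<close>

lemma nm_complete:
  assumes p: "prime p" and C: "\<And>\<epsilon>::real. 0 < \<epsilon> \<Longrightarrow> \<exists>k. \<forall>m\<ge>k. \<forall>n\<ge>k. nm p (u m - u n) < \<epsilon>"
  shows "\<exists>l. (\<lambda>n. nm p (u n - l)) \<longlonglongrightarrow> 0"
proof -
  have "\<forall>m. \<exists>k. \<forall>i\<ge>k. \<forall>j\<ge>k. padic_abs p (seq (u m) p i - seq (u m) p j) < 1 / real (Suc m)"
    using seq_Cauchy[OF p] unfolding padic_Cauchy_def by (metis of_nat_0_less_iff zero_less_Suc zero_less_divide_1_iff)
  then obtain k where k: "\<And>m i j. i \<ge> k m \<Longrightarrow> j \<ge> k m \<Longrightarrow> padic_abs p (seq (u m) p i - seq (u m) p j) < 1 / real (Suc m)"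
    by metis
  define X where "X m = seq (u m) p (k m)" for m
  have near: "padic_abs p (seq (u m) p i - X m) < 1 / real (Suc m)" if "i \<ge> k m" for m i
    using k[OF that, of "k m"] by (simp add: X_def)
  have X: "padic_Cauchy p X"
    unfolding padic_Cauchy_def
  proof (intro allI impI)
    fix e :: real assume e: "0 < e"
    obtain K where K: "\<And>m n. m \<ge> K \<Longrightarrow> n \<ge> K \<Longrightarrow> nm p (u m - u n) < e" using C[OF e] by blast
    obtain L where L: "1 / real (Suc L) < e" using reals_Archimedean[OF e] by (auto simp: inverse_eq_divide)
    have L': "1 / real (Suc m) < e" if "m \<ge> L" for m
      using L that by (smt (verit) frac_le of_nat_0_less_iff of_nat_mono Suc_le_mono zero_less_Suc)
    show "\<exists>N. \<forall>m\<ge>N. \<forall>n\<ge>N. padic_abs p (X m - X n) < e"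
    proof (intro exI[of _ "max K L"] allI impI)
      fix m n assume mn: "m \<ge> max K L" "n \<ge> max K L"
      obtain J where J: "\<And>i. i \<ge> J \<Longrightarrow> padic_abs p (seq (u m - u n) p i) < e"
        using order_tendstoD(2)[OF nm_lim[OF p], of "u m - u n" e] K[of m n] mn
        unfolding eventually_sequentially by auto
      define i where "i = max J (max (k m) (k n))"
      have i: "k m \<le> i" "k n \<le> i" "J \<le> i" by (auto simp: i_def)
      have "padic_abs p (X m - seq (u m) p i) < e"
        using near[OF i(1)] L'[of m] mn by (simp add: padic_abs_diff_commute[OF p])
      moreover have "padic_abs p (seq (u n) p i - X n) < e"
        using near[OF i(2)] L'[of n] mn by simp
      moreover have "padic_abs p (seq (u m) p i - seq (u n) p i) < e" using J[OF i(3)] by simp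
      ultimately show "padic_abs p (X m - X n) < e"
        using padic_abs_triangle[OF p, of "X m" "X n" "seq (u m) p i"]
          padic_abs_triangle[OF p, of "seq (u m) p i" "X n" "seq (u n) p i"] by simp
    qed
  qed
  then obtain l where l: "seq l p = X" by (rule mk_single)
  have "(\<lambda>n. nm p (u n - l)) \<longlonglongrightarrow> 0"
  proof (rule LIMSEQ_I)
    fix e :: real assume e: "0 < e"
    have e2: "0 < e / 2" using e by simp
    obtain K where K: "\<And>m n. m \<ge> K \<Longrightarrow> n \<ge> K \<Longrightarrow> padic_abs p (X m - X n) < e / 2"
      using X e2 unfolding padic_Cauchy_def by meson
    obtain L where L: "1 / real (Suc L) < e / 2" using reals_Archimedean[OF e2] by (auto simp: inverse_eq_divide)
    show "\<exists>no. \<forall>n\<ge>no. norm (nm p (u n - l) - 0) < e"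
    proof (intro exI[of _ "max K L"] allI impI)
      fix n assume n: "n \<ge> max K L"
      have "1 / real (Suc n) \<le> 1 / real (Suc L)" using n by (simp add: frac_le)
      then have n1: "1 / real (Suc n) < e / 2" using L by simp
      have "nm p (u n - l) \<le> e / 2"
      proof (rule nm_le[OF p])
        fix i assume i: "i \<ge> max (k n) K"
        have "padic_abs p (seq (u n) p i - X n) < e / 2" using near[of n i] i n1 by simp
        moreover have "padic_abs p (X n - X i) < e / 2" using K[of n i] i n by simp
        ultimately show "padic_abs p (seq (u n - l) p i) \<le> e / 2"
          using padic_abs_triangle[OF p, of "seq (u n) p i" "X i" "X n"] by (simp add: l)
      qed
      moreover have "0 \<le> nm p (u n - l)" by (rule LIMSEQ_le_const[OF nm_lim[OF p]]) auto
      ultimately show "norm (nm p (u n - l) - 0) < e" using e by simp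
    qed
  qed
  then show ?thesis by blast
qed

lemma vring_nm: assumes p: "prime p" shows "vring (nm p)"
proof
  fix x y :: mpadic
  show "0 \<le> nm p x" by (rule LIMSEQ_le_const[OF nm_lim[OF p]]) auto
  show "nm p 0 = 0" "nm p 1 = 1" using nm_const[OF p] by force+
  show "nm p (x * y) = nm p x * nm p y"
    using tendsto_mult[OF nm_lim[OF p, of x] nm_lim[OF p, of y]] by (intro nm_eqI[OF p]) (simp add: padic_abs_mult[OF p])
  show "nm p (x + y) \<le> max (nm p x) (nm p y)"
    by (rule LIMSEQ_le[OF nm_lim[OF p] tendsto_max[OF nm_lim[OF p, of x] nm_lim[OF p, of y]]])
      (auto simp: padic_abs_add[OF p])
  show "\<exists>y. nm p (x * y - 1) = 0" if "nm p x \<noteq> 0" by (rule nm_inverse[OF p that])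
next
  fix n :: nat assume "0 < n"
  then show "nm p (of_nat n) \<noteq> 0"
    using nm_const[OF p, of "of_nat n" "of_nat n"] by (simp add: padic_abs_eq_0[OF p])
next
  fix u :: "nat \<Rightarrow> mpadic" assume "\<And>\<epsilon>::real. 0 < \<epsilon> \<Longrightarrow> \<exists>k. \<forall>m\<ge>k. \<forall>n\<ge>k. nm p (u m - u n) < \<epsilon>"
  then show "\<exists>l. (\<lambda>n. nm p (u n - l)) \<longlonglongrightarrow> 0" by (rule nm_complete[OF p])
next
  have "nm p (of_nat p) = 1 / real p"
    using nm_const[OF p, of "of_nat p" "of_nat p"] padic_abs_prime[OF p] by simp
  then show "\<exists>x. 0 < nm p x \<and> nm p x < 1" using prime_gt_1_nat[OF p] by (intro exI[of _ "of_nat p"]) auto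
qed

section \<open>Balls, and the p-adic field as Hausdorff quotient of the ring\<close>

definition in_ball :: "(fname, 'r rname, 'u) struc \<Rightarrow> 'u \<Rightarrow> 'u \<Rightarrow> 'u \<Rightarrow> bool" where
  "in_ball M b b0 z \<longleftrightarrow> (\<exists>u\<in>univ M. rint M ValRing [u] \<and> b = fint M Plus [b0, fint M Times [z, u]])"

text \<open>Radii are nonzero elements of the structure instead of real numbers, so the notion makes
  sense in every model and is expressed by a formula.\<close>

definition has_interior :: "(fname, 'r rname, 'u) struc \<Rightarrow> 'u set \<Rightarrow> bool" where
  "has_interior M S \<longleftrightarrow> (\<exists>b0\<in>univ M. \<exists>z\<in>univ M. z \<noteq> fint M Zero [] \<and>
     (\<forall>b\<in>univ M. in_ball M b b0 z \<longrightarrow> b \<in> S))"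

locale padic_prime =
  fixes p :: nat
  assumes p: "prime p"
begin

sublocale vring "nm p"
  by (rule vring_nm[OF p])

definition pr :: "mpadic \<Rightarrow> padic" where
  "pr x = Qp_class p (seq x p)"

lemma padic_rel_iff: "(seq x p, seq y p) \<in> padic_rel p \<longleftrightarrow> nm p (x - y) = 0"
proof -
  have "(\<lambda>n. padic_abs p (seq x p n - seq y p n)) \<longlonglongrightarrow> 0 \<longleftrightarrow> nm p (x - y) = 0"
    using nm_lim[OF p, of "x - y"] nm_eqI[OF p, of "x - y" 0] by auto
  then show ?thesis by (simp add: padic_rel_def seq_Cauchy[OF p])
qed

lemma padic_rel_seqE:
  assumes "(X, Y) \<in> padic_rel p"
  obtains x y where "seq x p = X" "seq y p = Y"
proof -
  have "padic_Cauchy p X" "padic_Cauchy p Y" using assms by (auto simp: padic_rel_def)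
  then show thesis using that mk_single[of p X] mk_single[of p Y] by metis
qed

lemma equiv_padic_rel: "equiv {X. padic_Cauchy p X} (padic_rel p)"
proof (rule equivI)
  show "padic_rel p \<subseteq> {X. padic_Cauchy p X} \<times> {X. padic_Cauchy p X}" by (auto simp: padic_rel_def)
  show "refl_on {X. padic_Cauchy p X} (padic_rel p)"
    by (rule refl_onI) (auto simp: padic_rel_def)
  show "sym (padic_rel p)"
  proof (rule symI)
    fix X Y assume r: "(X, Y) \<in> padic_rel p"
    then obtain x y where xy: "seq x p = X" "seq y p = Y" by (rule padic_rel_seqE)
    show "(Y, X) \<in> padic_rel p"
      using r N_diff_commute[of x y] unfolding xy[symmetric] padic_rel_iff by simp
  qed
  show "trans (padic_rel p)"
  proof (rule transI)
    fix X Y Z assume r: "(X, Y) \<in> padic_rel p" "(Y, Z) \<in> padic_rel p"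
    obtain x y where xy: "seq x p = X" "seq y p = Y" using r(1) by (rule padic_rel_seqE)
    obtain y' z where z: "seq y' p = Y" "seq z p = Z" using r(2) by (rule padic_rel_seqE)
    show "(X, Z) \<in> padic_rel p"
      using r N_triangle[of x z y] unfolding xy[symmetric] z(2)[symmetric] padic_rel_iff by simp
  qed
qed

lemma pr_eq_iff: "pr x = pr y \<longleftrightarrow> nm p (x - y) = 0"
  unfolding pr_def Qp_class_def padic_rel_iff[symmetric]
  using eq_equiv_class_iff[OF equiv_padic_rel, of "seq x p" "seq y p"] seq_Cauchy[OF p] by simp

lemma pr_in: "pr x \<in> Qp p"
  unfolding pr_def Qp_class_def Qp_def by (rule quotientI) (simp add: seq_Cauchy[OF p])

lemma pr_surj: assumes "a \<in> Qp p" obtains x where "pr x = a"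
proof -
  obtain X where X: "padic_Cauchy p X" "a = padic_rel p `` {X}"
    using assms unfolding Qp_def by (auto elim!: quotientE)
  then obtain x where "seq x p = X" using mk_single by blast
  then show thesis using that X(2) by (auto simp: pr_def Qp_class_def)
qed

lemma Qp_eq: "Qp p = range pr"
  using pr_in pr_surj by (metis image_subsetI rangeI subsetI subset_antisym)

text \<open>The operations on the quotient use representatives obtained by choice. Any such
  representative comes from a ring element at distance \<open>0\<close>, so the operations can be
  computed in the ring.\<close>

lemma rep_pr: obtains x' where "seq x' p = Qp_rep (pr x)" "nm p (x' - x) = 0"
proof -
  have "seq x p \<in> pr x" unfolding pr_def Qp_class_def
    using equiv_class_self[OF equiv_padic_rel] seq_Cauchy[OF p] by simp
  then have "Qp_rep (pr x) \<in> pr x" unfolding Qp_rep_def by (rule someI[of "\<lambda>X. X \<in> pr x"])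
  then have r: "(seq x p, Qp_rep (pr x)) \<in> padic_rel p" by (simp add: pr_def Qp_class_def)
  then obtain y x' where y: "seq y p = seq x p" and x': "seq x' p = Qp_rep (pr x)" by (rule padic_rel_seqE)
  have "nm p (x - x') = 0" using r unfolding x'[symmetric] padic_rel_iff .
  then show thesis using that x' by (simp add: N_diff_commute)
qed

lemma Qp_add_pr: "Qp_add p (pr x) (pr y) = pr (x + y)"
proof -
  obtain x' where x': "seq x' p = Qp_rep (pr x)" "nm p (x' - x) = 0" by (rule rep_pr)
  obtain y' where y': "seq y' p = Qp_rep (pr y)" "nm p (y' - y) = 0" by (rule rep_pr)
  have "Qp_add p (pr x) (pr y) = pr (x' + y')"
    unfolding Qp_add_def x'(1)[symmetric] y'(1)[symmetric] pr_def[of "x' + y'"]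
    by (rule arg_cong[where f = "Qp_class p"]) auto
  also have "\<dots> = pr (x + y)"
    unfolding pr_eq_iff using N_null_add[OF x'(2) y'(2)] by (simp add: algebra_simps)
  finally show ?thesis .
qed

lemma Qp_mult_pr: "Qp_mult p (pr x) (pr y) = pr (x * y)"
proof -
  obtain x' where x': "seq x' p = Qp_rep (pr x)" "nm p (x' - x) = 0" by (rule rep_pr)
  obtain y' where y': "seq y' p = Qp_rep (pr y)" "nm p (y' - y) = 0" by (rule rep_pr)
  have "Qp_mult p (pr x) (pr y) = pr (x' * y')"
    unfolding Qp_mult_def x'(1)[symmetric] y'(1)[symmetric] pr_def[of "x' * y'"]
    by (rule arg_cong[where f = "Qp_class p"]) auto
  also have "\<dots> = pr (x * y)"
  proof -
    have "x' * y' - x * y = (x' - x) * y' + x * (y' - y)" by (simp add: algebra_simps)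
    then show ?thesis unfolding pr_eq_iff using x'(2) y'(2) by (simp add: N_null_add N_mult)
  qed
  finally show ?thesis .
qed

lemma Qp_abs_pr: "Qp_abs p (pr x) = nm p x"
proof -
  obtain x' where x': "seq x' p = Qp_rep (pr x)" "nm p (x' - x) = 0" by (rule rep_pr)
  have "Qp_abs p (pr x) = nm p x'" unfolding Qp_abs_def nm_def x'(1) ..
  then show ?thesis using N_eq_if_null[OF x'(2)] by simp
qed

lemma Qp_of_rat_pr: assumes "\<And>n. seq x p n = r" shows "Qp_of_rat p r = pr x"
proof -
  have "seq x p = (\<lambda>_. r)" using assms by auto
  then show ?thesis by (simp add: Qp_of_rat_def pr_def)
qed

lemma Qp_zero: "Qp_of_rat p 0 = pr 0" and Qp_one: "Qp_of_rat p 1 = pr 1"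
  by (rule Qp_of_rat_pr; simp)+

lemma Qp_power_pr: "Qp_power p (pr x) n = pr (x ^ n)"
  by (induction n) (simp_all add: Qp_power_def Qp_one Qp_mult_pr)

lemma univ_Qp [simp]: "univ (Qp_struc p) = range pr"
  by (simp add: Qp_struc_def Qp_eq)

lemma fint_Qp [simp]:
  "fint (Qp_struc p) Zero [] = pr 0" "fint (Qp_struc p) One [] = pr 1"
  "fint (Qp_struc p) Plus [pr x, pr y] = pr (x + y)" "fint (Qp_struc p) Times [pr x, pr y] = pr (x * y)"
  by (simp_all add: Qp_struc_def Qp_zero Qp_one Qp_add_pr Qp_mult_pr)

lemma rint_Qp [simp]:
  "rint (Qp_struc p) ValRing [pr x] \<longleftrightarrow> nm p x \<le> 1"
  "rint (Qp_struc p) (PowP n) [pr x] \<longleftrightarrow> (\<exists>y. nm p (y ^ n - x) = 0)"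
  by (auto simp: Qp_struc_def Qp_abs_pr Qp_eq Qp_power_pr pr_eq_iff)

section \<open>Definable sets in the p-adic field\<close>

lemma eval_Qp:
  assumes "trm_in (L_beta :: (fname, 'r rname) lang) t"
  shows "\<exists>h\<in>polyfun. \<forall>e. eval (Qp_struc p :: (fname, 'r rname, padic) struc) (\<lambda>i. pr (e i)) t = pr (h e)"
  using assms
proof (induction t)
  case (Var x) then show ?case by (auto intro: polyfun.var)
next
  case (Fn f ts)
  consider "f = Zero" "ts = []" | "f = One" "ts = []"
    | s t where "f = Plus" "ts = [s, t]" | s t where "f = Times" "ts = [s, t]"
    using Fn.prems by (auto simp: L_beta_def length_Suc_conv numeral_2_eq_2)
  then show ?case
  proof cases
    case 1 then show ?thesis by (auto intro: bexI[OF _ polyfun.const])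
  next
    case 2 then show ?thesis by (auto intro: bexI[OF _ polyfun.const])
  next
    case 3
    then obtain g h where "g \<in> polyfun" "h \<in> polyfun"
      "\<And>e. eval (Qp_struc p :: (fname, 'r rname, padic) struc) (\<lambda>i. pr (e i)) s = pr (g e)"
      "\<And>e. eval (Qp_struc p :: (fname, 'r rname, padic) struc) (\<lambda>i. pr (e i)) t = pr (h e)"
      using Fn.IH[of s] Fn.IH[of t] Fn.prems by auto
    then show ?thesis using 3 by (intro bexI[OF _ polyfun.add[of g h]]) auto
  next
    case 4
    then obtain g h where "g \<in> polyfun" "h \<in> polyfun"
      "\<And>e. eval (Qp_struc p :: (fname, 'r rname, padic) struc) (\<lambda>i. pr (e i)) s = pr (g e)"
      "\<And>e. eval (Qp_struc p :: (fname, 'r rname, padic) struc) (\<lambda>i. pr (e i)) t = pr (h e)"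
      using Fn.IH[of s] Fn.IH[of t] Fn.prems by auto
    then show ?thesis using 4 by (intro bexI[OF _ polyfun.mult[of g h]]) auto
  qed
qed

theorem det_sat:
  fixes \<phi> :: "(fname, 'r rname) fm"
  assumes "fm_in L_beta \<phi>"
  shows "det (\<lambda>e. sat (Qp_struc p) (\<lambda>i. pr (e i)) \<phi>)"
  using assms
proof (induction \<phi>)
  case Fls then show ?case by (simp add: det_def ev_True)
next
  case (Equ s t)
  obtain g where g: "g \<in> polyfun" "\<And>e. eval (Qp_struc p :: (fname, 'r rname, padic) struc) (\<lambda>i. pr (e i)) s = pr (g e)"
    using Equ eval_Qp[of s] by auto
  obtain h where h: "h \<in> polyfun" "\<And>e. eval (Qp_struc p :: (fname, 'r rname, padic) struc) (\<lambda>i. pr (e i)) t = pr (h e)"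
    using Equ eval_Qp[of t] by auto
  show ?case using det_null[OF ring_diff[OF good_ring[OF good_polyfun] g(1) h(1)]] by (simp add: g h pr_eq_iff)
next
  case (Rel R ts)
  then obtain t where t: "ts = [t]" "trm_in (L_beta :: (fname, 'r rname) lang) t" and R: "R = ValRing \<or> (\<exists>n\<ge>2. R = PowP n)"
  proof -
    have "(R, length ts) \<in> rels (L_beta :: (fname, 'r rname) lang)" using Rel by simp
    then have "length ts = Suc 0" "R = ValRing \<or> (\<exists>n\<ge>2. R = PowP n)" by (auto simp: L_beta_def)
    then show thesis using that Rel by (auto simp: length_Suc_conv)
  qed
  obtain h where h: "h \<in> polyfun" "\<And>e. eval (Qp_struc p :: (fname, 'r rname, padic) struc) (\<lambda>i. pr (e i)) t = pr (h e)"
    using t eval_Qp by blast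
  from R show ?case
  proof
    assume "R = ValRing" then show ?thesis using det_le_1[OF h(1)] by (simp add: t h)
  next
    assume "\<exists>n\<ge>2. R = PowP n"
    then obtain n where "n \<ge> 2" "R = PowP n" by blast
    then show ?thesis using det_power[OF h(1), of n] by (simp add: t h)
  qed
next
  case (Neg \<phi>) then show ?case by (simp add: det_Not)
next
  case (And \<phi> \<psi>) then show ?case by (simp add: det_conj)
next
  case (Exi x \<phi>)
  have "sat (Qp_struc p) (\<lambda>i. pr (e i)) (Exi x \<phi>) = (\<exists>t. sat (Qp_struc p) (\<lambda>i. pr ((e(x := t)) i)) \<phi>)" for e
  proof -
    have "(\<lambda>i. pr (e i))(x := pr t) = (\<lambda>i. pr ((e(x := t)) i))" for t by (auto simp: fun_eq_iff)
    then show ?thesis by simp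
  qed
  then show ?case using det_ex[OF Exi.IH, of x] Exi.prems by simp
qed

lemma in_ball_Qp:
  assumes z: "nm p z \<noteq> 0"
  shows "in_ball (Qp_struc p) (pr b) (pr b0) (pr z) \<longleftrightarrow> nm p (b - b0) \<le> nm p z"
proof
  assume "in_ball (Qp_struc p) (pr b) (pr b0) (pr z)"
  then obtain u where u: "nm p u \<le> 1" "nm p (b - (b0 + z * u)) = 0"
    by (auto simp: in_ball_def pr_eq_iff)
  have "nm p (b - b0) = nm p (z * u)" using N_eq_if_null[of "b - b0" "z * u"] u(2) by (simp add: algebra_simps)
  then show "nm p (b - b0) \<le> nm p z" using u(1) by (simp add: N_mult mult_left_le)
next
  assume le: "nm p (b - b0) \<le> nm p z"
  obtain y where y: "nm p (z * y - 1) = 0" using N_inv[OF z] by blast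
  have zy: "nm p z * nm p y = 1" using N_eq_if_null[OF y] by (simp add: N_mult)
  define u where "u = (b - b0) * y"
  have "nm p (b - b0) * nm p y \<le> nm p z * nm p y" using le by (intro mult_right_mono) auto
  then have "nm p u \<le> 1" using zy by (simp add: u_def N_mult)
  moreover have "nm p (b - (b0 + z * u)) = 0"
  proof -
    have "b - (b0 + z * u) = - (b - b0) * (z * y - 1)" by (simp add: u_def algebra_simps)
    then show ?thesis using y by (simp add: N_mult)
  qed
  ultimately show "in_ball (Qp_struc p) (pr b) (pr b0) (pr z)" by (auto simp: in_ball_def pr_eq_iff)
qed

lemma dichotomy_Qp:
  fixes Q :: "(fname, 'r rname, padic) struc"
  assumes "fm_in L_beta \<phi>" and Q: "Q = Qp_struc p"
  shows "\<exists>n. \<forall>e. assignment Q e \<longrightarrow>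
    (let S = {b \<in> univ Q. sat Q (e(i := b)) \<phi>}
     in finite S \<and> card S \<le> n \<or> has_interior Q S)"
proof -
  obtain n where n: "\<And>e. (\<forall>X. finite X \<and> (\<forall>x\<in>X. sat Q (\<lambda>j. pr ((e(i := x)) j)) \<phi>) \<and>
        (\<forall>x\<in>X. \<forall>y\<in>X. x \<noteq> y \<longrightarrow> nm p (x - y) \<noteq> 0) \<longrightarrow> card X \<le> n)
     \<or> (\<exists>s r. 0 < r \<and> (\<forall>t. nm p (t - s) \<le> r \<longrightarrow> sat Q (\<lambda>j. pr ((e(i := t)) j)) \<phi>))"
    using det_dichotomy[OF det_sat[OF assms(1)], of i] unfolding Q by blast
  have "finite S \<and> card S \<le> n \<or> has_interior Q S"
    if e: "assignment Q e" and S: "S = {b \<in> univ Q. sat Q (e(i := b)) \<phi>}" for e S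
  proof -
    have "\<forall>j. \<exists>x. e j = pr x" using e by (auto simp: Q assignment_def image_iff)
    then obtain f where f: "e = (\<lambda>j. pr (f j))" by metis
    have upd: "e(i := pr x) = (\<lambda>j. pr ((f(i := x)) j))" for x by (auto simp: f fun_eq_iff)
    from n[of f] show ?thesis
    proof
      assume bound: "\<forall>X. finite X \<and> (\<forall>x\<in>X. sat Q (\<lambda>j. pr ((f(i := x)) j)) \<phi>) \<and>
        (\<forall>x\<in>X. \<forall>y\<in>X. x \<noteq> y \<longrightarrow> nm p (x - y) \<noteq> 0) \<longrightarrow> card X \<le> n"
      have "card F \<le> n" if F: "finite F" "F \<subseteq> S" for F
      proof -
        define X where "X = inv pr ` F"
        have inv: "pr (inv pr b) = b" if "b \<in> F" for b using that F(2) S by (auto simp: Q intro!: f_inv_into_f)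
        then have "inj_on (inv pr) F" by (metis inj_onI)
        then have "card F = card X" by (simp add: X_def card_image)
        also have "card X \<le> n"
        proof (rule bound[rule_format], intro conjI ballI impI)
          show "finite X" using F by (simp add: X_def)
          show "sat Q (\<lambda>j. pr ((f(i := x)) j)) \<phi>" if "x \<in> X" for x
            unfolding upd[symmetric] using that inv F(2) S by (auto simp: X_def)
          show "nm p (x - y) \<noteq> 0" if "x \<in> X" "y \<in> X" "x \<noteq> y" for x y
            using that inv unfolding pr_eq_iff[symmetric] by (auto simp: X_def)
        qed
        finally show ?thesis .
      qed
      then show ?thesis using finite_if_finite_subsets_card_bdd[of S n] by blast
    next
      assume "\<exists>s r. 0 < r \<and> (\<forall>t. nm p (t - s) \<le> r \<longrightarrow> sat Q (\<lambda>j. pr ((f(i := t)) j)) \<phi>)"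
      then obtain s r where r: "0 < r" "\<And>t. nm p (t - s) \<le> r \<Longrightarrow> sat Q (e(i := pr t)) \<phi>"
        unfolding upd by blast
      obtain x where x: "0 < nm p x" "nm p x < 1" using N_small by blast
      \<comment> \<open>The real radius is shrunk to the norm of a power of \<open>x\<close>, so
        that the ball is given by an element of the field.\<close>
      obtain m where m: "nm p x ^ m < r" using real_arch_pow_inv[OF r(1) x(2)] by blast
      have z: "nm p (x ^ m) \<noteq> 0" using x(1) by (simp add: N_power)
      have "has_interior Q S"
        unfolding has_interior_def
      proof (rule bexI[of _ "pr s"], rule bexI[of _ "pr (x ^ m)"], intro conjI ballI impI)
        show "pr (x ^ m) \<noteq> fint Q Zero []" using z by (simp add: Q pr_eq_iff)
        fix b assume "b \<in> univ Q" and b: "in_ball Q b (pr s) (pr (x ^ m))"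
        then obtain t where t: "b = pr t" by (auto simp: Q)
        have "nm p (t - s) \<le> r" using iffD1[OF in_ball_Qp[OF z] b[unfolded t Q]] m by (simp add: N_power)
        then show "b \<in> S" using r(2) t S by (auto simp: Q)
      qed (auto simp: Q)
      then show ?thesis by blast
    qed
  qed
  then show ?thesis unfolding Let_def by blast
qed

lemma rational_dense:
  assumes z: "nm p z \<noteq> 0"
  obtains r where "in_ball (Qp_struc p) (Qp_of_rat p r) (pr x) (pr z)"
proof -
  have "0 < nm p z" using z N_nonneg[of z] by linarith
  then obtain k where k: "\<And>m n. m \<ge> k \<Longrightarrow> n \<ge> k \<Longrightarrow> padic_abs p (seq x p m - seq x p n) < nm p z"
    using seq_Cauchy[OF p, of x] unfolding padic_Cauchy_def by meson
  define r where "r = seq x p k"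
  obtain y where y: "seq y p = (\<lambda>_. r)" using mk_single[OF padic_Cauchy_const] by blast
  have "nm p (y - x) \<le> nm p z"
    by (rule nm_le[OF p, of k]) (use k[of k] in \<open>auto simp: y r_def less_imp_le\<close>)
  then show thesis using that[of r] in_ball_Qp[OF z, of y x] Qp_of_rat_pr[of y r] y by simp
qed

text \<open>A definable set cannot have fibres with interior over a ball in one direction and finite
  fibres in the other: every fibre with interior contains a rational number, so the ball
  would be countable.\<close>

lemma interior_fibres_Qp:
  fixes Q :: "(fname, 'r rname, padic) struc"
  assumes Q: "Q = Qp_struc p" and "has_interior Q {y \<in> univ Q. has_interior Q {z. \<theta> y z}}"
  shows "\<exists>z\<in>univ Q. infinite {y \<in> univ Q. \<theta> y z}"
proof (rule ccontr)
  assume "\<not> ?thesis"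
  then have fin: "finite {y \<in> range pr. \<theta> y z}" if "z \<in> range pr" for z using that by (auto simp: Q)
  obtain s w where w: "nm p w \<noteq> 0"
    "\<And>t. nm p (t - s) \<le> nm p w \<Longrightarrow> has_interior Q {z. \<theta> (pr t) z}"
  proof -
    have "\<exists>s w. nm p w \<noteq> 0 \<and> (\<forall>t. nm p (t - s) \<le> nm p w \<longrightarrow> has_interior Q (Collect (\<theta> (pr t))))"
      using assms(2) unfolding has_interior_def[of _ "{y \<in> _. _ y}"] by (auto simp: Q pr_eq_iff in_ball_Qp) blast
    then show thesis using that by blast
  qed
  define C where "C = (\<Union>r. {y \<in> range pr. \<theta> y (Qp_of_rat p r)})"
  have "Qp_of_rat p r \<in> range pr" for r
    using mk_single[OF padic_Cauchy_const[of p r]] Qp_of_rat_pr by (metis rangeI)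
  then have C: "countable C" unfolding C_def using fin by (intro countable_UN) (auto intro: countable_finite)
  have in_C: "pr t \<in> C" if t: "nm p (t - s) \<le> nm p w" for t
  proof -
    obtain b0 z where z: "nm p z \<noteq> 0" "\<And>b. b \<in> range pr \<Longrightarrow> in_ball Q b (pr b0) (pr z) \<Longrightarrow> \<theta> (pr t) b"
      using w(2)[OF t] unfolding has_interior_def by (auto simp: Q pr_eq_iff)
    obtain r where "in_ball Q (Qp_of_rat p r) (pr b0) (pr z)" using rational_dense[OF z(1)] unfolding Q by blast
    then have "\<theta> (pr t) (Qp_of_rat p r)" using z(2) \<open>Qp_of_rat p r \<in> range pr\<close> by blast
    then show ?thesis by (auto simp: C_def)
  qed
  have "C \<noteq> {}" using in_C[of s] by auto
  define y where "y n = inv pr (from_nat_into C n)" for n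
  have y: "pr (y n) = from_nat_into C n" for n
    unfolding y_def using from_nat_into[OF \<open>C \<noteq> {}\<close>, of n] by (intro f_inv_into_f) (auto simp: C_def)
  have "0 < nm p w" using w(1) N_nonneg[of w] by linarith
  then obtain t where t: "nm p (t - s) \<le> nm p w" "\<And>n::nat. nm p (t - y n) \<noteq> 0"
    using ball_uncountable[of "nm p w" s y] by blast
  have "pr t \<in> range (from_nat_into C)" using in_C[OF t(1)] C \<open>C \<noteq> {}\<close> by (simp add: range_from_nat_into)
  then obtain n where "pr t = pr (y n)" using y by auto
  then show False using t(2)[of n] by (simp add: pr_eq_iff)
qed

end

subsection \<open>Derived connectives\<close>

lemma sat_Imp [simp]: "sat M e (Imp \<phi> \<psi>) \<longleftrightarrow> (sat M e \<phi> \<longrightarrow> sat M e \<psi>)"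
  by (simp add: Imp_def)

lemma sat_Forall [simp]: "sat M e (Forall x \<phi>) \<longleftrightarrow> (\<forall>a\<in>univ M. sat M (e(x := a)) \<phi>)"
  by (simp add: Forall_def)

lemma sat_Conjs [simp]: "sat M e (Conjs \<phi>s) \<longleftrightarrow> (\<forall>\<phi>\<in>set \<phi>s. sat M e \<phi>)"
  by (induction \<phi>s) (simp_all add: Conjs_def)

lemma sat_Disjs [simp]: "sat M e (Disjs \<phi>s) \<longleftrightarrow> (\<exists>\<phi>\<in>set \<phi>s. sat M e \<phi>)"
  by (simp add: Disjs_def)

lemma fm_in_Imp [simp]: "fm_in L (Imp \<phi> \<psi>) \<longleftrightarrow> fm_in L \<phi> \<and> fm_in L \<psi>"
  by (simp add: Imp_def)

lemma fm_in_Forall [simp]: "fm_in L (Forall x \<phi>) \<longleftrightarrow> fm_in L \<phi>"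
  by (simp add: Forall_def)

lemma fm_in_Conjs [simp]: "fm_in L (Conjs \<phi>s) \<longleftrightarrow> (\<forall>\<phi>\<in>set \<phi>s. fm_in L \<phi>)"
  by (induction \<phi>s) (simp_all add: Conjs_def)

lemma fm_in_Disjs [simp]: "fm_in L (Disjs \<phi>s) \<longleftrightarrow> (\<forall>\<phi>\<in>set \<phi>s. fm_in L \<phi>)"
  by (simp add: Disjs_def)

lemma fm_in_Foralls [simp]: "fm_in L (Foralls xs \<phi>) \<longleftrightarrow> fm_in L \<phi>"
  by (induction xs) (simp_all add: Foralls_def)

lemma fm_in_Exis [simp]: "fm_in L (Exis xs \<phi>) \<longleftrightarrow> fm_in L \<phi>"
  by (induction xs) (simp_all add: Exis_def)

lemma fv_Imp [simp]: "fv (Imp \<phi> \<psi>) = fv \<phi> \<union> fv \<psi>"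
  by (simp add: Imp_def)

lemma fv_Forall [simp]: "fv (Forall x \<phi>) = fv \<phi> - {x}"
  by (simp add: Forall_def)

lemma fv_Conjs [simp]: "fv (Conjs \<phi>s) = (\<Union>\<phi>\<in>set \<phi>s. fv \<phi>)"
  by (induction \<phi>s) (simp_all add: Conjs_def)

lemma fv_Disjs [simp]: "fv (Disjs \<phi>s) = (\<Union>\<phi>\<in>set \<phi>s. fv \<phi>)"
  by (simp add: Disjs_def)

lemma fv_Foralls [simp]: "fv (Foralls xs \<phi>) = fv \<phi> - set xs"
  by (induction xs) (auto simp: Foralls_def)

lemma fv_Exis [simp]: "fv (Exis xs \<phi>) = fv \<phi> - set xs"
  by (induction xs) (auto simp: Exis_def)

text \<open>A block of quantifiers amounts to one change of assignment on the listed variables;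
  repetitions in the list do no harm.\<close>

lemma sat_Exis:
  "sat M e (Exis xs \<phi>) \<longleftrightarrow>
     (\<exists>e'. (\<forall>y. y \<notin> set xs \<longrightarrow> e' y = e y) \<and> (\<forall>x\<in>set xs. e' x \<in> univ M) \<and> sat M e' \<phi>)"
proof (induction xs arbitrary: e)
  case Nil
  have "(\<forall>y. e' y = e y) \<longleftrightarrow> e' = e" for e' by auto
  then show ?case by (simp add: Exis_def)
next
  case (Cons x xs)
  have step: "sat M e (Exis (x # xs) \<phi>) \<longleftrightarrow> (\<exists>a\<in>univ M. sat M (e(x := a)) (Exis xs \<phi>))"
    by (simp add: Exis_def)
  show ?case
  proof
    assume "sat M e (Exis (x # xs) \<phi>)"
    then obtain a e' where a: "a \<in> univ M" "\<forall>y. y \<notin> set xs \<longrightarrow> e' y = (e(x := a)) y" "\<forall>x\<in>set xs. e' x \<in> univ M" "sat M e' \<phi>"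
      unfolding step Cons.IH by blast
    then show "\<exists>e'. (\<forall>y. y \<notin> set (x # xs) \<longrightarrow> e' y = e y) \<and> (\<forall>x\<in>set (x # xs). e' x \<in> univ M) \<and> sat M e' \<phi>"
      by (intro exI[of _ e']) (cases "x \<in> set xs"; auto)
  next
    assume "\<exists>e'. (\<forall>y. y \<notin> set (x # xs) \<longrightarrow> e' y = e y) \<and> (\<forall>x\<in>set (x # xs). e' x \<in> univ M) \<and> sat M e' \<phi>"
    then obtain e' where e': "\<forall>y. y \<notin> set (x # xs) \<longrightarrow> e' y = e y" "\<forall>x\<in>set (x # xs). e' x \<in> univ M" "sat M e' \<phi>"
      by blast
    have "sat M (e(x := e' x)) (Exis xs \<phi>)"
      unfolding Cons.IH using e' by (intro exI[of _ e']) auto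
    then show "sat M e (Exis (x # xs) \<phi>)" unfolding step using e'(2) by auto
  qed
qed

lemma Foralls_Exis: "sat M e (Foralls xs \<phi>) \<longleftrightarrow> \<not> sat M e (Exis xs (Neg \<phi>))"
  by (induction xs arbitrary: e) (simp_all add: Foralls_def Exis_def)

lemma sat_Foralls:
  "sat M e (Foralls xs \<phi>) \<longleftrightarrow>
     (\<forall>e'. (\<forall>y. y \<notin> set xs \<longrightarrow> e' y = e y) \<and> (\<forall>x\<in>set xs. e' x \<in> univ M) \<longrightarrow> sat M e' \<phi>)"
  unfolding Foralls_Exis sat_Exis by auto

lemma eval_cong: "(\<And>x. x \<in> trm_vars t \<Longrightarrow> e x = e' x) \<Longrightarrow> eval M e t = eval M e' t"
proof (induction t)
  case (Fn f ts)
  have "map (eval M e) ts = map (eval M e') ts" using Fn by (intro map_cong refl Fn.IH) auto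
  then show ?case by (simp only: eval.simps)
qed simp

lemma sat_cong: "(\<And>x. x \<in> fv \<phi> \<Longrightarrow> e x = e' x) \<Longrightarrow> sat M e \<phi> = sat M e' \<phi>"
proof (induction \<phi> arbitrary: e e')
  case (Equ s t)
  then have "eval M e s = eval M e' s" "eval M e t = eval M e' t" by (auto intro: eval_cong)
  then show ?case by simp
next
  case (Rel R ts)
  have "map (eval M e) ts = map (eval M e') ts" using Rel by (intro map_cong refl eval_cong) auto
  then show ?case by (simp only: sat.simps)
next
  case (Neg \<phi>) then show ?case by (metis fv.simps(4) sat.simps(4))
next
  case (And \<phi> \<psi>) then show ?case by (metis UnCI fv.simps(5) sat.simps(5))
next
  case (Exi x \<phi>)
  have "sat M (e(x := a)) \<phi> = sat M (e'(x := a)) \<phi>" for a using Exi.prems by (intro Exi.IH) auto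
  then show ?case by simp
qed auto

lemma finite_trm_vars: "finite (trm_vars t)"
  by (induction t) auto

lemma finite_fv: "finite (fv \<phi>)"
  by (induction \<phi>) (auto simp: finite_trm_vars)

lemma fv_bounded: obtains n where "fv \<phi> \<subseteq> {..<n}"
  using finite_nat_set_iff_bounded[of "fv \<phi>"] finite_fv by auto

subsection \<open>Counting solutions and interior\<close>

lemma fm_in_at_most [simp]: "fm_in L (at_most_fm n k \<phi>) \<longleftrightarrow> fm_in L \<phi>"
  by (auto simp: at_most_fm_def)

lemma fv_at_most: "fv \<phi> \<subseteq> {..n} \<Longrightarrow> fv (at_most_fm n k \<phi>) \<subseteq> {..<n}"
  by (auto simp: at_most_fm_def)

text \<open>The \<open>k\<close> witnesses need not be distinct or solutions themselves, so they
  cover any solution set with at most \<open>k\<close> elements.\<close>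

lemma sat_at_most:
  assumes \<phi>: "fv \<phi> \<subseteq> {..n}" and U: "univ M \<noteq> {}"
  shows "sat M e (at_most_fm n k \<phi>) \<longleftrightarrow>
    finite {b \<in> univ M. sat M (e(n := b)) \<phi>} \<and> card {b \<in> univ M. sat M (e(n := b)) \<phi>} \<le> k"
proof -
  define S where "S = {b \<in> univ M. sat M (e(n := b)) \<phi>}"
  let ?I = "{Suc n..<Suc n + k}"
  have sat: "sat M e (at_most_fm n k \<phi>) \<longleftrightarrow>
     (\<exists>e'. (\<forall>y. y \<notin> ?I \<longrightarrow> e' y = e y) \<and> (\<forall>x\<in>?I. e' x \<in> univ M) \<and> (\<forall>b\<in>univ M. sat M (e'(n := b)) \<phi> \<longrightarrow> b \<in> e' ` ?I))"
  proof -
    have "(\<exists>\<psi>\<in>set (map (\<lambda>i. Equ (Var n) (Var i)) [Suc n..<Suc n + k]). sat M (e'(n := b)) \<psi>) \<longleftrightarrow> b \<in> e' ` ?I" for e' b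
    proof -
      have "(\<exists>\<psi>\<in>set (map (\<lambda>i. Equ (Var n) (Var i)) [Suc n..<Suc n + k]). sat M (e'(n := b)) \<psi>)
          \<longleftrightarrow> (\<exists>i\<in>?I. sat M (e'(n := b)) (Equ (Var n) (Var i)))" by (simp only: set_map set_upt bex_simps)
      also have "\<dots> \<longleftrightarrow> (\<exists>i\<in>?I. b = e' i)" by (rule bex_cong) auto
      finally show ?thesis by blast
    qed
    then show ?thesis unfolding at_most_fm_def sat_Exis by (simp only: sat_Forall sat_Imp sat_Disjs set_upt)
  qed
  have same: "sat M (e'(n := b)) \<phi> = sat M (e(n := b)) \<phi>" if "\<forall>y. y \<notin> ?I \<longrightarrow> e' y = e y" for e' b
  proof (rule sat_cong)
    fix x assume "x \<in> fv \<phi>"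
    then have "x \<le> n" using \<phi> by auto
    then show "(e'(n := b)) x = (e(n := b)) x" using that[rule_format, of x] by simp
  qed
  show ?thesis unfolding sat S_def[symmetric]
  proof
    assume "\<exists>e'. (\<forall>y. y \<notin> ?I \<longrightarrow> e' y = e y) \<and> (\<forall>x\<in>?I. e' x \<in> univ M) \<and> (\<forall>b\<in>univ M. sat M (e'(n := b)) \<phi> \<longrightarrow> b \<in> e' ` ?I)"
    then obtain e' where e': "\<forall>y. y \<notin> ?I \<longrightarrow> e' y = e y" "\<forall>b\<in>univ M. sat M (e'(n := b)) \<phi> \<longrightarrow> b \<in> e' ` ?I" by blast
    then have S: "S \<subseteq> e' ` ?I" using same[OF e'(1)] by (auto simp: S_def)
    then show "finite S \<and> card S \<le> k"
      using finite_subset card_mono[OF _ S] card_image_le[of ?I e'] by fastforce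
  next
    assume S: "finite S \<and> card S \<le> k"
    then obtain ws where ws: "set ws = S" "distinct ws" using finite_distinct_list by blast
    then have len: "length ws \<le> k" using S distinct_card by fastforce
    obtain u where u: "u \<in> univ M" using U by blast
    \<comment> \<open>An arbitrary element \<open>u\<close> fills the witnesses left over; here
      nonemptiness of the universe enters.\<close>
    define e' where "e' i = (if i \<in> ?I then if i - Suc n < length ws then ws ! (i - Suc n) else u else e i)" for i
    have 1: "\<forall>y. y \<notin> ?I \<longrightarrow> e' y = e y" by (simp add: e'_def)
    have 2: "\<forall>x\<in>?I. e' x \<in> univ M"
    proof
      fix x assume "x \<in> ?I"
      moreover have "ws ! (x - Suc n) \<in> univ M" if "x - Suc n < length ws"
        using nth_mem[OF that] ws(1) by (auto simp: S_def)
      ultimately show "e' x \<in> univ M" using u by (simp add: e'_def)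
    qed
    have 3: "b \<in> e' ` ?I" if b: "b \<in> S" for b
    proof -
      obtain j where j: "j < length ws" "ws ! j = b" using b ws(1) in_set_conv_nth[of b ws] by auto
      have "e' (Suc n + j) = b" "Suc n + j \<in> ?I" using j len by (auto simp: e'_def)
      then show ?thesis by blast
    qed
    show "\<exists>e'. (\<forall>y. y \<notin> ?I \<longrightarrow> e' y = e y) \<and> (\<forall>x\<in>?I. e' x \<in> univ M) \<and> (\<forall>b\<in>univ M. sat M (e'(n := b)) \<phi> \<longrightarrow> b \<in> e' ` ?I)"
      using 1 2 3 same[OF 1] by (intro exI[of _ e']) (auto simp: S_def)
  qed
qed

lemma sat_in_ball [simp]:
  "distinct [x, b, z, u] \<Longrightarrow> sat M e (in_ball_fm x b z u) \<longleftrightarrow> in_ball M (e x) (e b) (e z)"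
  by (auto simp: in_ball_fm_def in_ball_def)

lemma fv_in_ball [simp]: "distinct [x, b, z, u] \<Longrightarrow> fv (in_ball_fm x b z u) = {x, b, z}"
  by (auto simp: in_ball_fm_def)

lemma fm_in_in_ball: "fm_in L_beta (in_ball_fm x b z u)"
  by (simp add: in_ball_fm_def L_beta_def)

lemma fm_in_nonzero: "fm_in L_beta (nonzero_fm z)"
  by (simp add: L_beta_def)

text \<open>For \<open>v\<close> above \<open>i\<close> and all variables of \<open>\<phi>\<close>,
  the fresh variables \<open>v\<close>, \<open>Suc v\<close> and \<open>v + 2\<close> hold the
  centre, the radius and the bound variable of the ball formula.\<close>

definition interior_fm :: "nat \<Rightarrow> nat \<Rightarrow> (fname, 'r rname) fm \<Rightarrow> (fname, 'r rname) fm" where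
  "interior_fm i v \<phi> = Exi v (Exi (Suc v) (And (nonzero_fm (Suc v))
     (Forall i (Imp (in_ball_fm i v (Suc v) (v + 2)) \<phi>))))"

lemma fm_in_interior: "fm_in L_beta \<phi> \<Longrightarrow> fm_in L_beta (interior_fm i v \<phi>)"
  using fm_in_in_ball fm_in_nonzero by (auto simp: interior_fm_def)

lemma fv_interior: "i < v \<Longrightarrow> fv (interior_fm i v \<phi>) \<subseteq> fv \<phi> - {i}"
  by (auto simp: interior_fm_def)

lemma sat_interior:
  assumes "fv \<phi> \<subseteq> {..<v}" "i < v"
  shows "sat M e (interior_fm i v \<phi>) \<longleftrightarrow> has_interior M {b \<in> univ M. sat M (e(i := b)) \<phi>}"
proof -
  have "sat M (e(v := b0, Suc v := z, i := b)) \<phi> = sat M (e(i := b)) \<phi>" for b0 z b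
    using assms by (intro sat_cong) auto
  then show ?thesis using assms(2) by (simp add: interior_fm_def has_interior_def)
qed

subsection \<open>Parameters\<close>

lemma funs_lang_params [simp]:
  "(Inl f, n) \<in> funs (lang_params L X) \<longleftrightarrow> (f, n) \<in> funs L"
  "(Inr c, n) \<in> funs (lang_params L X) \<longleftrightarrow> c \<in> X \<and> n = 0"
  and rels_lang_params [simp]: "rels (lang_params L X) = rels L"
  by (auto simp: lang_params_def)

fun trm_consts :: "('f + 'u) trm \<Rightarrow> 'u set" where
  "trm_consts (Var x) = {}"
| "trm_consts (Fn f ts) = (case f of Inl _ \<Rightarrow> {} | Inr c \<Rightarrow> {c}) \<union> (\<Union>t\<in>set ts. trm_consts t)"

fun fm_consts :: "('f + 'u, 'r) fm \<Rightarrow> 'u set" where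
  "fm_consts Fls = {}"
| "fm_consts (Equ s t) = trm_consts s \<union> trm_consts t"
| "fm_consts (Rel R ts) = (\<Union>t\<in>set ts. trm_consts t)"
| "fm_consts (Neg \<phi>) = fm_consts \<phi>"
| "fm_consts (And \<phi> \<psi>) = fm_consts \<phi> \<union> fm_consts \<psi>"
| "fm_consts (Exi x \<phi>) = fm_consts \<phi>"

text \<open>Constants become the variables below \<open>m\<close>, the old variables are shifted by \<open>m\<close>.\<close>

fun trm_abs :: "('u \<Rightarrow> nat) \<Rightarrow> nat \<Rightarrow> ('f + 'u) trm \<Rightarrow> 'f trm" where
  "trm_abs ix m (Var x) = Var (x + m)"
| "trm_abs ix m (Fn f ts) = (case f of Inl g \<Rightarrow> Fn g (map (trm_abs ix m) ts) | Inr c \<Rightarrow> Var (ix c))"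

fun fm_abs :: "('u \<Rightarrow> nat) \<Rightarrow> nat \<Rightarrow> ('f + 'u, 'r) fm \<Rightarrow> ('f, 'r) fm" where
  "fm_abs ix m Fls = Fls"
| "fm_abs ix m (Equ s t) = Equ (trm_abs ix m s) (trm_abs ix m t)"
| "fm_abs ix m (Rel R ts) = Rel R (map (trm_abs ix m) ts)"
| "fm_abs ix m (Neg \<phi>) = Neg (fm_abs ix m \<phi>)"
| "fm_abs ix m (And \<phi> \<psi>) = And (fm_abs ix m \<phi>) (fm_abs ix m \<psi>)"
| "fm_abs ix m (Exi x \<phi>) = Exi (x + m) (fm_abs ix m \<phi>)"

lemma univ_name_all [simp]: "univ (name_all M) = univ M"
  and fint_name_all [simp]: "fint (name_all M) (Inl f) = fint M f" "fint (name_all M) (Inr c) = (\<lambda>_. c)"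
  and rint_name_all [simp]: "rint (name_all M) = rint M"
  by (simp_all add: name_all_def)

lemma eval_abs:
  "(\<And>c. c \<in> trm_consts t \<Longrightarrow> e' (ix c) = c) \<Longrightarrow> (\<And>x. e' (x + m) = e x) \<Longrightarrow>
    eval (name_all M) e t = eval M e' (trm_abs ix m t)"
proof (induction t)
  case (Fn f ts)
  then have *: "map (eval (name_all M) e) ts = map (eval M e') (map (trm_abs ix m) ts)" by auto
  show ?case
  proof (cases f)
    case (Inl g)
    then show ?thesis by (simp only: eval.simps trm_abs.simps sum.case fint_name_all *)
  next
    case (Inr c)
    then show ?thesis using Fn.prems by simp
  qed
qed auto

lemma sat_abs:
  "(\<And>c. c \<in> fm_consts \<phi> \<Longrightarrow> ix c < m \<and> e' (ix c) = c) \<Longrightarrow> (\<And>x. e' (x + m) = e x) \<Longrightarrow>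
    sat (name_all M) e \<phi> = sat M e' (fm_abs ix m \<phi>)"
proof (induction \<phi> arbitrary: e e')
  case (Equ s t)
  then have "eval (name_all M) e s = eval M e' (trm_abs ix m s)" "eval (name_all M) e t = eval M e' (trm_abs ix m t)"
    by (auto intro!: eval_abs)
  then show ?case by simp
next
  case (Rel R ts)
  have "map (eval (name_all M) e) ts = map (eval M e') (map (trm_abs ix m) ts)"
    using Rel by (auto intro!: eval_abs)
  then show ?case by (metis sat.simps(3) fm_abs.simps(3) rint_name_all)
next
  case (Exi x \<phi>)
  have "sat (name_all M) (e(x := a)) \<phi> = sat M (e'(x + m := a)) (fm_abs ix m \<phi>)" for a
    using Exi.prems by (intro Exi.IH) force+
  then show ?case by simp
next
  case (And \<phi> \<psi>)
  then show ?case by (metis UnCI fm_abs.simps(5) fm_consts.simps(5) sat.simps(5))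
next
  case (Neg \<phi>) then show ?case by (metis fm_abs.simps(4) fm_consts.simps(4) sat.simps(4))
qed auto

lemma finite_trm_consts: "finite (trm_consts t)"
  by (induction t) (auto split: sum.split)

lemma finite_fm_consts: "finite (fm_consts \<phi>)"
  by (induction \<phi>) (auto simp: finite_trm_consts)

lemma trm_in_abs: "trm_in (lang_params L X) t \<Longrightarrow> trm_in L (trm_abs ix m t) \<and> trm_consts t \<subseteq> X"
proof (induction t)
  case (Fn f ts) then show ?case by (cases f) auto
qed simp

lemma fm_in_abs: "fm_in (lang_params L X) \<phi> \<Longrightarrow> fm_in L (fm_abs ix m \<phi>) \<and> fm_consts \<phi> \<subseteq> X"
proof (induction \<phi>)
  case (Rel R ts)
  then have "\<forall>t\<in>set ts. trm_in L (trm_abs ix m t) \<and> trm_consts t \<subseteq> X" using trm_in_abs[of L X _ ix m] by auto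
  then show ?case using Rel by auto
next
  case (Equ s t)
  then show ?case using trm_in_abs[of L X s ix m] trm_in_abs[of L X t ix m] by auto
qed auto

lemma trm_vars_abs: "y \<in> trm_vars (trm_abs ix m t) \<Longrightarrow> y \<in> ix ` trm_consts t \<or> (\<exists>x\<in>trm_vars t. y = x + m)"
proof (induction t)
  case (Fn f ts)
  show ?case
  proof (cases f)
    case (Inl g)
    then obtain t where "t \<in> set ts" "y \<in> trm_vars (trm_abs ix m t)" using Fn.prems by auto
    then show ?thesis using Fn.IH[of t] Inl by auto
  next
    case (Inr c) then show ?thesis using Fn.prems by auto
  qed
qed simp

lemma fv_abs: "y \<in> fv (fm_abs ix m \<phi>) \<Longrightarrow> y \<in> ix ` fm_consts \<phi> \<or> (\<exists>x\<in>fv \<phi>. y = x + m)"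
proof (induction \<phi>)
  case (Equ s t)
  then show ?case using trm_vars_abs[of y ix m s] trm_vars_abs[of y ix m t] by auto
next
  case (Rel R ts)
  then obtain t where "t \<in> set ts" "y \<in> trm_vars (trm_abs ix m t)" by auto
  then show ?case using trm_vars_abs[of y ix m t] by auto
qed auto

text \<open>Constants are traded for variables that take their values from \<open>ds\<close>. The
  list only has to contain the constants, so several formulas can be put over one common
  list.\<close>

lemma unary_abstract:
  assumes "\<phi> \<in> unary_fms L X"
  shows "finite (fm_consts \<phi>)" "fm_consts \<phi> \<subseteq> X"
    "fm_consts \<phi> \<subseteq> set ds \<Longrightarrow> \<exists>\<phi>'\<in>fms L {..length ds}. \<forall>M e b. (\<forall>i<length ds. e i = ds ! i) \<longrightarrow>
      holds_at M \<phi> b = sat M (e(length ds := b)) \<phi>'"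
proof -
  have \<phi>: "fm_in (lang_params L X) \<phi>" "fv \<phi> \<subseteq> {0}" using assms by (auto simp: unary_fms_def fms_def)
  show "finite (fm_consts \<phi>)" "fm_consts \<phi> \<subseteq> X" using finite_fm_consts fm_in_abs[OF \<phi>(1)] by auto
  assume ds: "fm_consts \<phi> \<subseteq> set ds"
  define m where "m = length ds"
  define ix where "ix c = (SOME i. i < m \<and> ds ! i = c)" for c
  have ix: "ix c < m \<and> ds ! (ix c) = c" if "c \<in> set ds" for c
    unfolding ix_def using that by (intro someI_ex[of "\<lambda>i. i < m \<and> ds ! i = c"]) (auto simp: in_set_conv_nth m_def)
  define \<phi>' where "\<phi>' = fm_abs ix m \<phi>"
  have fv: "fv \<phi>' \<subseteq> {..m}"
  proof
    fix y assume "y \<in> fv \<phi>'"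
    then have "y \<in> ix ` fm_consts \<phi> \<or> (\<exists>x\<in>fv \<phi>. y = x + m)" unfolding \<phi>'_def by (rule fv_abs)
    then show "y \<in> {..m}"
    proof
      assume "y \<in> ix ` fm_consts \<phi>"
      then obtain c where "c \<in> set ds" "y = ix c" using ds by blast
      then show ?thesis using ix[of c] by simp
    qed (use \<phi>(2) in auto)
  qed
  have "holds_at M \<phi> b = sat M (e(m := b)) \<phi>'" if e: "\<forall>i<m. e i = ds ! i" for M e b
  proof -
    define e' where "e' i = (if i < m then ds ! i else b)" for i
    have "holds_at M \<phi> b = sat M e' \<phi>'"
      unfolding holds_at_def \<phi>'_def using ix ds by (intro sat_abs) (auto simp: e'_def)
    also have "\<dots> = sat M (e(m := b)) \<phi>'"
      using fv e by (intro sat_cong) (auto simp: e'_def)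
    finally show ?thesis .
  qed
  moreover have "\<phi>' \<in> fms L {..m}" using fv fm_in_abs[OF \<phi>(1)] by (simp add: fms_def \<phi>'_def)
  ultimately show "\<exists>\<phi>'\<in>fms L {..length ds}. \<forall>M e b. (\<forall>i<length ds. e i = ds ! i) \<longrightarrow>
      holds_at M \<phi> b = sat M (e(length ds := b)) \<phi>'" unfolding m_def by blast
qed

text \<open>Bound variables are shifted by one, so that \<open>x\<^sub>0\<close> is free for the distinguished variable.\<close>

fun trm_sub :: "(nat \<Rightarrow> ('f + 'u) trm) \<Rightarrow> 'f trm \<Rightarrow> ('f + 'u) trm" where
  "trm_sub \<sigma> (Var x) = \<sigma> x"
| "trm_sub \<sigma> (Fn f ts) = Fn (Inl f) (map (trm_sub \<sigma>) ts)"

fun fm_sub :: "(nat \<Rightarrow> ('f + 'u) trm) \<Rightarrow> ('f, 'r) fm \<Rightarrow> ('f + 'u, 'r) fm" where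
  "fm_sub \<sigma> Fls = Fls"
| "fm_sub \<sigma> (Equ s t) = Equ (trm_sub \<sigma> s) (trm_sub \<sigma> t)"
| "fm_sub \<sigma> (Rel R ts) = Rel R (map (trm_sub \<sigma>) ts)"
| "fm_sub \<sigma> (Neg \<phi>) = Neg (fm_sub \<sigma> \<phi>)"
| "fm_sub \<sigma> (And \<phi> \<psi>) = And (fm_sub \<sigma> \<phi>) (fm_sub \<sigma> \<psi>)"
| "fm_sub \<sigma> (Exi x \<phi>) = Exi (Suc x) (fm_sub (\<sigma>(x := Var (Suc x))) \<phi>)"

lemma eval_sub: "eval (name_all M) e (trm_sub \<sigma> t) = eval M (\<lambda>x. eval (name_all M) e (\<sigma> x)) t"
proof (induction t)
  case (Fn f ts)
  then have "map (eval (name_all M) e) (map (trm_sub \<sigma>) ts) = map (eval M (\<lambda>x. eval (name_all M) e (\<sigma> x))) ts" by auto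
  then show ?case by (simp only: trm_sub.simps eval.simps fint_name_all)
qed simp

lemma sat_sub:
  "(\<And>y. trm_vars (\<sigma> y) \<subseteq> {0, Suc y}) \<Longrightarrow>
    sat (name_all M) e (fm_sub \<sigma> \<phi>) = sat M (\<lambda>x. eval (name_all M) e (\<sigma> x)) \<phi>"
proof (induction \<phi> arbitrary: e \<sigma>)
  case (Rel R ts)
  have "map (eval (name_all M) e) (map (trm_sub \<sigma>) ts) = map (eval M (\<lambda>x. eval (name_all M) e (\<sigma> x))) ts"
    by (simp add: eval_sub)
  then show ?case by (metis sat.simps(3) fm_sub.simps(3) rint_name_all)
next
  case (Exi x \<phi>)
  have "sat (name_all M) (e(Suc x := a)) (fm_sub (\<sigma>(x := Var (Suc x))) \<phi>)
      = sat M ((\<lambda>x. eval (name_all M) e (\<sigma> x))(x := a)) \<phi>" for a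
  proof -
    have "eval (name_all M) (e(Suc x := a)) (\<sigma> y) = eval (name_all M) e (\<sigma> y)" if "y \<noteq> x" for y
      using Exi.prems[of y] that by (intro eval_cong) auto
    then have eq: "(\<lambda>y. eval (name_all M) (e(Suc x := a)) ((\<sigma>(x := Var (Suc x))) y))
        = (\<lambda>x. eval (name_all M) e (\<sigma> x))(x := a)" by (auto simp: fun_eq_iff)
    show ?thesis unfolding eq[symmetric] using Exi.prems by (intro Exi.IH) auto
  qed
  then show ?case by simp
qed (simp_all add: eval_sub)

lemma trm_in_sub:
  "trm_in L t \<Longrightarrow> (\<And>x. x \<in> trm_vars t \<Longrightarrow> trm_in (lang_params L C) (\<sigma> x)) \<Longrightarrow> trm_in (lang_params L C) (trm_sub \<sigma> t)"
  by (induction t) auto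

lemma fm_in_sub:
  "fm_in L \<phi> \<Longrightarrow> (\<And>x. x \<in> fv \<phi> \<Longrightarrow> trm_in (lang_params L C) (\<sigma> x)) \<Longrightarrow> fm_in (lang_params L C) (fm_sub \<sigma> \<phi>)"
proof (induction \<phi> arbitrary: \<sigma>)
  case (Rel R ts)
  then show ?case using Rel by (auto intro!: trm_in_sub)
qed (auto intro!: trm_in_sub)

lemma trm_vars_sub: "trm_vars (trm_sub \<sigma> t) = (\<Union>x\<in>trm_vars t. trm_vars (\<sigma> x))"
  by (induction t) auto

lemma fv_sub: "y \<in> fv (fm_sub \<sigma> \<phi>) \<Longrightarrow> \<exists>x\<in>fv \<phi>. y \<in> trm_vars (\<sigma> x)"
proof (induction \<phi> arbitrary: \<sigma>)
  case (Exi x \<phi>)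
  then obtain x' where x': "x' \<in> fv \<phi>" "y \<in> trm_vars ((\<sigma>(x := Var (Suc x))) x')" "y \<noteq> Suc x" by fastforce
  then have "x' \<noteq> x" by auto
  then show ?case using x' by auto
qed (auto simp: trm_vars_sub)

text \<open>The converse of abstraction: values of an assignment become constants and the variable
  \<open>y\<close> becomes the distinguished one.\<close>

lemma unary_instantiate:
  fixes \<phi> :: "('f, 'r) fm" and e :: "nat \<Rightarrow> 'u"
  assumes \<phi>: "fm_in L \<phi>" and e: "e ` (fv \<phi> - {y}) \<subseteq> C"
  shows "\<exists>\<chi>\<in>unary_fms L C. \<forall>M b. holds_at M \<chi> b = sat M (e(y := b)) \<phi>"
proof -
  \<comment> \<open>Variables that do not occur freely are sent to \<open>Var 0\<close> as well, so
    that no constant outside \<open>C\<close> appears.\<close>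
  define \<sigma> :: "nat \<Rightarrow> ('f + 'u) trm" where "\<sigma> x = (if x \<in> fv \<phi> - {y} then Fn (Inr (e x)) [] else Var 0)" for x
  have "fm_sub \<sigma> \<phi> \<in> unary_fms L C"
  proof -
    have "fm_in (lang_params L C) (fm_sub \<sigma> \<phi>)" using \<phi> e by (intro fm_in_sub) (auto simp: \<sigma>_def)
    moreover have "fv (fm_sub \<sigma> \<phi>) \<subseteq> {0}"
    proof
      fix v assume "v \<in> fv (fm_sub \<sigma> \<phi>)"
      from fv_sub[OF this] show "v \<in> {0}" by (auto simp: \<sigma>_def split: if_splits)
    qed
    ultimately show ?thesis by (simp add: unary_fms_def fms_def)
  qed
  moreover have "holds_at M (fm_sub \<sigma> \<phi>) b = sat M (e(y := b)) \<phi>" for M b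
    unfolding holds_at_def by (subst sat_sub) (auto simp: \<sigma>_def intro!: sat_cong)
  ultimately show ?thesis by blast
qed

section \<open>Algebraic closure in terms of formulas and assignments\<close>

lemma acl_I:
  assumes "fm_in L \<phi>" "e ` (fv \<phi> - {y}) \<subseteq> X" "b \<in> univ M" "sat M (e(y := b)) \<phi>"
    "finite {b' \<in> univ M. sat M (e(y := b')) \<phi>}"
  shows "b \<in> acl L M X"
  using unary_instantiate[OF assms(1,2)] assms(3-) unfolding acl_def by fastforce

text \<open>\<open>F\<close> collects the constants of one algebraic formula. Admitting every list
  that contains \<open>F\<close> leaves the order of the parameters, and further parameters, to the
  application.\<close>

lemma acl_E:
  assumes "b \<in> acl L M X"
  obtains F where "finite F" "F \<subseteq> X"
    "\<And>ds. F \<subseteq> set ds \<Longrightarrow> \<exists>\<phi>\<in>fms L {..length ds}. \<forall>e. (\<forall>i<length ds. e i = ds ! i) \<longrightarrow>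
      sat M (e(length ds := b)) \<phi> \<and> finite {b' \<in> univ M. sat M (e(length ds := b')) \<phi>}"
proof -
  obtain \<phi> where \<phi>: "\<phi> \<in> unary_fms L X" "holds_at M \<phi> b" "finite {b' \<in> univ M. holds_at M \<phi> b'}"
    using assms by (auto simp: acl_def)
  show thesis
  proof (rule that[OF unary_abstract(1,2)[OF \<phi>(1)]])
    fix ds assume "fm_consts \<phi> \<subseteq> set ds"
    then obtain \<phi>' where \<phi>': "\<phi>' \<in> fms L {..length ds}"
      "\<And>M :: (_, _, _) struc. \<And>e b. (\<forall>i<length ds. e i = ds ! i) \<Longrightarrow> holds_at M \<phi> b = sat M (e(length ds := b)) \<phi>'"
      using unary_abstract(3)[OF \<phi>(1), of ds] by blast
    show "\<exists>\<phi>\<in>fms L {..length ds}. \<forall>e. (\<forall>i<length ds. e i = ds ! i) \<longrightarrow>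
      sat M (e(length ds := b)) \<phi> \<and> finite {b' \<in> univ M. sat M (e(length ds := b')) \<phi>}"
    proof (intro bexI[OF _ \<phi>'(1)] allI impI)
      fix e assume e: "\<forall>i<length ds. e i = ds ! i"
      then show "sat M (e(length ds := b)) \<phi>' \<and> finite {b' \<in> univ M. sat M (e(length ds := b')) \<phi>'}"
        using \<phi>(2,3) \<phi>'(2)[OF e] by simp
    qed
  qed
qed

lemma acl_univ: "acl L M X \<subseteq> univ M"
  by (auto simp: acl_def)

lemma unary_fms_mono: "X \<subseteq> Y \<Longrightarrow> unary_fms L X \<subseteq> unary_fms L Y"
proof -
  assume XY: "X \<subseteq> Y"
  have t: "trm_in (lang_params L X) t \<Longrightarrow> trm_in (lang_params L Y) t" for t
  proof (induction t)
    case (Fn f ts) then show ?case using XY by (cases f) auto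
  qed simp
  have "fm_in (lang_params L X) \<phi> \<Longrightarrow> fm_in (lang_params L Y) \<phi>" for \<phi>
    by (induction \<phi>) (auto simp: t)
  then show ?thesis by (auto simp: unary_fms_def fms_def)
qed

lemma acl_mono: "X \<subseteq> Y \<Longrightarrow> acl L M X \<subseteq> acl L M Y"
  using unary_fms_mono[of X Y L] by (auto simp: acl_def)

lemma acl_finite: assumes "b \<in> acl L M X" obtains F where "F \<subseteq> X" "finite F" "b \<in> acl L M F"
proof -
  obtain \<phi> where \<phi>: "\<phi> \<in> unary_fms L X" "holds_at M \<phi> b" "finite {b' \<in> univ M. holds_at M \<phi> b'}" "b \<in> univ M"
    using assms by (auto simp: acl_def)
  have t: "trm_in (lang_params L X) t \<Longrightarrow> trm_consts t \<subseteq> Y \<Longrightarrow> trm_in (lang_params L Y) t" for t Y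
  proof (induction t)
    case (Fn f ts) then show ?case by (cases f) auto
  qed simp
  have "fm_in (lang_params L X) \<psi> \<Longrightarrow> fm_consts \<psi> \<subseteq> Y \<Longrightarrow> fm_in (lang_params L Y) \<psi>" for \<psi> Y
  proof (induction \<psi>)
    case (Rel R ts)
    have "trm_in (lang_params L Y) x" if "x \<in> set ts" for x using t[of x Y] Rel that by auto
    then show ?case using Rel by simp
  qed (auto simp: t)
  then have "\<phi> \<in> unary_fms L (fm_consts \<phi>)" using \<phi>(1) by (auto simp: unary_fms_def fms_def)
  then have "b \<in> acl L M (fm_consts \<phi>)" using \<phi> by (auto simp: acl_def)
  then show thesis using that unary_abstract(1,2)[OF \<phi>(1)] by blast
qed

lemma acl_extensive: assumes "X \<subseteq> univ M" shows "X \<subseteq> acl L M X"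
proof
  fix x assume x: "x \<in> X"
  have "finite {b' \<in> univ M. b' = x}" by (rule finite_subset[of _ "{x}"]) auto
  then show "x \<in> acl L M X"
    using x assms acl_I[of L "Equ (Var 0) (Var 1)" "\<lambda>_. x" 0 X x M] by auto
qed

subsection \<open>Models of the theory of the p-adic field\<close>

text \<open>\<open>at_most_fm\<close> counts values of the last variable only; \<open>x\<^sub>i\<close> is copied to a fresh \<open>x\<^sub>n\<close>.\<close>

definition few_fm :: "nat \<Rightarrow> nat \<Rightarrow> nat \<Rightarrow> ('f, 'r) fm \<Rightarrow> ('f, 'r) fm" where
  "few_fm i n k \<phi> = at_most_fm n k (Exi i (And (Equ (Var i) (Var n)) \<phi>))"

lemma fm_in_few [simp]: "fm_in L (few_fm i n k \<phi>) \<longleftrightarrow> fm_in L \<phi>"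
  by (simp add: few_fm_def)

lemma sat_few:
  assumes n: "fv \<phi> \<subseteq> {..<n}" "i < n" and U: "univ M \<noteq> {}"
  shows "sat M e (few_fm i n k \<phi>) \<longleftrightarrow>
    finite {b \<in> univ M. sat M (e(i := b)) \<phi>} \<and> card {b \<in> univ M. sat M (e(i := b)) \<phi>} \<le> k"
proof -
  define \<psi> where "\<psi> = Exi i (And (Equ (Var i) (Var n)) \<phi>)"
  have \<psi>: "fv \<psi> \<subseteq> {..n}" using n by (auto simp: \<psi>_def)
  have "sat M (e(n := b)) \<psi> = sat M (e(i := b)) \<phi>" if "b \<in> univ M" for b
  proof -
    have "sat M (e(n := b, i := b)) \<phi> = sat M (e(i := b)) \<phi>" using n by (intro sat_cong) auto
    then show ?thesis using that n(2) by (auto simp: \<psi>_def)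
  qed
  then have "{b \<in> univ M. sat M (e(n := b)) \<psi>} = {b \<in> univ M. sat M (e(i := b)) \<phi>}" by auto
  then show ?thesis using sat_at_most[OF \<psi> U, of e k] by (simp add: few_fm_def \<psi>_def)
qed

context padic_prime
begin

text \<open>A formula valid at all tuples of the p-adic field has its universal closure in
  \<open>T_beta\<close>, so it is valid at all tuples of every model. Analytic facts reach models
  only in this way, which is why they are packaged as single formulas.\<close>

lemma transfer:
  fixes M :: "(fname, 'r rname, 'u) struc" and \<chi> :: "(fname, 'r rname) fm"
  assumes M: "model L_beta M (T_beta p)" and \<chi>: "fm_in L_beta \<chi>"
    and Q: "\<And>f. sat (Qp_struc p) (\<lambda>j. pr (f j)) \<chi>" and e: "assignment M e"
  shows "sat M e \<chi>"
proof -
  obtain n where n: "fv \<chi> \<subseteq> {..<n}" by (rule fv_bounded)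
  have Q': "sat (Qp_struc p) e \<chi>" if "assignment (Qp_struc p :: (fname, 'r rname, padic) struc) e" for e
  proof -
    have "\<forall>j. \<exists>x. e j = pr x" using that by (auto simp: assignment_def image_iff)
    then obtain f where "e = (\<lambda>j. pr (f j))" by metis
    then show ?thesis using Q by simp
  qed
  have "Foralls [0..<n] \<chi> \<in> T_beta p"
    unfolding T_beta_def theory_of_def fms_def
  proof (intro CollectI conjI allI impI)
    fix e assume e: "assignment (Qp_struc p :: (fname, 'r rname, padic) struc) e"
    show "sat (Qp_struc p) e (Foralls [0..<n] \<chi>)"
      unfolding sat_Foralls
    proof (intro allI impI)
      fix e' assume e': "(\<forall>y. y \<notin> set [0..<n] \<longrightarrow> e' y = e y) \<and> (\<forall>x\<in>set [0..<n]. e' x \<in> univ (Qp_struc p :: (fname, 'r rname, padic) struc))"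
      have "assignment (Qp_struc p :: (fname, 'r rname, padic) struc) e'"
        unfolding assignment_def
      proof
        fix i show "e' i \<in> univ (Qp_struc p :: (fname, 'r rname, padic) struc)"
          using e e' unfolding assignment_def by (cases "i \<in> set [0..<n]") metis+
      qed
      then show "sat (Qp_struc p) e' \<chi>" by (rule Q')
    qed
  qed (use \<chi> n in auto)
  then have "sat M e (Foralls [0..<n] \<chi>)" using M e by (auto simp: model_def)
  then show ?thesis using e unfolding sat_Foralls assignment_def by blast
qed

text \<open>Because \<open>N\<close> does not depend on the parameters, "at most \<open>N\<close>
  solutions or interior" is one formula, valid in the p-adic field and hence in every model.\<close>

lemma dichotomy:
  fixes \<phi> :: "(fname, 'r rname) fm"
  assumes \<phi>: "fm_in L_beta \<phi>"
  shows "\<exists>N. \<forall>(M :: (fname, 'r rname, 'u) struc) e. model L_beta M (T_beta p) \<and> assignment M e \<longrightarrow>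
    finite {b \<in> univ M. sat M (e(i := b)) \<phi>} \<and> card {b \<in> univ M. sat M (e(i := b)) \<phi>} \<le> N \<or>
    has_interior M {b \<in> univ M. sat M (e(i := b)) \<phi>}"
proof -
  obtain n0 where n0: "fv \<phi> \<subseteq> {..<n0}" by (rule fv_bounded)
  define n where "n = max n0 (Suc i)"
  have n: "fv \<phi> \<subseteq> {..<n}" "i < n" using n0 by (auto simp: n_def)
  obtain N where N: "\<And>e. assignment (Qp_struc p :: (fname, 'r rname, padic) struc) e \<Longrightarrow>
    (let S = {b \<in> univ (Qp_struc p :: (fname, 'r rname, padic) struc). sat (Qp_struc p) (e(i := b)) \<phi>}
     in finite S \<and> card S \<le> N \<or> has_interior (Qp_struc p :: (fname, 'r rname, padic) struc) S)"
    using dichotomy_Qp[OF \<phi> refl, of i] by blast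
  define \<chi> where "\<chi> = Imp (Neg (few_fm i n N \<phi>)) (interior_fm i n \<phi>)"
  have "sat (Qp_struc p) (\<lambda>j. pr (f j)) \<chi>" for f
    using N[of "\<lambda>j. pr (f j)"] by (auto simp: \<chi>_def sat_few[OF n] sat_interior[OF n] assignment_def Let_def)
  moreover have "fm_in L_beta \<chi>" using \<phi> fm_in_interior[OF \<phi>] by (simp add: \<chi>_def)
  ultimately have \<chi>: "sat M e \<chi>" if "model L_beta M (T_beta p)" "assignment M e" for M :: "(fname, 'r rname, 'u) struc" and e
    using transfer that by blast
  show ?thesis
  proof (intro exI[of _ N] allI impI)
    fix M :: "(fname, 'r rname, 'u) struc" and e assume M: "model L_beta M (T_beta p) \<and> assignment M e"
    then have "univ M \<noteq> {}" by (simp add: model_def is_struc_def)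
    then show "finite {b \<in> univ M. sat M (e(i := b)) \<phi>} \<and> card {b \<in> univ M. sat M (e(i := b)) \<phi>} \<le> N \<or>
      has_interior M {b \<in> univ M. sat M (e(i := b)) \<phi>}"
      using \<chi>[of M e] M sat_few[OF n, of M e N] sat_interior[OF n, of M e] unfolding \<chi>_def by auto
  qed
qed

lemma interior_infinite_Qp:
  fixes Q :: "(fname, 'r rname, padic) struc"
  assumes Q: "Q = Qp_struc p" and "has_interior Q S"
  shows "infinite S"
proof
  assume fin: "finite S"
  obtain s z where z: "nm p z \<noteq> 0" "\<And>b. b \<in> range pr \<Longrightarrow> in_ball Q b (pr s) (pr z) \<Longrightarrow> b \<in> S"
    using assms(2) unfolding has_interior_def by (auto simp: Q pr_eq_iff)
  have S: "pr t \<in> S" if "nm p (t - s) \<le> nm p z" for t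
    using z(2)[of "pr t"] that iffD2[OF in_ball_Qp[OF z(1)]] Q by blast
  have "S \<noteq> {}" using S[of s] by auto
  define y where "y n = inv pr (from_nat_into S n)" for n
  have "0 < nm p z" using z(1) N_nonneg[of z] by linarith
  then obtain t where t: "nm p (t - s) \<le> nm p z" "\<And>n::nat. nm p (t - y n) \<noteq> 0"
    using ball_uncountable[of "nm p z" s y] by blast
  have "pr t \<in> range (from_nat_into S)"
    using S[OF t(1)] fin \<open>S \<noteq> {}\<close> by (simp add: range_from_nat_into countable_finite)
  then obtain n where n: "pr t = from_nat_into S n" by auto
  then have "pr (y n) = pr t" unfolding y_def by (metis f_inv_into_f rangeI)
  then show False using t(2)[of n] by (metis pr_eq_iff)
qed

end

locale padic_model = padic_prime p for p +
  fixes M :: "(fname, 'r rname, 'u) struc"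
  assumes M: "model L_beta M (T_beta p)"
begin

abbreviation "cl \<equiv> acl L_beta M"

lemma univ_nonempty: "univ M \<noteq> {}"
  using M by (simp add: model_def is_struc_def)

lemma Plus_closed: "x \<in> univ M \<Longrightarrow> y \<in> univ M \<Longrightarrow> fint M Plus [x, y] \<in> univ M"
  using M by (simp add: model_def is_struc_def L_beta_def)

lemma infinite_interior:
  assumes "fm_in L_beta \<phi>" "assignment M e" "infinite {b \<in> univ M. sat M (e(i := b)) \<phi>}"
  shows "has_interior M {b \<in> univ M. sat M (e(i := b)) \<phi>}"
  using dichotomy[OF assms(1), of i] M assms(2,3) by blast

text \<open>Finiteness is not first order, but for the actual number \<open>k\<close> of solutions
  the implication from "at most \<open>k\<close> solutions" to "no interior" is, and it holds in the
  p-adic field since balls there are infinite.\<close>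

lemma interior_infinite:
  assumes \<phi>: "fm_in L_beta \<phi>" "assignment M e" "has_interior M {b \<in> univ M. sat M (e(i := b)) \<phi>}"
  shows "infinite {b \<in> univ M. sat M (e(i := b)) \<phi>}"
proof
  assume fin: "finite {b \<in> univ M. sat M (e(i := b)) \<phi>}"
  define k where "k = card {b \<in> univ M. sat M (e(i := b)) \<phi>}"
  obtain n0 where n0: "fv \<phi> \<subseteq> {..<n0}" by (rule fv_bounded)
  define n where "n = max n0 (Suc i)"
  have n: "fv \<phi> \<subseteq> {..<n}" "i < n" using n0 by (auto simp: n_def)
  define \<chi> where "\<chi> = Imp (few_fm i n k \<phi>) (Neg (interior_fm i n \<phi>))"
  have "sat (Qp_struc p) (\<lambda>j. pr (f j)) \<chi>" for f
    using interior_infinite_Qp[OF refl] by (auto simp: \<chi>_def sat_few[OF n] sat_interior[OF n])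
  moreover have "fm_in L_beta \<chi>" using \<phi>(1) fm_in_interior[OF \<phi>(1)] by (simp add: \<chi>_def)
  ultimately have "sat M e \<chi>" using transfer[OF M] \<phi>(2) by blast
  then show False using sat_few[OF n univ_nonempty, of e k] sat_interior[OF n, of M e] fin assms(3) by (simp add: \<chi>_def k_def)
qed

section \<open>The laws of a pregeometry for algebraic closure\<close>

text \<open>The first-order form of \<open>interior_fibres_Qp\<close>, with \<open>n\<close> as the
  variable of the fibres and \<open>Suc n\<close> as that of the base. The bound \<open>k\<close> on
  the fibres in the other direction makes their finiteness expressible.\<close>

lemma no_fibred_interior:
  assumes \<theta>: "\<theta> \<in> fms L_beta {..Suc n}" and e: "assignment M e"
  shows "\<not> sat M e (interior_fm (Suc n) (n + 2) (interior_fm n (n + 2) (And \<theta> (at_most_fm (Suc n) k \<theta>))))"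
proof -
  define \<theta>1 where "\<theta>1 = And \<theta> (at_most_fm (Suc n) k \<theta>)"
  have fv\<theta>: "fv \<theta> \<subseteq> {..Suc n}" "fm_in L_beta \<theta>" using \<theta> by (auto simp: fms_def)
  have fv1: "fv \<theta>1 \<subseteq> {..<n + 2}" using fv\<theta> fv_at_most[OF fv\<theta>(1)] by (force simp: \<theta>1_def)
  define \<theta>2 where "\<theta>2 = interior_fm n (n + 2) \<theta>1"
  have fv2: "fv \<theta>2 \<subseteq> {..<n + 2}" using fv_interior[of n "n + 2" \<theta>1] fv1 by (auto simp: \<theta>2_def)
  define \<chi> where "\<chi> = Neg (interior_fm (Suc n) (n + 2) \<theta>2)"
  have "sat (Qp_struc p) (\<lambda>j. pr (f j)) \<chi>" for f
  proof (rule ccontr)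
    define Q :: "(fname, 'r rname, padic) struc" where "Q = Qp_struc p"
    define e where "e = (\<lambda>j. pr (f j))"
    have U: "univ Q \<noteq> {}" by (simp add: Q_def)
    assume "\<not> sat (Qp_struc p) (\<lambda>j. pr (f j)) \<chi>"
    then have "sat Q e (interior_fm (Suc n) (n + 2) \<theta>2)" by (simp add: \<chi>_def Q_def e_def)
    then have "has_interior Q {y \<in> univ Q. sat Q (e(Suc n := y)) \<theta>2}" using fv2 by (subst (asm) sat_interior) auto
    then have "has_interior Q {y \<in> univ Q. has_interior Q {z. z \<in> univ Q \<and> sat Q (e(Suc n := y, n := z)) \<theta>1}}"
    proof -
      have "sat Q (e(Suc n := y)) \<theta>2 \<longleftrightarrow> has_interior Q {z. z \<in> univ Q \<and> sat Q (e(Suc n := y, n := z)) \<theta>1}" for y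
        unfolding \<theta>2_def using sat_interior[OF fv1, of n Q "e(Suc n := y)"] by simp
      with \<open>has_interior Q _\<close> show ?thesis by simp
    qed
    from interior_fibres_Qp[OF Q_def this] obtain z where z: "z \<in> univ Q"
      "infinite {y \<in> univ Q. z \<in> univ Q \<and> sat Q (e(Suc n := y, n := z)) \<theta>1}" by blast
    then obtain y where "sat Q (e(Suc n := y, n := z)) \<theta>1" using not_finite_existsD by fastforce
    then have fin: "finite {b \<in> univ Q. sat Q (e(Suc n := y, n := z, Suc n := b)) \<theta>}"
      using sat_at_most[OF fv\<theta>(1) U, of "e(Suc n := y, n := z)" k] by (simp add: \<theta>1_def)
    have "{y \<in> univ Q. z \<in> univ Q \<and> sat Q (e(Suc n := y, n := z)) \<theta>1} \<subseteq> {b \<in> univ Q. sat Q (e(Suc n := y, n := z, Suc n := b)) \<theta>}"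
    proof
      fix y' assume "y' \<in> {y \<in> univ Q. z \<in> univ Q \<and> sat Q (e(Suc n := y, n := z)) \<theta>1}"
      moreover have "e(Suc n := y, n := z, Suc n := y') = e(Suc n := y', n := z)" by (auto simp: fun_eq_iff)
      ultimately show "y' \<in> {b \<in> univ Q. sat Q (e(Suc n := y, n := z, Suc n := b)) \<theta>}" by (simp add: \<theta>1_def)
    qed
    then show False using z(2) fin finite_subset by blast
  qed
  moreover have "fm_in L_beta \<chi>" using fv\<theta>(2) by (auto simp: \<chi>_def \<theta>2_def \<theta>1_def intro!: fm_in_interior)
  ultimately have "sat M e \<chi>" using transfer[OF M] e by blast
  then show ?thesis by (simp add: \<chi>_def \<theta>2_def \<theta>1_def)
qed

text \<open>There are finitely many possible values for \<open>a\<close>, and each contributes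
  finitely many values for \<open>b\<close>.\<close>

lemma cl_insert_absorb:
  assumes X: "X \<subseteq> univ M" and a: "a \<in> cl X" and b: "b \<in> cl (insert a X)"
  shows "b \<in> cl X"
proof -
  obtain F where F: "finite F" "F \<subseteq> X" "\<And>ds. F \<subseteq> set ds \<Longrightarrow> \<exists>\<phi>\<in>fms L_beta {..length ds}. \<forall>e. (\<forall>i<length ds. e i = ds ! i) \<longrightarrow>
      sat M (e(length ds := a)) \<phi> \<and> finite {b' \<in> univ M. sat M (e(length ds := b')) \<phi>}"
    by (rule acl_E[OF a]) (rule that)
  obtain G where G: "finite G" "G \<subseteq> insert a X" "\<And>ds. G \<subseteq> set ds \<Longrightarrow> \<exists>\<phi>\<in>fms L_beta {..length ds}. \<forall>e. (\<forall>i<length ds. e i = ds ! i) \<longrightarrow>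
      sat M (e(length ds := b)) \<phi> \<and> finite {b' \<in> univ M. sat M (e(length ds := b')) \<phi>}"
    by (rule acl_E[OF b]) (rule that)
  obtain ds where ds: "set ds = F \<union> (G - {a})" using finite_list[of "F \<union> (G - {a})"] F(1) G(1) by auto
  define n where "n = length ds"
  have dsX: "set ds \<subseteq> X" using ds F(2) G(2) by auto
  define e where "e i = (if i < n then ds ! i else b)" for i
  have bU: "b \<in> univ M" and aU: "a \<in> univ M" using a b acl_univ[of L_beta M] by blast+
  obtain \<phi> where \<phi>: "\<phi> \<in> fms L_beta {..n}" "sat M (e(n := a)) \<phi>" "finite {b' \<in> univ M. sat M (e(n := b')) \<phi>}"
    using F(3)[of ds] ds by (auto simp: n_def e_def)
  obtain \<theta> where \<theta>: "\<theta> \<in> fms L_beta {..Suc n}" "\<And>e. (\<forall>i<Suc n. e i = (ds @ [a]) ! i) \<Longrightarrow>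
      sat M (e(Suc n := b)) \<theta> \<and> finite {b' \<in> univ M. sat M (e(Suc n := b')) \<theta>}"
  proof -
    have sub: "G \<subseteq> set (ds @ [a])" and len: "length (ds @ [a]) = Suc n" using ds by (auto simp: n_def)
    show thesis using G(3)[OF sub, unfolded len] by (elim bexE) (rule that, auto)
  qed
  have fv\<theta>: "fv \<theta> \<subseteq> {..Suc n}" using \<theta> by (auto simp: fms_def)
  have \<theta>a: "sat M (e(n := a, Suc n := b)) \<theta>" "finite {b' \<in> univ M. sat M (e(n := a, Suc n := b')) \<theta>}"
    using \<theta>(2)[of "e(n := a)"] by (auto simp: e_def n_def nth_append less_Suc_eq)
  define k where "k = card {b' \<in> univ M. sat M (e(n := a, Suc n := b')) \<theta>}"
  \<comment> \<open>The cardinality clause discards those solutions \<open>a'\<close> of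
    \<open>\<phi>\<close> over which \<open>\<theta>\<close> would have infinitely many
    solutions.\<close>
  define \<psi> where "\<psi> = Exi n (And \<phi> (And \<theta> (at_most_fm (Suc n) k \<theta>)))"
  have swap: "e(Suc n := b', n := a') = e(n := a', Suc n := b')" for a' b' by (auto simp: fun_eq_iff)
  have at: "sat M (e(n := a', Suc n := b')) (at_most_fm (Suc n) k \<theta>) \<longleftrightarrow>
      finite {b \<in> univ M. sat M (e(n := a', Suc n := b)) \<theta>} \<and> card {b \<in> univ M. sat M (e(n := a', Suc n := b)) \<theta>} \<le> k" for a' b'
    using sat_at_most[OF fv\<theta> univ_nonempty, of "e(n := a', Suc n := b')" k] by simp
  have \<phi>eq: "sat M (e(n := a', Suc n := b')) \<phi> = sat M (e(n := a')) \<phi>" for a' b'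
    using \<phi>(1) by (intro sat_cong) (auto simp: fms_def)
  show ?thesis
  proof (rule acl_I[where \<phi> = \<psi> and e = e and y = "Suc n"])
    show "fm_in L_beta \<psi>" using \<phi>(1) \<theta>(1) by (simp add: \<psi>_def fms_def)
    show "e ` (fv \<psi> - {Suc n}) \<subseteq> X"
    proof -
      have "fv \<psi> - {Suc n} \<subseteq> {..<n}"
        using \<phi>(1) fv\<theta> fv_at_most[OF fv\<theta>, of k] by (fastforce simp: \<psi>_def fms_def)
      then show ?thesis using dsX by (force simp: e_def n_def)
    qed
    show "b \<in> univ M" by (rule bU)
    show "sat M (e(Suc n := b)) \<psi>"
    proof -
      have "sat M (e(n := a, Suc n := b)) (at_most_fm (Suc n) k \<theta>)" unfolding at using \<theta>a by (simp add: k_def)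
      then show ?thesis using \<phi>(2) \<theta>a(1) aU by (auto simp: \<psi>_def swap \<phi>eq simp del: fun_upd_apply)
    qed
    define T where "T a' = (if finite {b \<in> univ M. sat M (e(n := a', Suc n := b)) \<theta>} then {b \<in> univ M. sat M (e(n := a', Suc n := b)) \<theta>} else {})" for a'
    have "{b' \<in> univ M. sat M (e(Suc n := b')) \<psi>} \<subseteq> (\<Union>a'\<in>{a' \<in> univ M. sat M (e(n := a')) \<phi>}. T a')"
      by (auto simp: \<psi>_def swap \<phi>eq at T_def simp del: fun_upd_apply)
    moreover have "finite (\<Union>a'\<in>{a' \<in> univ M. sat M (e(n := a')) \<phi>}. T a')"
      using \<phi>(3) by (intro finite_UN_I) (auto simp: T_def)
    ultimately show "finite {b' \<in> univ M. sat M (e(Suc n := b')) \<psi>}" by (rule finite_subset)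
  qed
qed

lemma cl_Un_absorb:
  assumes X: "X \<subseteq> univ M" and F: "finite F" "F \<subseteq> cl X"
  shows "cl (X \<union> F) \<subseteq> cl X"
  using F
proof (induction F rule: finite_induct)
  case (insert a F)
  have "F \<subseteq> univ M" "a \<in> univ M" using insert.prems acl_univ[of L_beta M X] by auto
  have "cl (insert a (X \<union> F)) \<subseteq> cl (X \<union> F)"
    using cl_insert_absorb[of "X \<union> F" a] X \<open>F \<subseteq> univ M\<close> insert.prems acl_mono[of X "X \<union> F" L_beta M] by blast
  then show ?case using insert by auto
qed simp

lemma cl_idem: assumes X: "X \<subseteq> univ M" shows "cl (cl X) = cl X"
proof
  show "cl X \<subseteq> cl (cl X)" by (rule acl_extensive[OF acl_univ])
  show "cl (cl X) \<subseteq> cl X"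
  proof
    fix b assume "b \<in> cl (cl X)"
    then obtain F where F: "F \<subseteq> cl X" "finite F" "b \<in> cl F" by (rule acl_finite)
    then have "b \<in> cl (X \<union> F)" using acl_mono[of F "X \<union> F" L_beta M] by blast
    then show "b \<in> cl X" using cl_Un_absorb[OF X F(2,1)] by blast
  qed
qed

lemma cl_subset: "X \<subseteq> univ M \<Longrightarrow> Y \<subseteq> cl X \<Longrightarrow> cl Y \<subseteq> cl X"
  using acl_mono[of Y "cl X" L_beta M] cl_idem[of X] by simp

text \<open>Suppose exchange fails, with \<open>\<theta>1\<close> witnessing that \<open>b\<close>
  is algebraic over \<open>c\<close>. As \<open>c\<close> is not algebraic over \<open>b\<close>,
  the fibre over \<open>b\<close> is infinite and so has interior; as \<open>b\<close> is not
  algebraic over \<open>X\<close>, the points whose fibre has interior are infinitely many and so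
  have interior too. Such a configuration is excluded by \<open>no_fibred_interior\<close>.\<close>

lemma cl_exchange:
  assumes X: "X \<subseteq> univ M" and c: "c \<in> univ M" and b: "b \<in> cl (insert c X)" "b \<notin> cl X"
  shows "c \<in> cl (insert b X)"
proof (rule ccontr)
  assume nc: "c \<notin> cl (insert b X)"
  obtain G where G: "finite G" "G \<subseteq> insert c X" "\<And>ds. G \<subseteq> set ds \<Longrightarrow> \<exists>\<phi>\<in>fms L_beta {..length ds}. \<forall>e. (\<forall>i<length ds. e i = ds ! i) \<longrightarrow>
      sat M (e(length ds := b)) \<phi> \<and> finite {b' \<in> univ M. sat M (e(length ds := b')) \<phi>}"
    by (rule acl_E[OF b(1)]) (rule that)
  obtain ds where ds: "set ds = G - {c}" using finite_list[of "G - {c}"] G(1) by auto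
  define n where "n = length ds"
  have dsX: "set ds \<subseteq> X" using ds G(2) by auto
  have bU: "b \<in> univ M" using b acl_univ[of L_beta M "insert c X"] by blast
  define e where "e i = (if i < n then ds ! i else b)" for i
  have e: "assignment M e"
    unfolding assignment_def
  proof
    fix i show "e i \<in> univ M"
    proof (cases "i < n")
      case True
      then have "ds ! i \<in> set ds" by (simp add: n_def)
      then show ?thesis using True dsX X by (auto simp: e_def)
    qed (simp add: e_def bU)
  qed
  have e': "assignment M (e(Suc n := b))" using e bU by (simp add: assignment_def)
  obtain \<theta> where \<theta>: "\<theta> \<in> fms L_beta {..Suc n}" "\<And>e. (\<forall>i<Suc n. e i = (ds @ [c]) ! i) \<Longrightarrow>
      sat M (e(Suc n := b)) \<theta> \<and> finite {b' \<in> univ M. sat M (e(Suc n := b')) \<theta>}"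
  proof -
    have sub: "G \<subseteq> set (ds @ [c])" and len: "length (ds @ [c]) = Suc n" using ds by (auto simp: n_def)
    show thesis using G(3)[OF sub, unfolded len] by (elim bexE) (rule that, auto)
  qed
  have fv\<theta>: "fv \<theta> \<subseteq> {..Suc n}" "fm_in L_beta \<theta>" using \<theta> by (auto simp: fms_def)
  have \<theta>c: "sat M (e(n := c, Suc n := b)) \<theta>" "finite {b' \<in> univ M. sat M (e(n := c, Suc n := b')) \<theta>}"
    using \<theta>(2)[of "e(n := c)"] by (auto simp: e_def n_def nth_append less_Suc_eq)
  define k where "k = card {b' \<in> univ M. sat M (e(n := c, Suc n := b')) \<theta>}"
  define \<theta>1 where "\<theta>1 = And \<theta> (at_most_fm (Suc n) k \<theta>)"
  have fv1: "fv \<theta>1 \<subseteq> {..<n + 2}" using fv\<theta> fv_at_most[OF fv\<theta>(1), of k] by (force simp: \<theta>1_def)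
  have in1: "fm_in L_beta \<theta>1" using fv\<theta> by (simp add: \<theta>1_def)
  have swap: "e(Suc n := b', n := a') = e(n := a', Suc n := b')" for a' b' by (auto simp: fun_eq_iff)
  have sat1: "sat M (e(Suc n := b, n := c)) \<theta>1"
    using \<theta>c sat_at_most[OF fv\<theta>(1) univ_nonempty, of "e(n := c, Suc n := b)" k]
    by (simp add: \<theta>1_def swap k_def del: fun_upd_apply)
  have en: "e ` {..<n} \<subseteq> X" using dsX by (force simp: e_def n_def)
  have "infinite {z \<in> univ M. sat M (e(Suc n := b, n := z)) \<theta>1}"
  proof
    assume "finite {z \<in> univ M. sat M (e(Suc n := b, n := z)) \<theta>1}"
    moreover have "e(Suc n := b) ` (fv \<theta>1 - {n}) \<subseteq> insert b X"
    proof -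
      have "fv \<theta>1 - {n} \<subseteq> insert (Suc n) {..<n}" using fv1 by fastforce
      moreover have "(e(Suc n := b)) ` insert (Suc n) {..<n} \<subseteq> insert b X" using en by auto
      ultimately show ?thesis by blast
    qed
    ultimately have "c \<in> cl (insert b X)" using acl_I[OF in1 _ c sat1] by blast
    then show False using nc by blast
  qed
  then have "has_interior M {z \<in> univ M. sat M (e(Suc n := b, n := z)) \<theta>1}"
    by (rule infinite_interior[OF in1 e'])
  then have sat2: "sat M (e(Suc n := b)) (interior_fm n (n + 2) \<theta>1)" using fv1 by (subst sat_interior) auto
  define \<theta>2 where "\<theta>2 = interior_fm n (n + 2) \<theta>1"
  have fv2: "fv \<theta>2 \<subseteq> fv \<theta>1 - {n}" using fv_interior[of n "n + 2" \<theta>1] by (simp add: \<theta>2_def)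
  have in2: "fm_in L_beta \<theta>2" using fm_in_interior[OF in1] by (simp add: \<theta>2_def)
  have "infinite {y \<in> univ M. sat M (e(Suc n := y)) \<theta>2}"
  proof
    assume "finite {y \<in> univ M. sat M (e(Suc n := y)) \<theta>2}"
    moreover have "e ` (fv \<theta>2 - {Suc n}) \<subseteq> X"
    proof -
      have "fv \<theta>2 - {Suc n} \<subseteq> {..<n}" using fv1 fv2 by fastforce
      then show ?thesis using en by blast
    qed
    ultimately have "b \<in> cl X" using acl_I[OF in2 _ bU] sat2 by (simp add: \<theta>2_def)
    then show False using b(2) by blast
  qed
  then have "has_interior M {y \<in> univ M. sat M (e(Suc n := y)) \<theta>2}" by (rule infinite_interior[OF in2 e])
  then have "sat M e (interior_fm (Suc n) (n + 2) \<theta>2)" using fv1 fv2 by (subst sat_interior) auto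
  then show False using no_fibred_interior[OF \<theta>(1) e] by (simp add: \<theta>2_def \<theta>1_def)
qed

theorem pregeometry_cl: "pregeometry (univ M) cl"
  unfolding pregeometry_def
proof (intro conjI allI impI ballI)
  fix X b assume "b \<in> cl X"
  then show "\<exists>F\<subseteq>X. finite F \<and> b \<in> cl F" by (metis acl_finite)
qed (auto simp: acl_extensive acl_univ cl_idem intro: acl_mono[THEN subsetD] cl_exchange dest: acl_univ[THEN subsetD])

lemma in_ball_trans:
  assumes "x \<in> univ M" "y \<in> univ M" "b \<in> univ M" "z \<in> univ M" "z \<noteq> fint M Zero []" "in_ball M y x z" "in_ball M x b z"
  shows "in_ball M y b z"
proof -
  define \<chi> where "\<chi> = Imp (Conjs [nonzero_fm 3, in_ball_fm 0 1 3 4, in_ball_fm 1 2 3 4]) (in_ball_fm 0 2 3 4 :: (fname, 'r rname) fm)"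
  define e where "e i = (if i = 0 then y else if i = 1 then x else if i = 2 then b else z)" for i :: nat
  have "sat (Qp_struc p) (\<lambda>j. pr (f j)) \<chi>" for f
  proof (cases "nm p (f 3) = 0")
    case True then show ?thesis by (simp add: \<chi>_def pr_eq_iff)
  next
    case False
    then show ?thesis using N_triangle[of "f 0" "f 2" "f 1"] by (auto simp: \<chi>_def in_ball_Qp)
  qed
  moreover have "fm_in L_beta \<chi>" using fm_in_in_ball fm_in_nonzero by (auto simp: \<chi>_def)
  moreover have "assignment M e" using assms by (simp add: assignment_def e_def)
  ultimately have "sat M e \<chi>" using transfer[OF M] by blast
  then show ?thesis using assms by (simp add: \<chi>_def e_def)
qed

section \<open>Addition and algebraic closure\<close>

abbreviation plus_fm :: "nat \<Rightarrow> nat \<Rightarrow> nat \<Rightarrow> (fname, 'r rname) fm" where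
  "plus_fm i j k \<equiv> Equ (Fn Plus [Var i, Var j]) (Var k)"

lemma fm_in_plus: "fm_in L_beta (plus_fm i j k)"
  by (simp add: L_beta_def)

lemma plus_cancel:
  assumes "x \<in> univ M" "y \<in> univ M" "z \<in> univ M"
  shows "fint M Plus [x, y] = fint M Plus [x, z] \<longleftrightarrow> y = z" "fint M Plus [y, x] = fint M Plus [z, x] \<longleftrightarrow> y = z"
proof -
  define \<chi> :: "(fname, 'r rname) fm" where
    "\<chi> = And (Imp (Equ (Fn Plus [Var 0, Var 1]) (Fn Plus [Var 0, Var 2])) (Equ (Var 1) (Var 2)))
       (Imp (Equ (Fn Plus [Var 1, Var 0]) (Fn Plus [Var 2, Var 0])) (Equ (Var 1) (Var 2)))"
  define e where "e i = (if i = 0 then x else if i = 1 then y else z)" for i :: nat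
  have "sat (Qp_struc p) (\<lambda>j. pr (f j)) \<chi>" for f by (simp add: \<chi>_def pr_eq_iff)
  moreover have "fm_in L_beta \<chi>" by (simp add: \<chi>_def L_beta_def)
  moreover have "assignment M e" using assms by (simp add: assignment_def e_def)
  ultimately have "sat M e \<chi>" using transfer[OF M] by blast
  then show "fint M Plus [x, y] = fint M Plus [x, z] \<longleftrightarrow> y = z" "fint M Plus [y, x] = fint M Plus [z, x] \<longleftrightarrow> y = z"
    by (auto simp: \<chi>_def e_def)
qed

lemma plus_solve:
  assumes "x \<in> univ M" "z \<in> univ M"
  shows "\<exists>y\<in>univ M. fint M Plus [x, y] = z"
proof -
  define \<chi> :: "(fname, 'r rname) fm" where "\<chi> = Exi 2 (plus_fm 0 2 1)"
  define e where "e i = (if i = 0 then x else z)" for i :: nat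
  have "sat (Qp_struc p) (\<lambda>j. pr (f j)) \<chi>" for f
    by (auto simp: \<chi>_def pr_eq_iff intro!: exI[of _ "f 1 - f 0"])
  moreover have "fm_in L_beta \<chi>" by (simp add: \<chi>_def L_beta_def)
  moreover have "assignment M e" using assms by (simp add: assignment_def e_def)
  ultimately have "sat M e \<chi>" using transfer[OF M] by blast
  then show ?thesis by (auto simp: \<chi>_def e_def)
qed

lemma plus_cl:
  assumes x: "x \<in> univ M" and y: "y \<in> univ M" and s: "s = fint M Plus [x, y]"
  shows "s \<in> cl {x, y}" "x \<in> cl {s, y}" "y \<in> cl {s, x}"
proof -
  define e where "e i = (if i = 0 then x else if i = 1 then y else s)" for i :: nat
  have sU: "s \<in> univ M" using Plus_closed x y s by simp
  have fin: "finite {a \<in> univ M. P a}" if "\<And>a. a \<in> univ M \<Longrightarrow> P a \<Longrightarrow> a = c" for P and c :: 'u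
    by (rule finite_subset[of _ "{c}"]) (use that in auto)
  show "s \<in> cl {x, y}"
    by (rule acl_I[OF fm_in_plus[of 0 1 2], of e 2]) (auto simp: e_def s Plus_closed[OF x y] intro!: fin[where c = s])
  show "x \<in> cl {s, y}"
    by (rule acl_I[OF fm_in_plus[of 0 1 2], of e 0])
      (use plus_cancel(2)[OF y _ x] in \<open>auto simp: e_def x s intro!: fin[where c = x]\<close>)
  show "y \<in> cl {s, x}"
    by (rule acl_I[OF fm_in_plus[of 0 1 2], of e 1])
      (use plus_cancel(1)[OF x _ y] in \<open>auto simp: e_def y s intro!: fin[where c = y]\<close>)
qed

end

subsection \<open>Pairs\<close>

lemma trm_in_mono: "trm_in L t \<Longrightarrow> funs L \<subseteq> funs K \<Longrightarrow> trm_in K t"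
  by (induction t) auto

lemma fm_in_mono: "fm_in L \<phi> \<Longrightarrow> funs L \<subseteq> funs K \<Longrightarrow> rels L \<subseteq> rels K \<Longrightarrow> fm_in K \<phi>"
proof (induction \<phi>)
  case (Rel R ts)
  then have "trm_in K t" if "t \<in> set ts" for t using that trm_in_mono[of L t K] by auto
  then show ?case using Rel by auto
qed (auto intro: trm_in_mono)

lemma funs_lang2 [simp]: "funs (lang2 A L K) = funs K \<union> funs L"
  and rels_lang2 [simp]: "rels (lang2 A L K) = rels K \<union> rels L \<union> {(A, 1)}"
  by (auto simp: lang2_def lang_Un_def)

lemma funs_L_alpha [simp]: "funs (L_alpha L') = funs L'"
  and rels_L_alpha [simp]: "rels (L_alpha L') = insert (EqRel, 2) (rels L')"
  by (auto simp: L_alpha_def lang_Un_def)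

lemma univ_induced [simp]: "univ (induced A M) = pred_ext A M"
  and rint_induced [simp]: "rint (induced A M) = rint M"
  by (simp_all add: induced_def)

lemma sat_relativize: "sat M e (relativize A \<phi>) = sat (induced A M) e \<phi>"
proof -
  have ev: "eval (induced A M) e t = eval M e t" for e t
  proof (induction t)
    case (Fn f ts)
    then have "map (eval (induced A M) e) ts = map (eval M e) ts" by auto
    then show ?case by (simp only: eval.simps) (simp add: induced_def)
  qed simp
  show ?thesis
  proof (induction \<phi> arbitrary: e)
    case (Rel R ts)
    have "map (eval (induced A M) e) ts = map (eval M e) ts" using ev by simp
    then show ?case by (simp only: relativize.simps sat.simps) (simp add: induced_def)
  qed (auto simp: ev pred_ext_def)
qed

lemma name_all_induced: "name_all (induced A M) = induced A (name_all M)"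
  by (simp add: name_all_def induced_def pred_ext_def)

lemma holds_at_relativize: "holds_at M (relativize A \<psi>) b = holds_at (induced A M) \<psi> b"
  by (simp add: holds_at_def name_all_induced sat_relativize)

lemma fv_relativize [simp]: "fv (relativize A \<phi>) = fv \<phi>"
  by (induction \<phi>) auto

lemma fm_in_relativize:
  "fm_in L \<phi> \<Longrightarrow> funs L \<subseteq> funs K \<Longrightarrow> rels L \<subseteq> rels K \<Longrightarrow> (A, 1) \<in> rels K \<Longrightarrow> fm_in K (relativize A \<phi>)"
proof (induction \<phi>)
  case (Rel R ts)
  then have "fm_in K (Rel R ts)" by (intro fm_in_mono[of L _ K])
  then show ?case by simp
qed (auto intro: trm_in_mono)

lemma E_axioms_sentences:
  "E_equiv_axs \<union> {E_invariant_ax R n |R n. (R, n) \<in> rels L'} \<subseteq> sentences (L_alpha L')"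
proof -
  have "E_invariant_ax R n \<in> sentences (L_alpha L')" if "(R, n) \<in> rels L'" for R n
    using that by (auto simp: E_invariant_ax_def fms_def)
  moreover have "E_equiv_axs \<subseteq> sentences (L_alpha L')"
    by (auto simp: E_equiv_axs_def fms_def)
  ultimately show ?thesis by auto
qed

lemma T_star_sentences:
  fixes L' :: "(fname, 'r rname) lang"
  shows "T_star p L' T' \<subseteq> sentences (lang2 APred (L_alpha L') L_beta)"
proof -
  let ?K = "lang2 APred (L_alpha L') L_beta"
  have beta: "fm_in ?K \<phi>" if "fm_in L_beta \<phi>" for \<phi> using that by (rule fm_in_mono) auto
  have 1: "T_beta p \<subseteq> sentences ?K" using beta by (auto simp: T_beta_def theory_of_def fms_def)
  have 2: "relativize APred \<phi> \<in> sentences ?K" if "\<phi> \<in> sentences (L_alpha L')" for \<phi>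
    using that by (auto simp: fms_def intro!: fm_in_relativize)
  have 3: "fun_closed_ax APred f n \<in> sentences ?K" if "(f, n) \<in> funs (L_alpha L')" for f n
    using that by (auto simp: fms_def fun_closed_ax_def)
  have 4: "rel_within_ax APred R n \<in> sentences ?K" if "(R, n) \<in> rels (L_alpha L')" for R n
    using that by (auto simp: fms_def rel_within_ax_def)
  have 5: "A_dense_ax \<in> sentences ?K" "E_class_dense_ax \<in> sentences ?K"
    using beta[OF fm_in_in_ball] beta[OF fm_in_nonzero] by (auto simp: fms_def A_dense_ax_def E_class_dense_ax_def)
  have 6: "A_indep_ax n k \<phi> \<in> sentences ?K" if "\<phi> \<in> fms L_beta {..n}" for n k \<phi>
  proof -
    have "fv \<phi> \<subseteq> {..n}" "fm_in ?K \<phi>" using that beta by (auto simp: fms_def)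
    moreover have "fv (at_most_fm n k \<phi>) \<subseteq> {..<n}" using \<open>fv \<phi> \<subseteq> {..n}\<close> by (rule fv_at_most)
    ultimately show ?thesis by (auto simp: fms_def A_indep_ax_def)
  qed
  show ?thesis unfolding T_star_def theory2_def using 1 2 3 4 5 6 by auto
qed

context padic_prime
begin

text \<open>A finite solution set has no interior, so the uniform bound of the dichotomy applies to
  it; this eliminates the quantifier for infinitely many.\<close>

theorem geometric_T_beta: "geometric (L_beta :: (fname, 'r rname) lang) (T_beta p)"
  unfolding geometric_def
proof (intro conjI allI impI)
  fix M :: "(fname, 'r rname) struc0" assume "model L_beta M (T_beta p)"
  then interpret padic_model p M by unfold_locales
  show "pregeometry (univ M) (acl L_beta M)" by (rule pregeometry_cl)
next
  show "eliminates_ex_inf (L_beta :: (fname, 'r rname) lang) (T_beta p)"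
    unfolding eliminates_ex_inf_def
  proof (intro allI impI)
    fix \<phi> :: "(fname, 'r rname) fm" and y assume \<phi>: "fm_in L_beta \<phi>"
    obtain N where N: "\<And>(M :: (fname, 'r rname) struc0) e. model L_beta M (T_beta p) \<and> assignment M e \<Longrightarrow>
      finite {b \<in> univ M. sat M (e(y := b)) \<phi>} \<and> card {b \<in> univ M. sat M (e(y := b)) \<phi>} \<le> N \<or>
      has_interior M {b \<in> univ M. sat M (e(y := b)) \<phi>}" using dichotomy[OF \<phi>, of y] by blast
    show "\<exists>N. \<forall>(M :: (fname, 'r rname) struc0) e. model L_beta M (T_beta p) \<and> assignment M e \<and>
           finite {b \<in> univ M. sat M (e(y := b)) \<phi>} \<longrightarrow> card {b \<in> univ M. sat M (e(y := b)) \<phi>} \<le> N"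
    proof (intro exI[of _ N] allI impI, elim conjE)
      fix M :: "(fname, 'r rname) struc0" and e
      assume M: "model L_beta M (T_beta p)" and e: "assignment M e" and fin: "finite {b \<in> univ M. sat M (e(y := b)) \<phi>}"
      interpret padic_model p M by unfold_locales (rule M)
      show "card {b \<in> univ M. sat M (e(y := b)) \<phi>} \<le> N" using N[of M e] M e fin interior_infinite[OF \<phi> e] by blast
    qed
  qed
qed

end

section \<open>Models of the theory of pairs\<close>

locale pair_model = padic_prime p for p +
  fixes L' :: "(fname, 'r rname) lang" and T' :: "(fname, 'r rname) fm set" and M :: "(fname, 'r rname, 'u) struc"
  assumes L'_funs: "funs L' = {}"
    and M2: "model (lang2 APred (L_alpha L') L_beta) M (T_star p L' T')"
begin

sublocale padic_model p M
proof
  have "T_beta p \<subseteq> T_star p L' T'" by (auto simp: T_star_def theory2_def)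
  then show "model L_beta M (T_beta p)" using M2 by (auto simp: model_def is_struc_def)
qed

abbreviation "A \<equiv> pred_ext APred M"

lemma A_univ: "A \<subseteq> univ M"
  by (auto simp: pred_ext_def)

lemma axiom: "\<phi> \<in> T_star p L' T' \<Longrightarrow> assignment M e \<Longrightarrow> sat M e \<phi>"
  using M2 by (auto simp: model_def)

lemma alpha_axiom:
  assumes "\<phi> \<in> E_equiv_axs \<union> {E_invariant_ax R n |R n. (R, n) \<in> rels L'}" "assignment M e"
  shows "sat (induced APred M) e \<phi>"
proof -
  have "\<phi> \<in> T_alpha L' T'" using assms by (auto simp: T_alpha_def)
  then have "entails (L_alpha L') (T_alpha L' T') \<phi>" by (auto simp: entails_def model_def)
  moreover have "\<phi> \<in> sentences (L_alpha L')" using assms(1) E_axioms_sentences by blast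
  ultimately have "relativize APred \<phi> \<in> T_star p L' T'" unfolding T_star_def theory2_def by blast
  then show ?thesis using axiom assms(2) by (simp add: sat_relativize[symmetric])
qed

lemma some_assignment: obtains e where "assignment M e"
proof -
  obtain u where "u \<in> univ M" using univ_nonempty by blast
  then have "assignment M (\<lambda>_. u)" by (simp add: assignment_def)
  then show thesis by (rule that)
qed

lemma A_dense:
  assumes "b \<in> univ M" "z \<in> univ M" "z \<noteq> fint M Zero []"
  shows "\<exists>a\<in>A. in_ball M a b z"
proof -
  obtain e where "assignment M e" by (rule some_assignment)
  then have "sat M e A_dense_ax" by (intro axiom) (auto simp: T_star_def)
  then show ?thesis using assms by (auto simp: A_dense_ax_def Foralls_def pred_ext_def)
qed

lemma E_class_dense:
  assumes "a \<in> A" "b \<in> A" "z \<in> univ M" "z \<noteq> fint M Zero []"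
  shows "\<exists>c\<in>A. rint M EqRel [c, a] \<and> in_ball M c b z"
proof -
  obtain e where "assignment M e" by (rule some_assignment)
  then have "sat M e E_class_dense_ax" by (intro axiom) (auto simp: T_star_def)
  then show ?thesis using assms by (simp add: E_class_dense_ax_def Foralls_def pred_ext_def) blast
qed

lemma E_refl: "a \<in> A \<Longrightarrow> rint M EqRel [a, a]"
  and E_sym: "a \<in> A \<Longrightarrow> b \<in> A \<Longrightarrow> rint M EqRel [a, b] \<Longrightarrow> rint M EqRel [b, a]"
  and E_trans: "a \<in> A \<Longrightarrow> b \<in> A \<Longrightarrow> c \<in> A \<Longrightarrow> rint M EqRel [a, b] \<Longrightarrow> rint M EqRel [b, c] \<Longrightarrow> rint M EqRel [a, c]"
proof -
  obtain e where e: "assignment M e" by (rule some_assignment)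
  have ax: "sat (induced APred M) e \<phi>" if "\<phi> \<in> E_equiv_axs" for \<phi> using alpha_axiom[OF _ e] that by blast
  have "sat (induced APred M) e (Forall 0 (E_fm 0 0))" by (rule ax) (simp add: E_equiv_axs_def)
  then have r: "\<forall>a\<in>A. rint M EqRel [a, a]" by simp
  have "sat (induced APred M) e (Foralls [0, 1] (Imp (E_fm 0 1) (E_fm 1 0)))" by (rule ax) (simp add: E_equiv_axs_def)
  then have s: "\<forall>a\<in>A. \<forall>b\<in>A. rint M EqRel [a, b] \<longrightarrow> rint M EqRel [b, a]" by (simp add: Foralls_def)
  have "sat (induced APred M) e (Foralls [0, 1, 2] (Imp (And (E_fm 0 1) (E_fm 1 2)) (E_fm 0 2)))"
    by (rule ax) (simp add: E_equiv_axs_def)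
  then have t: "\<forall>a\<in>A. \<forall>b\<in>A. \<forall>c\<in>A. rint M EqRel [a, b] \<and> rint M EqRel [b, c] \<longrightarrow> rint M EqRel [a, c]"
    unfolding Foralls_def by (simp (no_asm_use))
  show "a \<in> A \<Longrightarrow> rint M EqRel [a, a]" using r by blast
  show "a \<in> A \<Longrightarrow> b \<in> A \<Longrightarrow> rint M EqRel [a, b] \<Longrightarrow> rint M EqRel [b, a]" using s by blast
  show "a \<in> A \<Longrightarrow> b \<in> A \<Longrightarrow> c \<in> A \<Longrightarrow> rint M EqRel [a, b] \<Longrightarrow> rint M EqRel [b, c] \<Longrightarrow> rint M EqRel [a, c]"
    using t by blast
qed

lemma E_invariant:
  assumes R: "(R, n) \<in> rels L'" and xs: "set xs \<subseteq> A" "length xs = n" and ys: "set ys \<subseteq> A" "length ys = n"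
    and E: "\<And>i. i < n \<Longrightarrow> rint M EqRel [xs ! i, ys ! i]" and Rxs: "rint M R xs"
  shows "rint M R ys"
proof -
  obtain e where e: "assignment M e" by (rule some_assignment)
  have sat: "sat (induced APred M) e (E_invariant_ax R n)" using R by (intro alpha_axiom[OF _ e]) blast
  define e' where "e' i = (if i < n then xs ! i else if i < 2 * n then ys ! (i - n) else e i)" for i
  have in_A: "e' i \<in> A" if "i < 2 * n" for i
    using xs ys that nth_mem[of i xs] nth_mem[of "i - n" ys] by (auto simp: e'_def)
  have "sat (induced APred M) e' (Imp (And (Conjs (map (\<lambda>i. E_fm i (n + i)) [0..<n])) (Rel R (map Var [0..<n]))) (Rel R (map Var [n..<2 * n])))"
    using sat[unfolded E_invariant_ax_def sat_Foralls, rule_format, of e'] in_A by (auto simp: e'_def)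
  moreover have "map (eval (induced APred M) e') (map Var [0..<n]) = xs"
    using xs by (auto simp: e'_def intro!: nth_equalityI)
  moreover have "map (eval (induced APred M) e') (map Var [n..<2 * n]) = ys"
    using ys by (auto simp: e'_def intro!: nth_equalityI)
  moreover have "rint M EqRel [e' i, e' (n + i)]" if "i < n" for i using E[OF that] that by (simp add: e'_def)
  ultimately show ?thesis using Rxs by (simp del: map_map)
qed

text \<open>The axiom scheme is applied to a formula witnessing algebraicity, with \<open>k\<close>
  the actual number of its solutions.\<close>

lemma A_independent: assumes a: "a \<in> A" shows "a \<notin> cl (A - {a})"
proof
  assume "a \<in> cl (A - {a})"
  then obtain F where F: "finite F" "F \<subseteq> A - {a}" "\<And>ds. F \<subseteq> set ds \<Longrightarrow> \<exists>\<phi>\<in>fms L_beta {..length ds}. \<forall>e. (\<forall>i<length ds. e i = ds ! i) \<longrightarrow>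
      sat M (e(length ds := a)) \<phi> \<and> finite {b' \<in> univ M. sat M (e(length ds := b')) \<phi>}"
    by (rule acl_E) (rule that)
  obtain ds where ds: "set ds = F" using finite_list[OF F(1)] by blast
  define n where "n = length ds"
  define e where "e i = (if i < n then ds ! i else a)" for i
  obtain \<phi> where \<phi>: "\<phi> \<in> fms L_beta {..n}" "sat M (e(n := a)) \<phi>" "finite {b' \<in> univ M. sat M (e(n := b')) \<phi>}"
    using F(3)[of ds] ds by (auto simp: n_def e_def)
  define k where "k = card {b' \<in> univ M. sat M (e(n := b')) \<phi>}"
  have dsA: "ds ! i \<in> A - {a}" if "i < n" for i using that nth_mem[of i ds] ds F(2) by (auto simp: n_def)
  have en: "e(n := a) = e" by (auto simp: e_def fun_eq_iff)
  have eA: "e i \<in> A" for i using dsA a by (auto simp: e_def)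
  have "A_indep_ax n k \<phi> \<in> T_star p L' T'" using \<phi>(1) by (auto simp: T_star_def)
  moreover have "assignment M (\<lambda>_. a)" using a A_univ by (auto simp: assignment_def)
  ultimately have "sat M (\<lambda>_. a) (A_indep_ax n k \<phi>)" by (rule axiom)
  then have "sat M e (Imp (Conjs [Conjs (map A_fm [0..<Suc n]),
                  Conjs (map (\<lambda>i. Neg (Equ (Var n) (Var i))) [0..<n]), at_most_fm n k \<phi>]) (Neg \<phi>))"
  proof -
    have "\<forall>y. y \<notin> set [0..<Suc n] \<longrightarrow> e y = a" by (auto simp: e_def)
    moreover have "\<forall>x\<in>set [0..<Suc n]. e x \<in> univ M" using eA A_univ by blast
    ultimately show ?thesis using \<open>sat M (\<lambda>_. a) _\<close> unfolding A_indep_ax_def sat_Foralls by blast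
  qed
  moreover have "sat M e (at_most_fm n k \<phi>)"
    using sat_at_most[of \<phi> n M e k] \<phi> univ_nonempty by (auto simp: fms_def k_def)
  moreover have "rint M APred [e i]" for i using eA[of i] by (simp add: pred_ext_def)
  moreover have "e n \<noteq> e i" if "i < n" for i using dsA[OF that] that by (auto simp: e_def)
  ultimately have "\<not> sat M e \<phi>" by auto
  then show False using \<phi>(2) en by simp
qed

text \<open>Exchanging two \<open>E\<close>-equivalent elements is an automorphism of the induced structure.\<close>

lemma swap_invariant:
  assumes ab: "a \<in> A" "b \<in> A" "rint M EqRel [a, b]" and f: "f = (\<lambda>x. if x = a then b else if x = b then a else x)"
    and \<psi>: "fm_in (lang_params (L_alpha L') C) \<psi>" "fm_consts \<psi> \<subseteq> A - {a, b}" and e: "\<And>x. e x \<in> A"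
  shows "sat (name_all (induced APred M)) e \<psi> = sat (name_all (induced APred M)) (\<lambda>x. f (e x)) \<psi>"
  using \<psi> e
proof (induction \<psi> arbitrary: e)
  let ?N = "name_all (induced APred M)"
  have fA: "f x \<in> A" if "x \<in> A" for x using that ab by (simp add: f)
  have Ef: "rint M EqRel [x, f x]" if "x \<in> A" for x using that ab E_refl E_sym by (auto simp: f)
  have ff: "f (f x) = x" for x by (simp add: f)
  \<comment> \<open>Without function symbols in \<open>L'\<close> a term is a variable or a
    constant, and the constants differ from \<open>a\<close> and \<open>b\<close>, so they are fixed
    by the exchange.\<close>
  have trm: "eval ?N (\<lambda>x. f (e x)) t = f (eval ?N e t) \<and> eval ?N e t \<in> A"
    if t: "trm_in (lang_params (L_alpha L') C) t" "trm_consts t \<subseteq> A - {a, b}" and e: "\<And>x. e x \<in> A" for t e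
  proof (cases t)
    case (Var x) then show ?thesis using e by simp
  next
    case (Fn g ts)
    then obtain c where "g = Inr c" using t(1) L'_funs by (cases g) auto
    then show ?thesis using t(2) Fn by (auto simp: f)
  qed
  {
    case Fls show ?case by simp
  next
    case (Equ s t)
    then show ?case using trm[of s e] trm[of t e] ff by (auto; metis)
  next
    case (Rel R ts)
    define xs where "xs = map (eval ?N e) ts"
    have t: "eval ?N (\<lambda>x. f (e x)) t = f (eval ?N e t)" "eval ?N e t \<in> A" if "t \<in> set ts" for t
      using trm[of t e] Rel that by auto
    have xs: "set xs \<subseteq> A" using t by (auto simp: xs_def)
    have eq: "map (eval ?N (\<lambda>x. f (e x))) ts = map f xs" using t by (auto simp: xs_def)
    have len: "length xs = length ts" by (simp add: xs_def)
    have R: "(R, length ts) \<in> rels L' \<or> R = EqRel \<and> length ts = 2" using Rel.prems by auto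
    have inv: "rint M R ys \<Longrightarrow> rint M R (map f ys)" if ys: "set ys \<subseteq> A" "length ys = length ts" for ys
      using R
    proof
      assume R: "(R, length ts) \<in> rels L'" and "rint M R ys"
      show ?thesis
        by (rule E_invariant[OF R ys]) (use ys fA Ef \<open>rint M R ys\<close> in \<open>auto simp: subset_iff\<close>)
    next
      assume R: "R = EqRel \<and> length ts = 2" and Ry: "rint M R ys"
      then obtain x y where xy: "ys = [x, y]" using ys(2) by (auto simp: numeral_2_eq_2 length_Suc_conv)
      have "x \<in> A" "y \<in> A" using ys(1) xy by auto
      then have "rint M EqRel [f x, f y]"
        using E_trans[of "f x" x "f y"] E_trans[of x y "f y"] E_sym[of x "f x"] Ef fA Ry R xy by metis
      then show ?thesis using R xy by simp
    qed
    \<comment> \<open>The exchange is an involution, so the converse is the same implication applied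
      to the exchanged tuple.\<close>
    have "rint M R xs = rint M R (map f xs)"
    proof
      assume "rint M R xs" then show "rint M R (map f xs)" using inv[OF xs len] by blast
    next
      assume "rint M R (map f xs)"
      moreover have "set (map f xs) \<subseteq> A" using xs fA by auto
      ultimately have "rint M R (map f (map f xs))" using inv[of "map f xs"] len by simp
      then show "rint M R xs" by (simp add: ff comp_def)
    qed
    then show ?case unfolding sat.simps eq xs_def[symmetric] by simp
  next
    case (Neg \<psi>) then show ?case by simp
  next
    case (And \<psi> \<chi>) then show ?case by simp
  next
    case (Exi x \<psi>)
    have step: "sat ?N (e(x := c)) \<psi> = sat ?N ((\<lambda>x. f (e x))(x := f c)) \<psi>" if "c \<in> A" for c
    proof -
      have "sat ?N (e(x := c)) \<psi> = sat ?N (\<lambda>y. f ((e(x := c)) y)) \<psi>"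
        using Exi that by (intro Exi.IH) auto
      also have "(\<lambda>y. f ((e(x := c)) y)) = (\<lambda>x. f (e x))(x := f c)" by (auto simp: fun_eq_iff)
      finally show ?thesis .
    qed
    have "(\<exists>c\<in>A. sat ?N (e(x := c)) \<psi>) = (\<exists>c\<in>A. sat ?N ((\<lambda>x. f (e x))(x := c)) \<psi>)"
      using step fA ff by metis
    then show ?case by simp
  }
qed

text \<open>Removing finitely many points leaves an infinite definable set, and infinite definable
  sets have interior.\<close>

lemma ball_avoiding:
  assumes \<phi>: "fm_in L_beta \<phi>" and e: "assignment M e" and inf: "infinite {b \<in> univ M. sat M (e(i := b)) \<phi>}"
    and G: "finite G" "G \<subseteq> univ M"
  obtains b0 z where "b0 \<in> univ M" "z \<in> univ M" "z \<noteq> fint M Zero []"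
    "\<And>x. x \<in> univ M \<Longrightarrow> in_ball M x b0 z \<Longrightarrow> sat M (e(i := x)) \<phi> \<and> x \<notin> G"
proof -
  obtain n0 where n0: "fv \<phi> \<subseteq> {..<n0}" by (rule fv_bounded)
  define n where "n = max n0 (Suc i)"
  have n: "fv \<phi> \<subseteq> {..<n}" "i < n" using n0 by (auto simp: n_def)
  obtain gs where gs: "set gs = G" using finite_list[OF G(1)] by blast
  \<comment> \<open>The points to be avoided are stored in fresh variables from \<open>n\<close>
    on.\<close>
  define e' where "e' j = (if n \<le> j \<and> j < n + length gs then gs ! (j - n) else e j)" for j
  define \<psi> where "\<psi> = And \<phi> (Conjs (map (\<lambda>j. Neg (Equ (Var i) (Var j))) [n..<n + length gs]))"
  have sat\<psi>: "sat M (e'(i := x)) \<psi> \<longleftrightarrow> sat M (e(i := x)) \<phi> \<and> x \<notin> G" for x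
  proof -
    have "sat M (e'(i := x)) \<phi> = sat M (e(i := x)) \<phi>" using n by (intro sat_cong) (auto simp: e'_def)
    moreover have "(\<forall>j\<in>{n..<n + length gs}. x \<noteq> (e'(i := x)) j) \<longleftrightarrow> x \<notin> G"
    proof -
      have "(\<forall>j\<in>{n..<n + length gs}. x \<noteq> (e'(i := x)) j) \<longleftrightarrow> (\<forall>j\<in>{n..<n + length gs}. x \<noteq> gs ! (j - n))"
        using n(2) by (intro ball_cong) (auto simp: e'_def)
      also have "\<dots> \<longleftrightarrow> (\<forall>j<length gs. x \<noteq> gs ! j)"
      proof
        assume L: "\<forall>j\<in>{n..<n + length gs}. x \<noteq> gs ! (j - n)"
        show "\<forall>j<length gs. x \<noteq> gs ! j"
        proof (intro allI impI)
          fix j assume "j < length gs"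
          then show "x \<noteq> gs ! j" using L[rule_format, of "n + j"] by simp
        qed
      next
        assume L: "\<forall>j<length gs. x \<noteq> gs ! j"
        show "\<forall>j\<in>{n..<n + length gs}. x \<noteq> gs ! (j - n)"
        proof
          fix j assume "j \<in> {n..<n + length gs}"
          then have "j - n < length gs" by auto
          then show "x \<noteq> gs ! (j - n)" using L by blast
        qed
      qed
      finally show ?thesis unfolding gs[symmetric] in_set_conv_nth by auto
    qed
    ultimately show ?thesis by (simp add: \<psi>_def)
  qed
  have "assignment M e'"
    unfolding assignment_def e'_def using e G gs nth_mem by (auto simp: assignment_def; fastforce)
  moreover have "fm_in L_beta \<psi>" using \<phi> by (simp add: \<psi>_def)
  moreover have "infinite {b \<in> univ M. sat M (e'(i := b)) \<psi>}"
  proof -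
    have "{b \<in> univ M. sat M (e'(i := b)) \<psi>} = {b \<in> univ M. sat M (e(i := b)) \<phi>} - G" using sat\<psi> by auto
    then show ?thesis using inf G(1) by simp
  qed
  ultimately have "has_interior M {b \<in> univ M. sat M (e'(i := b)) \<psi>}" by (intro infinite_interior)
  then show thesis using that sat\<psi> unfolding has_interior_def by blast
qed

lemma holds_definable:
  assumes "\<phi> \<in> unary_fms L_beta C" "C \<subseteq> univ M"
  obtains \<phi>' e i where "fm_in L_beta \<phi>'" "assignment M e" "\<And>b. holds_at M \<phi> b = sat M (e(i := b)) \<phi>'"
proof -
  obtain ds where ds: "set ds = fm_consts \<phi>" using finite_list[OF unary_abstract(1)[OF assms(1)]] by blast
  obtain u where u: "u \<in> univ M" using univ_nonempty by blast
  define e where "e i = (if i < length ds then ds ! i else u)" for i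
  obtain \<phi>' where \<phi>': "\<phi>' \<in> fms L_beta {..length ds}" "\<And>b. holds_at M \<phi> b = sat M (e(length ds := b)) \<phi>'"
    using unary_abstract(3)[OF assms(1), of ds] ds by (force simp: e_def)
  have "assignment M e"
    unfolding assignment_def
  proof
    fix i show "e i \<in> univ M"
    proof (cases "i < length ds")
      case True
      then have "ds ! i \<in> fm_consts \<phi>" using ds nth_mem by blast
      then show ?thesis using unary_abstract(2)[OF assms(1)] assms(2) True by (auto simp: e_def)
    qed (simp add: e_def u)
  qed
  then show thesis using that[of \<phi>' e "length ds"] \<phi>' by (auto simp: fms_def)
qed

end

section \<open>Unary types and finite disjunctions of equalities\<close>

lemma holds_at_simps [simp]:
  "holds_at M (Conjs \<phi>s) b \<longleftrightarrow> (\<forall>\<phi>\<in>set \<phi>s. holds_at M \<phi> b)"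
  "holds_at M (Disjs \<phi>s) b \<longleftrightarrow> (\<exists>\<phi>\<in>set \<phi>s. holds_at M \<phi> b)"
  "holds_at M (Equ (Var 0) (Fn (Inr c) [])) b \<longleftrightarrow> b = c"
  by (simp_all add: holds_at_def)

lemma unary_type_Conjs:
  assumes q: "unary_type L C M q" and F: "set fs \<subseteq> q"
  shows "Conjs fs \<in> q"
proof -
  have "set fs \<subseteq> unary_fms L C" using q F by (auto simp: unary_type_def)
  then have "Conjs fs \<in> unary_fms L C" by (auto simp: unary_fms_def fms_def)
  moreover have "type_implies M q (Conjs fs)" unfolding type_implies_def using F by (intro exI[of _ "set fs"]) auto
  ultimately show ?thesis using q by (auto simp: unary_type_def)
qed

lemma quantifier_free_Disjs: "(\<And>\<phi>. \<phi> \<in> set \<phi>s \<Longrightarrow> quantifier_free \<phi>) \<Longrightarrow> quantifier_free (Disjs \<phi>s)"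
proof -
  have "(\<And>\<phi>. \<phi> \<in> set \<phi>s \<Longrightarrow> quantifier_free \<phi>) \<Longrightarrow> quantifier_free (Conjs (map Neg \<phi>s))"
    by (induction \<phi>s) (simp_all add: Conjs_def)
  then show "(\<And>\<phi>. \<phi> \<in> set \<phi>s \<Longrightarrow> quantifier_free \<phi>) \<Longrightarrow> quantifier_free (Disjs \<phi>s)" by (simp add: Disjs_def)
qed

text \<open>Only equality and parameters occur, so this formula lies in both languages and in their
  intersection; it is the test formula through which the assumption of the density condition is
  used.\<close>

definition one_of :: "'u list \<Rightarrow> ('f + 'u, 'r) fm" where
  "one_of cs = Disjs (map (\<lambda>c. Equ (Var 0) (Fn (Inr c) [])) cs)"

lemma holds_one_of [simp]: "holds_at M (one_of cs) b \<longleftrightarrow> b \<in> set cs"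
  by (auto simp: one_of_def)

lemma one_of_unary: "set cs \<subseteq> C \<Longrightarrow> one_of cs \<in> unary_fms L C"
  by (auto simp: one_of_def unary_fms_def fms_def)

lemma quantifier_free_one_of: "quantifier_free (one_of cs)"
  unfolding one_of_def by (rule quantifier_free_Disjs) auto

lemma fm_in_params_mono:
  assumes "funs L \<subseteq> funs K" "rels L \<subseteq> rels K"
  shows "unary_fms L C \<subseteq> unary_fms K C"
proof -
  have "funs (lang_params L C) \<subseteq> funs (lang_params K C)" using assms by (auto simp: lang_params_def)
  then show ?thesis using assms by (auto simp: unary_fms_def fms_def intro!: fm_in_mono[of "lang_params L C"])
qed

context pair_model
begin

section \<open>The density condition\<close>

text \<open>Saturation reduces the claim to one formula \<open>\<phi>\<close> of \<open>q\<close>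
  and one formula \<open>\<psi>\<close> of \<open>r\<close>. A solution of \<open>\<psi>\<close> in
  \<open>A\<close> outside its parameters can be replaced by any equivalent element of
  \<open>A\<close> that also avoids the parameters, and among these some lie in a ball on which
  \<open>\<phi>\<close> holds.\<close>

lemma density_realized:
  assumes sat: "saturated_setting APred (L_alpha L') L_beta (T_star p L' T') \<kappa> M C q"
    and r: "unary_type (L_alpha L') (A \<inter> C) (induced APred M) r"
    and qf: "\<And>\<psi>. \<psi> \<in> r \<Longrightarrow> quantifier_free \<psi> \<Longrightarrow> \<psi> \<in> unary_fms (lang_Int (L_alpha L') L_beta) (A \<inter> C) \<Longrightarrow> type_implies M q \<psi>"
  shows "\<exists>a\<in>A. (\<forall>\<psi>\<in>r. holds_at M (relativize APred \<psi>) a) \<and> (\<forall>\<phi>\<in>q. holds_at M \<phi> a)"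
proof -
  let ?K = "lang2 APred (L_alpha L') L_beta"
  have C: "C \<subseteq> univ M" "|C| <o \<kappa>" and q: "unary_type L_beta C M q" and na: "nonalgebraic M q" and S: "saturated ?K \<kappa> M"
    using sat by (auto simp: saturated_setting_def)
  define X where "X = insert (Rel APred [Var 0]) (q \<union> relativize APred ` r)"
  have "X \<subseteq> unary_fms ?K C"
  proof -
    have "q \<subseteq> unary_fms ?K C" using q fm_in_params_mono[of L_beta ?K C] by (auto simp: unary_type_def)
    moreover have "relativize APred \<psi> \<in> unary_fms ?K C" if "\<psi> \<in> r" for \<psi>
    proof -
      have "\<psi> \<in> unary_fms (L_alpha L') C" using r that unary_fms_mono[of "A \<inter> C" C] by (auto simp: unary_type_def)
      then show ?thesis
        by (auto simp: unary_fms_def fms_def lang_params_def intro!: fm_in_relativize[of "lang_params (L_alpha L') C"])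
    qed
    moreover have "Rel APred [Var 0] \<in> unary_fms ?K C" by (simp add: unary_fms_def fms_def)
    ultimately show ?thesis by (auto simp: X_def)
  qed
  moreover have "fin_sat M X"
    unfolding fin_sat_def
  proof (intro allI impI, elim conjE)
    fix F assume F: "finite F" "F \<subseteq> X"
    obtain fs where fs: "set fs = F \<inter> q" using finite_list[of "F \<inter> q"] F(1) by auto
    have "\<exists>G\<subseteq>r. finite G \<and> F \<inter> relativize APred ` r = relativize APred ` G"
      using finite_subset_image[of "F \<inter> relativize APred ` r" "relativize APred" r] F(1) by auto
    then obtain G where G: "G \<subseteq> r" "finite G" "F \<inter> relativize APred ` r = relativize APred ` G" by blast
    obtain gs where gs: "set gs = G" using finite_list[OF G(2)] by blast
    define \<phi> \<psi> where "\<phi> = Conjs fs" and "\<psi> = Conjs gs"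
    have \<phi>: "\<phi> \<in> q" unfolding \<phi>_def using unary_type_Conjs[OF q] fs by blast
    have \<psi>: "\<psi> \<in> r" unfolding \<psi>_def using unary_type_Conjs[OF r] gs G(1) by blast
    have \<psi>u: "\<psi> \<in> unary_fms (L_alpha L') (A \<inter> C)" and \<phi>u: "\<phi> \<in> unary_fms L_beta C" using r \<psi> q \<phi> by (auto simp: unary_type_def)
    define D where "D = fm_consts \<psi>"
    have D: "finite D" "D \<subseteq> A \<inter> C" using unary_abstract(1,2)[OF \<psi>u] by (auto simp: D_def)
    obtain cs where cs: "set cs = D" using finite_list[OF D(1)] by blast
    \<comment> \<open>If only parameters solved \<open>\<psi>\<close> in \<open>A\<close>, then
      \<open>one_of cs\<close> would belong to \<open>r\<close>. Being quantifier free over the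
      common language it would be implied by \<open>q\<close>, and \<open>q\<close> would be
      algebraic.\<close>
    have "\<exists>b\<in>A - D. holds_at (induced APred M) \<psi> b"
    proof (rule ccontr)
      assume "\<not> ?thesis"
      then have "type_implies (induced APred M) r (one_of cs)"
        unfolding type_implies_def using \<psi> cs by (intro exI[of _ "{\<psi>}"]) auto
      then have "one_of cs \<in> r" using r one_of_unary[of cs "A \<inter> C" "L_alpha L'"] D(2) cs by (auto simp: unary_type_def)
      then have "type_implies M q (one_of cs)" using D(2) cs by (intro qf quantifier_free_one_of one_of_unary) auto
      then have "one_of cs \<in> q" using q one_of_unary[of cs C L_beta] D(2) cs by (auto simp: unary_type_def)
      then have "infinite {b \<in> univ M. holds_at M (one_of cs :: (fname + 'u, 'r rname) fm) b}" using na by (auto simp: nonalgebraic_def)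
      then show False using D(1) cs by (auto elim: finite_subset[rotated] dest!: infinite_super[rotated])
    qed
    then obtain b where b: "b \<in> A" "b \<notin> D" "holds_at (induced APred M) \<psi> b" by blast
    obtain \<phi>' e i where \<phi>': "fm_in L_beta \<phi>'" "assignment M e" "\<And>b. holds_at M \<phi> b = sat M (e(i := b)) \<phi>'"
      using holds_definable[OF \<phi>u C(1)] by metis
    have inf: "infinite {b \<in> univ M. sat M (e(i := b)) \<phi>'}" using na \<phi> unfolding nonalgebraic_def \<phi>'(3)[symmetric] by blast
    have DU: "D \<subseteq> univ M" using D(2) A_univ by blast
    obtain b0 z where z: "b0 \<in> univ M" "z \<in> univ M" "z \<noteq> fint M Zero []"
      "\<And>x. x \<in> univ M \<Longrightarrow> in_ball M x b0 z \<Longrightarrow> sat M (e(i := x)) \<phi>' \<and> x \<notin> D"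
      by (rule ball_avoiding[OF \<phi>'(1,2) inf D(1) DU]) (rule that)
    \<comment> \<open>Classes are assumed dense only around points of \<open>A\<close>, so the ball
      is recentred at a point of \<open>A\<close> before the class of \<open>b\<close> is
      used.\<close>
    obtain a1 where a1: "a1 \<in> A" "in_ball M a1 b0 z" using A_dense[OF z(1-3)] by blast
    obtain a where a: "a \<in> A" "rint M EqRel [a, b]" "in_ball M a a1 z" using E_class_dense[OF b(1) a1(1) z(2,3)] by blast
    have "in_ball M a b0 z" using in_ball_trans[of a1 a b0 z] a a1 z A_univ by blast
    then have a': "holds_at M \<phi> a" "a \<notin> D" using z(4)[of a] a(1) A_univ \<phi>'(3) by auto
    \<comment> \<open>The exchange of \<open>a\<close> and \<open>b\<close> fixes \<open>D\<close>,
      the parameters of \<open>\<psi>\<close>, and so carries \<open>\<psi>\<close> from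
      \<open>b\<close> to \<open>a\<close>.\<close>
    have "sat (name_all (induced APred M)) (\<lambda>_. b) \<psi> = sat (name_all (induced APred M)) (\<lambda>_. (\<lambda>x. if x = a then b else if x = b then a else x) b) \<psi>"
      using \<psi>u D(2) a'(2) b(1,2) by (intro swap_invariant[OF a(1) b(1) a(2) refl, where C = "A \<inter> C"]) (auto simp: D_def unary_fms_def fms_def)
    then have "holds_at (induced APred M) \<psi> a" using b(3) by (auto simp: holds_at_def split: if_splits)
    then have hG: "\<forall>\<psi>\<in>G. holds_at M (relativize APred \<psi>) a" using gs by (simp add: \<psi>_def holds_at_relativize)
    have "holds_at M \<chi> a" if \<chi>: "\<chi> \<in> F" for \<chi>
    proof -
      have "\<chi> = Rel APred [Var 0] \<or> \<chi> \<in> F \<inter> q \<or> \<chi> \<in> F \<inter> relativize APred ` r" using \<chi> F(2) by (auto simp: X_def)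
      then show ?thesis
      proof (elim disjE)
        assume "\<chi> = Rel APred [Var 0]"
        then show ?thesis using a(1) by (simp add: holds_at_def pred_ext_def)
      next
        assume "\<chi> \<in> F \<inter> q"
        then show ?thesis using a'(1) fs by (simp add: \<phi>_def)
      next
        assume "\<chi> \<in> F \<inter> relativize APred ` r"
        then show ?thesis using hG unfolding G(3) by auto
      qed
    qed
    then show "\<exists>b\<in>univ M. \<forall>\<phi>\<in>F. holds_at M \<phi> b" using a(1) A_univ by blast
  qed
  ultimately obtain b where b: "b \<in> univ M" "\<forall>\<phi>\<in>X. holds_at M \<phi> b" using S C unfolding saturated_def by blast
  have "b \<in> A" using b by (auto simp: X_def pred_ext_def holds_at_def)
  then show ?thesis using b by (auto simp: X_def)
qed

section \<open>The codensity condition\<close>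

text \<open>One further parameter \<open>x\<close> destroys independence at finitely many elements
  of \<open>A\<close> only. If \<open>x\<close> is algebraic over \<open>D\<close> and
  \<open>A\<close>, it is so over a finite subset, whose elements of \<open>A\<close> are discarded;
  otherwise exchange shows that nothing is lost.\<close>

lemma independent_up_to_finite:
  assumes "finite D" "D \<subseteq> univ M"
  shows "\<exists>A0. finite A0 \<and> A0 \<subseteq> A \<and> (\<forall>a\<in>A - A0. a \<notin> cl (D \<union> (A - {a})))"
  using assms
proof (induction D rule: finite_induct)
  case empty
  then show ?case using A_independent by (intro exI[of _ "{}"]) auto
next
  case (insert x D)
  then obtain A0 where A0: "finite A0" "A0 \<subseteq> A" "\<And>a. a \<in> A - A0 \<Longrightarrow> a \<notin> cl (D \<union> (A - {a}))" by auto
  have U: "D \<union> A \<subseteq> univ M" "x \<in> univ M" using insert.prems A_univ by auto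
  show ?case
  proof (cases "x \<in> cl (D \<union> A)")
    case True
    then obtain F where F: "F \<subseteq> D \<union> A" "finite F" "x \<in> cl F" by (rule acl_finite)
    have "a \<notin> cl (insert x D \<union> (A - {a}))" if a: "a \<in> A - (A0 \<union> (F \<inter> A))" for a
    proof -
      have "F \<subseteq> D \<union> (A - {a})" using F(1) a by auto
      then have "x \<in> cl (D \<union> (A - {a}))" using F(3) acl_mono by blast
      moreover have sub: "D \<union> (A - {a}) \<subseteq> univ M" using U by auto
      ultimately have "insert x D \<union> (A - {a}) \<subseteq> cl (D \<union> (A - {a}))" using acl_extensive[OF sub, of L_beta] by auto
      then have "cl (insert x D \<union> (A - {a})) \<subseteq> cl (D \<union> (A - {a}))" by (rule cl_subset[OF sub])
      then show ?thesis using A0(3) a by blast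
    qed
    then show ?thesis using A0 F(2) by (intro exI[of _ "A0 \<union> (F \<inter> A)"]) auto
  next
    case False
    have "a \<notin> cl (insert x D \<union> (A - {a}))" if a: "a \<in> A - A0" for a
    proof
      assume "a \<in> cl (insert x D \<union> (A - {a}))"
      then have "a \<in> cl (insert x (D \<union> (A - {a})))" by simp
      moreover have "D \<union> (A - {a}) \<subseteq> univ M" using U by auto
      ultimately have "x \<in> cl (insert a (D \<union> (A - {a})))" using cl_exchange[OF _ U(2)] A0(3)[OF a] by blast
      moreover have "insert a (D \<union> (A - {a})) = D \<union> A" using a by auto
      ultimately show False using False by simp
    qed
    then show ?thesis using A0 by blast
  qed
qed

text \<open>The witness is the sum of the elements of \<open>Y\<close>, the last of which steers it into the ball.\<close>

lemma sums_of_A: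
  assumes \<phi>: "fm_in L_beta \<phi>" and e: "assignment M e" and inf: "infinite {b \<in> univ M. sat M (e(i := b)) \<phi>}"
    and A0: "finite A0" "A0 \<subseteq> A"
  shows "\<exists>Y w. finite Y \<and> card Y = Suc m \<and> Y \<subseteq> A - A0 \<and> w \<in> univ M \<and> sat M (e(i := w)) \<phi> \<and>
     w \<in> cl Y \<and> (\<forall>a\<in>Y. a \<in> cl (insert w (Y - {a})))"
proof (induction m)
  case 0
  have A0U: "A0 \<subseteq> univ M" using A0 A_univ by blast
  obtain b0 z where z: "b0 \<in> univ M" "z \<in> univ M" "z \<noteq> fint M Zero []"
    "\<And>x. x \<in> univ M \<Longrightarrow> in_ball M x b0 z \<Longrightarrow> sat M (e(i := x)) \<phi> \<and> x \<notin> A0"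
    by (rule ball_avoiding[OF \<phi> e inf A0(1) A0U]) (rule that)
  then obtain a where a: "a \<in> A" "in_ball M a b0 z" using A_dense by blast
  have "a \<in> univ M" using a A_univ by blast
  then show ?case using z(4)[of a] a acl_extensive[of "{a}" M L_beta] by (intro exI[of _ "{a}"] exI[of _ a]) (auto simp del: fun_upd_apply)
next
  case (Suc m)
  then obtain Y w where Y: "finite Y" "card Y = Suc m" "Y \<subseteq> A - A0" and w: "w \<in> univ M" "w \<in> cl Y"
    and ex: "\<And>a. a \<in> Y \<Longrightarrow> a \<in> cl (insert w (Y - {a}))" by blast
  have YU: "Y \<subseteq> univ M" using Y(3) A_univ by blast
  obtain n0 where n0: "fv \<phi> \<subseteq> {..<n0}" by (rule fv_bounded)
  define n where "n = max n0 (Suc i)"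
  have n: "fv \<phi> \<subseteq> {..<n}" "i < n" using n0 by (auto simp: n_def)
  \<comment> \<open>The summands \<open>x\<close> for which \<open>w + x\<close> solves
    \<open>\<phi>\<close>; translation by \<open>w\<close> is injective and onto, so there are again
    infinitely many.\<close>
  define \<psi> where "\<psi> = Exi i (And (plus_fm n (Suc n) i) \<phi>)"
  define e' where "e' = e(n := w)"
  have e': "assignment M e'" using e w by (simp add: assignment_def e'_def)
  have \<psi>: "fm_in L_beta \<psi>" using \<phi> fm_in_plus by (simp add: \<psi>_def)
  have sat\<psi>: "sat M (e'(Suc n := x)) \<psi> \<longleftrightarrow> sat M (e(i := fint M Plus [w, x])) \<phi>" if "x \<in> univ M" for x
  proof -
    have "sat M (e'(Suc n := x, i := s)) \<phi> = sat M (e(i := s)) \<phi>" for s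
      using n by (intro sat_cong) (auto simp: e'_def)
    then show ?thesis using Plus_closed[OF w(1) that] n(2) by (auto simp: \<psi>_def e'_def)
  qed
  have inf': "infinite {x \<in> univ M. sat M (e'(Suc n := x)) \<psi>}"
  proof
    assume fin: "finite {x \<in> univ M. sat M (e'(Suc n := x)) \<psi>}"
    have "{b \<in> univ M. sat M (e(i := b)) \<phi>} \<subseteq> (\<lambda>x. fint M Plus [w, x]) ` {x \<in> univ M. sat M (e'(Suc n := x)) \<psi>}"
    proof
      fix b assume b: "b \<in> {b \<in> univ M. sat M (e(i := b)) \<phi>}"
      then obtain x where "x \<in> univ M" "fint M Plus [w, x] = b" using plus_solve[OF w(1)] by blast
      then show "b \<in> (\<lambda>x. fint M Plus [w, x]) ` {x \<in> univ M. sat M (e'(Suc n := x)) \<psi>}" using b sat\<psi>[of x] by auto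
    qed
    then show False using inf fin finite_surj by blast
  qed
  have AY: "finite (A0 \<union> Y)" "A0 \<union> Y \<subseteq> univ M" using A0 Y(1) YU A_univ by auto
  obtain b0 z where z: "b0 \<in> univ M" "z \<in> univ M" "z \<noteq> fint M Zero []"
    "\<And>x. x \<in> univ M \<Longrightarrow> in_ball M x b0 z \<Longrightarrow> sat M (e'(Suc n := x)) \<psi> \<and> x \<notin> A0 \<union> Y"
    by (rule ball_avoiding[OF \<psi> e' inf' AY]) (rule that)
  then obtain a where a: "a \<in> A" "in_ball M a b0 z" using A_dense by blast
  have aU: "a \<in> univ M" using a A_univ by blast
  define s where "s = fint M Plus [w, a]"
  have s: "sat M (e(i := s)) \<phi>" "a \<notin> A0" "a \<notin> Y" "s \<in> univ M"
    using z(4)[OF aU a(2)] sat\<psi>[OF aU] Plus_closed[OF w(1) aU] by (auto simp: s_def)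
  note plus = plus_cl[OF w(1) aU s_def]
  have U1: "insert a Y \<subseteq> univ M" "insert s Y \<subseteq> univ M" using aU s(4) YU by auto
  have wY: "w \<in> cl Z" if "Y \<subseteq> Z" for Z using w(2) acl_mono[OF that, of L_beta M] by blast
  have 1: "s \<in> cl (insert a Y)"
    using plus(1) cl_subset[OF U1(1), of "{w, a}"] wY[of "insert a Y"] acl_extensive[OF U1(1), of L_beta] by blast
  have 2: "a \<in> cl (insert s Y)"
    using plus(3) cl_subset[OF U1(2), of "{s, w}"] wY[of "insert s Y"] acl_extensive[OF U1(2), of L_beta] by blast
  have 3: "y \<in> cl (insert s (insert a Y - {y}))" if y: "y \<in> Y" for y
  proof -
    let ?Z = "insert s (insert a Y - {y})"
    have Z: "?Z \<subseteq> univ M" using U1 by auto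
    have "a \<noteq> y" using y s(3) by auto
    then have "{s, a} \<subseteq> cl ?Z" using acl_extensive[OF Z, of L_beta] by auto
    then have "w \<in> cl ?Z" using plus(2) cl_subset[OF Z, of "{s, a}"] by blast
    \<comment> \<open>From the new sum \<open>s\<close> and the new summand \<open>a\<close> one
      recovers \<open>w\<close>; with it the induction hypothesis recovers \<open>y\<close> from the
      remaining elements of \<open>Y\<close>.\<close>
    moreover have "Y - {y} \<subseteq> cl ?Z" using acl_extensive[OF Z, of L_beta] by auto
    ultimately have "cl (insert w (Y - {y})) \<subseteq> cl ?Z" by (intro cl_subset[OF Z]) auto
    then show ?thesis using ex[OF y] by blast
  qed
  have "insert a Y - {a} = Y" using s(3) by auto
  then have "\<forall>y\<in>insert a Y. y \<in> cl (insert s (insert a Y - {y}))" using 2 3 by auto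
  then show ?case using Y a s 1 by (intro exI[of _ "insert a Y"] exI[of _ s]) (auto simp del: fun_upd_apply)
qed

text \<open>The type \<open>q\<close> is enlarged by formulas that together keep a realization out
  of the closure of \<open>A\<close> and \<open>C\<close>. Finitely many of them concern a finite
  part of \<open>C\<close> and a bounded number of elements of \<open>A\<close>, and a sum of more
  elements of \<open>A\<close> meets all of these.\<close>

lemma codensity_realized:
  assumes sat: "saturated_setting APred (L_alpha L') L_beta (T_star p L' T') \<kappa> M C q"
  shows "\<exists>b\<in>univ M - cl (A \<union> C). \<forall>\<phi>\<in>q. holds_at M \<phi> b"
proof -
  let ?K = "lang2 APred (L_alpha L') L_beta"
  have C: "C \<subseteq> univ M" "|C| <o \<kappa>" and q: "unary_type L_beta C M q" and na: "nonalgebraic M q" and S: "saturated ?K \<kappa> M"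
    using sat by (auto simp: saturated_setting_def)
  \<comment> \<open>Non-algebraicity over \<open>D\<close> together with any \<open>n\<close>
    elements of \<open>A\<close>: the finite approximation of the property wanted.\<close>
  define far where "far D n b \<longleftrightarrow> (\<forall>Y\<subseteq>A. finite Y \<and> card Y \<le> n \<longrightarrow> b \<notin> cl (D \<union> Y))" for D and n :: nat and b
  \<comment> \<open>All formulas over \<open>C\<close> that follow from some finite approximation.
    Collecting them by their meaning avoids listing them syntactically.\<close>
  define Q where "Q = {\<chi> \<in> unary_fms ?K C. \<exists>D\<subseteq>C. \<exists>n. finite D \<and> (\<forall>b\<in>univ M. far D n b \<longrightarrow> holds_at M \<chi> b)}"
  have "q \<union> Q \<subseteq> unary_fms ?K C"
    using q fm_in_params_mono[of L_beta ?K C] by (auto simp: unary_type_def Q_def)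
  moreover have "fin_sat M (q \<union> Q)"
    unfolding fin_sat_def
  proof (intro allI impI, elim conjE)
    fix F assume F: "finite F" "F \<subseteq> q \<union> Q"
    obtain fs where fs: "set fs = F \<inter> q" using finite_list[of "F \<inter> q"] F(1) by auto
    define \<phi> where "\<phi> = Conjs fs"
    have \<phi>: "\<phi> \<in> q" unfolding \<phi>_def using unary_type_Conjs[OF q] fs by blast
    have \<phi>u: "\<phi> \<in> unary_fms L_beta C" using q \<phi> by (auto simp: unary_type_def)
    have "\<forall>\<chi>\<in>F \<inter> Q. \<exists>D n. D \<subseteq> C \<and> finite D \<and> (\<forall>b\<in>univ M. far D n b \<longrightarrow> holds_at M \<chi> b)" by (auto simp: Q_def)
    then obtain D n where Dn: "\<And>\<chi>. \<chi> \<in> F \<inter> Q \<Longrightarrow> D \<chi> \<subseteq> C \<and> finite (D \<chi>) \<and> (\<forall>b\<in>univ M. far (D \<chi>) (n \<chi>) b \<longrightarrow> holds_at M \<chi> b)"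
      by metis
    define D' where "D' = (\<Union>\<chi>\<in>F \<inter> Q. D \<chi>)"
    define n' where "n' = (\<Sum>\<chi>\<in>F \<inter> Q. n \<chi>)"
    have D': "finite D'" "D' \<subseteq> C" using F(1) Dn unfolding D'_def by auto
    have DU: "D' \<subseteq> univ M" using D'(2) C(1) by blast
    obtain A0 where A0: "finite A0" "A0 \<subseteq> A" "\<forall>a\<in>A - A0. a \<notin> cl (D' \<union> (A - {a}))"
      using independent_up_to_finite[OF D'(1) DU] by (elim exE conjE)
    obtain \<phi>' e i where \<phi>': "fm_in L_beta \<phi>'" "assignment M e" "\<And>b. holds_at M \<phi> b = sat M (e(i := b)) \<phi>'"
      using holds_definable[OF \<phi>u C(1)] by metis
    have "infinite {b \<in> univ M. sat M (e(i := b)) \<phi>'}" using na \<phi> unfolding nonalgebraic_def \<phi>'(3)[symmetric] by blast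
    then obtain Y w where Y: "finite Y" "card Y = Suc n'" "Y \<subseteq> A - A0" and w: "w \<in> univ M" "sat M (e(i := w)) \<phi>'"
      and ex: "\<And>a. a \<in> Y \<Longrightarrow> a \<in> cl (insert w (Y - {a}))"
      using sums_of_A[OF \<phi>'(1,2) _ A0(1,2), of i n'] by blast
    \<comment> \<open>Among the \<open>n' + 1\<close> summands some \<open>a\<close> is missing from
      \<open>Z\<close>. If \<open>w\<close> were algebraic over \<open>D'\<close> and
      \<open>Z\<close>, then \<open>a\<close> would be algebraic over \<open>D'\<close> and the rest
      of \<open>A\<close>, against the choice of \<open>A0\<close>.\<close>
    have far: "far D' n' w"
      unfolding far_def
    proof (intro allI impI notI)
      fix Z assume Z: "Z \<subseteq> A" "finite Z \<and> card Z \<le> n'" and wZ: "w \<in> cl (D' \<union> Z)"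
      have "\<not> Y \<subseteq> Z" using card_mono[of Z Y] Z(2) Y(2) by auto
      then obtain a where a: "a \<in> Y" "a \<notin> Z" by blast
      let ?W = "D' \<union> (A - {a})"
      have W: "?W \<subseteq> univ M" using D'(2) C(1) A_univ by auto
      have "D' \<union> Z \<subseteq> ?W" using Z(1) a(2) by auto
      then have "w \<in> cl ?W" using wZ acl_mono by blast
      moreover have "Y - {a} \<subseteq> cl ?W" using acl_extensive[OF W, of L_beta] Y(3) by auto
      ultimately have "cl (insert w (Y - {a})) \<subseteq> cl ?W" by (intro cl_subset[OF W]) auto
      then show False using ex[OF a(1)] A0(3) Y(3) a(1) by blast
    qed
    have "holds_at M \<chi> w" if \<chi>: "\<chi> \<in> F \<inter> Q" for \<chi>
    proof -
      have "D \<chi> \<subseteq> D'" using \<chi> by (auto simp: D'_def)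
      moreover have "n \<chi> \<le> n'" unfolding n'_def using \<chi> F(1) by (intro member_le_sum) auto
      moreover have "cl (D \<chi> \<union> Y) \<subseteq> cl (D' \<union> Y)" for Y using \<open>D \<chi> \<subseteq> D'\<close> by (intro acl_mono) auto
      ultimately have "far (D \<chi>) (n \<chi>) w" using far unfolding far_def by (meson order_trans subsetD)
      then show ?thesis using Dn[OF \<chi>] w(1) by blast
    qed
    moreover have "\<forall>\<phi>\<in>F \<inter> q. holds_at M \<phi> w" using w(2) \<phi>'(3) fs by (simp add: \<phi>_def)
    ultimately show "\<exists>b\<in>univ M. \<forall>\<phi>\<in>F. holds_at M \<phi> b" using F(2) w(1) by blast
  qed
  ultimately obtain b where b: "b \<in> univ M" "\<forall>\<phi>\<in>q \<union> Q. holds_at M \<phi> b" using S C unfolding saturated_def by blast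
  have "b \<notin> cl (A \<union> C)"
  proof
    assume "b \<in> cl (A \<union> C)"
    then obtain F where F: "finite F" "F \<subseteq> A \<union> C" "\<And>ds. F \<subseteq> set ds \<Longrightarrow> \<exists>\<phi>\<in>fms L_beta {..length ds}. \<forall>e. (\<forall>i<length ds. e i = ds ! i) \<longrightarrow>
      sat M (e(length ds := b)) \<phi> \<and> finite {b' \<in> univ M. sat M (e(length ds := b')) \<phi>}"
      by (rule acl_E) (rule that)
    \<comment> \<open>The parameters from \<open>A\<close> are listed in front, so that they can be
      quantified out and only parameters from \<open>C\<close> remain.\<close>
    obtain as where as: "set as = F \<inter> A" using finite_list[of "F \<inter> A"] F(1) by auto
    obtain cs where cs: "set cs = F - A" using finite_list[of "F - A"] F(1) by auto
    define m where "m = length as"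
    define ds where "ds = as @ cs"
    define n where "n = length ds"
    define e where "e i = (if i < n then ds ! i else b)" for i
    have dsF: "set ds = F" using as cs by (auto simp: ds_def)
    obtain \<theta> where \<theta>: "\<theta> \<in> fms L_beta {..n}" "sat M (e(n := b)) \<theta>" "finite {b' \<in> univ M. sat M (e(n := b')) \<theta>}"
      using F(3)[of ds] dsF by (auto simp: n_def e_def)
    have fv\<theta>: "fv \<theta> \<subseteq> {..n}" "fm_in L_beta \<theta>" using \<theta>(1) by (auto simp: fms_def)
    define k where "k = card {b' \<in> univ M. sat M (e(n := b')) \<theta>}"
    \<comment> \<open>No choice of \<open>m\<close> elements of \<open>A\<close> makes
      \<open>\<theta>\<close> an algebraic formula satisfied by \<open>x\<^sub>n\<close>. This
      follows from \<open>far (set cs) m\<close>, hence its instance belongs to \<open>Q\<close>,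
      yet \<open>b\<close> violates it.\<close>
    define \<chi>0 where "\<chi>0 = Foralls [0..<m] (Imp (Conjs (map A_fm [0..<m])) (Imp (at_most_fm n k \<theta>) (Neg \<theta>)))"
    have mn: "m \<le> n" by (simp add: m_def n_def ds_def)
    have eC: "e i \<in> set cs" if "m \<le> i" "i < n" for i
      using that by (auto simp: e_def ds_def nth_append m_def n_def)
    have eA: "e i \<in> A" if "i < m" for i
      using that mn nth_mem[of i as] as by (auto simp: e_def ds_def nth_append m_def)
    have \<chi>0: "fm_in ?K \<chi>0" using fm_in_mono[OF fv\<theta>(2), of ?K] by (auto simp: \<chi>0_def)
    have "e ` (fv \<chi>0 - {n}) \<subseteq> C"
    proof -
      have "fv \<chi>0 - {n} \<subseteq> {m..<n}" using fv\<theta>(1) fv_at_most[OF fv\<theta>(1), of k] by (force simp: \<chi>0_def)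
      then show ?thesis using eC cs F(2) by force
    qed
    then obtain \<chi> where \<chi>: "\<chi> \<in> unary_fms ?K C" "\<And>b. holds_at M \<chi> b = sat M (e(n := b)) \<chi>0"
      using unary_instantiate[OF \<chi>0] by metis
    have at: "sat M e' (at_most_fm n k \<theta>) \<longleftrightarrow> finite {b \<in> univ M. sat M (e'(n := b)) \<theta>} \<and> card {b \<in> univ M. sat M (e'(n := b)) \<theta>} \<le> k" for e'
      by (rule sat_at_most[OF fv\<theta>(1) univ_nonempty])
    have "holds_at M \<chi> b'" if b': "b' \<in> univ M" "far (set cs) m b'" for b'
      unfolding \<chi>(2) \<chi>0_def sat_Foralls sat_Imp sat.simps
    proof (intro allI impI notI)
      fix e' assume e': "(\<forall>y. y \<notin> set [0..<m] \<longrightarrow> e' y = (e(n := b')) y) \<and> (\<forall>x\<in>set [0..<m]. e' x \<in> univ M)"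
        and Ae: "sat M e' (Conjs (map A_fm [0..<m]))" and am: "sat M e' (at_most_fm n k \<theta>)" and sat: "sat M e' \<theta>"
      have e'n: "e'(n := b') = e'" using e' mn by (auto simp: fun_eq_iff)
      define Y where "Y = e' ` {..<m}"
      have "b' \<in> cl (set cs \<union> Y)"
      proof (rule acl_I[OF fv\<theta>(2), of e' n])
        show "e' ` (fv \<theta> - {n}) \<subseteq> set cs \<union> Y"
        proof
          fix y assume "y \<in> e' ` (fv \<theta> - {n})"
          then obtain j where "j \<in> fv \<theta>" "j \<noteq> n" "y = e' j" by auto
          then have j: "j < n" "y = e' j" using fv\<theta>(1) by (auto simp: order_le_less subset_iff)
          then show "y \<in> set cs \<union> Y" using eC[of j] e' by (cases "j < m") (auto simp: Y_def)
        qed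
        show "finite {b' \<in> univ M. sat M (e'(n := b')) \<theta>}" using am at by blast
      qed (use b' sat e'n in auto)
      moreover have "Y \<subseteq> A" using Ae e' by (auto simp: Y_def pred_ext_def)
      moreover have "finite Y" "card Y \<le> m" using card_image_le[of "{..<m}" e'] by (auto simp: Y_def)
      ultimately show False using b'(2) unfolding far_def by blast
    qed
    then have "\<chi> \<in> Q" using \<chi>(1) cs F unfolding Q_def by (intro CollectI conjI exI[of _ "set cs"] exI[of _ m]) auto
    then have "sat M (e(n := b)) \<chi>0" using b(2) \<chi>(2) by blast
    moreover have "e(n := b) = e" by (auto simp: e_def fun_eq_iff)
    ultimately have "sat M e \<chi>0" by simp
    moreover have "\<forall>x\<in>set [0..<m]. e x \<in> univ M" using eA A_univ by auto
    ultimately have "sat M e (Imp (Conjs (map A_fm [0..<m])) (Imp (at_most_fm n k \<theta>) (Neg \<theta>)))"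
      unfolding \<chi>0_def sat_Foralls by blast
    moreover have "sat M e (at_most_fm n k \<theta>)" unfolding at using \<theta>(3) by (simp add: k_def)
    moreover have "rint M APred [e i]" if "i < m" for i using eA[OF that] by (simp add: pred_ext_def)
    ultimately show False using \<theta>(2) \<open>e(n := b) = e\<close> by auto
  qed
  then show ?thesis using b by blast
qed

section \<open>The Mordell-Lang condition\<close>

text \<open>Take a smallest part \<open>Y\<close> of \<open>c\<close> over which, together with
  \<open>Z\<close>, the element \<open>a\<close> is algebraic. Minimality makes \<open>Y\<close>
  independent over \<open>Z\<close>, hence over \<open>A\<close>; exchange would make a member of
  \<open>Y\<close> dependent on the others and \<open>A\<close>, so \<open>Y\<close> is empty. Then
  \<open>a\<close> is algebraic over \<open>Z\<close>, and independence of \<open>A\<close> puts it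
  into \<open>Z\<close>.\<close>

lemma algebraic_in_A:
  assumes c: "set c \<subseteq> univ M" and Z: "Z \<subseteq> A" "Z \<subseteq> set c" and ind: "indep_over L_beta M (set c) Z A"
    and a: "a \<in> A" "a \<in> cl (set c)"
  shows "a \<in> Z"
proof -
  have ZU: "Z \<subseteq> univ M" using Z A_univ by blast
  define P where "P n \<longleftrightarrow> (\<exists>Y\<subseteq>set c. finite Y \<and> card Y = n \<and> a \<in> cl (Y \<union> Z))" for n
  have "P (card (set c))" unfolding P_def using a(2) acl_mono[of "set c" "set c \<union> Z" L_beta M] by (intro exI[of _ "set c"]) auto
  then have "P (LEAST n. P n)" by (rule LeastI)
  then obtain Y where Y: "Y \<subseteq> set c" "finite Y" "card Y = (LEAST n. P n)" "a \<in> cl (Y \<union> Z)" unfolding P_def by blast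
  have min: "a \<notin> cl ((Y - {y}) \<union> Z)" if y: "y \<in> Y" for y
  proof
    assume "a \<in> cl ((Y - {y}) \<union> Z)"
    then have "P (card (Y - {y}))" unfolding P_def using Y by (intro exI[of _ "Y - {y}"]) auto
    then have "card Y \<le> card (Y - {y})" using Y(3) Least_le[of P] by simp
    then show False using Y(2) y by (metis card_Diff1_less not_less)
  qed
  have "Y = {}"
  proof (rule ccontr)
    assume "Y \<noteq> {}"
    then obtain y where y: "y \<in> Y" by blast
    have "acl_indep L_beta M Y Z"
      unfolding acl_indep_def
    proof (intro ballI notI)
      fix y assume y: "y \<in> Y" "y \<in> cl (Y - {y} \<union> Z)"
      have U: "Y - {y} \<union> Z \<subseteq> univ M" using Y(1) c ZU by auto
      have "Y \<union> Z \<subseteq> cl (Y - {y} \<union> Z)" using acl_extensive[OF U, of L_beta] y(2) by auto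
      then have "a \<in> cl (Y - {y} \<union> Z)" using cl_subset[OF U] Y(4) by blast
      then show False using min[OF y(1)] by blast
    qed
    then have "acl_indep L_beta M Y (A \<union> Z)" using ind Y(1) by (auto simp: indep_over_def)
    then have ny: "y \<notin> cl ((Y - {y}) \<union> (A \<union> Z))" using y by (auto simp: acl_indep_def)
    have U: "(Y - {y}) \<union> Z \<subseteq> univ M" "y \<in> univ M" using Y(1) c ZU y by auto
    have "insert y ((Y - {y}) \<union> Z) = Y \<union> Z" using y by auto
    then have "a \<in> cl (insert y ((Y - {y}) \<union> Z))" using Y(4) by simp
    then have "y \<in> cl (insert a ((Y - {y}) \<union> Z))" using cl_exchange[OF U] min[OF y] by blast
    moreover have "insert a ((Y - {y}) \<union> Z) \<subseteq> (Y - {y}) \<union> (A \<union> Z)" using a(1) by auto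
    ultimately show False using ny acl_mono by blast
  qed
  then have aZ: "a \<in> cl Z" using Y(4) by simp
  show ?thesis
  proof (rule ccontr)
    assume "a \<notin> Z"
    then have "Z \<subseteq> A - {a}" using Z(1) by auto
    then show False using aZ A_independent[OF a(1)] acl_mono by blast
  qed
qed

text \<open>Finiteness of the solutions of \<open>\<phi>\<close> is assumed in structures on the
  type of formulas, whereas \<open>c\<close> lives in \<open>M\<close>. The complete type
  \<open>q\<close> connects the two: an infinite solution set in \<open>M\<close> has interior, and
  \<open>q\<close> records this.\<close>

lemma solution_is_entry:
  assumes ch: "mordell_lang_challenge (L_alpha L') L_beta n S r q \<phi> \<psi>"
    and sol: "solution APred (L_alpha L') L_beta (T_star p L' T') n S r q \<phi> \<psi> M c a"
  shows "\<exists>i\<in>S. a = c ! i"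
proof -
  have c: "length c = n" "set c \<subseteq> univ M" "\<And>\<chi>. \<chi> \<in> q \<Longrightarrow> sat M ((!) c) \<chi>" "{i. i < n \<and> c ! i \<in> A} = S"
    "indep_over L_beta M (set c) ((!) c ` S) A"
    and a: "a \<in> A" "sat M ((!) (c @ [a])) \<phi>"
    using sol by (auto simp: solution_def contender_def)
  have qc: "complete_type L_beta {..<n} q" and \<phi>: "\<phi> \<in> fms L_beta {..n}"
    and fin: "\<And>(N :: (fname, 'r rname) struc0) e. is_struc L_beta N \<Longrightarrow> assignment N e \<Longrightarrow> (\<forall>\<chi>\<in>q. sat N e \<chi>) \<Longrightarrow>
        finite {b \<in> univ N. sat N (e(n := b)) \<phi>}"
    using ch unfolding mordell_lang_challenge_def by blast+
  have q_iff: "\<chi> \<in> q" if "\<chi> \<in> fms L_beta {..<n}" "sat M ((!) c) \<chi>" for \<chi>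
    using qc that c(3) unfolding complete_type_def by (metis sat.simps(4))
  have aU: "a \<in> univ M" using a A_univ by blast
  define e where "e i = (if i < n then c ! i else a)" for i
  have e: "assignment M e" unfolding assignment_def e_def using aU c(1,2) nth_mem by (auto; blast)
  have e_c: "sat M e \<chi> = sat M ((!) c) \<chi>" if "fv \<chi> \<subseteq> {..<n}" for \<chi> :: "(fname, 'r rname) fm"
    using that by (intro sat_cong) (auto simp: e_def)
  have sat_a: "sat M (e(n := a)) \<phi>"
  proof -
    have "sat M (e(n := a)) \<phi> = sat M ((!) (c @ [a])) \<phi>"
      using \<phi> c(1) by (intro sat_cong) (auto simp: e_def fms_def nth_append)
    then show ?thesis using a(2) by simp
  qed
  have "finite {b \<in> univ M. sat M (e(n := b)) \<phi>}"
  proof (rule ccontr)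
    assume "infinite {b \<in> univ M. sat M (e(n := b)) \<phi>}"
    then have int: "has_interior M {b \<in> univ M. sat M (e(n := b)) \<phi>}" using \<phi> e by (intro infinite_interior) (auto simp: fms_def)
    define \<iota> where "\<iota> = interior_fm n (Suc n) \<phi>"
    have fv: "fv \<phi> \<subseteq> {..<Suc n}" using \<phi> by (auto simp: fms_def)
    have fv\<iota>: "fv \<iota> \<subseteq> {..<n}" using fv_interior[of n "Suc n" \<phi>] fv unfolding \<iota>_def by (force simp: less_Suc_eq)
    have "sat M e \<iota>" unfolding \<iota>_def using sat_interior[OF fv, of n M e] int by simp
    then have \<iota>q: "\<iota> \<in> q"
      using q_iff[of \<iota>] e_c[OF fv\<iota>] fv\<iota> fm_in_interior[of \<phi>] \<phi> by (auto simp: fms_def \<iota>_def)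
    obtain N :: "(fname, 'r rname) struc0" and e1 where N: "is_struc L_beta N" "assignment N e1" "\<forall>\<chi>\<in>q. sat N e1 \<chi>"
      using qc unfolding complete_type_def by blast
    \<comment> \<open>A complete type realized in \<open>M\<close> contains every sentence true in
      \<open>M\<close>, in particular the theory of the p-adic field, so interior means infinitely
      many solutions in \<open>N\<close> too.\<close>
    have "model L_beta N (T_beta p)"
      unfolding model_def
    proof (intro conjI ballI allI impI)
      fix \<chi> :: "(fname, 'r rname) fm" and e2 assume \<chi>: "\<chi> \<in> T_beta p"
      then have \<chi>f: "fm_in L_beta \<chi>" "fv \<chi> = {}" by (auto simp: T_beta_def theory_of_def fms_def)
      have "sat M e \<chi>" using M \<chi> e by (auto simp: model_def)
      then have "\<chi> \<in> q" using q_iff[of \<chi>] e_c[of \<chi>] \<chi>f by (auto simp: fms_def)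
      then have "sat N e1 \<chi>" using N(3) by blast
      then show "sat N e2 \<chi>" using sat_cong[of \<chi> e1 e2 N] \<chi>f(2) by simp
    qed (rule N(1))
    then interpret N: padic_model p N by unfold_locales
    have "sat N e1 \<iota>" using N(3) \<iota>q by blast
    then have "has_interior N {b \<in> univ N. sat N (e1(n := b)) \<phi>}" unfolding \<iota>_def using sat_interior[OF fv, of n N e1] by simp
    then have "infinite {b \<in> univ N. sat N (e1(n := b)) \<phi>}" using \<phi> N(2) by (intro N.interior_infinite) (auto simp: fms_def)
    then show False using fin[OF N] by blast
  qed
  moreover have "e ` (fv \<phi> - {n}) \<subseteq> set c"
  proof
    fix y assume "y \<in> e ` (fv \<phi> - {n})"
    then obtain j where "j \<in> fv \<phi>" "j \<noteq> n" "y = e j" by auto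
    then have "j < n" "y = e j" using \<phi> by (auto simp: fms_def order_le_less subset_iff)
    then show "y \<in> set c" using c(1) by (auto simp: e_def)
  qed
  ultimately have acl: "a \<in> cl (set c)" using \<phi> sat_a aU by (intro acl_I[of L_beta \<phi> e n]) (auto simp: fms_def)
  have "(!) c ` S \<subseteq> A" "(!) c ` S \<subseteq> set c" using c(1,4) by auto
  then have "a \<in> (!) c ` S" using algebraic_in_A[OF c(2) _ _ c(5) a(1) acl] by blast
  then show ?thesis by blast
qed

end

lemma contender_pair_model:
  assumes "prime p" "funs L' = {}"
    and "contender APred (L_alpha L') L_beta (T_star p L' T') n S r q M c"
  shows "pair_model p L' T' M"
  using assms by unfold_locales (auto simp: contender_def)

text \<open>A solution is the entry of \<open>c\<close> at some index of \<open>S\<close>. That this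
  entry satisfies \<open>\<phi>\<close> and \<open>\<psi>\<close> is a condition on the tuple alone
  and is decided by the two types, so the entry with the same index solves the challenge for every
  contender.\<close>

theorem mordell_lang_T_star:
  assumes p: "prime p" and L': "funs L' = {}"
  shows "mordell_lang_condition TYPE('u) APred (L_alpha L') L_beta (T_star p L' T')"
  unfolding mordell_lang_condition_def
proof (intro allI impI, elim conjE exE)
  fix n S r q \<phi> \<psi> and M M' :: "(fname, 'a rname, 'u) struc" and c c' a
  assume ch: "mordell_lang_challenge (L_alpha L') L_beta n S r q \<phi> \<psi>"
    and sol: "solution APred (L_alpha L') L_beta (T_star p L' T') n S r q \<phi> \<psi> M c a"
    and con': "contender APred (L_alpha L') L_beta (T_star p L' T') n S r q M' c'"
  have con: "contender APred (L_alpha L') L_beta (T_star p L' T') n S r q M c" using sol by (simp add: solution_def)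
  interpret pair_model p L' T' M by (rule contender_pair_model[OF p L' con])
  obtain i where i: "i \<in> S" "a = c ! i" using solution_is_entry[OF ch sol] by blast
  have S: "S \<subseteq> {..<n}" and rc: "complete_type (L_alpha L') S r" and qc: "complete_type L_beta {..<n} q"
    and \<phi>: "\<phi> \<in> fms L_beta {..n}" and \<psi>: "\<psi> \<in> fms (L_alpha L') (insert n S)"
    using ch unfolding mordell_lang_challenge_def by blast+
  have "i < n" using i S by auto
  have c: "length c = n" "set c \<subseteq> univ M" "\<And>\<chi>. \<chi> \<in> q \<Longrightarrow> sat M ((!) c) \<chi>" "\<And>\<chi>. \<chi> \<in> r \<Longrightarrow> sat M ((!) c) (relativize APred \<chi>)"
    and a: "a \<in> A" "sat M ((!) (c @ [a])) \<phi>" "sat M ((!) (c @ [a])) (relativize APred \<psi>)"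
    using sol by (auto simp: solution_def contender_def)
  have c': "length c' = n" "set c' \<subseteq> univ M'" "\<And>\<chi>. \<chi> \<in> q \<Longrightarrow> sat M' ((!) c') \<chi>" "\<And>\<chi>. \<chi> \<in> r \<Longrightarrow> sat M' ((!) c') (relativize APred \<chi>)"
    "{i. i < n \<and> c' ! i \<in> pred_ext APred M'} = S"
    using con' by (auto simp: contender_def)
  \<comment> \<open>Quantifying \<open>x\<^sub>n\<close> under an equation with
    \<open>x\<^sub>i\<close> replaces syntactic substitution and its renaming of bound
    variables.\<close>
  define \<phi>i where "\<phi>i = Exi n (And (Equ (Var n) (Var i)) \<phi>)"
  define \<psi>i where "\<psi>i = Exi n (And (Equ (Var n) (Var i)) \<psi>)"
  have upd: "sat N (((!) d)(n := x)) \<chi> = sat N ((!) (d @ [x])) \<chi>" if "fv \<chi> \<subseteq> {..n}" "length d = n"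
    for N :: "(fname, 'a rname, 'u) struc" and d x \<chi>
    using that by (intro sat_cong) (auto simp: nth_append)
  have fv\<phi>: "fv \<phi> \<subseteq> {..n}" using \<phi> by (auto simp: fms_def)
  have fv\<psi>: "fv \<psi> \<subseteq> {..n}" using \<psi> S by (auto simp: fms_def)
  have "\<phi>i \<in> fms L_beta {..<n}" using \<phi> \<open>i < n\<close> by (auto simp: \<phi>i_def fms_def)
  moreover have "sat M ((!) c) \<phi>i"
    using upd[OF fv\<phi> c(1), of M a] a i \<open>i < n\<close> A_univ by (auto simp: \<phi>i_def)
  ultimately have "\<phi>i \<in> q" using qc c(3) unfolding complete_type_def by (metis sat.simps(4))
  then have 1: "sat M' ((!) (c' @ [c' ! i])) \<phi>"
    using c'(3)[of \<phi>i] upd[OF fv\<phi> c'(1), of M'] \<open>i < n\<close> by (auto simp: \<phi>i_def)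
  have "\<psi>i \<in> fms (L_alpha L') S" using \<psi> i(1) by (auto simp: \<psi>i_def fms_def)
  moreover have "sat M ((!) c) (relativize APred \<psi>i)"
    using upd[of "relativize APred \<psi>" c M a] fv\<psi> c(1) a i \<open>i < n\<close> A_univ by (auto simp: \<psi>i_def pred_ext_def)
  ultimately have "\<psi>i \<in> r" using rc c(4) unfolding complete_type_def by (metis sat.simps(4) relativize.simps(1))
  then have 2: "sat M' ((!) (c' @ [c' ! i])) (relativize APred \<psi>)"
    using c'(4)[of \<psi>i] upd[of "relativize APred \<psi>" c' M'] fv\<psi> c'(1) \<open>i < n\<close> by (auto simp: \<psi>i_def)
  have "c' ! i \<in> pred_ext APred M'" using c'(5) i(1) by blast
  then show "\<exists>a. solution APred (L_alpha L') L_beta (T_star p L' T') n S r q \<phi> \<psi> M' c' a"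
    using con' 1 2 unfolding solution_def by blast
qed

theorem theorem7p4:
  fixes p :: nat
    and L' :: "(fname, 'r rname) lang"
    and T' :: "(fname, 'r rname) fm set"
  assumes "prime p"
    and "funs L' = {}"
    and "rels L' \<inter> rels L_beta = {}"
    and "(EqRel, 2) \<notin> rels L'"
    and "(APred, 1) \<notin> rels L'"
    and "T' \<subseteq> sentences L'"
    and "consistent_theory L' T'"
    and "complete_theory L' T'"
  shows "ml_theory TYPE('u) APred (L_alpha L') L_beta (T_alpha L' T') (T_beta p) (T_star p L' T')"
proof -
  interpret padic_prime p by unfold_locales (rule assms(1))
  have pm: "pair_model p L' T' M" if "model (lang2 APred (L_alpha L') L_beta) M (T_star p L' T')"
    for M :: "(fname, 'r rname, 'u) struc"
    using that assms(2) by unfold_locales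
  have "density TYPE('u) APred (L_alpha L') L_beta (T_star p L' T')"
    unfolding density_def
  proof (intro allI impI, elim conjE)
    fix M :: "(fname, 'r rname, 'u) struc" and \<kappa> C q r
    assume s: "saturated_setting APred (L_alpha L') L_beta (T_star p L' T') \<kappa> M C q"
      and r: "unary_type (L_alpha L') (pred_ext APred M \<inter> C) (induced APred M) r"
      and qf: "\<forall>\<psi>\<in>r. quantifier_free \<psi> \<and> \<psi> \<in> unary_fms (lang_Int (L_alpha L') L_beta) (pred_ext APred M \<inter> C) \<longrightarrow> type_implies M q \<psi>"
    interpret pair_model p L' T' M by (rule pm) (use s in \<open>simp add: saturated_setting_def\<close>)
    show "\<exists>a\<in>pred_ext APred M. (\<forall>\<psi>\<in>r. holds_at M (relativize APred \<psi>) a) \<and> (\<forall>\<phi>\<in>q. holds_at M \<phi> a)"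
      by (rule density_realized[OF s r]) (use qf in blast)
  qed
  moreover have "codensity TYPE('u) APred (L_alpha L') L_beta (T_star p L' T')"
    unfolding codensity_def
  proof (intro allI impI)
    fix M :: "(fname, 'r rname, 'u) struc" and \<kappa> C q
    assume s: "saturated_setting APred (L_alpha L') L_beta (T_star p L' T') \<kappa> M C q"
    interpret pair_model p L' T' M by (rule pm) (use s in \<open>simp add: saturated_setting_def\<close>)
    show "\<exists>b\<in>univ M - acl L_beta M (pred_ext APred M \<union> C). \<forall>\<phi>\<in>q. holds_at M \<phi> b" by (rule codensity_realized[OF s])
  qed
  moreover have "theory2 APred (L_alpha L') L_beta (T_alpha L' T') (T_beta p) \<subseteq> T_star p L' T'" by (auto simp: T_star_def)
  ultimately show ?thesis
    unfolding ml_theory_def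
    using geometric_T_beta T_star_sentences mordell_lang_T_star[OF assms(1,2)] by blast
qed

end
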